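(* Let $D\subseteq\mathbb{C}^n$ be an open set and $D'\subseteq D$ a relatively compact open subset. Let $B^{(1)}\subset\mathbb{C}$ be a disk centered at $0$, let $\varepsilon,\delta$ be nonnegative rational numbers, and let $f_i(z,c)$ ($1\le i\le I$) and $g_j(z,c)$ ($1\le j\le J$) be holomorphic functions on $D\times B^{(1)}$, with the $f_i$ not all identically zero. Set $$R(z,c)=\frac{\big(\sum_{i=1}^I|f_i(z,c)|^2\big)^{\varepsilon/2}}{\big(\sum_{j=1}^J|g_j(z,c)|^2\big)^{\delta/2}}.$$ Assume that $\int_D R(z,0)\,dV_1\cdots dV_n<\infty$ and that $-\log R(z,c)$ is a nonpositive plurisubharmonic function on $D\times B^{(1)}$. Then there exists $\rho>0$ such that the function $c\mapsto\int_{D'}R(z,c)\,dV_1\cdots dV_n$ is finite and continuous on the disk $B^{(1)}_\rho=\{|c|<\rho\}$.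
   Context: $dV_1\cdots dV_n$ denotes Lebesgue measure on $\mathbb{C}^n$. *)

theory Defs
  imports "HOL-Analysis.Analysis"
begin

text \<open>Points of C^n x C are pairs (z, c) with z :: complex^'n, c :: complex.
  Lebesgue measure on complex^'n is Lebesgue measure on R^{2n}, i.e. dV_1...dV_n.\<close>

definition holo_on :: "('n::finite) itself \<Rightarrow> ((complex^'n) \<times> complex) set
    \<Rightarrow> (complex^'n \<Rightarrow> complex \<Rightarrow> complex) \<Rightarrow> bool" where
  "holo_on _ S F \<longleftrightarrow> (\<forall>p\<in>S. \<exists>L. ((\<lambda>q. F (fst q) (snd q)) has_derivative L) (at p) \<and>
      (\<forall>a v w. L (a *s v, a * w) = a * L (v, w)))"

definition cline :: "(complex^'n) \<times> complex \<Rightarrow> (complex^'n) \<times> complex \<Rightarrow> complex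
    \<Rightarrow> (complex^'n) \<times> complex" where
  "cline a b \<zeta> = (fst a + \<zeta> *s fst b, snd a + \<zeta> * snd b)"

definition usc_on :: "'a::topological_space set \<Rightarrow> ('a \<Rightarrow> ereal) \<Rightarrow> bool" where
  "usc_on S u \<longleftrightarrow> (\<forall>x\<in>S. \<forall>t. u x < t \<longrightarrow> (\<forall>\<^sub>F y in at x within S. u y < t))"

definition ereal_int :: "(real \<Rightarrow> ereal) \<Rightarrow> real set \<Rightarrow> ereal" where
  "ereal_int g A =
     enn2ereal (\<integral>\<^sup>+ t. e2ennreal (max 0 (g t)) * indicator A t \<partial>lborel)
   - enn2ereal (\<integral>\<^sup>+ t. e2ennreal (max 0 (- g t)) * indicator A t \<partial>lborel)"

definition psh_on :: "((complex^'n) \<times> complex) set \<Rightarrow> ((complex^'n) \<times> complex \<Rightarrow> ereal) \<Rightarrow> bool" where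
  "psh_on S u \<longleftrightarrow> open S \<and> (\<forall>x\<in>S. u x < \<infinity>) \<and> usc_on S u \<and>
     (\<forall>a b. (\<forall>\<zeta>. cmod \<zeta> \<le> 1 \<longrightarrow> cline a b \<zeta> \<in> S) \<longrightarrow>
        u a \<le> ereal (1 / (2 * pi)) * ereal_int (\<lambda>\<theta>. u (cline a b (cis \<theta>))) {0..2*pi})"

text \<open>Real power with the convention x^0 = 1 (also for x = 0).\<close>
definition rpow :: "real \<Rightarrow> real \<Rightarrow> real" where
  "rpow x a = (if a = 0 then 1 else x powr a)"

definition numR :: "nat \<Rightarrow> (nat \<Rightarrow> complex^'n \<Rightarrow> complex \<Rightarrow> complex) \<Rightarrow> real
    \<Rightarrow> complex^'n \<Rightarrow> complex \<Rightarrow> real" where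
  "numR I f \<epsilon> z c = rpow (\<Sum>i=1..I. (cmod (f i z c))\<^sup>2) (\<epsilon> / 2)"

text \<open>R = numerator / denominator in [0, inf]; a/0 = inf for a > 0, and at common
  zeros (0/0) we also put inf.\<close>
definition Rfun :: "nat \<Rightarrow> nat \<Rightarrow> (nat \<Rightarrow> complex^'n \<Rightarrow> complex \<Rightarrow> complex)
    \<Rightarrow> (nat \<Rightarrow> complex^'n \<Rightarrow> complex \<Rightarrow> complex) \<Rightarrow> real \<Rightarrow> real
    \<Rightarrow> complex^'n \<Rightarrow> complex \<Rightarrow> ennreal" where
  "Rfun I J f g \<epsilon> \<delta> z c =
     (if numR J g \<delta> z c = 0 then \<infinity>
      else ennreal (numR I f \<epsilon> z c / numR J g \<delta> z c))"

definition neglog :: "ennreal \<Rightarrow> ereal" where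
  "neglog x = (if x = \<infinity> then -\<infinity> else if x = 0 then \<infinity> else ereal (- ln (enn2real x)))"

end

theory Submission
  imports Defs "HOL-Complex_Analysis.Complex_Analysis"
begin

text \<open>By hypothesis \<open>\<psi> = - log R\<close> is plurisubharmonic and nonpositive. The key estimate is local and uniform in the weight:
  if the integral of \<open>min (exp (- \<psi>)) (exp (2 t))\<close> over \<open>\<psi> \<le> - t\<close> in a ball is small, then the integral of
  \<open>exp (- \<psi>)\<close> over \<open>\<psi> < - 2 t\<close> in the half ball is at most a constant times it. To prove it, take a cutoff \<open>h\<close>
  of \<open>\<psi> / t\<close> equal to 1 on \<open>\<psi> \<le> - 2 t\<close> and 0 on \<open>\<psi> \<ge> - t\<close>, and approximate it in weighted \<open>L\<^sup>2\<close> by an almost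
  holomorphic \<open>F\<close>, with the error bounded by the integral over the transition region (Bochner inequality for an almost
  minimiser of the penalised distance of \<open>h\<close> to the kernel of dbar). The mean value property makes \<open>F\<close> small on the
  half ball, hence \<open>h - F\<close> is bounded below on \<open>\<psi> \<le> - 2 t\<close>.

  The premise of the estimate involves only bounded integrands, so it passes from \<open>c = c0\<close> to nearby \<open>c\<close> by dominated
  convergence. Hence the functions \<open>R (\<cdot>, c)\<close> are uniformly integrable for \<open>c\<close> near any \<open>c0\<close> at which
  \<open>R (\<cdot>, c0)\<close> is locally integrable, which gives finiteness and continuity.\<close>

section \<open>Directional derivatives and Wirtinger operators\<close>

text \<open>The truncation at exp (2 t) costs nothing: \<open>dbar\<close> of the cutoff lives where
  \<psi> \<ge> - 2 t. The smallness of the truncated integral is a genuine condition: it brings the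
  approximation below 1/2.

  The estimate needs a C^2 weight on the whole space, whereas \<psi> lives on a ball and is -
  \<infinity> on the zeros of the denominator. A smooth maximum glues it to a quadratic polynomial
  that wins near the sphere; steeper and steeper polynomials disappear inside the ball, and Fatou's
  lemma recovers the singular weight, with constants depending only on radius and dimension.

  At common zeros of the f_i and g_j the quotient need not be continuous. A small power of the
  numerator repairs this, and its exponent tends to 0 together with the limit in c.

  In the dbar part the order of choices matters. The mollification scale depends on a ball fixed
  beforehand, the accuracy of the almost minimiser depends on that scale, and the support of the
  almost minimiser depends on the accuracy. Hence the second cutoff, applied to the mollified dbar
  F, with its large radius.\<close>

definition pd :: "'a::real_normed_vector \<Rightarrow> ('a \<Rightarrow> 'b::real_normed_vector) \<Rightarrow> 'a \<Rightarrow> 'b" where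
  "pd v f x = frechet_derivative f (at x) v"

text \<open>Continuity is asked of each directional derivative separately, and differentiability
  refers to a full neighbourhood of each point; on open sets the classes therefore glue and transfer
  along local equality.\<close>

definition C1_on :: "'a::real_normed_vector set \<Rightarrow> ('a \<Rightarrow> 'b::real_normed_vector) \<Rightarrow> bool" where
  "C1_on S f \<longleftrightarrow> (\<forall>x\<in>S. f differentiable (at x)) \<and> (\<forall>v. continuous_on S (pd v f))"

definition C2_on :: "'a::real_normed_vector set \<Rightarrow> ('a \<Rightarrow> 'b::real_normed_vector) \<Rightarrow> bool" where
  "C2_on S f \<longleftrightarrow> C1_on S f \<and> (\<forall>v. C1_on S (pd v f))"

lemma pd_eqI: "(f has_derivative f') (at x) \<Longrightarrow> pd v f x = f' v"
  unfolding pd_def by (simp add: frechet_derivative_at[symmetric])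

lemma has_derivative_pd: "f differentiable (at x) \<Longrightarrow> (f has_derivative (\<lambda>v. pd v f x)) (at x)"
  unfolding pd_def by (simp add: frechet_derivative_works[symmetric])

lemma linear_pd: "f differentiable (at x) \<Longrightarrow> linear (\<lambda>v. pd v f x)"
  using has_derivative_pd has_derivative_linear by blast

lemma pd_const [simp]: "pd v (\<lambda>x. c) x = 0"
  by (rule pd_eqI) (rule has_derivative_const)

lemma pd_bounded_linear:
  assumes "bounded_linear h" "f differentiable (at x)"
  shows "pd v (\<lambda>x. h (f x)) x = h (pd v f x)"
  by (rule pd_eqI) (rule bounded_linear.has_derivative[OF assms(1) has_derivative_pd[OF assms(2)]])

lemma pd_add:
  assumes "f differentiable (at x)" "g differentiable (at x)"
  shows "pd v (\<lambda>x. f x + g x) x = pd v f x + pd v g x"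
  by (rule pd_eqI) (intro has_derivative_add has_derivative_pd assms)

lemma pd_diff:
  assumes "f differentiable (at x)" "g differentiable (at x)"
  shows "pd v (\<lambda>x. f x - g x) x = pd v f x - pd v g x"
  by (rule pd_eqI) (intro has_derivative_diff has_derivative_pd assms)

lemma pd_sum:
  assumes "\<And>i. i \<in> I \<Longrightarrow> f i differentiable (at x)"
  shows "pd v (\<lambda>x. \<Sum>i\<in>I. f i x) x = (\<Sum>i\<in>I. pd v (f i) x)"
  by (rule pd_eqI) (intro has_derivative_sum has_derivative_pd assms)

lemma pd_mult:
  fixes f g :: "'a::real_normed_vector \<Rightarrow> 'b::real_normed_algebra"
  assumes "f differentiable (at x)" "g differentiable (at x)"
  shows "pd v (\<lambda>x. f x * g x) x = f x * pd v g x + pd v f x * g x"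
  by (rule pd_eqI) (intro has_derivative_mult has_derivative_pd assms)

lemma pd_compose:
  fixes f :: "'a::real_normed_vector \<Rightarrow> real"
  assumes "f differentiable (at x)" "(m has_real_derivative m') (at (f x))"
  shows "pd v (\<lambda>x. m (f x)) x = m' * pd v f x"
proof (rule pd_eqI)
  show "((\<lambda>x. m (f x)) has_derivative (\<lambda>v. m' * pd v f x)) (at x)"
    using has_derivative_compose[OF has_derivative_pd[OF assms(1)], of m "(*) m'"] assms(2)
    by (simp add: has_field_derivative_def)
qed

lemma
  fixes f :: "'a::real_normed_vector \<Rightarrow> 'b::real_normed_vector"
  assumes "f differentiable (at (a + r *\<^sub>R x))"
  shows pd_shift: "pd v (\<lambda>x. f (a + r *\<^sub>R x)) x = r *\<^sub>R pd v f (a + r *\<^sub>R x)"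
    and differentiable_shift: "(\<lambda>x. f (a + r *\<^sub>R x)) differentiable (at x)"
proof -
  have "((\<lambda>x. a + r *\<^sub>R x) has_derivative (\<lambda>v. r *\<^sub>R v)) (at x)"
    by (auto intro!: derivative_eq_intros)
  from has_derivative_compose[OF this, of f "\<lambda>v. pd v f (a + r *\<^sub>R x)"] has_derivative_pd[OF assms]
  have D: "((\<lambda>x. f (a + r *\<^sub>R x)) has_derivative (\<lambda>v. pd (r *\<^sub>R v) f (a + r *\<^sub>R x))) (at x)"
    by simp
  have "pd (r *\<^sub>R v) f (a + r *\<^sub>R x) = r *\<^sub>R pd v f (a + r *\<^sub>R x)"
    by (rule linear_scale[OF linear_pd[OF assms]])
  with pd_eqI[OF D] show "pd v (\<lambda>x. f (a + r *\<^sub>R x)) x = r *\<^sub>R pd v f (a + r *\<^sub>R x)" by simp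
  show "(\<lambda>x. f (a + r *\<^sub>R x)) differentiable (at x)"
    using D by (auto simp: differentiable_def)
qed

lemma differentiable_cong_open:
  assumes "open S" "x \<in> S" "\<And>y. y \<in> S \<Longrightarrow> f y = g y" "f differentiable (at x)"
  shows "g differentiable (at x)"
  using has_derivative_transform_within_open[OF has_derivative_pd[OF assms(4)] assms(1,2), of g] assms(3)
  by (auto simp: differentiable_def)

lemma pd_cong_open:
  assumes "open S" "x \<in> S" "\<And>y. y \<in> S \<Longrightarrow> f y = g y"
  shows "pd v f x = pd v g x"
proof -
  have "(f has_derivative D) (at x) \<longleftrightarrow> (g has_derivative D) (at x)" for D
    using has_derivative_transform_within_open[OF _ assms(1,2), of f D UNIV g]
      has_derivative_transform_within_open[OF _ assms(1,2), of g D UNIV f] assms(3) by auto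
  then show ?thesis unfolding pd_def frechet_derivative_def by simp
qed

lemma C1_on_continuous: "C1_on S f \<Longrightarrow> continuous_on S f"
  unfolding C1_on_def by (meson continuous_at_imp_continuous_on differentiable_imp_continuous_within)

lemma C1_on_pd_continuous: "C1_on S f \<Longrightarrow> continuous_on S (pd v f)"
  by (simp add: C1_on_def)

lemma C1_on_differentiable: "C1_on S f \<Longrightarrow> x \<in> S \<Longrightarrow> f differentiable (at x)"
  by (simp add: C1_on_def)

lemma C2_on_C1: "C2_on S f \<Longrightarrow> C1_on S f" and C2_on_pd: "C2_on S f \<Longrightarrow> C1_on S (pd v f)"
  by (auto simp: C2_on_def)

lemma C1_on_subset: "C1_on S f \<Longrightarrow> T \<subseteq> S \<Longrightarrow> C1_on T f"
  unfolding C1_on_def by (meson continuous_on_subset subsetD)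

lemma C2_on_subset: "C2_on S f \<Longrightarrow> T \<subseteq> S \<Longrightarrow> C2_on T f"
  unfolding C2_on_def by (meson C1_on_subset)

lemma C1_on_cong:
  assumes "open S" "\<And>y. y \<in> S \<Longrightarrow> f y = g y" "C1_on S f"
  shows "C1_on S g"
proof -
  have "pd v f x = pd v g x" if "x \<in> S" for v x
    by (rule pd_cong_open[OF assms(1) that]) (use assms in auto)
  then have "continuous_on S (pd v f) \<longleftrightarrow> continuous_on S (pd v g)" for v
    by (intro continuous_on_cong) auto
  moreover have "g differentiable (at x)" if "x \<in> S" for x
    using differentiable_cong_open[OF assms(1) that, of f g] assms(2) C1_on_differentiable[OF assms(3) that] by blast
  ultimately show ?thesis using assms(3) unfolding C1_on_def by blast
qed

lemma C2_on_cong: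
  assumes "open S" "\<And>y. y \<in> S \<Longrightarrow> f y = g y" "C2_on S f"
  shows "C2_on S g"
proof -
  have "pd v f x = pd v g x" if "x \<in> S" for v x
    by (rule pd_cong_open[OF assms(1) that]) (use assms in auto)
  then have "C1_on S (pd v g)" for v
    using C1_on_cong[OF assms(1), of "pd v f" "pd v g"] C2_on_pd[OF assms(3)] by blast
  then show ?thesis using C1_on_cong[OF assms(1), of f g] assms(2) C2_on_C1[OF assms(3)] unfolding C2_on_def by blast
qed

lemma C1_on_Un:
  assumes "open S" "open T" "C1_on S f" "C1_on T f"
  shows "C1_on (S \<union> T) f"
  using assms continuous_on_open_Un unfolding C1_on_def by blast

lemma C2_on_Un:
  assumes "open S" "open T" "C2_on S f" "C2_on T f"
  shows "C2_on (S \<union> T) f"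
  using assms C1_on_Un unfolding C2_on_def by blast

lemma C1_on_const [simp]: "C1_on S (\<lambda>x. c)"
proof -
  have "pd v (\<lambda>x. c) = (\<lambda>x. 0)" for v :: 'a by auto
  then show ?thesis unfolding C1_on_def by auto
qed

lemma C2_on_const [simp]: "C2_on S (\<lambda>x. c)"
proof -
  have "pd v (\<lambda>x. c) = (\<lambda>x. 0)" for v :: 'a by auto
  then show ?thesis unfolding C2_on_def by auto
qed

lemma C1_on_bounded_linear:
  assumes "bounded_linear h" "C1_on S f"
  shows "C1_on S (\<lambda>x. h (f x))"
proof -
  have A: "continuous_on S (\<lambda>x. h (pd v f x))" for v
    using assms by (intro bounded_linear.continuous_on[OF assms(1)]) (auto simp: C1_on_def)
  have "continuous_on S (pd v (\<lambda>x. h (f x)))" for v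
    by (rule continuous_on_eq[OF A[of v]]) (simp add: pd_bounded_linear[OF assms(1) C1_on_differentiable[OF assms(2)]])
  moreover have "(\<lambda>x. h (f x)) differentiable (at x)" if "x \<in> S" for x
    using bounded_linear.has_derivative[OF assms(1) has_derivative_pd[OF C1_on_differentiable[OF assms(2) that]]]
    by (auto simp: differentiable_def)
  ultimately show ?thesis by (simp add: C1_on_def)
qed

lemma C2_on_bounded_linear:
  assumes "open S" "bounded_linear h" "C2_on S f"
  shows "C2_on S (\<lambda>x. h (f x))"
proof -
  have A: "C1_on S (\<lambda>x. h (pd v f x))" for v
    by (rule C1_on_bounded_linear[OF assms(2) C2_on_pd[OF assms(3)]])
  have "C1_on S (pd v (\<lambda>x. h (f x)))" for v
    by (rule C1_on_cong[OF assms(1) _ A[of v]])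
       (simp add: pd_bounded_linear[OF assms(2) C1_on_differentiable[OF C2_on_C1[OF assms(3)]]])
  then show ?thesis using C1_on_bounded_linear[OF assms(2) C2_on_C1[OF assms(3)]] by (simp add: C2_on_def)
qed

lemma C1_on_add:
  assumes "C1_on S f" "C1_on S g" shows "C1_on S (\<lambda>x. f x + g x)"
  unfolding C1_on_def
proof (intro conjI allI ballI)
  fix v
  have "continuous_on S (\<lambda>x. pd v f x + pd v g x)"
    using assms by (intro continuous_intros) (auto simp: C1_on_def)
  then show "continuous_on S (pd v (\<lambda>x. f x + g x))"
    by (rule continuous_on_eq) (use assms in \<open>auto simp: pd_add C1_on_def\<close>)
qed (use assms in \<open>auto simp: C1_on_def\<close>)

lemma C2_on_add:
  assumes "open S" "C2_on S f" "C2_on S g" shows "C2_on S (\<lambda>x. f x + g x)"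
proof -
  have A: "C1_on S (\<lambda>x. pd v f x + pd v g x)" for v
    using assms by (intro C1_on_add) (auto simp: C2_on_def)
  have "C1_on S (pd v (\<lambda>x. f x + g x))" for v
    by (rule C1_on_cong[OF assms(1) _ A[of v]])
       (use assms in \<open>auto simp: pd_add C1_on_def C2_on_def\<close>)
  then show ?thesis using assms C1_on_add by (auto simp: C2_on_def)
qed

lemma C1_on_mult:
  fixes f g :: "'a::real_normed_vector \<Rightarrow> 'b::real_normed_algebra"
  assumes "C1_on S f" "C1_on S g" shows "C1_on S (\<lambda>x. f x * g x)"
  unfolding C1_on_def
proof (intro conjI allI ballI)
  fix v
  have "continuous_on S (\<lambda>x. f x * pd v g x + pd v f x * g x)"
    using assms C1_on_continuous by (intro continuous_intros) (auto simp: C1_on_def)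
  then show "continuous_on S (pd v (\<lambda>x. f x * g x))"
    by (rule continuous_on_eq) (use assms in \<open>auto simp: pd_mult C1_on_def\<close>)
qed (use assms in \<open>auto simp: C1_on_def\<close>)

lemma C2_on_mult:
  fixes f g :: "'a::real_normed_vector \<Rightarrow> 'b::real_normed_algebra"
  assumes "open S" "C2_on S f" "C2_on S g" shows "C2_on S (\<lambda>x. f x * g x)"
proof -
  have A: "C1_on S (\<lambda>x. f x * pd v g x + pd v f x * g x)" for v
    using assms by (intro C1_on_add C1_on_mult) (auto simp: C2_on_def)
  have "C1_on S (pd v (\<lambda>x. f x * g x))" for v
    by (rule C1_on_cong[OF assms(1) _ A[of v]])
       (use assms in \<open>auto simp: pd_mult C1_on_def C2_on_def\<close>)
  then show ?thesis using assms C1_on_mult by (auto simp: C2_on_def)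
qed

lemma C1_on_minus: "C1_on S f \<Longrightarrow> C1_on S (\<lambda>x. - f x)"
  using C1_on_bounded_linear[OF bounded_linear_minus[OF bounded_linear_ident]] .

lemma C1_on_diff: "C1_on S f \<Longrightarrow> C1_on S g \<Longrightarrow> C1_on S (\<lambda>x. f x - g x)"
  using C1_on_add[OF _ C1_on_minus, of S f g] by simp

lemma C2_on_minus: "open S \<Longrightarrow> C2_on S f \<Longrightarrow> C2_on S (\<lambda>x. - f x)"
  using C2_on_bounded_linear[OF _ bounded_linear_minus[OF bounded_linear_ident]] .

lemma C2_on_diff: "open S \<Longrightarrow> C2_on S f \<Longrightarrow> C2_on S g \<Longrightarrow> C2_on S (\<lambda>x. f x - g x)"
  using C2_on_add[OF _ _ C2_on_minus, of S f g] by simp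

lemma C2_on_sum: "open S \<Longrightarrow> (\<And>i. i \<in> I \<Longrightarrow> C2_on S (f i)) \<Longrightarrow> C2_on S (\<lambda>x. \<Sum>i\<in>I. f i x)"
  by (induction I rule: infinite_finite_induct) (auto intro: C2_on_add)

lemma C1_on_compose:
  fixes f :: "'a::real_normed_vector \<Rightarrow> real"
  assumes "C1_on S f" "\<And>x. x \<in> S \<Longrightarrow> f x \<in> T" "\<And>y. y \<in> T \<Longrightarrow> (m has_real_derivative m' y) (at y)"
    "continuous_on T m'"
  shows "C1_on S (\<lambda>x. m (f x))"
  unfolding C1_on_def
proof (intro conjI allI ballI)
  fix x assume x: "x \<in> S"
  show "(\<lambda>x. m (f x)) differentiable at x"
    using has_derivative_compose[OF has_derivative_pd, of f x m "(*) (m' (f x))"] assms x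
    by (auto simp: has_field_derivative_def C1_on_def differentiable_def)
next
  fix v
  have "continuous_on S (\<lambda>x. m' (f x))"
    by (rule continuous_on_compose2[OF assms(4)]) (use assms C1_on_continuous in auto)
  then have "continuous_on S (\<lambda>x. m' (f x) * pd v f x)"
    using assms by (intro continuous_intros) (auto simp: C1_on_def)
  then show "continuous_on S (pd v (\<lambda>x. m (f x)))"
    by (rule continuous_on_eq) (simp add: pd_compose[OF C1_on_differentiable[OF assms(1)] assms(3)[OF assms(2)]])
qed

lemma C2_on_compose:
  fixes f :: "'a::real_normed_vector \<Rightarrow> real"
  assumes "open S" "C2_on S f" "\<And>x. x \<in> S \<Longrightarrow> f x \<in> T" "\<And>y. y \<in> T \<Longrightarrow> (m has_real_derivative m' y) (at y)"
    "\<And>y. y \<in> T \<Longrightarrow> (m' has_real_derivative m'' y) (at y)" "continuous_on T m''"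
  shows "C2_on S (\<lambda>x. m (f x))"
proof -
  have c1: "C1_on S (\<lambda>x. m' (f x))"
    by (rule C1_on_compose[OF C2_on_C1[OF assms(2)] assms(3,5,6)])
  have c: "continuous_on T m'"
    using assms(5) by (meson DERIV_continuous_on has_field_derivative_at_within)
  have A: "C1_on S (\<lambda>x. m' (f x) * pd v f x)" for v
    using assms c1 by (intro C1_on_mult) (auto simp: C2_on_def)
  have "C1_on S (pd v (\<lambda>x. m (f x)))" for v
    by (rule C1_on_cong[OF assms(1) _ A[of v]])
       (simp add: pd_compose[OF C1_on_differentiable[OF C2_on_C1[OF assms(2)]] assms(4)[OF assms(3)]])
  then show ?thesis using C1_on_compose[OF C2_on_C1[OF assms(2)] assms(3,4) c]
    by (auto simp: C2_on_def)
qed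

definition dz :: "'n::finite \<Rightarrow> (complex^'n \<Rightarrow> complex) \<Rightarrow> complex^'n \<Rightarrow> complex" where
  "dz j f x = (pd (axis j 1) f x - \<i> * pd (axis j \<i>) f x) / 2"

definition dbar :: "'n::finite \<Rightarrow> (complex^'n \<Rightarrow> complex) \<Rightarrow> complex^'n \<Rightarrow> complex" where
  "dbar j f x = (pd (axis j 1) f x + \<i> * pd (axis j \<i>) f x) / 2"

lemma dz_const [simp]: "dz j (\<lambda>x. c) x = 0" and dbar_const [simp]: "dbar j (\<lambda>x. c) x = 0"
  by (auto simp: dz_def dbar_def)

lemma
  assumes "f differentiable (at x)" "g differentiable (at x)"
  shows dbar_add: "dbar j (\<lambda>x. f x + g x) x = dbar j f x + dbar j g x"
    and dbar_diff: "dbar j (\<lambda>x. f x - g x) x = dbar j f x - dbar j g x"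
    and dz_mult: "dz j (\<lambda>x. f x * g x) x = f x * dz j g x + dz j f x * g x"
    and dbar_mult: "dbar j (\<lambda>x. f x * g x) x = f x * dbar j g x + dbar j f x * g x"
  using assms by (auto simp: dz_def dbar_def pd_add pd_diff pd_mult field_simps)

lemma dbar_sum:
  assumes "\<And>i. i \<in> I \<Longrightarrow> f i differentiable (at x)"
  shows "dbar j (\<lambda>x. \<Sum>i\<in>I. f i x) x = (\<Sum>i\<in>I. dbar j (f i) x)"
  using assms by (auto simp: dz_def dbar_def pd_sum sum_distrib_left sum_divide_distrib sum.distrib sum_subtractf diff_divide_distrib add_divide_distrib)

lemma differentiable_cnj: "f differentiable (at x) \<Longrightarrow> (\<lambda>x. cnj (f x)) differentiable (at x)"
  using bounded_linear.has_derivative[OF bounded_linear_cnj has_derivative_pd] by (auto simp: differentiable_def)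

lemma differentiable_of_real:
  "f differentiable (at x) \<Longrightarrow> (\<lambda>x. complex_of_real (f x)) differentiable (at x)"
  using bounded_linear.has_derivative[OF bounded_linear_of_real has_derivative_pd] by (auto simp: differentiable_def)

lemma
  assumes "f differentiable (at x)"
  shows dz_cnj: "dz j (\<lambda>x. cnj (f x)) x = cnj (dbar j f x)"
    and dbar_cnj: "dbar j (\<lambda>x. cnj (f x)) x = cnj (dz j f x)"
    and dz_cmult: "dz j (\<lambda>x. c * f x) x = c * dz j f x"
    and dbar_cmult: "dbar j (\<lambda>x. c * f x) x = c * dbar j f x"
  using assms pd_bounded_linear[OF bounded_linear_mult_right[of c], of f x]
  by (auto simp: dz_def dbar_def pd_bounded_linear[OF bounded_linear_cnj] algebra_simps diff_divide_distrib add_divide_distrib)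

lemma
  fixes f :: "complex^'n::finite \<Rightarrow> real"
  assumes "f differentiable (at x)" "(m has_real_derivative m') (at (f x))"
  shows dz_compose: "dz j (\<lambda>x. of_real (m (f x))) x = of_real m' * dz j (\<lambda>x. of_real (f x)) x"
    and dbar_compose: "dbar j (\<lambda>x. of_real (m (f x))) x = of_real m' * dbar j (\<lambda>x. of_real (f x)) x"
proof -
  have "(\<lambda>x. m (f x)) differentiable at x"
    using has_derivative_compose[OF has_derivative_pd, of f x m "(*) m'"] assms
    by (auto simp: has_field_derivative_def differentiable_def)
  then show "dz j (\<lambda>x. of_real (m (f x))) x = of_real m' * dz j (\<lambda>x. of_real (f x)) x"
    "dbar j (\<lambda>x. of_real (m (f x))) x = of_real m' * dbar j (\<lambda>x. of_real (f x)) x"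
    using assms by (simp_all add: dz_def dbar_def pd_bounded_linear[OF bounded_linear_of_real] pd_compose field_simps)
qed

lemma dbar_eq_cnj_dz_real:
  fixes f :: "complex^'n::finite \<Rightarrow> real"
  assumes "f differentiable (at x)"
  shows "dbar j (\<lambda>x. of_real (f x)) x = cnj (dz j (\<lambda>x. of_real (f x)) x)"
  using dbar_cnj[OF differentiable_of_real[OF assms], of j] by simp

lemma
  assumes "open S" "x \<in> S" "\<And>y. y \<in> S \<Longrightarrow> f y = g y"
  shows dz_cong_open: "dz j f x = dz j g x" and dbar_cong_open: "dbar j f x = dbar j g x"
  using pd_cong_open[OF assms] by (auto simp: dz_def dbar_def)

lemma
  assumes "C1_on S f"
  shows continuous_on_dz: "continuous_on S (dz j f)" and continuous_on_dbar: "continuous_on S (dbar j f)"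
  using assms unfolding dz_def[abs_def] dbar_def[abs_def] C1_on_def by (auto intro!: continuous_intros)

lemma
  assumes "C2_on S f"
  shows C1_on_dz: "C1_on S (dz j f)" and C1_on_dbar: "C1_on S (dbar j f)"
proof -
  have 1: "C1_on S (\<lambda>x. (1/2) * (pd (axis j 1) f x - \<i> * pd (axis j \<i>) f x))"
    "C1_on S (\<lambda>x. (1/2) * (pd (axis j 1) f x + \<i> * pd (axis j \<i>) f x))"
    using assms unfolding C2_on_def
    by (intro C1_on_mult C1_on_diff C1_on_add C1_on_const; blast)+
  have 2: "dz j f = (\<lambda>x. (1/2) * (pd (axis j 1) f x - \<i> * pd (axis j \<i>) f x))"
     "dbar j f = (\<lambda>x. (1/2) * (pd (axis j 1) f x + \<i> * pd (axis j \<i>) f x))"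
    by (auto simp: dz_def dbar_def fun_eq_iff)
  show "C1_on S (dz j f)" "C1_on S (dbar j f)" unfolding 2 by (rule 1)+
qed

lemma vec_expand:
  fixes \<xi> :: "complex^'n::finite"
  shows "\<xi> = (\<Sum>j\<in>UNIV. Re (\<xi>$j) *\<^sub>R axis j 1 + Im (\<xi>$j) *\<^sub>R axis j \<i>)"
  by (auto simp: vec_eq_iff axis_def if_distrib[where f="\<lambda>x. _ *\<^sub>R x"] complex_eq_iff if_distrib[where f=Re] if_distrib[where f=Im] sum.distrib sum.delta cong: if_cong)

text \<open>The differential splits into its complex linear and its antilinear part. This separates
  \<partial>F from dbar F in the mean value property and turns Levi forms into Laplacians along
  complex lines.\<close>

lemma pd_expand:
  fixes f :: "complex^'n::finite \<Rightarrow> complex"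
  assumes "f differentiable (at x)"
  shows "pd \<xi> f x = (\<Sum>j\<in>UNIV. \<xi>$j * dz j f x + cnj (\<xi>$j) * dbar j f x)"
proof -
  note L = linear_pd[OF assms]
  have "pd \<xi> f x = (\<Sum>j\<in>UNIV. Re (\<xi>$j) *\<^sub>R pd (axis j 1) f x + Im (\<xi>$j) *\<^sub>R pd (axis j \<i>) f x)"
    by (subst vec_expand[of \<xi>]) (simp add: linear_sum[OF L] linear_add[OF L] linear_scale[OF L])
  also have "\<dots> = (\<Sum>j\<in>UNIV. \<xi>$j * dz j f x + cnj (\<xi>$j) * dbar j f x)"
    by (rule sum.cong) (auto simp: dz_def dbar_def complex_eq_iff field_simps)
  finally show ?thesis .
qed

section \<open>Compactly supported functions and integration by parts\<close>

definition C0c :: "('a::euclidean_space \<Rightarrow> 'b::real_normed_vector) \<Rightarrow> bool" where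
  "C0c f \<longleftrightarrow> continuous_on UNIV f \<and> (\<exists>R. \<forall>x. R < norm x \<longrightarrow> f x = 0)"

definition C1c :: "('a::euclidean_space \<Rightarrow> 'b::real_normed_vector) \<Rightarrow> bool" where
  "C1c f \<longleftrightarrow> C1_on UNIV f \<and> (\<exists>R. \<forall>x. R < norm x \<longrightarrow> f x = 0)"

lemma C0c_continuous: "C0c f \<Longrightarrow> continuous_on UNIV f"
  by (simp add: C0c_def)

lemma C0c_support:
  assumes "C0c f" obtains R where "R > 0" "\<And>x. R \<le> norm x \<Longrightarrow> f x = 0"
proof -
  obtain R where R: "\<And>x. R < norm x \<Longrightarrow> f x = 0" using assms by (auto simp: C0c_def)
  show ?thesis by (rule that[of "max 1 (R + 1)"]) (auto intro!: R)
qed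

lemma C0c_integrable:
  fixes f :: "'a::euclidean_space \<Rightarrow> 'b::{banach, second_countable_topology}"
  assumes "C0c f" shows "integrable lborel f"
proof -
  obtain R where R: "R > 0" "\<And>x. R \<le> norm x \<Longrightarrow> f x = 0" using C0c_support[OF assms] by blast
  have "integrable lborel (\<lambda>x. indicator (cball 0 R) x *\<^sub>R f x)"
    by (rule borel_integrable_compact) (use assms in \<open>auto intro: continuous_on_subset simp: C0c_def\<close>)
  moreover have "(\<lambda>x. indicator (cball 0 R) x *\<^sub>R f x) = f"
    using R by (auto simp: indicator_def fun_eq_iff)
  ultimately show ?thesis by simp
qed

lemma C0c_bounded:
  assumes "C0c f" obtains M where "M > 0" "\<And>x. norm (f x) \<le> M"
proof -
  obtain R where R: "R > 0" "\<And>x. R \<le> norm x \<Longrightarrow> f x = 0" using C0c_support[OF assms] by blast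
  have "compact (f ` cball 0 R)"
    using assms by (intro compact_continuous_image) (auto intro: continuous_on_subset simp: C0c_def)
  then obtain M where M: "M > 0" "\<And>y. y \<in> f ` cball 0 R \<Longrightarrow> norm y \<le> M"
    using compact_imp_bounded bounded_pos by metis
  have "norm (f x) \<le> M" for x
    by (cases "norm x \<le> R") (use M R in auto)
  then show ?thesis using that M by blast
qed

lemma C0c_mult1:
  fixes f g :: "'a::euclidean_space \<Rightarrow> 'b::real_normed_algebra"
  assumes "C0c f" "continuous_on UNIV g" shows "C0c (\<lambda>x. f x * g x)"
  using assms unfolding C0c_def by (auto intro!: continuous_intros) (metis mult_zero_left mult_zero_right)

lemma C0c_mult2:
  fixes f g :: "'a::euclidean_space \<Rightarrow> 'b::real_normed_algebra"
  assumes "C0c f" "continuous_on UNIV g" shows "C0c (\<lambda>x. g x * f x)"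
  using assms unfolding C0c_def by (auto intro!: continuous_intros) (metis mult_zero_left mult_zero_right)

lemma C0c_comp:
  assumes "C0c f" "continuous_on UNIV h" "h 0 = 0" shows "C0c (\<lambda>x. h (f x))"
  using assms unfolding C0c_def by (auto intro!: continuous_on_compose2[of UNIV h UNIV f]) metis

lemma C0c_add:
  assumes "C0c f" "C0c g" shows "C0c (\<lambda>x. f x + g x)"
proof -
  obtain R where R: "\<And>x. R < norm x \<Longrightarrow> f x = 0" using assms by (auto simp: C0c_def)
  obtain S where S: "\<And>x. S < norm x \<Longrightarrow> g x = 0" using assms by (auto simp: C0c_def)
  show ?thesis unfolding C0c_def
    by (intro conjI exI[of _ "max R S"]) (use assms R S in \<open>auto intro!: continuous_intros simp: C0c_def\<close>)
qed

lemma C0c_zero: "C0c (\<lambda>x. 0)" by (simp add: C0c_def)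

lemma C0c_minus: "C0c f \<Longrightarrow> C0c (\<lambda>x. - f x)"
  unfolding C0c_def by (auto intro!: continuous_intros)

lemma C0c_diff: "C0c f \<Longrightarrow> C0c g \<Longrightarrow> C0c (\<lambda>x. f x - g x)"
  using C0c_add[OF _ C0c_minus, of f g] by simp

lemma C0c_sum: "(\<And>i. i \<in> I \<Longrightarrow> C0c (f i)) \<Longrightarrow> C0c (\<lambda>x. \<Sum>i\<in>I. f i x)"
  by (induction I rule: infinite_finite_induct) (auto intro: C0c_add C0c_zero)

lemma C1c_C0c: "C1c f \<Longrightarrow> C0c f"
  by (auto simp: C1c_def C0c_def C1_on_continuous)

lemma C1c_C1: "C1c f \<Longrightarrow> C1_on UNIV f" by (simp add: C1c_def)

lemma C1c_differentiable: "C1c f \<Longrightarrow> f differentiable (at x)"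
  by (simp add: C1c_def C1_on_def)

lemma C1c_iff: "C1c f \<longleftrightarrow> C1_on UNIV f \<and> C0c f"
  by (auto simp: C1c_def C0c_def C1_on_continuous)

lemma C1c_pd_C0c:
  assumes "C1c f" shows "C0c (pd v f)"
proof -
  obtain R where R: "\<And>x. R < norm x \<Longrightarrow> f x = 0" using assms by (auto simp: C1c_def)
  have "pd v f x = 0" if "R < norm x" for x
  proof -
    have "open {x::'a. R < norm x}" by (intro open_Collect_less continuous_intros)
    then have "pd v f x = pd v (\<lambda>x. 0) x"
      by (rule pd_cong_open) (use R that in auto)
    then show ?thesis by simp
  qed
  then show ?thesis using assms by (auto simp: C0c_def C1c_def C1_on_def)
qed

lemma C1c_dbar_C0c: "C1c f \<Longrightarrow> C0c (dbar j f)" and C1c_dz_C0c: "C1c f \<Longrightarrow> C0c (dz j f)"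
  unfolding dbar_def[abs_def] dz_def[abs_def] divide_inverse
  by (intro C0c_mult1 C0c_add C0c_diff C0c_mult2 C1c_pd_C0c; simp)+

lemma C1c_add: "C1c f \<Longrightarrow> C1c g \<Longrightarrow> C1c (\<lambda>x. f x + g x)"
  unfolding C1c_iff by (auto intro: C1_on_add C0c_add)

lemma C1c_diff: "C1c f \<Longrightarrow> C1c g \<Longrightarrow> C1c (\<lambda>x. f x - g x)"
  unfolding C1c_iff by (auto intro: C1_on_diff C0c_diff)

lemma C1c_mult1:
  fixes f g :: "'a::euclidean_space \<Rightarrow> 'b::real_normed_algebra"
  shows "C1c f \<Longrightarrow> C1_on UNIV g \<Longrightarrow> C1c (\<lambda>x. f x * g x)"
  unfolding C1c_iff by (auto intro!: C1_on_mult C0c_mult1 C1_on_continuous)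

lemma C1c_mult2:
  fixes f g :: "'a::euclidean_space \<Rightarrow> 'b::real_normed_algebra"
  shows "C1c f \<Longrightarrow> C1_on UNIV g \<Longrightarrow> C1c (\<lambda>x. g x * f x)"
  unfolding C1c_iff by (auto intro!: C1_on_mult C0c_mult2 C1_on_continuous)

lemma C1c_zero: "C1c (\<lambda>x. 0)" by (simp add: C1c_def)

section \<open>Translation invariance and integration by parts\<close>

lemma lborel_integral_shift:
  fixes f :: "'a::euclidean_space \<Rightarrow> 'b::{banach, second_countable_topology}"
  assumes "f \<in> borel_measurable borel"
  shows "(\<integral>x. f (a + x) \<partial>lborel) = (\<integral>x. f x \<partial>lborel)"
proof -
  have "(\<integral>x. f x \<partial>lborel) = (\<integral>x. f x \<partial>(distr lborel borel ((+) a)))"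
    by (simp add: lborel_distr_plus)
  also have "\<dots> = (\<integral>x. f (a + x) \<partial>lborel)"
    by (rule integral_distr) (use assms in auto)
  finally show ?thesis by simp
qed

lemma lborel_integral_reflect:
  fixes f :: "'a::euclidean_space \<Rightarrow> 'b::{banach, second_countable_topology}"
  assumes "f \<in> borel_measurable borel"
  shows "(\<integral>x. f (a - x) \<partial>lborel) = (\<integral>x. f x \<partial>lborel)"
proof -
  have eq: "lborel = (distr lborel borel (\<lambda>x. a + (-1) *\<^sub>R x) :: 'a measure)"
  proof -
    have *: "density M (\<lambda>x. ennreal (\<bar>-1\<bar> ^ DIM('a))) = M" for M :: "'a measure"
      by (simp add: density_1)
    show ?thesis using lborel_affine[of "-1" a] unfolding * by simp
  qed
  have "(\<integral>x. f x \<partial>lborel) = (\<integral>x. f x \<partial>(distr lborel borel (\<lambda>x. a + (-1) *\<^sub>R x)))"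
    by (subst (1) eq) simp
  also have "\<dots> = (\<integral>x. f (a + (-1) *\<^sub>R x) \<partial>lborel)"
    by (rule integral_distr) (use assms in auto)
  finally show ?thesis by simp
qed

lemma line_has_vector_derivative:
  fixes f :: "'a::real_normed_vector \<Rightarrow> 'b::real_normed_vector"
  assumes "f differentiable (at (x + s *\<^sub>R v))"
  shows "((\<lambda>s. f (x + s *\<^sub>R v)) has_vector_derivative pd v f (x + s *\<^sub>R v)) (at s)"
proof -
  have "((\<lambda>s. x + s *\<^sub>R v) has_derivative (\<lambda>h. h *\<^sub>R v)) (at s)"
    by (auto intro!: derivative_eq_intros)
  from has_derivative_compose[OF this, of f "\<lambda>w. pd w f (x + s *\<^sub>R v)"] has_derivative_pd[OF assms]
  have D: "((\<lambda>s. f (x + s *\<^sub>R v)) has_derivative (\<lambda>h. pd (h *\<^sub>R v) f (x + s *\<^sub>R v))) (at s)"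
    by simp
  have "pd (h *\<^sub>R v) f (x + s *\<^sub>R v) = h *\<^sub>R pd v f (x + s *\<^sub>R v)" for h
    by (rule linear_scale[OF linear_pd[OF assms]])
  with D show ?thesis by (simp add: has_vector_derivative_def)
qed

lemma norm_diff_le_pd:
  fixes f :: "'a::real_normed_vector \<Rightarrow> 'b::real_normed_vector"
  assumes "\<And>s. s \<in> {0..h} \<Longrightarrow> f differentiable (at (x + s *\<^sub>R v))"
    "\<And>s. s \<in> {0..h} \<Longrightarrow> norm (pd v f (x + s *\<^sub>R v)) \<le> M" "h \<ge> 0"
  shows "norm (f (x + h *\<^sub>R v) - f x) \<le> M * h"
proof (cases "h = 0")
  case False
  then have "h > 0" using assms by simp
  have "norm (f (x + h *\<^sub>R v) - f (x + 0 *\<^sub>R v)) \<le> M * h - M * 0"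
  proof (rule differentiable_bound_general[OF \<open>h > 0\<close>])
    show "continuous_on {0..h} (\<lambda>s. f (x + s *\<^sub>R v))"
      using line_has_vector_derivative[OF assms(1)]
      by (meson continuous_at_imp_continuous_on has_vector_derivative_continuous)
    show "continuous_on {0..h} (\<lambda>s. M * s)" by (intro continuous_intros)
    fix s assume s: "0 < s" "s < h"
    show "((\<lambda>s. f (x + s *\<^sub>R v)) has_vector_derivative pd v f (x + s *\<^sub>R v)) (at s)"
      using line_has_vector_derivative[OF assms(1)] s by auto
    show "((\<lambda>s. M * s) has_vector_derivative M) (at s)"
      unfolding has_real_derivative_iff_has_vector_derivative[symmetric]
      by (auto intro!: derivative_eq_intros)
    show "norm (pd v f (x + s *\<^sub>R v)) \<le> M" using assms(2) s by auto
  qed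
  then show ?thesis by simp
qed auto

text \<open>Translation invariance makes the integral of every difference quotient vanish. The
  quotients converge to the directional derivative, and the mean value inequality gives an
  integrable majorant, so the limit passes under the integral.\<close>

lemma integral_pd_zero:
  fixes f :: "'a::euclidean_space \<Rightarrow> complex"
  assumes "C1c f"
  shows "(\<integral>x. pd v f x \<partial>lborel) = 0"
proof -
  obtain R where R: "R > 0" "\<And>x. R \<le> norm x \<Longrightarrow> f x = 0" using C0c_support[OF C1c_C0c[OF assms]] by blast
  obtain M where M: "M > 0" "\<And>x. norm (pd v f x) \<le> M" using C0c_bounded[OF C1c_pd_C0c[OF assms]] by blast
  define g where "g k x = of_nat (Suc k) * (f (x + (1 / real (Suc k)) *\<^sub>R v) - f x)" for k x
  have fm: "f \<in> borel_measurable borel"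
    using C1_on_continuous[OF C1c_C1[OF assms]] borel_measurable_continuous_onI by blast
  have int0: "(\<integral>x. g k x \<partial>lborel) = 0" for k
  proof -
    have "integrable lborel (\<lambda>x. f ((1 / real (Suc k)) *\<^sub>R v + x))"
    proof (rule C0c_integrable)
      have "f ((1 / real (Suc k)) *\<^sub>R v + x) = 0" if "R + norm ((1 / real (Suc k)) *\<^sub>R v) < norm x" for x
        by (rule R(2)) (use norm_triangle_ineq[of "(1 / real (Suc k)) *\<^sub>R v + x" "- ((1 / real (Suc k)) *\<^sub>R v)"] that in auto)
      then show "C0c (\<lambda>x. f ((1 / real (Suc k)) *\<^sub>R v + x))"
        unfolding C0c_def using C1_on_continuous[OF C1c_C1[OF assms]]
        by (auto intro!: continuous_on_compose2[of UNIV f] continuous_intros)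
    qed
    then have "(\<integral>x. f ((1 / real (Suc k)) *\<^sub>R v + x) - f x \<partial>lborel) = 0"
      using lborel_integral_shift[OF fm] C0c_integrable[OF C1c_C0c[OF assms]]
      by (subst Bochner_Integration.integral_diff) auto
    then show ?thesis unfolding g_def by (simp add: add.commute)
  qed
  have "(\<lambda>k. \<integral>x. g k x \<partial>lborel) \<longlonglongrightarrow> (\<integral>x. pd v f x \<partial>lborel)"
  \<comment> \<open>The step lengths are at most 1, so outside this ball both f and its translate
    vanish.\<close>
  proof (rule integral_dominated_convergence[where w="\<lambda>x. indicator (cball 0 (R + norm v)) x *\<^sub>R M"])
    show "pd v f \<in> borel_measurable lborel"
      using C1c_pd_C0c[OF assms, of v] by (auto simp: C0c_def intro!: borel_measurable_continuous_onI)
    show "g k \<in> borel_measurable lborel" for k unfolding g_def using fm by measurable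
    show "integrable lborel (\<lambda>x. indicator (cball 0 (R + norm v)) x *\<^sub>R M)"
      by (rule borel_integrable_compact) auto
    show "AE x in lborel. (\<lambda>k. g k x) \<longlonglongrightarrow> pd v f x"
    proof (intro AE_I2)
      fix x
      have "((\<lambda>s. f (x + s *\<^sub>R v)) has_vector_derivative pd v f (x + 0 *\<^sub>R v)) (at 0)"
        by (rule line_has_vector_derivative) (use assms in \<open>auto intro: C1c_differentiable\<close>)
      then have "((\<lambda>s. norm (f (x + s *\<^sub>R v) - f x - s *\<^sub>R pd v f x) / norm s) \<longlongrightarrow> 0) (at 0)"
        by (simp add: has_vector_derivative_def has_derivative_at)
      then have "((\<lambda>s. norm ((f (x + s *\<^sub>R v) - f x) /\<^sub>R s - pd v f x)) \<longlongrightarrow> 0) (at 0)"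
      proof (rule Lim_transform_eventually)
        have "norm (f (x + s *\<^sub>R v) - f x - s *\<^sub>R pd v f x) / norm s = norm ((f (x + s *\<^sub>R v) - f x) /\<^sub>R s - pd v f x)"
          if "s \<noteq> 0" for s
        proof -
          have "(f (x + s *\<^sub>R v) - f x) /\<^sub>R s - pd v f x = (f (x + s *\<^sub>R v) - f x - s *\<^sub>R pd v f x) /\<^sub>R s"
            using that by (simp add: scaleR_right_diff_distrib)
          then show ?thesis by (simp add: divide_inverse)
        qed
        then show "\<forall>\<^sub>F s in at 0. norm (f (x + s *\<^sub>R v) - f x - s *\<^sub>R pd v f x) / norm s
             = norm ((f (x + s *\<^sub>R v) - f x) /\<^sub>R s - pd v f x)"
          by (auto simp: eventually_at_filter)
      qed
      then have "((\<lambda>s. (f (x + s *\<^sub>R v) - f x) /\<^sub>R s) \<longlongrightarrow> pd v f x) (at 0)"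
        by (simp add: tendsto_norm_zero_iff LIM_zero_iff)
      then have "(\<lambda>k. (f (x + (1 / real (Suc k)) *\<^sub>R v) - f x) /\<^sub>R (1 / real (Suc k))) \<longlonglongrightarrow> pd v f x"
        by (rule filterlim_compose) (intro filterlim_atI LIMSEQ_Suc[OF lim_1_over_n] always_eventually allI, simp)
      then show "(\<lambda>k. g k x) \<longlonglongrightarrow> pd v f x"
        by (simp add: g_def scaleR_conv_of_real)
    qed
    fix k
    show "AE x in lborel. norm (g k x) \<le> indicator (cball 0 (R + norm v)) x *\<^sub>R M"
    proof (intro AE_I2)
      fix x
      have le: "norm (g k x) \<le> M"
      proof -
        have "norm (f (x + (1 / real (Suc k)) *\<^sub>R v) - f x) \<le> M * (1 / real (Suc k))"
          by (rule norm_diff_le_pd) (use M C1c_differentiable[OF assms] in auto)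
        then show ?thesis
          unfolding g_def norm_mult norm_of_nat by (simp add: field_simps)
      qed
      show "norm (g k x) \<le> indicator (cball 0 (R + norm v)) x *\<^sub>R M"
      proof (cases "norm x \<le> R + norm v")
        case False
        have "norm ((1 / real (Suc k)) *\<^sub>R v) \<le> norm v"
          using mult_left_mono[of 1 "real (Suc k)" "norm v"] by (simp add: field_simps)
        then have "R \<le> norm (x + (1 / real (Suc k)) *\<^sub>R v)"
          using False norm_triangle_ineq[of "x + (1 / real (Suc k)) *\<^sub>R v" "- ((1 / real (Suc k)) *\<^sub>R v)"] by auto
        moreover have "R \<le> norm x" using False norm_ge_zero[of v] by linarith
        ultimately have "g k x = 0" unfolding g_def using R by auto
        then show ?thesis using M by (auto simp: indicator_def)
      qed (use le in auto)
    qed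
  qed
  then show ?thesis using int0 by (simp add: LIMSEQ_const_iff)
qed

lemma integral_dbar_zero: "C1c f \<Longrightarrow> (\<integral>x. dbar j f x \<partial>lborel) = 0"
  and integral_dz_zero: "C1c f \<Longrightarrow> (\<integral>x. dz j f x \<partial>lborel) = 0"
  unfolding dz_def[abs_def] dbar_def[abs_def]
  by (simp_all add: integral_pd_zero C0c_integrable[OF C1c_pd_C0c])

text \<open>The product with the compactly supported f is compactly supported, so its derivative
  integrates to zero.\<close>

lemma
  assumes "C1c f" "C1_on UNIV g"
  shows integral_by_parts_dbar: "(\<integral>x. dbar j f x * g x \<partial>lborel) = - (\<integral>x. f x * dbar j g x \<partial>lborel)"
    and integral_by_parts_dz: "(\<integral>x. dz j f x * g x \<partial>lborel) = - (\<integral>x. f x * dz j g x \<partial>lborel)"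
proof -
  note d = C1c_differentiable[OF assms(1)] C1_on_differentiable[OF assms(2) UNIV_I]
  have i: "integrable lborel (\<lambda>x. dbar j f x * g x)" "integrable lborel (\<lambda>x. f x * dbar j g x)"
     "integrable lborel (\<lambda>x. dz j f x * g x)" "integrable lborel (\<lambda>x. f x * dz j g x)"
    by (rule C0c_integrable[OF C0c_mult1[OF C1c_dbar_C0c[OF assms(1)] C1_on_continuous[OF assms(2)]]]
        C0c_integrable[OF C0c_mult1[OF C1c_C0c[OF assms(1)] continuous_on_dbar[OF assms(2)]]]
        C0c_integrable[OF C0c_mult1[OF C1c_dz_C0c[OF assms(1)] C1_on_continuous[OF assms(2)]]]
        C0c_integrable[OF C0c_mult1[OF C1c_C0c[OF assms(1)] continuous_on_dz[OF assms(2)]]])+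
  have "0 = (\<integral>x. f x * dbar j g x + dbar j f x * g x \<partial>lborel)"
    using integral_dbar_zero[OF C1c_mult1[OF assms]] by (simp add: dbar_mult d)
  then show "(\<integral>x. dbar j f x * g x \<partial>lborel) = - (\<integral>x. f x * dbar j g x \<partial>lborel)"
    using i by (simp add: eq_neg_iff_add_eq_0 add.commute)
  have "0 = (\<integral>x. f x * dz j g x + dz j f x * g x \<partial>lborel)"
    using integral_dz_zero[OF C1c_mult1[OF assms]] by (simp add: dz_mult d)
  then show "(\<integral>x. dz j f x * g x \<partial>lborel) = - (\<integral>x. f x * dz j g x \<partial>lborel)"
    using i by (simp add: eq_neg_iff_add_eq_0 add.commute)
qed

text \<open>Differentiation under the integral over a compact box, in the form shared by
  convolutions and the Cauchy formula: \<phi> moves the point, k is the kernel, and U keeps the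
  moved points where f is C^1.\<close>

lemma
  fixes f :: "'a::euclidean_space \<Rightarrow> complex" and \<phi> :: "'p::euclidean_space \<Rightarrow> 'a" and k :: "'p \<Rightarrow> complex"
  assumes "C1_on S f" "continuous_on (cbox a b) \<phi>" "continuous_on (cbox a b) k" "open U"
    and sub: "\<And>x y. x \<in> U \<Longrightarrow> y \<in> cbox a b \<Longrightarrow> x + \<phi> y \<in> S"
  shows C1_on_param_integral: "C1_on U (\<lambda>x. integral (cbox a b) (\<lambda>y. k y * f (x + \<phi> y)))"
    and pd_param_integral: "x \<in> U \<Longrightarrow> pd v (\<lambda>x. integral (cbox a b) (\<lambda>y. k y * f (x + \<phi> y))) x
           = integral (cbox a b) (\<lambda>y. k y * pd v f (x + \<phi> y))"
proof -
  let ?G = "\<lambda>x. integral (cbox a b) (\<lambda>y. k y * f (x + \<phi> y))"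
  have cont: "continuous_on (U \<times> cbox a b) (\<lambda>(x,y). k y * g (x + \<phi> y))" if "continuous_on S g" for g
  proof -
    have "continuous_on (U \<times> cbox a b) (\<lambda>p. k (snd p))"
      by (rule continuous_on_compose2[OF assms(3)]) (auto intro!: continuous_intros)
    moreover have "continuous_on (U \<times> cbox a b) (\<lambda>p. \<phi> (snd p))"
      by (rule continuous_on_compose2[OF assms(2)]) (auto intro!: continuous_intros)
    then have "continuous_on (U \<times> cbox a b) (\<lambda>p. g (fst p + \<phi> (snd p)))"
      by (intro continuous_on_compose2[OF that]) (use sub in \<open>auto intro!: continuous_intros\<close>)
    ultimately show ?thesis unfolding split_def by (intro continuous_intros)
  qed
  have cont1: "continuous_on (cbox a b) (\<lambda>y. k y * g (x + \<phi> y))" if "continuous_on S g" "x \<in> U" for g x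
  proof -
    have "continuous_on (cbox a b) (\<lambda>y. (case (x, y) of (x, y) \<Rightarrow> k y * g (x + \<phi> y)))"
      by (rule continuous_on_compose2[OF cont[OF that(1)]]) (use that in \<open>auto intro!: continuous_intros\<close>)
    then show ?thesis by simp
  qed
  have D: "(?G has_derivative (\<lambda>v. integral (cbox a b) (\<lambda>y. k y * pd v f (x + \<phi> y)))) (at x)" if x: "x \<in> U" for x
  proof -
    obtain e where e: "e > 0" "ball x e \<subseteq> U" using assms(4) x open_contains_ball by blast
    \<comment> \<open>The Leibniz rule expects a derivative with values in bounded linear maps;
      \<open>Blinfun\<close> packs the directional derivatives, and continuity is checked one
      direction at a time.\<close>
    define fx where "fx x y = Blinfun (\<lambda>v. k y * pd v f (x + \<phi> y))" for x y
    have bl: "bounded_linear (\<lambda>v. k y * pd v f (x + \<phi> y))" if "x \<in> U" "y \<in> cbox a b" for x y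
    proof -
      have "bounded_linear (\<lambda>v. pd v f (x + \<phi> y))"
        using has_derivative_bounded_linear[OF has_derivative_pd[OF C1_on_differentiable[OF assms(1) sub[OF that]]]] .
      then show ?thesis by (rule bounded_linear_compose[OF bounded_linear_mult_right])
    qed
    have fx: "blinfun_apply (fx x y) v = k y * pd v f (x + \<phi> y)" if "x \<in> U" "y \<in> cbox a b" for x y v
      unfolding fx_def using bounded_linear_Blinfun_apply[OF bl[OF that]] by simp
    have contfx: "continuous_on (U \<times> cbox a b) (\<lambda>(x, y). fx x y)"
    proof (rule continuous_on_blinfun_componentwise)
      fix v :: 'a
      show "continuous_on (U \<times> cbox a b) (\<lambda>p. blinfun_apply (case p of (x, y) \<Rightarrow> fx x y) v)"
        by (rule continuous_on_eq[OF cont[OF C1_on_pd_continuous[OF assms(1), of v]]]) (auto simp: fx)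
    qed
    have "(?G has_derivative integral (cbox a b) (fx x)) (at x within ball x e)"
    proof (rule leibniz_rule)
      fix x' y assume xy: "x' \<in> ball x e" "y \<in> cbox a b"
      then have s: "x' + \<phi> y \<in> S" using sub e by blast
      have "((\<lambda>x. x + \<phi> y) has_derivative (\<lambda>v. v)) (at x')" by (auto intro!: derivative_eq_intros)
      from has_derivative_compose[OF this, of f "\<lambda>v. pd v f (x' + \<phi> y)"] has_derivative_pd[OF C1_on_differentiable[OF assms(1) s]]
      have "((\<lambda>x. f (x + \<phi> y)) has_derivative (\<lambda>v. pd v f (x' + \<phi> y))) (at x')" by simp
      then have "((\<lambda>x. k y * f (x + \<phi> y)) has_derivative (\<lambda>v. k y * pd v f (x' + \<phi> y))) (at x')"
        by (rule has_derivative_mult_right)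
      moreover have "blinfun_apply (fx x' y) = (\<lambda>v. k y * pd v f (x' + \<phi> y))"
        using fx xy e by (auto simp: fun_eq_iff subset_iff)
      ultimately show "((\<lambda>x. k y * f (x + \<phi> y)) has_derivative blinfun_apply (fx x' y)) (at x' within ball x e)"
        by (simp add: has_derivative_at_withinI)
    next
      fix x' assume "x' \<in> ball x e"
      then show "(\<lambda>y. k y * f (x' + \<phi> y)) integrable_on cbox a b"
        using cont1[OF C1_on_continuous[OF assms(1)], of x'] e by (intro integrable_continuous) auto
    next
      show "continuous_on (ball x e \<times> cbox a b) (\<lambda>(x, y). fx x y)"
        by (rule continuous_on_subset[OF contfx]) (use e in auto)
    qed (use e in auto)
    then have 1: "(?G has_derivative integral (cbox a b) (fx x)) (at x)"
      using has_derivative_at_withinI at_within_open[of x "ball x e"] e(1) by simp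
    have "fx x integrable_on cbox a b"
    proof (rule integrable_continuous)
      have "continuous_on (cbox a b) (\<lambda>y. (case (x, y) of (x, y) \<Rightarrow> fx x y))"
        by (rule continuous_on_compose2[OF contfx]) (use x in \<open>auto intro!: continuous_intros\<close>)
      then show "continuous_on (cbox a b) (fx x)" by simp
    qed
    then have "blinfun_apply (integral (cbox a b) (fx x)) v = integral (cbox a b) (\<lambda>y. k y * pd v f (x + \<phi> y))" for v
      using fx[OF x] by (auto simp: blinfun_apply_integral intro!: integral_cong)
    then have "blinfun_apply (integral (cbox a b) (fx x)) = (\<lambda>v. integral (cbox a b) (\<lambda>y. k y * pd v f (x + \<phi> y)))"
      by (rule ext)
    with 1 show ?thesis by simp
  qed
  show pd: "pd v ?G x = integral (cbox a b) (\<lambda>y. k y * pd v f (x + \<phi> y))" if "x \<in> U" for x v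
    using pd_eqI[OF D[OF that]] .
  have "continuous_on U (pd v ?G)" for v
  proof -
    have "continuous_on U (\<lambda>x. integral (cbox a b) (\<lambda>y. k y * pd v f (x + \<phi> y)))"
      by (rule integral_continuous_on_param) (use cont[OF C1_on_pd_continuous[OF assms(1), of v]] in auto)
    then show ?thesis by (rule continuous_on_eq) (use pd in auto)
  qed
  then show "C1_on U ?G" using D unfolding C1_on_def differentiable_def by blast
qed

section \<open>Convolution and mollifiers\<close>

lemma lborel_integral_cbox:
  fixes f :: "'a::euclidean_space \<Rightarrow> 'b::euclidean_space"
  assumes "integrable lborel f" "\<And>x. x \<notin> cbox a b \<Longrightarrow> f x = 0"
  shows "(\<integral>x. f x \<partial>lborel) = integral (cbox a b) f"
proof -
  have "(\<integral>x. f x \<partial>lborel) = integral UNIV f" using integral_lborel[OF assms(1)] by simp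
  also have "\<dots> = integral UNIV (\<lambda>x. if x \<in> cbox a b then f x else 0)"
    using assms(2) by (intro arg_cong[of f _ "integral UNIV"]) auto
  finally show ?thesis by (simp only: integral_restrict_UNIV)
qed

lemma C0c_cbox:
  assumes "C0c f" obtains a b where "\<And>x. x \<notin> cbox a b \<Longrightarrow> f x = 0"
proof -
  obtain R where R: "R > 0" "\<And>x. R \<le> norm x \<Longrightarrow> f x = 0" using C0c_support[OF assms] by blast
  obtain a b where "cball (0::'a) R \<subseteq> cbox a b" using bounded_subset_cbox_symmetric[OF bounded_cball] by metis
  then have "f x = 0" if "x \<notin> cbox a b" for x using that R(2)[of x] by (force simp: subset_iff)
  then show ?thesis using that by blast
qed

lemma Fubini_C0c:
  fixes H :: "'a::euclidean_space \<Rightarrow> 'b::euclidean_space \<Rightarrow> 'c::{banach, second_countable_topology}"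
  assumes "C0c (\<lambda>p. H (fst p) (snd p))"
  shows "(\<integral>x. (\<integral>u. H x u \<partial>lborel) \<partial>lborel) = (\<integral>u. (\<integral>x. H x u \<partial>lborel) \<partial>lborel)"
proof -
  have "integrable (lborel \<Otimes>\<^sub>M lborel) (\<lambda>p. H (fst p) (snd p))"
    unfolding lborel_prod using C0c_integrable[OF assms] .
  then have "integrable (lborel \<Otimes>\<^sub>M lborel) (\<lambda>(x, u). H x u)" by (simp add: split_def)
  from lborel_pair.Fubini_integral[OF this] show ?thesis by simp
qed

lemma continuous_on_translate:
  "continuous_on UNIV f \<Longrightarrow> continuous_on UNIV (\<lambda>y. f (x - y :: 'a::real_normed_vector))"
  by (auto intro!: continuous_on_compose2[of UNIV f UNIV] continuous_intros)

lemma C0c_translate: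
  assumes "C0c f" shows "C0c (\<lambda>y. f (x - y))"
proof -
  obtain R where R: "R > 0" "\<And>x. R \<le> norm x \<Longrightarrow> f x = 0" using C0c_support[OF assms] by blast
  have "f (x - y) = 0" if "R + norm x < norm y" for y
    by (rule R(2)) (use norm_triangle_ineq2[of y x] that in \<open>simp add: norm_minus_commute\<close>)
  then show ?thesis using assms continuous_on_translate[of f x] by (auto simp: C0c_def)
qed

text \<open>The first argument is the rough, compactly supported factor and the second the smooth
  kernel: derivatives fall on \<rho>, and \<open>conv_pd_left\<close> moves them to b when b is
  C^1.\<close>

definition conv :: "('a::euclidean_space \<Rightarrow> complex) \<Rightarrow> ('a \<Rightarrow> complex) \<Rightarrow> 'a \<Rightarrow> complex" where
  "conv b \<rho> x = (\<integral>y. b y * \<rho> (x - y) \<partial>lborel)"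

lemma conv_integrable:
  fixes b :: "'a::euclidean_space \<Rightarrow> complex"
  shows "C0c b \<Longrightarrow> continuous_on UNIV \<rho> \<Longrightarrow> integrable lborel (\<lambda>y. b y * \<rho> (x - y))"
  by (intro C0c_integrable C0c_mult1 continuous_on_translate)

lemma conv_flip:
  assumes "C0c b" "continuous_on UNIV \<rho>"
  shows "conv b \<rho> x = (\<integral>u. b (x - u) * \<rho> u \<partial>lborel)"
proof -
  have "(\<lambda>y. b y * \<rho> (x - y)) \<in> borel_measurable borel"
    using borel_measurable_integrable[OF conv_integrable[OF assms]] by simp
  from lborel_integral_reflect[OF this, of x] show ?thesis unfolding conv_def by simp
qed

lemma
  assumes b: "C0c b" and \<rho>: "C1_on UNIV \<rho>"
  shows C1_on_conv: "C1_on UNIV (conv b \<rho>)" and pd_conv: "pd v (conv b \<rho>) x = conv b (pd v \<rho>) x"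
proof -
  obtain l u where lu: "\<And>x. x \<notin> cbox l u \<Longrightarrow> b x = 0" using C0c_cbox[OF b] by blast
  have eq: "conv b g x = integral (cbox l u) (\<lambda>y. b y * g (x + (- y)))" if "continuous_on UNIV g" for g x
    unfolding conv_def using lborel_integral_cbox[OF conv_integrable[OF b that], of l u x] lu by simp
  have eq': "conv b \<rho> = (\<lambda>x. integral (cbox l u) (\<lambda>y. b y * \<rho> (x + (- y))))"
    using eq[OF C1_on_continuous[OF \<rho>]] by auto
  have cb: "continuous_on (cbox l u) b" using b continuous_on_subset by (auto simp: C0c_def)
  have cm: "continuous_on (cbox l u) uminus" by (intro continuous_intros)
  show "C1_on UNIV (conv b \<rho>)"
    unfolding eq' by (rule C1_on_param_integral[OF \<rho> cm cb open_UNIV UNIV_I])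
  show "pd v (conv b \<rho>) x = conv b (pd v \<rho>) x"
    unfolding eq' eq[OF C1_on_pd_continuous[OF \<rho>]] by (rule pd_param_integral[OF \<rho> cm cb open_UNIV UNIV_I UNIV_I])
qed

lemma
  assumes b: "C0c b" and \<rho>: "C1_on UNIV \<rho>"
  shows dz_conv: "dz j (conv b \<rho>) x = conv b (dz j \<rho>) x"
    and dbar_conv: "dbar j (conv b \<rho>) x = conv b (dbar j \<rho>) x"
proof -
  note i = conv_integrable[OF b C1_on_pd_continuous[OF \<rho>]]
  have "conv b (dz j \<rho>) x = (\<integral>y. (b y * pd (axis j 1) \<rho> (x - y) - \<i> * (b y * pd (axis j \<i>) \<rho> (x - y))) / 2 \<partial>lborel)"
    unfolding conv_def by (rule Bochner_Integration.integral_cong) (auto simp: dz_def algebra_simps diff_divide_distrib)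
  then show "dz j (conv b \<rho>) x = conv b (dz j \<rho>) x"
    unfolding dz_def[of j "conv b \<rho>"] pd_conv[OF b \<rho>] by (simp add: conv_def i)
  have "conv b (dbar j \<rho>) x = (\<integral>y. (b y * pd (axis j 1) \<rho> (x - y) + \<i> * (b y * pd (axis j \<i>) \<rho> (x - y))) / 2 \<partial>lborel)"
    unfolding conv_def by (rule Bochner_Integration.integral_cong) (auto simp: dbar_def algebra_simps add_divide_distrib)
  then show "dbar j (conv b \<rho>) x = conv b (dbar j \<rho>) x"
    unfolding dbar_def[of j "conv b \<rho>"] pd_conv[OF b \<rho>] by (simp add: conv_def i)
qed

lemma C2_on_conv:
  assumes b: "C0c b" and \<rho>: "C2_on UNIV \<rho>"
  shows "C2_on UNIV (conv b \<rho>)"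
proof -
  have "pd v (conv b \<rho>) = conv b (pd v \<rho>)" for v
    using pd_conv[OF b C2_on_C1[OF \<rho>]] by auto
  then show ?thesis unfolding C2_on_def
    using C1_on_conv[OF b C2_on_C1[OF \<rho>]] C1_on_conv[OF b C2_on_pd[OF \<rho>]] by simp
qed

lemma pd_translate:
  assumes "C1_on UNIV \<rho>"
  shows "pd v (\<lambda>y. \<rho> (x - y)) y = - pd v \<rho> (x - y)" "C1_on UNIV (\<lambda>y. \<rho> (x - y))"
proof -
  have eq: "(\<lambda>y. \<rho> (x - y)) = (\<lambda>y. \<rho> (x + (-1) *\<^sub>R y))" by simp
  have d: "\<rho> differentiable at z" for z using assms by (simp add: C1_on_def)
  show p: "pd v (\<lambda>y. \<rho> (x - y)) y = - pd v \<rho> (x - y)" for y v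
    unfolding eq using pd_shift[OF d, of v x "-1" y] by simp
  have "pd v (\<lambda>y. \<rho> (x - y)) = (\<lambda>y. - pd v \<rho> (x - y))" for v using p by auto
  moreover have "(\<lambda>y. \<rho> (x - y)) differentiable at y" for y
    unfolding eq by (rule differentiable_shift[OF d])
  ultimately show "C1_on UNIV (\<lambda>y. \<rho> (x - y))"
    unfolding C1_on_def
    using continuous_on_minus[OF continuous_on_translate[OF C1_on_pd_continuous[OF assms]]] by simp
qed

lemma conv_pd_left:
  assumes b: "C1c b" and \<rho>: "C1_on UNIV \<rho>"
  shows "conv b (pd v \<rho>) x = conv (pd v b) \<rho> x"
proof -
  note t = pd_translate[OF \<rho>, where x=x]
  have "pd v (\<lambda>y. b y * \<rho> (x - y)) y = pd v b y * \<rho> (x - y) - b y * pd v \<rho> (x - y)" for y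
    using pd_mult[OF C1c_differentiable[OF b] C1_on_differentiable[OF t(2) UNIV_I], of v y] t(1) by simp
  then have "(\<integral>y. pd v b y * \<rho> (x - y) - b y * pd v \<rho> (x - y) \<partial>lborel) = 0"
    using integral_pd_zero[OF C1c_mult1[OF b t(2)], of v] by simp
  then show ?thesis unfolding conv_def
    using conv_integrable[OF C1c_C0c[OF b] C1_on_pd_continuous[OF \<rho>], of v x]
      conv_integrable[OF C1c_pd_C0c[OF b] C1_on_continuous[OF \<rho>], of v x] by simp
qed

lemma conv_dbar_left:
  assumes b: "C1c b" and \<rho>: "C1_on UNIV \<rho>"
  shows "conv b (dbar j \<rho>) x = conv (dbar j b) \<rho> x"
proof -
  note i = conv_integrable[OF C1c_pd_C0c[OF b] C1_on_continuous[OF \<rho>]]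
  have "conv (dbar j b) \<rho> x = (\<integral>y. (pd (axis j 1) b y * \<rho> (x - y) + \<i> * (pd (axis j \<i>) b y * \<rho> (x - y))) / 2 \<partial>lborel)"
    unfolding conv_def by (rule Bochner_Integration.integral_cong) (auto simp: dbar_def algebra_simps add_divide_distrib)
  also have "\<dots> = (conv (pd (axis j 1) b) \<rho> x + \<i> * conv (pd (axis j \<i>) b) \<rho> x) / 2"
    by (simp add: conv_def i)
  also have "\<dots> = dbar j (conv b \<rho>) x"
    unfolding dbar_def pd_conv[OF C1c_C0c[OF b] \<rho>] conv_pd_left[OF b \<rho>] ..
  finally show ?thesis using dbar_conv[OF C1c_C0c[OF b] \<rho>] by simp
qed

lemma conv_C0c:
  assumes "C0c b" "C0c \<rho>" "C1_on UNIV \<rho>" shows "C0c (conv b \<rho>)"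
proof -
  obtain R where R: "R > 0" "\<And>x. R \<le> norm x \<Longrightarrow> b x = 0" using C0c_support[OF assms(1)] by blast
  obtain S where S: "S > 0" "\<And>x. S \<le> norm x \<Longrightarrow> \<rho> x = 0" using C0c_support[OF assms(2)] by blast
  have "conv b \<rho> x = 0" if "R + S < norm x" for x
  proof -
    have "b y * \<rho> (x - y) = 0" for y
      using R(2)[of y] S(2)[of "x - y"] norm_triangle_ineq2[of x y] that by fastforce
    then have "(\<lambda>y. b y * \<rho> (x - y)) = (\<lambda>y. 0)" by auto
    then show ?thesis unfolding conv_def by simp
  qed
  then show ?thesis using C1_on_continuous[OF C1_on_conv[OF assms(1,3)]] by (auto simp: C0c_def)
qed

text \<open>Symmetry of second derivatives is carried as a hypothesis: all functions it is needed for are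
  convolutions with, or products of, explicit bumps, so Schwarz's theorem is not required.\<close>

definition sym2 :: "('a::real_normed_vector \<Rightarrow> 'b::real_normed_vector) \<Rightarrow> bool" where
  "sym2 f \<longleftrightarrow> (\<forall>u v x. pd u (pd v f) x = pd v (pd u f) x)"

text \<open>Both derivatives sit on the kernel, so symmetry is inherited from \<rho> even when b is
  merely continuous.\<close>

lemma sym2_conv:
  assumes b: "C0c b" and \<rho>: "C2_on UNIV \<rho>" "sym2 \<rho>"
  shows "sym2 (conv b \<rho>)"
proof -
  have 1: "pd v (conv b \<rho>) = conv b (pd v \<rho>)" for v
    using pd_conv[OF b C2_on_C1[OF \<rho>(1)]] by auto
  have 2: "pd u (pd v \<rho>) = pd v (pd u \<rho>)" for u v using \<rho>(2) by (auto simp: sym2_def)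
  show ?thesis unfolding sym2_def 1 pd_conv[OF b C2_on_pd[OF \<rho>(1)]] by (subst 2) simp
qed

lemma sym2_mult:
  fixes f g :: "'a::real_normed_vector \<Rightarrow> complex"
  assumes "C2_on UNIV f" "C2_on UNIV g" "sym2 f" "sym2 g"
  shows "sym2 (\<lambda>x. f x * g x)"
proof -
  have d: "f differentiable at x" "g differentiable at x" "pd v f differentiable at x" "pd v g differentiable at x" for v x
    using assms by (auto simp: C2_on_def C1_on_def)
  have 1: "pd v (\<lambda>x. f x * g x) = (\<lambda>x. f x * pd v g x + pd v f x * g x)" for v
    using pd_mult[OF d(1,2)] by auto
  have "pd u (pd v (\<lambda>x. f x * g x)) x = f x * pd u (pd v g) x + pd u f x * pd v g x + pd v f x * pd u g x + pd u (pd v f) x * g x" for u v x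
    unfolding 1 by (subst pd_add) (auto intro!: differentiable_mult d simp: pd_mult d)
  then show ?thesis using assms(3,4) unfolding sym2_def by (simp add: algebra_simps)
qed

lemma dbar_dz_commute:
  assumes "C2_on UNIV f" "sym2 f"
  shows "dbar k (dz j f) x = dz j (dbar k f) x"
proof -
  have d: "pd v f differentiable at x" for v
    using assms by (auto simp: C2_on_def C1_on_def)
  have d2: "(\<lambda>x. \<i> * pd v f x) differentiable at x" for v by (intro differentiable_mult d) auto
  have e: "pd u (dz j f) x = (pd u (pd (axis j 1) f) x - \<i> * pd u (pd (axis j \<i>) f) x) / 2" for u
  proof -
    have "dz j f = (\<lambda>x. (1/2) * (pd (axis j 1) f x - \<i> * pd (axis j \<i>) f x))" by (auto simp: dz_def fun_eq_iff)
    then show ?thesis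
      using pd_bounded_linear[OF bounded_linear_mult_right[of "1/2"] differentiable_diff[OF d d2], of u "axis j 1" "axis j \<i>"]
      by (simp add: pd_diff[OF d d2] pd_bounded_linear[OF bounded_linear_mult_right d])
  qed
  have e': "pd u (dbar k f) x = (pd u (pd (axis k 1) f) x + \<i> * pd u (pd (axis k \<i>) f) x) / 2" for u
  proof -
    have "dbar k f = (\<lambda>x. (1/2) * (pd (axis k 1) f x + \<i> * pd (axis k \<i>) f x))" by (auto simp: dbar_def fun_eq_iff)
    then show ?thesis
      using pd_bounded_linear[OF bounded_linear_mult_right[of "1/2"] differentiable_add[OF d d2], of u "axis k 1" "axis k \<i>"]
      by (simp add: pd_add[OF d d2] pd_bounded_linear[OF bounded_linear_mult_right d])
  qed
  have s: "pd u (pd v f) x = pd v (pd u f) x" for u v using assms(2) by (simp add: sym2_def)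
  show ?thesis
    unfolding dbar_def[of k "dz j f"] dz_def[of j "dbar k f"] e e'
    by (simp add: s[of "axis k 1"] s[of "axis k \<i>"] field_simps)
qed

section \<open>Explicit bumps and the mollifiers built from them\<close>

lemma has_derivative_norm_sq:
  "((\<lambda>x::'a::real_inner. (norm x)\<^sup>2) has_derivative (\<lambda>v. 2 * (x \<bullet> v))) (at x)"
  unfolding power2_norm_eq_inner
  by (auto intro!: derivative_eq_intros simp: inner_commute)

lemma pd_norm_sq: "pd v (\<lambda>x::'a::real_inner. (norm x)\<^sup>2) x = 2 * (x \<bullet> v)"
  using pd_eqI[OF has_derivative_norm_sq] .

lemma C1_on_inner: "C1_on S (\<lambda>x::'a::real_inner. 2 * (x \<bullet> v))" and pd_inner: "pd u (\<lambda>x::'a::real_inner. 2 * (x \<bullet> v)) x = 2 * (u \<bullet> v)"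
proof -
  have d: "((\<lambda>x::'a. 2 * (x \<bullet> v)) has_derivative (\<lambda>u. 2 * (u \<bullet> v))) (at x)" for x
    by (auto intro!: derivative_eq_intros)
  show p: "pd u (\<lambda>x::'a. 2 * (x \<bullet> v)) x = 2 * (u \<bullet> v)" for u x using pd_eqI[OF d] .
  then have "pd u (\<lambda>x::'a. 2 * (x \<bullet> v)) = (\<lambda>x. 2 * (u \<bullet> v))" for u by auto
  then show "C1_on S (\<lambda>x::'a. 2 * (x \<bullet> v))" unfolding C1_on_def using d by (auto simp: differentiable_def)
qed

lemma C2_on_norm_sq: "C2_on S (\<lambda>x::'a::real_inner. (norm x)\<^sup>2)"
proof -
  have p: "pd v (\<lambda>x::'a. (norm x)\<^sup>2) = (\<lambda>x. 2 * (x \<bullet> v))" for v using pd_norm_sq by auto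
  have "C1_on S (\<lambda>x::'a. (norm x)\<^sup>2)" unfolding C1_on_def p
    using has_derivative_norm_sq by (auto simp: differentiable_def intro!: continuous_intros)
  then show ?thesis unfolding C2_on_def p using C1_on_inner by auto
qed

text \<open>Away from 0 this is a power or a constant; at 0 the difference quotient is at most
  |h|^k, which tends to 0 because k \<ge> 1.\<close>

lemma tpow_deriv:
  assumes "k \<ge> 1"
  shows "((\<lambda>y::real. (max 0 y) ^ (Suc k)) has_real_derivative (real (Suc k) * (max 0 y) ^ k)) (at y)"
proof (cases y "0::real" rule: linorder_cases)
  case less
  have "((\<lambda>y::real. 0) has_real_derivative 0) (at y)" by simp
  then have "((\<lambda>y::real. (max 0 y) ^ (Suc k)) has_real_derivative 0) (at y)"
    by (rule has_field_derivative_transform_within_open[where S="{..<0}"]) (use less in auto)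
  then show ?thesis using less assms by (simp add: power_0_left)
next
  case greater
  have "((\<lambda>y::real. y ^ (Suc k)) has_real_derivative real (Suc k) * y ^ k) (at y)"
    by (rule derivative_eq_intros refl)+ simp
  then have "((\<lambda>y::real. (max 0 y) ^ (Suc k)) has_real_derivative real (Suc k) * y ^ k) (at y)"
    by (rule has_field_derivative_transform_within_open[where S="{0<..}"]) (use greater in auto)
  then show ?thesis using greater by simp
next
  case equal
  have "((\<lambda>h::real. (max 0 h) ^ Suc k / h) \<longlongrightarrow> 0) (at 0)"
  proof (rule Lim_null_comparison)
    show "\<forall>\<^sub>F h in at (0::real). norm ((max 0 h) ^ Suc k / h) \<le> \<bar>h\<bar> ^ k"
    proof (intro always_eventually allI)
      fix h :: real
      show "norm ((max 0 h) ^ Suc k / h) \<le> \<bar>h\<bar> ^ k"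
        by (cases "h > 0") (use assms in \<open>auto simp: max_def\<close>)
    qed
    show "((\<lambda>h::real. \<bar>h\<bar> ^ k) \<longlongrightarrow> 0) (at 0)"
      using assms by (auto intro!: tendsto_eq_intros)
  qed
  then show ?thesis using equal assms unfolding DERIV_def by (simp add: power_0_left)
qed

text \<open>A truncated cube is C^2 with explicit derivatives, from which the symmetry of the second
  derivatives and the size of the gradient can be read off. Its maximum is R^6. It serves both as
  mollifier and as large cutoff.\<close>

definition bump :: "real \<Rightarrow> 'a::real_inner \<Rightarrow> real" where
  "bump R x = (max 0 (R\<^sup>2 - (norm x)\<^sup>2)) ^ 3"

lemma C2_on_Rnorm: "C2_on UNIV (\<lambda>x::'a::real_inner. R\<^sup>2 - (norm x)\<^sup>2)"
  by (intro C2_on_diff C2_on_const C2_on_norm_sq) auto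

lemma tpow_derivs:
  "((\<lambda>y::real. (max 0 y) ^ 3) has_real_derivative (3 * (max 0 y) ^ 2)) (at y)"
  "((\<lambda>y::real. 3 * (max 0 y) ^ 2) has_real_derivative (6 * max 0 y)) (at y)"
  using tpow_deriv[of 2 y] DERIV_cmult[OF tpow_deriv[of 1 y], of 3]
  by (simp_all add: numeral_3_eq_3 numeral_2_eq_2)

lemma C2_on_bump: "C2_on UNIV (bump R)"
  unfolding bump_def[abs_def]
  by (rule C2_on_compose[where T=UNIV, OF open_UNIV C2_on_Rnorm _ tpow_derivs]) (auto intro!: continuous_intros)

lemma pd_Rnorm: "pd v (\<lambda>x::'a::real_inner. R\<^sup>2 - (norm x)\<^sup>2) x = - (2 * (x \<bullet> v))"
  using pd_diff[of "\<lambda>x. R\<^sup>2" x "\<lambda>x. (norm x)\<^sup>2" v] has_derivative_norm_sq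
  by (auto simp: pd_norm_sq differentiable_def)

lemma pd_bump: "pd v (bump R) x = - (2 * (x \<bullet> v)) * (3 * (max 0 (R\<^sup>2 - (norm x)\<^sup>2)) ^ 2)"
  unfolding bump_def[abs_def]
  by (subst pd_compose[OF C1_on_differentiable[OF C2_on_C1[OF C2_on_Rnorm] UNIV_I] tpow_derivs(1)])
     (simp add: pd_Rnorm)

lemma sym2_bump: "sym2 (bump R)"
proof -
  have 1: "pd v (bump R) = (\<lambda>x. - (2 * (x \<bullet> v)) * (3 * (max 0 (R\<^sup>2 - (norm x)\<^sup>2)) ^ 2))" for v :: 'a
    using pd_bump by auto
  have d1: "(\<lambda>x::'a. - (2 * (x \<bullet> v))) differentiable at x" for v x
    using C1_on_differentiable[OF C1_on_minus[OF C1_on_inner[of UNIV v]]] by auto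
  have p1: "pd u (\<lambda>x::'a. - (2 * (x \<bullet> v))) x = - (2 * (u \<bullet> v))" for u v x
    using pd_bounded_linear[OF bounded_linear_minus[OF bounded_linear_ident], of "\<lambda>x::'a. 2 * (x \<bullet> v)" x]
      C1_on_differentiable[OF C1_on_inner[of UNIV v]] by (simp add: pd_inner)
  have d2: "(\<lambda>x::'a. 3 * (max 0 (R\<^sup>2 - (norm x)\<^sup>2)) ^ 2) differentiable at x" for x
    by (rule C1_on_differentiable[OF C1_on_compose[where T=UNIV, OF C2_on_C1[OF C2_on_Rnorm] _ tpow_derivs(2)]])
       (auto intro!: continuous_intros)
  have p2: "pd u (\<lambda>x::'a. 3 * (max 0 (R\<^sup>2 - (norm x)\<^sup>2)) ^ 2) x = 6 * max 0 (R\<^sup>2 - (norm x)\<^sup>2) * - (2 * (x \<bullet> u))" for u x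
    by (subst pd_compose[OF C1_on_differentiable[OF C2_on_C1[OF C2_on_Rnorm] UNIV_I] tpow_derivs(2)])
       (simp add: pd_Rnorm)
  show ?thesis unfolding sym2_def 1 pd_mult[OF d1 d2] p1 p2 by (simp add: inner_commute)
qed

lemma C2_on_of_real: "open S \<Longrightarrow> C2_on S f \<Longrightarrow> C2_on S (\<lambda>x. complex_of_real (f x))"
  by (rule C2_on_bounded_linear[OF _ bounded_linear_of_real])

lemma sym2_of_real:
  assumes "C2_on UNIV f" "sym2 f" shows "sym2 (\<lambda>x. complex_of_real (f x))"
proof -
  have d: "f differentiable at x" "pd v f differentiable at x" for v x
    using assms by (auto simp: C2_on_def C1_on_def)
  have "pd v (\<lambda>x. complex_of_real (f x)) = (\<lambda>x. of_real (pd v f x))" for v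
    using pd_bounded_linear[OF bounded_linear_of_real d(1)] by auto
  then show ?thesis using assms(2) unfolding sym2_def
    by (simp add: pd_bounded_linear[OF bounded_linear_of_real d(2)])
qed

lemma inner_axis_complex: "(x::complex^'n::finite) \<bullet> axis j 1 = Re (x $ j)" "(x::complex^'n::finite) \<bullet> axis j \<i> = Im (x $ j)"
  by (simp_all add: inner_axis inner_complex_def)

lemma dbar_bump: "dbar j (\<lambda>x. complex_of_real (bump R x)) x = - (of_real (3 * (max 0 (R\<^sup>2 - (norm x)\<^sup>2)) ^ 2) * x $ j)"
  and dz_bump: "dz j (\<lambda>x. complex_of_real (bump R x)) x = - (of_real (3 * (max 0 (R\<^sup>2 - (norm x)\<^sup>2)) ^ 2) * cnj (x $ j))"
  unfolding dbar_def dz_def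
  by (simp_all add: pd_bounded_linear[OF bounded_linear_of_real C1_on_differentiable[OF C2_on_C1[OF C2_on_bump] UNIV_I]] pd_bump inner_axis_complex complex_eq_iff)

lemma bump_nonneg: "bump R x \<ge> 0" by (simp add: bump_def)

lemma bump_eq_0: "R > 0 \<Longrightarrow> R \<le> norm x \<Longrightarrow> bump R x = 0"
  using power_mono[of R "norm x" 2] by (auto simp: bump_def max_def)

lemma bump_pos: "norm x < R \<Longrightarrow> bump R x > 0"
  using power_strict_mono[of "norm x" R 2] by (auto simp: bump_def max_def)

lemma C1c_bump: "R > 0 \<Longrightarrow> C1c (bump R :: 'a::euclidean_space \<Rightarrow> real)"
  unfolding C1c_def using C2_on_C1[OF C2_on_bump] bump_eq_0 by (metis less_eq_real_def)

lemma integral_bump_pos: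
  assumes "R > 0" shows "(\<integral>x. bump R x \<partial>(lborel :: 'a::euclidean_space measure)) > 0"
proof -
  note c = C1c_C0c[OF C1c_bump[OF assms, where 'a='a]]
  have "(\<integral>x. bump R x \<partial>(lborel :: 'a measure)) \<noteq> 0"
  proof
    assume "(\<integral>x. bump R x \<partial>(lborel :: 'a measure)) = 0"
    then have "AE x in (lborel :: 'a measure). bump R x = 0"
      using integral_nonneg_eq_0_iff_AE[OF C0c_integrable[OF c]] bump_nonneg by auto
    then have "AE x in (lborel :: 'a measure). x \<notin> ball 0 R"
      by eventually_elim (use bump_pos in force)
    then have "ball (0::'a) R \<in> null_sets lborel"
      by (subst (asm) AE_iff_null_sets[symmetric]) auto
    then have "negligible (ball (0::'a) R)"
      by (simp add: negligible_iff_null_sets null_sets_completionI)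
    then show False
      using open_not_negligible[OF open_ball, of "0::'a" R] assms by auto
  qed
  moreover have "(\<integral>x. bump R x \<partial>(lborel :: 'a measure)) \<ge> 0" by (rule Bochner_Integration.integral_nonneg) (simp add: bump_nonneg)
  ultimately show ?thesis by linarith
qed

definition mollr :: "real \<Rightarrow> 'a::euclidean_space \<Rightarrow> real" where
  "mollr \<sigma> x = inverse (\<integral>x. bump \<sigma> x \<partial>(lborel::'a measure)) * bump \<sigma> x"

abbreviation moll :: "real \<Rightarrow> 'a::euclidean_space \<Rightarrow> complex" where
  "moll \<sigma> x \<equiv> complex_of_real (mollr \<sigma> x)"

lemma C2_on_mollr: "C2_on UNIV (mollr \<sigma> :: 'a::euclidean_space \<Rightarrow> real)"
  unfolding mollr_def[abs_def] by (intro C2_on_mult C2_on_bump C2_on_const) auto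

lemma C2_on_moll: "C2_on UNIV (\<lambda>x::'a::euclidean_space. moll \<sigma> x)"
  by (intro C2_on_of_real C2_on_mollr) auto

lemma pd_mollr: "pd v (mollr \<sigma> :: 'a::euclidean_space \<Rightarrow> real) x = inverse (\<integral>x. bump \<sigma> x \<partial>(lborel::'a measure)) * pd v (bump \<sigma>) x"
  unfolding mollr_def[abs_def]
  by (rule pd_bounded_linear[OF bounded_linear_mult_right C1_on_differentiable[OF C2_on_C1[OF C2_on_bump] UNIV_I]])

lemma sym2_moll: "sym2 (\<lambda>x::'a::euclidean_space. moll \<sigma> x)"
proof (rule sym2_of_real[OF C2_on_mollr])
  have 1: "pd v (mollr \<sigma> :: 'a \<Rightarrow> real) = (\<lambda>x. inverse (\<integral>x. bump \<sigma> x \<partial>(lborel::'a measure)) * pd v (bump \<sigma>) x)" for v :: 'a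
    using pd_mollr by auto
  show "sym2 (mollr \<sigma> :: 'a \<Rightarrow> real)"
    using sym2_bump[of \<sigma>, where 'a='a] unfolding sym2_def 1
    by (simp add: pd_bounded_linear[OF bounded_linear_mult_right C1_on_differentiable[OF C2_on_pd[OF C2_on_bump] UNIV_I]])
qed

lemma mollr_nonneg: "mollr \<sigma> x \<ge> 0"
  unfolding mollr_def by (intro mult_nonneg_nonneg) (auto simp: bump_nonneg intro!: Bochner_Integration.integral_nonneg)

lemma mollr_eq_0: "\<sigma> > 0 \<Longrightarrow> \<sigma> \<le> norm x \<Longrightarrow> mollr \<sigma> x = 0"
  by (simp add: mollr_def bump_eq_0)

lemma mollr_C0c: "\<sigma> > 0 \<Longrightarrow> C0c (mollr \<sigma> :: 'a::euclidean_space \<Rightarrow> real)"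
  unfolding C0c_def using C1_on_continuous[OF C2_on_C1[OF C2_on_mollr]]
  by (auto intro!: exI[of _ \<sigma>] mollr_eq_0)

lemma moll_C0c: "\<sigma> > 0 \<Longrightarrow> C0c (\<lambda>x::'a::euclidean_space. moll \<sigma> x)"
  by (rule C0c_comp[OF mollr_C0c]) (auto intro!: continuous_intros)

lemma integral_mollr: "\<sigma> > 0 \<Longrightarrow> (\<integral>x. mollr \<sigma> x \<partial>(lborel::'a::euclidean_space measure)) = 1"
  unfolding mollr_def using integral_bump_pos[of \<sigma>, where 'a='a] by simp

lemma integral_moll: "\<sigma> > 0 \<Longrightarrow> (\<integral>x. moll \<sigma> x \<partial>(lborel::'a::euclidean_space measure)) = 1"
  by (simp add: integral_mollr)

lemma moll_continuous: "continuous_on UNIV (\<lambda>x::'a::euclidean_space. moll \<sigma> x)"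
  by (rule C1_on_continuous[OF C2_on_C1[OF C2_on_moll]])

text \<open>The mollifier is radial, so the generator of the rotation of a single complex coordinate
  annihilates it. In \<open>mean_value_moll\<close> this exchanges \<partial> for dbar.\<close>

lemma moll_rotation:
  fixes x :: "complex^'n::finite"
  shows "x $ j * dz j (\<lambda>x. moll \<sigma> x) x = cnj (x $ j) * dbar j (\<lambda>x. moll \<sigma> x) x"
proof -
  define c where "c = inverse (\<integral>x. bump \<sigma> x \<partial>(lborel::(complex^'n) measure))"
  have eq: "(\<lambda>x::complex^'n. moll \<sigma> x) = (\<lambda>x. of_real c * of_real (bump \<sigma> x))"
    by (simp add: mollr_def c_def)
  have d: "(\<lambda>x::complex^'n. complex_of_real (bump \<sigma> x)) differentiable at x"
    by (rule differentiable_of_real[OF C1_on_differentiable[OF C2_on_C1[OF C2_on_bump] UNIV_I]])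
  show ?thesis unfolding eq dz_cmult[OF d] dbar_cmult[OF d] dz_bump dbar_bump by simp
qed

section \<open>Mollification in weighted L^2 spaces\<close>

lemma conv_moll_C0c: "C0c b \<Longrightarrow> \<sigma> > 0 \<Longrightarrow> C0c (conv b (moll \<sigma>))"
  by (rule conv_C0c[OF _ moll_C0c C2_on_C1[OF C2_on_moll]])

text \<open>Jensen's inequality for the probability density \<open>mollr \<sigma>\<close>, read off
  from the nonnegative variance of b (x - u) about its mean c.\<close>

lemma conv_moll_sq_le:
  fixes b :: "'a::euclidean_space \<Rightarrow> complex"
  assumes b: "C0c b" and \<sigma>: "\<sigma> > 0"
  shows "(cmod (conv b (moll \<sigma>) x))\<^sup>2 \<le> (\<integral>u. (cmod (b (x - u)))\<^sup>2 * mollr \<sigma> u \<partial>lborel)"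
proof -
  define c where "c = conv b (moll \<sigma>) x"
  have cb: "continuous_on UNIV (\<lambda>u. b (x - u))" using continuous_on_translate b by (auto simp: C0c_def)
  have i1: "integrable lborel (\<lambda>u. (cmod (b (x - u)))\<^sup>2 * mollr \<sigma> u)"
    by (intro C0c_integrable C0c_mult2 mollr_C0c \<sigma> continuous_intros cb)
  have i2: "integrable lborel (\<lambda>u. b (x - u) * moll \<sigma> u)"
    by (intro C0c_integrable C0c_mult2 moll_C0c \<sigma> cb)
  have i3: "integrable lborel (mollr \<sigma> :: 'a \<Rightarrow> real)" using C0c_integrable[OF mollr_C0c[OF \<sigma>]] .
  have e: "c = (\<integral>u. b (x - u) * moll \<sigma> u \<partial>lborel)"
    unfolding c_def by (rule conv_flip[OF b moll_continuous])
  define r where "r u = Re (cnj c * (b (x - u) * moll \<sigma> u))" for u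
  have i4': "integrable lborel (\<lambda>u. Re (cnj c * (b (x - u) * moll \<sigma> u)))"
    by (intro integrable_Re integrable_mult_right i2)
  have "(\<integral>u. Re (cnj c * (b (x - u) * moll \<sigma> u)) \<partial>lborel) = Re (cnj c * c)"
    by (subst integral_Re) (use i2 e in auto)
  then have e4: "(\<integral>u. r u \<partial>lborel) = (cmod c)\<^sup>2" unfolding r_def
    by (simp only: cmod_power2) (simp add: power2_eq_square)
  have i4: "integrable lborel r" using i4' by (simp only: r_def[abs_def])
  have "0 \<le> (\<integral>u. (cmod (b (x - u) - c))\<^sup>2 * mollr \<sigma> u \<partial>lborel)"
    by (rule Bochner_Integration.integral_nonneg) (simp add: mollr_nonneg)
  also have "\<dots> = (\<integral>u. (cmod (b (x - u)))\<^sup>2 * mollr \<sigma> u - 2 * r u + (cmod c)\<^sup>2 * mollr \<sigma> u \<partial>lborel)"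
  proof (rule Bochner_Integration.integral_cong[OF refl])
    fix u
    have "(cmod (z - c))\<^sup>2 = (cmod z)\<^sup>2 - 2 * Re (cnj c * z) + (cmod c)\<^sup>2" for z
      by (simp only: cmod_power2) (simp add: power2_eq_square algebra_simps)
    note z = this
    have e: "Re (cnj c * (b (x - u) * moll \<sigma> u)) = mollr \<sigma> u * Re (cnj c * b (x - u))"
      by (simp add: algebra_simps)
    show "(cmod (b (x - u) - c))\<^sup>2 * mollr \<sigma> u = (cmod (b (x - u)))\<^sup>2 * mollr \<sigma> u - 2 * r u + (cmod c)\<^sup>2 * mollr \<sigma> u"
      unfolding r_def e z by (simp add: algebra_simps)
  qed
  also have "\<dots> = (\<integral>u. (cmod (b (x - u)))\<^sup>2 * mollr \<sigma> u \<partial>lborel) - 2 * (cmod c)\<^sup>2 + (cmod c)\<^sup>2 * 1"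
    using i1 i3 i4 integral_mollr[OF \<sigma>, where 'a='a] e4 by simp
  finally show ?thesis unfolding c_def by simp
qed

text \<open>Compact support in both variables jointly, as Fubini needs it: m bounds u, b bounds x -
  u, and together they bound x.\<close>

lemma C0c_double:
  fixes b :: "'a::euclidean_space \<Rightarrow> 'c::real_normed_algebra" and m :: "'a \<Rightarrow> 'c"
  assumes b: "C0c b" and m: "C0c m" and g: "continuous_on UNIV g"
  shows "C0c (\<lambda>p. g (fst p) * (b (fst p - snd p) * m (snd p)))"
proof -
  obtain R where R: "R > 0" "\<And>x. R \<le> norm x \<Longrightarrow> b x = 0" using C0c_support[OF b] by blast
  obtain S where S: "S > 0" "\<And>x. S \<le> norm x \<Longrightarrow> m x = 0" using C0c_support[OF m] by blast
  have "b (x - u) * m u = 0" if "R + S + S < norm (x, u)" for x u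
  proof (cases "S \<le> norm u")
    case False
    have "norm (x, u) \<le> norm x + norm u" using norm_Pair_le by blast
    then have "R \<le> norm (x - u)" using that False norm_triangle_ineq2[of x u] by linarith
    then show ?thesis using R by simp
  qed (use S in auto)
  moreover have "continuous_on UNIV (\<lambda>p. g (fst p) * (b (fst p - snd p) * m (snd p)))"
    using assms by (intro continuous_intros continuous_on_compose2[of UNIV g UNIV fst]
        continuous_on_compose2[of UNIV b UNIV "\<lambda>p. fst p - snd p"] continuous_on_compose2[of UNIV m UNIV snd]) (auto simp: C0c_def)
  ultimately show ?thesis unfolding C0c_def by (auto intro!: exI[of _ "R + S + S"])
qed

lemma C0c_shift: "C0c f \<Longrightarrow> C0c (\<lambda>y. f (u + y))"
proof -
  assume "C0c f"
  then obtain R where R: "R > 0" "\<And>x. R \<le> norm x \<Longrightarrow> f x = 0" using C0c_support by blast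
  have "f (u + y) = 0" if "R + norm u < norm y" for y
    by (rule R(2)) (use norm_triangle_ineq[of "u + y" "-u"] that in auto)
  moreover have "continuous_on UNIV (\<lambda>y. f (u + y))"
    using \<open>C0c f\<close> by (auto intro!: continuous_on_compose2[of UNIV f UNIV] continuous_intros simp: C0c_def)
  ultimately show ?thesis by (auto simp: C0c_def)
qed

lemma Fubini_C0c_integrable:
  fixes H :: "'a::euclidean_space \<Rightarrow> 'b::euclidean_space \<Rightarrow> 'c::{banach, second_countable_topology}"
  assumes "C0c (\<lambda>p. H (fst p) (snd p))"
  shows "integrable lborel (\<lambda>u. \<integral>x. H x u \<partial>lborel)" "integrable lborel (\<lambda>x. \<integral>u. H x u \<partial>lborel)"
proof -
  have "integrable (lborel \<Otimes>\<^sub>M lborel) (\<lambda>p. H (fst p) (snd p))"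
    unfolding lborel_prod using C0c_integrable[OF assms] .
  then have "integrable (lborel \<Otimes>\<^sub>M lborel) (\<lambda>(x, u). H x u)" by (simp add: split_def)
  from lborel_pair.integrable_snd[OF this] lborel_pair.integrable_fst[OF this]
  show "integrable lborel (\<lambda>u. \<integral>x. H x u \<partial>lborel)" "integrable lborel (\<lambda>x. \<integral>u. H x u \<partial>lborel)" by simp_all
qed

text \<open>Jensen pointwise, then Fubini and a translation move the average from b to the weight;
  \<open>gG\<close> compares the weight with its translates over the support of the mollifier. In
  the applications g is a cutoff factor times \<open>wtr\<close> and G a multiple of
  \<open>wtr\<close>.\<close>

lemma weighted_conv_le:
  fixes b :: "'a::euclidean_space \<Rightarrow> complex"
  assumes b: "C0c b" and \<sigma>: "\<sigma> > 0" and g: "continuous_on UNIV g" "\<And>x. g x \<ge> 0" and G: "continuous_on UNIV G"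
    and gG: "\<And>y u. norm u \<le> \<sigma> \<Longrightarrow> g (u + y) \<le> G y"
  shows "(\<integral>x. g x * (cmod (conv b (moll \<sigma>) x))\<^sup>2 \<partial>lborel) \<le> (\<integral>y. G y * (cmod (b y))\<^sup>2 \<partial>lborel)"
proof -
  define B where "B = (\<lambda>y. (cmod (b y))\<^sup>2)"
  have B: "C0c B" unfolding B_def by (rule C0c_comp[OF b]) (auto intro!: continuous_intros)
  let ?H = "\<lambda>x u. g x * (B (x - u) * mollr \<sigma> u)"
  have H: "C0c (\<lambda>p. ?H (fst p) (snd p))" by (rule C0c_double[OF B mollr_C0c[OF \<sigma>] g(1)])
  have cmc: "C0c (\<lambda>x. g x * (cmod (conv b (moll \<sigma>) x))\<^sup>2)"
    by (rule C0c_mult2[OF C0c_comp[OF conv_moll_C0c[OF b \<sigma>], of "\<lambda>z. (cmod z)\<^sup>2"] g(1)]) (auto intro!: continuous_intros)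
  have "(\<integral>x. g x * (cmod (conv b (moll \<sigma>) x))\<^sup>2 \<partial>lborel) \<le> (\<integral>x. (\<integral>u. ?H x u \<partial>lborel) \<partial>lborel)"
  proof (rule integral_mono[OF C0c_integrable[OF cmc] Fubini_C0c_integrable(2)[OF H]])
    fix x
    show "g x * (cmod (conv b (moll \<sigma>) x))\<^sup>2 \<le> (\<integral>u. ?H x u \<partial>lborel)"
      using mult_left_mono[OF conv_moll_sq_le[OF b \<sigma>] g(2)] by (simp add: B_def)
  qed
  also have "\<dots> = (\<integral>u. (\<integral>x. ?H x u \<partial>lborel) \<partial>lborel)" by (rule Fubini_C0c[OF H])
  also have "\<dots> \<le> (\<integral>u. mollr \<sigma> u * (\<integral>y. G y * B y \<partial>lborel) \<partial>(lborel::'a measure))"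
  proof (rule integral_mono[OF Fubini_C0c_integrable(1)[OF H]])
    show "integrable lborel (\<lambda>u. mollr \<sigma> u * (\<integral>y. G y * B y \<partial>lborel))"
      by (intro integrable_mult_left C0c_integrable mollr_C0c \<sigma>)
    fix u :: 'a
    show "(\<integral>x. ?H x u \<partial>lborel) \<le> mollr \<sigma> u * (\<integral>y. G y * B y \<partial>lborel)"
    proof (cases "norm u \<le> \<sigma>")
      case True
      have gu: "continuous_on UNIV (\<lambda>y. g (u + y))"
        using g(1) by (auto intro!: continuous_on_compose2[of UNIV g UNIV] continuous_intros)
      have m: "(\<lambda>x. g x * B (x - u)) \<in> borel_measurable borel"
        using g(1) B by (intro borel_measurable_continuous_onI continuous_intros)
          (auto simp: C0c_def intro!: continuous_on_compose2[of UNIV B UNIV] continuous_intros)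
      have "(\<integral>x. ?H x u \<partial>lborel) = (\<integral>x. mollr \<sigma> u * (g x * B (x - u)) \<partial>lborel)"
        by (simp add: algebra_simps)
      also have "\<dots> = mollr \<sigma> u * (\<integral>x. g x * B (x - u) \<partial>lborel)" by simp
      also have "(\<integral>x. g x * B (x - u) \<partial>lborel) = (\<integral>y. g (u + y) * B y \<partial>lborel)"
        using lborel_integral_shift[OF m, of u] by simp
      also have "mollr \<sigma> u * (\<integral>y. g (u + y) * B y \<partial>lborel) \<le> mollr \<sigma> u * (\<integral>y. G y * B y \<partial>lborel)"
      proof (rule mult_left_mono[OF integral_mono mollr_nonneg])
        show "integrable lborel (\<lambda>y. g (u + y) * B y)" "integrable lborel (\<lambda>y. G y * B y)"
          by (intro C0c_integrable C0c_mult2 B gu G)+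
        show "g (u + y) * B y \<le> G y * B y" for y
          by (rule mult_right_mono[OF gG[OF True]]) (simp add: B_def)
      qed
      finally show ?thesis .
    next
      case False then show ?thesis using mollr_eq_0[OF \<sigma>, of u] by simp
    qed
  qed
  also have "\<dots> = (\<integral>y. G y * B y \<partial>lborel)" by (simp add: integral_mollr[OF \<sigma>])
  finally show ?thesis by (simp add: B_def)
qed

text \<open>Fubini shifts the average from b to P, so only the oscillation of P at scale \<sigma>
  enters. In the application b comes from the almost minimiser while P is known beforehand, which
  decides the side that has to carry the modulus of continuity.\<close>

lemma conv_pairing:
  fixes b :: "'a::euclidean_space \<Rightarrow> complex"
  assumes b: "C0c b" and \<sigma>: "\<sigma> > 0" and P: "C0c P" and Z: "continuous_on UNIV Z"
    and PZ: "\<And>y u. norm u \<le> \<sigma> \<Longrightarrow> cmod (P (u + y) - P y) \<le> Z y"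
  shows "cmod ((\<integral>x. conv b (moll \<sigma>) x * P x \<partial>lborel) - (\<integral>x. b x * P x \<partial>lborel)) \<le> (\<integral>y. Z y * cmod (b y) \<partial>lborel)"
proof -
  let ?H = "\<lambda>x u. P x * (b (x - u) * moll \<sigma> u)"
  have H: "C0c (\<lambda>p. ?H (fst p) (snd p))" by (rule C0c_double[OF b moll_C0c[OF \<sigma>] C0c_continuous[OF P]])
  have ib: "integrable lborel (\<lambda>u. moll \<sigma> u * (\<integral>x. b x * P x \<partial>lborel))"
    by (intro integrable_mult_left C0c_integrable moll_C0c \<sigma>)
  have "(\<integral>x. conv b (moll \<sigma>) x * P x \<partial>lborel) = (\<integral>x. (\<integral>u. ?H x u \<partial>lborel) \<partial>lborel)"
    unfolding conv_flip[OF b moll_continuous] by (simp add: mult.commute)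
  also have "\<dots> = (\<integral>u. (\<integral>x. ?H x u \<partial>lborel) \<partial>lborel)" by (rule Fubini_C0c[OF H])
  finally have 1: "(\<integral>x. conv b (moll \<sigma>) x * P x \<partial>lborel) = (\<integral>u. (\<integral>x. ?H x u \<partial>lborel) \<partial>lborel)" .
  have 2: "(\<integral>x. b x * P x \<partial>lborel) = (\<integral>u. moll \<sigma> u * (\<integral>x. b x * P x \<partial>lborel) \<partial>(lborel::'a measure))"
    using integral_moll[OF \<sigma>, where 'a='a] by simp
  have "cmod ((\<integral>x. conv b (moll \<sigma>) x * P x \<partial>lborel) - (\<integral>x. b x * P x \<partial>lborel))
     = cmod (\<integral>u. (\<integral>x. ?H x u \<partial>lborel) - moll \<sigma> u * (\<integral>x. b x * P x \<partial>lborel) \<partial>lborel)"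
    by (simp only: 1 Bochner_Integration.integral_diff[OF Fubini_C0c_integrable(1)[OF H] ib] 2[symmetric])
  also have "\<dots> \<le> (\<integral>u. mollr \<sigma> u * (\<integral>y. Z y * cmod (b y) \<partial>lborel) \<partial>(lborel::'a measure))"
  proof (rule Bochner_Integration.integral_norm_bound_integral)
    show "integrable lborel (\<lambda>u. (\<integral>x. ?H x u \<partial>lborel) - moll \<sigma> u * (\<integral>x. b x * P x \<partial>lborel))"
      by (rule Bochner_Integration.integrable_diff[OF Fubini_C0c_integrable(1)[OF H] ib])
    show "integrable lborel (\<lambda>u. mollr \<sigma> u * (\<integral>y. Z y * cmod (b y) \<partial>lborel))"
      by (intro integrable_mult_left C0c_integrable mollr_C0c \<sigma>)
    fix u :: 'a
    show "norm ((\<integral>x. ?H x u \<partial>lborel) - moll \<sigma> u * (\<integral>x. b x * P x \<partial>lborel)) \<le> mollr \<sigma> u * (\<integral>y. Z y * cmod (b y) \<partial>lborel)"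
    proof (cases "norm u \<le> \<sigma>")
      case True
      have Pu: "continuous_on UNIV (\<lambda>y. P (u + y))" using C0c_shift[OF P] by (simp add: C0c_def)
      have m: "(\<lambda>x. P x * b (x - u)) \<in> borel_measurable borel"
        using P b by (intro borel_measurable_continuous_onI continuous_intros)
          (auto simp: C0c_def intro!: continuous_on_compose2[of UNIV b UNIV] continuous_intros)
      have i: "integrable lborel (\<lambda>y. P (u + y) * b y)" "integrable lborel (\<lambda>x. b x * P x)"
        by (intro C0c_integrable C0c_mult2 b P Pu C0c_continuous[OF b])+
      have "(\<integral>x. ?H x u \<partial>lborel) = (\<integral>x. moll \<sigma> u * (P x * b (x - u)) \<partial>lborel)"
        by (simp add: algebra_simps)
      also have "\<dots> = moll \<sigma> u * (\<integral>x. P x * b (x - u) \<partial>lborel)" by simp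
      also have "(\<integral>x. P x * b (x - u) \<partial>lborel) = (\<integral>y. P (u + y) * b y \<partial>lborel)"
        using lborel_integral_shift[OF m, of u] by simp
      finally have "norm ((\<integral>x. ?H x u \<partial>lborel) - moll \<sigma> u * (\<integral>x. b x * P x \<partial>lborel))
          = cmod (moll \<sigma> u * ((\<integral>y. P (u + y) * b y \<partial>lborel) - (\<integral>x. b x * P x \<partial>lborel)))"
        by (simp add: algebra_simps)
      also have "\<dots> = mollr \<sigma> u * cmod (\<integral>y. P (u + y) * b y - b y * P y \<partial>lborel)"
        using i by (simp add: norm_mult mollr_nonneg)
      also have "\<dots> \<le> mollr \<sigma> u * (\<integral>y. Z y * cmod (b y) \<partial>lborel)"
      proof (rule mult_left_mono[OF Bochner_Integration.integral_norm_bound_integral mollr_nonneg])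
        show "integrable lborel (\<lambda>y. P (u + y) * b y - b y * P y)" using i by simp
        show "integrable lborel (\<lambda>y. Z y * cmod (b y))"
          by (intro C0c_integrable C0c_mult2 Z C0c_comp[OF b]) (auto intro!: continuous_intros)
        fix y
        have "P (u + y) * b y - b y * P y = (P (u + y) - P y) * b y" by (simp add: algebra_simps)
        then show "norm (P (u + y) * b y - b y * P y) \<le> Z y * cmod (b y)"
          using mult_right_mono[OF PZ[OF True, of y] norm_ge_zero[of "b y"]] by (simp add: norm_mult)
      qed
      finally show ?thesis .
    next
      case False then show ?thesis using mollr_eq_0[OF \<sigma>, of u] by simp
    qed
  qed
  also have "\<dots> = (\<integral>y. Z y * cmod (b y) \<partial>lborel)" by (simp add: integral_mollr[OF \<sigma>])
  finally show ?thesis .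
qed

lemma C0c_cnj: "C0c f \<Longrightarrow> C0c (\<lambda>x. cnj (f x))"
  by (rule C0c_comp) (auto intro!: continuous_intros)

lemma C1c_cnj: "C1c f \<Longrightarrow> C1c (\<lambda>x. cnj (f x))"
  unfolding C1c_iff by (auto intro!: C0c_cnj C1_on_bounded_linear[OF bounded_linear_cnj])

section \<open>The weighted Bochner inequality\<close>

locale weight =
  fixes \<Phi> :: "complex^'n::finite \<Rightarrow> real"
  assumes \<Phi>: "C2_on UNIV \<Phi>"
begin

text \<open>One weight in two types: \<open>wt\<close> for complex integrals, where derivatives fall
  on it, and \<open>wtr\<close> for norms.\<close>

definition "wt x = complex_of_real (exp (- \<Phi> x))"
definition "wtr x = exp (- \<Phi> x)"
definition "dPhi j = dz j (\<lambda>x. complex_of_real (\<Phi> x))"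

lemma wt_of_real: "wt x = of_real (wtr x)" by (simp add: wt_def wtr_def)
lemma wtr_pos: "wtr x > 0" by (simp add: wtr_def)

lemma Phi_diff: "\<Phi> differentiable at x" using \<Phi> by (auto simp: C2_on_def C1_on_def)

lemma C1_wt: "C1_on UNIV wt"
  unfolding wt_def[abs_def]
  by (rule C1_on_bounded_linear[OF bounded_linear_of_real], rule C1_on_compose[OF C2_on_C1[OF \<Phi>], where T=UNIV and m'="\<lambda>y. - exp (- y)"])
     (auto intro!: derivative_eq_intros continuous_intros)

lemma wtr_continuous: "continuous_on UNIV wtr"
  unfolding wtr_def[abs_def] using C1_on_continuous[OF C2_on_C1[OF \<Phi>]] by (intro continuous_intros)

lemma wt_continuous: "continuous_on UNIV wt"
  using C1_on_continuous[OF C1_wt] .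

lemma dz_wt: "dz j wt x = - (dPhi j x * wt x)"
  and dbar_wt: "dbar j wt x = - (cnj (dPhi j x) * wt x)"
proof -
  have D: "((\<lambda>y. exp (- y)) has_real_derivative - exp (- \<Phi> x)) (at (\<Phi> x))"
    by (auto intro!: derivative_eq_intros)
  show "dz j wt x = - (dPhi j x * wt x)"
    unfolding wt_def[abs_def] using dz_compose[OF Phi_diff D, of j] by (simp add: dPhi_def)
  show "dbar j wt x = - (cnj (dPhi j x) * wt x)"
    unfolding wt_def[abs_def] using dbar_compose[OF Phi_diff D, of j] dbar_eq_cnj_dz_real[OF Phi_diff, of j x]
    by (simp add: dPhi_def)
qed

lemma C1_dPhi: "C1_on UNIV (dPhi j)"
  unfolding dPhi_def by (rule C1_on_dz) (intro C2_on_of_real \<Phi> open_UNIV)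

text \<open>Minus the formal adjoint of \<open>dbar j\<close> in L^2 with weight exp (- \<Phi>). Its
  commutator with \<open>dbar k\<close> is multiplication by \<open>dbar k (dPhi j)\<close> up to
  sign, the source of the curvature term.\<close>

definition "delta j g x = dz j g x - dPhi j x * g x"

text \<open>Two integrations by parts: the first turns \<open>delta k\<close> on b into
  \<open>dbar k\<close> on the other factor, commuting it past \<open>delta j\<close> releases the
  mixed derivative of \<Phi>, and the second turns the remaining \<partial> into
  \<open>dbar j\<close> on b.\<close>

lemma bochner_pair:
  assumes a: "C2_on UNIV a" "sym2 a" "C0c a" and b: "C2_on UNIV b" "C0c b"
  shows "(\<integral>x. delta j a x * cnj (delta k b x) * wt x \<partial>lborel) =
    (\<integral>x. dbar k (dPhi j) x * a x * cnj (b x) * wt x \<partial>lborel) + (\<integral>x. dbar k a x * cnj (dbar j b x) * wt x \<partial>lborel)"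
proof -
  have a1: "C1_on UNIV a" and b1: "C1_on UNIV b" using a b by (auto simp: C2_on_def)
  have da: "a differentiable at x" "b differentiable at x" "wt differentiable at x" "dPhi j differentiable at x"
     "dz j a differentiable at x" "dbar k a differentiable at x" "(\<lambda>x. cnj (b x)) differentiable at x" for x
    using a1 b1 C1_wt C1_dPhi C1_on_dz[OF a(1)] C1_on_dbar[OF a(1)] by (auto simp: C1_on_def intro!: differentiable_cnj)
  have c1: "C1c (\<lambda>x. cnj (b x) * wt x)"
    by (intro C1c_mult1 C1c_cnj C1_wt) (use b1 b(2) in \<open>auto simp: C1c_iff\<close>)
  have c2: "C1_on UNIV (delta j a)"
    unfolding delta_def[abs_def] by (intro C1_on_diff C1_on_mult C1_dPhi a1 C1_on_dz a)
  have ca: "C1c a" using a1 a(3) by (simp add: C1c_iff)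
  have c3: "C1c (\<lambda>x. dbar k a x * wt x)"
    by (intro C1c_mult1 C1_wt) (use C1_on_dbar[OF a(1)] C1c_dbar_C0c[OF ca] in \<open>auto simp: C1c_iff\<close>)
  have "(\<integral>x. delta j a x * cnj (delta k b x) * wt x \<partial>lborel) = (\<integral>x. dbar k (\<lambda>x. cnj (b x) * wt x) x * delta j a x \<partial>lborel)"
  proof (rule Bochner_Integration.integral_cong[OF refl])
    fix x
    show "delta j a x * cnj (delta k b x) * wt x = dbar k (\<lambda>x. cnj (b x) * wt x) x * delta j a x"
      by (simp add: dbar_mult da dbar_wt dbar_cnj delta_def[of k] algebra_simps)
  qed
  also have "\<dots> = - (\<integral>x. (cnj (b x) * wt x) * dbar k (delta j a) x \<partial>lborel)"
    by (rule integral_by_parts_dbar[OF c1 c2])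
  also have "\<dots> = (\<integral>x. dbar k (dPhi j) x * a x * cnj (b x) * wt x - dz j (\<lambda>x. dbar k a x * wt x) x * cnj (b x) \<partial>lborel)"
    unfolding Bochner_Integration.integral_minus[symmetric]
  proof (rule Bochner_Integration.integral_cong[OF refl])
    fix x
    have d: "dbar k (delta j a) x = dz j (dbar k a) x - (dPhi j x * dbar k a x + dbar k (dPhi j) x * a x)"
      unfolding delta_def[abs_def] by (simp add: dbar_diff dbar_mult da differentiable_mult dbar_dz_commute[OF a(1,2)])
    show "- (cnj (b x) * wt x * dbar k (delta j a) x) = dbar k (dPhi j) x * a x * cnj (b x) * wt x - dz j (\<lambda>x. dbar k a x * wt x) x * cnj (b x)"
      unfolding d by (simp add: dz_mult da dz_wt algebra_simps)
  qed
  also have "\<dots> = (\<integral>x. dbar k (dPhi j) x * a x * cnj (b x) * wt x \<partial>lborel) - (\<integral>x. dz j (\<lambda>x. dbar k a x * wt x) x * cnj (b x) \<partial>lborel)"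
  proof (rule Bochner_Integration.integral_diff)
    show "integrable lborel (\<lambda>x. dbar k (dPhi j) x * a x * cnj (b x) * wt x)"
      by (intro C0c_integrable C0c_mult1 C0c_mult2[OF a(3)] wt_continuous continuous_on_dbar C1_dPhi continuous_intros C1_on_continuous[OF b1])
    show "integrable lborel (\<lambda>x. dz j (\<lambda>x. dbar k a x * wt x) x * cnj (b x))"
      by (intro C0c_integrable C0c_mult1 C1c_dz_C0c c3 continuous_intros C1_on_continuous[OF b1])
  qed
  also have "(\<integral>x. dz j (\<lambda>x. dbar k a x * wt x) x * cnj (b x) \<partial>lborel) = - (\<integral>x. dbar k a x * wt x * dz j (\<lambda>x. cnj (b x)) x \<partial>lborel)"
    by (rule integral_by_parts_dz[OF c3]) (intro C1_on_bounded_linear[OF bounded_linear_cnj] b1)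
  finally show ?thesis by (simp add: dz_cnj da algebra_simps)
qed

end

lemma cmod_sq_add_le: "(cmod (a + b))\<^sup>2 \<le> 2 * (cmod a)\<^sup>2 + 2 * (cmod b)\<^sup>2"
proof -
  have "(cmod (a + b))\<^sup>2 \<le> (cmod a + cmod b)\<^sup>2" by (intro power_mono norm_triangle_ineq) simp
  also have "\<dots> \<le> 2 * (cmod a)\<^sup>2 + 2 * (cmod b)\<^sup>2" using sum_squares_bound[of "cmod a" "cmod b"] by (simp add: power2_sum)
  finally show ?thesis .
qed

lemma cmod_sq_expand: "(cmod (a + s * b))\<^sup>2 = (cmod a)\<^sup>2 + 2 * Re (cnj s * (a * cnj b)) + (cmod s)\<^sup>2 * (cmod b)\<^sup>2"
  by (simp only: cmod_power2) (simp add: power2_eq_square algebra_simps)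

lemma cmod_sum_sq_le:
  fixes a b :: "'n::finite \<Rightarrow> complex"
  shows "(cmod (\<Sum>j\<in>UNIV. a j * b j))\<^sup>2 \<le> (\<Sum>j\<in>UNIV. (cmod (a j))\<^sup>2) * (\<Sum>j\<in>UNIV. (cmod (b j))\<^sup>2)"
proof -
  have "cmod (\<Sum>j\<in>UNIV. a j * b j) \<le> (\<Sum>j\<in>UNIV. cmod (a j) * cmod (b j))"
    using norm_sum[of "\<lambda>j. a j * b j" UNIV] by (simp add: norm_mult)
  then have "(cmod (\<Sum>j\<in>UNIV. a j * b j))\<^sup>2 \<le> (\<Sum>j\<in>UNIV. cmod (a j) * cmod (b j))\<^sup>2"
    by (intro power_mono) auto
  also have "\<dots> \<le> (\<Sum>j\<in>UNIV. (cmod (a j))\<^sup>2) * (\<Sum>j\<in>UNIV. (cmod (b j))\<^sup>2)"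
    by (rule Cauchy_Schwarz_ineq_sum)
  finally show ?thesis .
qed

text \<open>Re (x cnj y) \<ge> - |x - y|^2 / 2 is applied to the entries (j, k) and (k, j): the
  symmetric S cancels in the difference. In \<open>bochner_cutoff\<close>, S is the cutoff times the
  derivatives of a closed form, and a is the term in which the cutoff is differentiated.\<close>

lemma symmetric_perturbation_lower_bound:
  fixes a S :: "'n::finite \<Rightarrow> 'n \<Rightarrow> complex"
  assumes "\<And>j k. S j k = S k j"
  shows "Re (\<Sum>j\<in>UNIV. \<Sum>k\<in>UNIV. (a j k + S j k) * cnj (a k j + S k j)) \<ge> - 2 * (\<Sum>j\<in>UNIV. \<Sum>k\<in>UNIV. (cmod (a j k))\<^sup>2)"
proof -
  let ?X = "\<lambda>j k. a j k + S j k"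
  have p: "Re (x * cnj y) \<ge> - (cmod (x - y))\<^sup>2 / 2" for x y
  proof -
    have "(cmod (x - y))\<^sup>2 = (cmod x)\<^sup>2 + (cmod y)\<^sup>2 - 2 * Re (x * cnj y)"
      using cmod_sq_expand[of x "-1" y] by simp
    then show ?thesis using zero_le_power2[of "cmod x"] zero_le_power2[of "cmod y"] by linarith
  qed
  have "- (cmod (?X j k - ?X k j))\<^sup>2 / 2 \<ge> - ((cmod (a j k))\<^sup>2 + (cmod (a k j))\<^sup>2)" for j k
  proof -
    have "?X j k - ?X k j = a j k + - a k j" using assms[of j k] by simp
    then show ?thesis using cmod_sq_add_le[of "a j k" "- a k j"] by simp
  qed
  then have "Re (?X j k * cnj (?X k j)) \<ge> - ((cmod (a j k))\<^sup>2 + (cmod (a k j))\<^sup>2)" for j k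
    using p[of "?X j k" "?X k j"] order_trans by blast
  then have "(\<Sum>j\<in>UNIV. \<Sum>k\<in>UNIV. Re (?X j k * cnj (?X k j))) \<ge> (\<Sum>j\<in>UNIV. \<Sum>k\<in>UNIV. - ((cmod (a j k))\<^sup>2 + (cmod (a k j))\<^sup>2))"
    by (intro sum_mono)
  also have "(\<Sum>j\<in>UNIV. \<Sum>k\<in>UNIV. - ((cmod (a j k))\<^sup>2 + (cmod (a k j))\<^sup>2)) = - 2 * (\<Sum>j\<in>UNIV. \<Sum>k\<in>UNIV. (cmod (a j k))\<^sup>2)"
    using sum.swap[of "\<lambda>j k. (cmod (a k j))\<^sup>2" UNIV UNIV]
    by (simp add: sum_negf sum.distrib sum_subtractf)
  finally show ?thesis by simp
qed

context weight begin

section \<open>Weighted norms, the penalised energy and its almost minimisers\<close>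

definition "wnorm2 a = (\<integral>x. (cmod (a x))\<^sup>2 * wtr x \<partial>lborel)"
definition "wprod a b = (\<integral>x. a x * cnj (b x) * wt x \<partial>lborel)"

lemma wnorm2_C0c: "C0c a \<Longrightarrow> C0c (\<lambda>x. (cmod (a x))\<^sup>2 * wtr x)"
  by (rule C0c_mult1[OF C0c_comp[of a "\<lambda>z. (cmod z)\<^sup>2"] wtr_continuous]) (auto intro!: continuous_intros)

lemma wnorm2_integrable: "C0c a \<Longrightarrow> integrable lborel (\<lambda>x. (cmod (a x))\<^sup>2 * wtr x)"
  by (rule C0c_integrable[OF wnorm2_C0c])

lemma wprod_integrable: "C0c a \<Longrightarrow> C0c b \<Longrightarrow> integrable lborel (\<lambda>x. a x * cnj (b x) * wt x)"
  by (intro C0c_integrable C0c_mult1 wt_continuous continuous_intros C0c_continuous)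

lemma wnorm2_nonneg: "wnorm2 a \<ge> 0"
  unfolding wnorm2_def by (rule Bochner_Integration.integral_nonneg) (simp add: wtr_pos less_imp_le)

lemma wnorm2_expand:
  assumes a: "C0c a" and b: "C0c b"
  shows "wnorm2 (\<lambda>x. a x + s * b x) = wnorm2 a + 2 * Re (cnj s * wprod a b) + (cmod s)\<^sup>2 * wnorm2 b"
proof -
  define f where "f x = Re (cnj s * (a x * cnj (b x) * wt x))" for x
  have f: "integrable lborel f" "(\<integral>x. f x \<partial>lborel) = Re (cnj s * wprod a b)"
    unfolding f_def[abs_def] wprod_def
    using integrable_Re[OF integrable_mult_right[OF wprod_integrable[OF a b], of "cnj s"]]
      integral_Re[OF integrable_mult_right[OF wprod_integrable[OF a b], of "cnj s"]] by simp_all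
  have "wnorm2 (\<lambda>x. a x + s * b x) = (\<integral>x. (cmod (a x))\<^sup>2 * wtr x + 2 * f x + (cmod s)\<^sup>2 * ((cmod (b x))\<^sup>2 * wtr x) \<partial>lborel)"
    unfolding wnorm2_def
  proof (rule Bochner_Integration.integral_cong[OF refl])
    fix x
    have "f x = Re (cnj s * (a x * cnj (b x))) * wtr x"
      by (simp add: f_def wt_of_real algebra_simps)
    then show "(cmod (a x + s * b x))\<^sup>2 * wtr x = (cmod (a x))\<^sup>2 * wtr x + 2 * f x + (cmod s)\<^sup>2 * ((cmod (b x))\<^sup>2 * wtr x)"
      unfolding cmod_sq_expand by (simp add: distrib_right)
  qed
  also have "\<dots> = wnorm2 a + 2 * Re (cnj s * wprod a b) + (cmod s)\<^sup>2 * wnorm2 b"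
    using f wnorm2_integrable[OF a] wnorm2_integrable[OF b] by (simp add: wnorm2_def)
  finally show ?thesis .
qed

lemma wnorm2_add_le: "C0c a \<Longrightarrow> C0c b \<Longrightarrow> wnorm2 (\<lambda>x. a x + b x) \<le> 2 * wnorm2 a + 2 * wnorm2 b"
proof -
  assume a: "C0c a" and b: "C0c b"
  have "wnorm2 (\<lambda>x. a x + b x) \<le> (\<integral>x. 2 * ((cmod (a x))\<^sup>2 * wtr x) + 2 * ((cmod (b x))\<^sup>2 * wtr x) \<partial>lborel)"
    unfolding wnorm2_def
  proof (rule integral_mono)
    fix x
    show "(cmod (a x + b x))\<^sup>2 * wtr x \<le> 2 * ((cmod (a x))\<^sup>2 * wtr x) + 2 * ((cmod (b x))\<^sup>2 * wtr x)"
      using mult_right_mono[OF cmod_sq_add_le[of "a x" "b x"], of "wtr x"] wtr_pos[of x] by (simp add: algebra_simps)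
  qed (use wnorm2_integrable[OF a] wnorm2_integrable[OF b] wnorm2_integrable[OF C0c_add[OF a b]] in auto)
  then show ?thesis using wnorm2_integrable[OF a] wnorm2_integrable[OF b] by (simp add: wnorm2_def)
qed

definition "energy \<mu> h F = wnorm2 (\<lambda>x. h x - F x) + \<mu> * (\<Sum>j\<in>UNIV. wnorm2 (dbar j F))"
text \<open>The quadratic part of \<open>energy\<close> along the line F + s g; the Euler-Lagrange
  error of an almost minimiser is measured against it.\<close>

definition "enorm \<mu> g = wnorm2 g + \<mu> * (\<Sum>j\<in>UNIV. wnorm2 (dbar j g))"
\<comment> \<open>The Euler-Lagrange form of \<open>energy\<close>: half its negative derivative at \<open>F\<close> in direction \<open>g\<close>.\<close>
definition "EL \<mu> h F g = wprod (\<lambda>x. h x - F x) g - of_real \<mu> * (\<Sum>j\<in>UNIV. wprod (dbar j F) (dbar j g))"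

lemma energy_expand:
  assumes h: "C1c h" and F: "C1c F" and g: "C1c g"
  shows "energy \<mu> h (\<lambda>x. F x + s * g x) = energy \<mu> h F - 2 * Re (cnj s * EL \<mu> h F g) + (cmod s)\<^sup>2 * enorm \<mu> g"
proof -
  have 1: "wnorm2 (\<lambda>x. h x - (F x + s * g x)) = wnorm2 (\<lambda>x. h x - F x) - 2 * Re (cnj s * wprod (\<lambda>x. h x - F x) g) + (cmod s)\<^sup>2 * wnorm2 g"
    using wnorm2_expand[OF C1c_C0c[OF C1c_diff[OF h F]] C1c_C0c[OF g], of "- s"] by (simp add: algebra_simps)
  have "dbar j (\<lambda>x. F x + s * g x) = (\<lambda>x. dbar j F x + s * dbar j g x)" for j
    using dbar_add[OF C1c_differentiable[OF F], of "\<lambda>x. s * g x"] dbar_cmult[OF C1c_differentiable[OF g]] C1c_differentiable[OF g]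
    by (auto simp: differentiable_mult)
  then have 2: "wnorm2 (dbar j (\<lambda>x. F x + s * g x)) = wnorm2 (dbar j F) + 2 * Re (cnj s * wprod (dbar j F) (dbar j g)) + (cmod s)\<^sup>2 * wnorm2 (dbar j g)" for j
    using wnorm2_expand[OF C1c_dbar_C0c[OF F] C1c_dbar_C0c[OF g]] by simp
  show ?thesis unfolding energy_def 1 2 EL_def enorm_def
    by (simp add: sum.distrib sum_distrib_left algebra_simps flip: sum_distrib_left) (simp add: mult.commute flip: sum_distrib_right)
qed

lemma energy_nonneg: "\<mu> \<ge> 0 \<Longrightarrow> energy \<mu> h F \<ge> 0" and enorm_nonneg: "\<mu> \<ge> 0 \<Longrightarrow> enorm \<mu> g \<ge> 0"
  unfolding energy_def enorm_def by (auto intro!: add_nonneg_nonneg mult_nonneg_nonneg sum_nonneg wnorm2_nonneg)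

text \<open>For s = t A with real t the hypothesis is a quadratic inequality in t, and t = 1 / N
  gives the bound. For N = 0 the inequality is linear in t and forces A = 0.\<close>

lemma quadratic_min_bound:
  fixes A :: complex
  assumes "\<And>s. 2 * Re (cnj s * A) \<le> \<epsilon>\<^sup>2 + (cmod s)\<^sup>2 * N" "\<epsilon> > 0" "N \<ge> 0"
  shows "(cmod A)\<^sup>2 \<le> \<epsilon>\<^sup>2 * N"
proof -
  have 1: "2 * t * (cmod A)\<^sup>2 \<le> \<epsilon>\<^sup>2 + t\<^sup>2 * (cmod A)\<^sup>2 * N" for t :: real
  proof -
    have "Re (cnj (of_real t * A) * A) = t * (cmod A)\<^sup>2"
      by (simp add: cmod_power2) (simp add: power2_eq_square algebra_simps)
    then show ?thesis using assms(1)[of "of_real t * A"] by (simp add: norm_mult power_mult_distrib)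
  qed
  show ?thesis
  proof (cases "N = 0")
    case True
    have "(cmod A)\<^sup>2 = 0"
    proof (rule ccontr)
      assume n: "(cmod A)\<^sup>2 \<noteq> 0"
      then have "2 * (\<epsilon>\<^sup>2 / (cmod A)\<^sup>2) * (cmod A)\<^sup>2 \<le> \<epsilon>\<^sup>2" using 1[of "\<epsilon>\<^sup>2 / (cmod A)\<^sup>2"] True by simp
      then show False using n assms(2) by (simp add: field_simps)
    qed
    then show ?thesis using True by simp
  next
    case False
    then have N: "N > 0" using assms by simp
    have "2 * (1 / N) * (cmod A)\<^sup>2 \<le> \<epsilon>\<^sup>2 + (1 / N) * (cmod A)\<^sup>2"
      using 1[of "1/N"] N by (simp add: power2_eq_square)
    then have "(1 / N) * (cmod A)\<^sup>2 \<le> \<epsilon>\<^sup>2" by linarith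
    then show ?thesis using N by (simp add: field_simps)
  qed
qed

text \<open>F has energy within \<epsilon>^2 of the infimum; comparison with F + s g for all s is a
  quadratic inequality that bounds its linear coefficient. The competitor 0, whose energy is
  \<open>wnorm2 h\<close>, gives the bound on the energy.\<close>

lemma almost_minimiser:
  assumes h: "C1c h" and \<mu>: "\<mu> > 0" and \<epsilon>: "\<epsilon> > 0"
  obtains F where "C1c F" "energy \<mu> h F \<le> wnorm2 h + \<epsilon>\<^sup>2"
    "\<And>g. C1c g \<Longrightarrow> (cmod (EL \<mu> h F g))\<^sup>2 \<le> \<epsilon>\<^sup>2 * enorm \<mu> g"
proof -
  let ?S = "energy \<mu> h ` {F. C1c F}"
  have bb: "bdd_below ?S" using energy_nonneg[of \<mu>] \<mu> by (intro bdd_belowI[of _ 0]) auto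
  have ne: "?S \<noteq> {}" using C1c_zero by blast
  obtain F where F: "C1c F" "energy \<mu> h F < Inf ?S + \<epsilon>\<^sup>2"
    using cInf_lessD[OF ne, of "Inf ?S + \<epsilon>\<^sup>2"] \<epsilon> by auto
  have low: "Inf ?S \<le> energy \<mu> h G" if "C1c G" for G by (rule cInf_lower[OF _ bb]) (use that in auto)
  have "energy \<mu> h (\<lambda>x. 0) = wnorm2 h"
  proof -
    have "dbar j (\<lambda>x::complex^'n. 0) = (\<lambda>x. 0)" for j by auto
    then show ?thesis by (simp add: energy_def wnorm2_def)
  qed
  then have e: "energy \<mu> h F \<le> wnorm2 h + \<epsilon>\<^sup>2" using low[OF C1c_zero] F(2) by simp
  have "(cmod (EL \<mu> h F g))\<^sup>2 \<le> \<epsilon>\<^sup>2 * enorm \<mu> g" if g: "C1c g" for g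
  proof (rule quadratic_min_bound[OF _ \<epsilon>])
    fix s
    have "C1c (\<lambda>x. F x + s * g x)" by (intro C1c_add C1c_mult2 F g) auto
    then show "2 * Re (cnj s * EL \<mu> h F g) \<le> \<epsilon>\<^sup>2 + (cmod s)\<^sup>2 * enorm \<mu> g"
      using low F(2) energy_expand[OF h F(1) g, of \<mu> s] by fastforce
  qed (use enorm_nonneg \<mu> in auto)
  then show ?thesis using that F e by blast
qed

text \<open>\<open>bochner_pair\<close> summed over all pairs (j, k), for the components of one
  form. The curvature integral is bounded below by the rank-one form that \<open>levi\<close> places
  under the Levi form of \<Phi>.\<close>

lemma bochner_ineq:
  assumes \<gamma>: "\<And>j. C2_on UNIV (\<gamma> j)" "\<And>j. sym2 (\<gamma> j)" "\<And>j. C0c (\<gamma> j)"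
    and el: "\<And>j. continuous_on UNIV (el j)"
    and levi: "\<And>x \<xi>. (cmod (\<Sum>j\<in>UNIV. el j x * \<xi> j))\<^sup>2 \<le> Re (\<Sum>j\<in>UNIV. \<Sum>k\<in>UNIV. dbar k (dPhi j) x * \<xi> j * cnj (\<xi> k))"
  shows "(\<integral>x. (cmod (\<Sum>j\<in>UNIV. el j x * \<gamma> j x))\<^sup>2 * wtr x \<partial>lborel) +
       (\<integral>x. Re (\<Sum>j\<in>UNIV. \<Sum>k\<in>UNIV. dbar k (\<gamma> j) x * cnj (dbar j (\<gamma> k) x)) * wtr x \<partial>lborel)
     \<le> wnorm2 (\<lambda>x. \<Sum>j\<in>UNIV. delta j (\<gamma> j) x)"
proof -
  have \<gamma>1: "C1c (\<gamma> j)" for j using \<gamma> by (auto simp: C1c_iff C2_on_def)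
  have dc: "C0c (delta j (\<gamma> j))" for j
    unfolding delta_def[abs_def] by (intro C0c_diff C1c_dz_C0c \<gamma>1 C0c_mult2 \<gamma> C1_on_continuous C1_dPhi)
  have i0: "integrable lborel (\<lambda>x. delta j (\<gamma> j) x * cnj (delta k (\<gamma> k) x) * wt x)" for j k
    by (intro wprod_integrable dc)
  have i1: "integrable lborel (\<lambda>x. dbar k (dPhi j) x * \<gamma> j x * cnj (\<gamma> k x) * wt x)" for j k
    by (intro C0c_integrable C0c_mult1 C0c_mult2[OF \<gamma>(3)] wt_continuous continuous_on_dbar C1_dPhi continuous_intros C0c_continuous \<gamma>)
  have i2: "integrable lborel (\<lambda>x. dbar k (\<gamma> j) x * cnj (dbar j (\<gamma> k) x) * wt x)" for j k
    by (intro wprod_integrable C1c_dbar_C0c \<gamma>1)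
  define A where "A x = (\<Sum>j\<in>UNIV. \<Sum>k\<in>UNIV. dbar k (dPhi j) x * \<gamma> j x * cnj (\<gamma> k x) * wt x)" for x
  define B where "B x = (\<Sum>j\<in>UNIV. \<Sum>k\<in>UNIV. dbar k (\<gamma> j) x * cnj (dbar j (\<gamma> k) x) * wt x)" for x
  have iA: "integrable lborel A" and iB: "integrable lborel B"
    unfolding A_def[abs_def] B_def[abs_def] by (intro Bochner_Integration.integrable_sum i1 i2)+
  have "complex_of_real (wnorm2 (\<lambda>x. \<Sum>j\<in>UNIV. delta j (\<gamma> j) x)) =
     (\<integral>x. (\<Sum>j\<in>UNIV. \<Sum>k\<in>UNIV. delta j (\<gamma> j) x * cnj (delta k (\<gamma> k) x) * wt x) \<partial>lborel)"
    unfolding wnorm2_def integral_complex_of_real[symmetric]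
  proof (rule Bochner_Integration.integral_cong[OF refl])
    fix x
    have "complex_of_real ((cmod (\<Sum>j\<in>UNIV. delta j (\<gamma> j) x))\<^sup>2) = (\<Sum>j\<in>UNIV. delta j (\<gamma> j) x) * cnj (\<Sum>k\<in>UNIV. delta k (\<gamma> k) x)"
      by (simp only: complex_norm_square)
    also have "\<dots> = (\<Sum>j\<in>UNIV. \<Sum>k\<in>UNIV. delta j (\<gamma> j) x * cnj (delta k (\<gamma> k) x))"
      by (simp add: sum_product)
    finally show "complex_of_real ((cmod (\<Sum>j\<in>UNIV. delta j (\<gamma> j) x))\<^sup>2 * wtr x) = (\<Sum>j\<in>UNIV. \<Sum>k\<in>UNIV. delta j (\<gamma> j) x * cnj (delta k (\<gamma> k) x) * wt x)"
      by (simp add: wt_of_real sum_distrib_right)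
  qed
  also have "\<dots> = (\<Sum>j\<in>UNIV. \<Sum>k\<in>UNIV. (\<integral>x. delta j (\<gamma> j) x * cnj (delta k (\<gamma> k) x) * wt x \<partial>lborel))"
    using i0 by (simp add: Bochner_Integration.integral_sum Bochner_Integration.integrable_sum)
  also have "\<dots> = (\<Sum>j\<in>UNIV. \<Sum>k\<in>UNIV. (\<integral>x. dbar k (dPhi j) x * \<gamma> j x * cnj (\<gamma> k x) * wt x \<partial>lborel) + (\<integral>x. dbar k (\<gamma> j) x * cnj (dbar j (\<gamma> k) x) * wt x \<partial>lborel))"
    by (intro sum.cong refl bochner_pair \<gamma>)
  also have "\<dots> = (\<integral>x. A x \<partial>lborel) + (\<integral>x. B x \<partial>lborel)"
    unfolding A_def B_def using i1 i2
    by (simp add: Bochner_Integration.integral_sum Bochner_Integration.integrable_sum sum.distrib)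
  finally have eq: "wnorm2 (\<lambda>x. \<Sum>j\<in>UNIV. delta j (\<gamma> j) x) = Re (\<integral>x. A x \<partial>lborel) + Re (\<integral>x. B x \<partial>lborel)"
    by (metis Re_complex_of_real plus_complex.sel(1))
  have "Re (\<integral>x. B x \<partial>lborel) = (\<integral>x. Re (B x) \<partial>lborel)" by (rule integral_Re[OF iB, symmetric])
  also have "\<dots> = (\<integral>x. Re (\<Sum>j\<in>UNIV. \<Sum>k\<in>UNIV. dbar k (\<gamma> j) x * cnj (dbar j (\<gamma> k) x)) * wtr x \<partial>lborel)"
  proof (rule Bochner_Integration.integral_cong[OF refl])
    fix x
    have "B x = of_real (wtr x) * (\<Sum>j\<in>UNIV. \<Sum>k\<in>UNIV. dbar k (\<gamma> j) x * cnj (dbar j (\<gamma> k) x))"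
      unfolding B_def by (simp add: wt_of_real sum_distrib_left algebra_simps)
    then show "Re (B x) = Re (\<Sum>j\<in>UNIV. \<Sum>k\<in>UNIV. dbar k (\<gamma> j) x * cnj (dbar j (\<gamma> k) x)) * wtr x"
      by (simp del: Re_sum)
  qed
  finally have eB: "Re (\<integral>x. B x \<partial>lborel) = (\<integral>x. Re (\<Sum>j\<in>UNIV. \<Sum>k\<in>UNIV. dbar k (\<gamma> j) x * cnj (dbar j (\<gamma> k) x)) * wtr x \<partial>lborel)" .
  have "(\<integral>x. (cmod (\<Sum>j\<in>UNIV. el j x * \<gamma> j x))\<^sup>2 * wtr x \<partial>lborel) \<le> (\<integral>x. Re (A x) \<partial>lborel)"
  proof (rule integral_mono)
    show "integrable lborel (\<lambda>x. (cmod (\<Sum>j\<in>UNIV. el j x * \<gamma> j x))\<^sup>2 * wtr x)"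
      by (intro wnorm2_integrable C0c_sum C0c_mult2 \<gamma> el)
    show "integrable lborel (\<lambda>x. Re (A x))" by (rule integrable_Re[OF iA])
    fix x
    have "A x = of_real (wtr x) * (\<Sum>j\<in>UNIV. \<Sum>k\<in>UNIV. dbar k (dPhi j) x * \<gamma> j x * cnj (\<gamma> k x))"
      unfolding A_def by (simp add: wt_of_real sum_distrib_left algebra_simps)
    then have "Re (A x) = Re (\<Sum>j\<in>UNIV. \<Sum>k\<in>UNIV. dbar k (dPhi j) x * \<gamma> j x * cnj (\<gamma> k x)) * wtr x"
      by (simp del: Re_sum)
    then show "(cmod (\<Sum>j\<in>UNIV. el j x * \<gamma> j x))\<^sup>2 * wtr x \<le> Re (A x)"
      using mult_right_mono[OF levi[of x "\<lambda>j. \<gamma> j x"], of "wtr x"] wtr_pos[of x] by simp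
  qed
  also have "\<dots> = Re (\<integral>x. A x \<partial>lborel)" by (rule integral_Re[OF iA])
  finally show ?thesis using eq eB by linarith
qed

text \<open>The form \<beta> comes from an almost minimiser with uncontrolled support, while weight
  comparisons hold on a ball fixed beforehand; hence the cutoff. Differentiating it costs a term in
  \<beta> twice, each time with factor 2: in the divergence, and in the product of
  \<open>dbar k (\<gamma> j)\<close> and \<open>dbar j (\<gamma> k)\<close>, which for a closed
  \<beta> is a nonnegative square up to that cost.\<close>

lemma bochner_cutoff:
  assumes \<beta>: "\<And>j. C2_on UNIV (\<beta> j)" "\<And>j. sym2 (\<beta> j)" "\<And>j. C0c (\<beta> j)"
    and \<beta>s: "\<And>j k x. dbar k (\<beta> j) x = dbar j (\<beta> k) x"
    and ch: "C2_on UNIV ch" "sym2 (\<lambda>x. complex_of_real (ch x))"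
    and el: "\<And>j. continuous_on UNIV (el j)"
    and levi: "\<And>x \<xi>. (cmod (\<Sum>j\<in>UNIV. el j x * \<xi> j))\<^sup>2 \<le> Re (\<Sum>j\<in>UNIV. \<Sum>k\<in>UNIV. dbar k (dPhi j) x * \<xi> j * cnj (\<xi> k))"
  shows "(\<integral>x. (ch x)\<^sup>2 * (cmod (\<Sum>j\<in>UNIV. el j x * \<beta> j x))\<^sup>2 * wtr x \<partial>lborel)
     \<le> 2 * (\<integral>x. (ch x)\<^sup>2 * (cmod (\<Sum>j\<in>UNIV. delta j (\<beta> j) x))\<^sup>2 * wtr x \<partial>lborel)
      + 4 * (\<integral>x. (\<Sum>k\<in>UNIV. (cmod (dbar k (\<lambda>x. of_real (ch x)) x))\<^sup>2) * (\<Sum>j\<in>UNIV. (cmod (\<beta> j x))\<^sup>2) * wtr x \<partial>lborel)"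
proof -
  let ?c = "\<lambda>x. complex_of_real (ch x)"
  have c2: "C2_on UNIV ?c" by (rule C2_on_of_real[OF open_UNIV ch(1)])
  define \<gamma> where "\<gamma> j x = ?c x * \<beta> j x" for j x
  have \<gamma>: "C2_on UNIV (\<gamma> j)" "sym2 (\<gamma> j)" "C0c (\<gamma> j)" for j
    unfolding \<gamma>_def[abs_def]
    by (intro C2_on_mult open_UNIV c2 \<beta> sym2_mult ch C0c_mult2 C1_on_continuous[OF C2_on_C1[OF c2]])+
  have \<gamma>1: "C1c (\<gamma> j)" and \<beta>1: "C1c (\<beta> j)" for j using \<gamma> \<beta> by (auto simp: C1c_iff C2_on_def)
  have d: "?c differentiable at x" "\<beta> j differentiable at x" for x j
    using c2 \<beta>(1) by (auto simp: C2_on_def C1_on_def)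
  have cch: "continuous_on UNIV ch" using C1_on_continuous[OF C2_on_C1[OF ch(1)]] .
  define n2 where "n2 x = (\<Sum>k\<in>UNIV. (cmod (dbar k ?c x))\<^sup>2)" for x
  define bb where "bb x = (\<Sum>j\<in>UNIV. (cmod (\<beta> j x))\<^sup>2)" for x
  have n2c: "continuous_on UNIV n2" unfolding n2_def[abs_def]
    by (intro continuous_intros continuous_on_dbar C2_on_C1[OF c2])
  have bbc: "C0c bb" unfolding bb_def[abs_def]
    by (intro C0c_sum C0c_comp[OF \<beta>(3)]) (auto intro!: continuous_intros)
  have iN: "integrable lborel (\<lambda>x. n2 x * bb x * wtr x)"
    by (intro C0c_integrable C0c_mult1 C0c_mult2[OF bbc] n2c wtr_continuous)
  have d\<gamma>: "dbar k (\<gamma> j) x = dbar k ?c x * \<beta> j x + ?c x * dbar k (\<beta> j) x" for j k x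
    unfolding \<gamma>_def[abs_def] by (simp add: dbar_mult d)
  have \<delta>\<gamma>: "delta j (\<gamma> j) x = ?c x * delta j (\<beta> j) x + dz j ?c x * \<beta> j x" for j x
    unfolding delta_def \<gamma>_def[abs_def] by (simp add: dz_mult d algebra_simps)
  have cdz: "cmod (dz j ?c x) = cmod (dbar j ?c x)" for j x
    using dbar_eq_cnj_dz_real[of ch x j] C1_on_differentiable[OF C2_on_C1[OF ch(1)]] by simp
  have sum\<delta>: "(\<Sum>j\<in>UNIV. delta j (\<gamma> j) x) = ?c x * (\<Sum>j\<in>UNIV. delta j (\<beta> j) x) + (\<Sum>j\<in>UNIV. dz j ?c x * \<beta> j x)" for x
    by (simp add: \<delta>\<gamma> sum.distrib sum_distrib_left)
  have dc: "C0c (delta j (\<beta> j))" for j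
    unfolding delta_def[abs_def] by (intro C0c_diff C1c_dz_C0c \<beta>1 C0c_mult2 \<beta> C1_on_continuous C1_dPhi)
  have iD: "integrable lborel (\<lambda>x. (ch x)\<^sup>2 * (cmod (\<Sum>j\<in>UNIV. delta j (\<beta> j) x))\<^sup>2 * wtr x)"
    by (intro C0c_integrable C0c_mult1 C0c_mult2 C0c_comp[OF C0c_sum[OF dc], of "\<lambda>z. (cmod z)\<^sup>2"] continuous_intros cch wtr_continuous) auto
  have i3: "integrable lborel (\<lambda>x. Re (\<Sum>j\<in>UNIV. \<Sum>k\<in>UNIV. dbar k (\<gamma> j) x * cnj (dbar j (\<gamma> k) x)) * wtr x)"
    by (intro C0c_integrable C0c_mult1 wtr_continuous C0c_comp[where h=Re] C0c_sum C1c_dbar_C0c[OF \<gamma>1] C0c_mult1 continuous_intros C0c_continuous[OF C1c_dbar_C0c[OF \<gamma>1]]) auto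
  have "(\<integral>x. (ch x)\<^sup>2 * (cmod (\<Sum>j\<in>UNIV. el j x * \<beta> j x))\<^sup>2 * wtr x \<partial>lborel) = (\<integral>x. (cmod (\<Sum>j\<in>UNIV. el j x * \<gamma> j x))\<^sup>2 * wtr x \<partial>lborel)"
  proof (rule Bochner_Integration.integral_cong[OF refl])
    fix x
    have "(\<Sum>j\<in>UNIV. el j x * \<gamma> j x) = ?c x * (\<Sum>j\<in>UNIV. el j x * \<beta> j x)"
      by (simp add: \<gamma>_def sum_distrib_left algebra_simps)
    then show "(ch x)\<^sup>2 * (cmod (\<Sum>j\<in>UNIV. el j x * \<beta> j x))\<^sup>2 * wtr x = (cmod (\<Sum>j\<in>UNIV. el j x * \<gamma> j x))\<^sup>2 * wtr x"
      by (simp add: norm_mult power_mult_distrib)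
  qed
  also have "\<dots> \<le> wnorm2 (\<lambda>x. \<Sum>j\<in>UNIV. delta j (\<gamma> j) x) - (\<integral>x. Re (\<Sum>j\<in>UNIV. \<Sum>k\<in>UNIV. dbar k (\<gamma> j) x * cnj (dbar j (\<gamma> k) x)) * wtr x \<partial>lborel)"
    using bochner_ineq[of \<gamma>, OF \<gamma> el levi] by linarith
  finally have f1: "(\<integral>x. (ch x)\<^sup>2 * (cmod (\<Sum>j\<in>UNIV. el j x * \<beta> j x))\<^sup>2 * wtr x \<partial>lborel)
    \<le> wnorm2 (\<lambda>x. \<Sum>j\<in>UNIV. delta j (\<gamma> j) x) - (\<integral>x. Re (\<Sum>j\<in>UNIV. \<Sum>k\<in>UNIV. dbar k (\<gamma> j) x * cnj (dbar j (\<gamma> k) x)) * wtr x \<partial>lborel)" .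
  have f2: "- (\<integral>x. Re (\<Sum>j\<in>UNIV. \<Sum>k\<in>UNIV. dbar k (\<gamma> j) x * cnj (dbar j (\<gamma> k) x)) * wtr x \<partial>lborel) \<le> (\<integral>x. 2 * (n2 x * bb x * wtr x) \<partial>lborel)"
    unfolding Bochner_Integration.integral_minus[symmetric]
  proof (rule integral_mono)
    fix x
    have "(\<Sum>j\<in>UNIV. \<Sum>k\<in>UNIV. (cmod (dbar k ?c x * \<beta> j x))\<^sup>2) = n2 x * bb x"
      unfolding n2_def bb_def sum_product by (subst sum.swap) (simp add: norm_mult power_mult_distrib)
    then have "- 2 * (n2 x * bb x) \<le> Re (\<Sum>j\<in>UNIV. \<Sum>k\<in>UNIV. dbar k (\<gamma> j) x * cnj (dbar j (\<gamma> k) x))"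
      using symmetric_perturbation_lower_bound[of "\<lambda>j k. ?c x * dbar k (\<beta> j) x" "\<lambda>j k. dbar k ?c x * \<beta> j x"] \<beta>s
      by (simp add: d\<gamma>)
    then show "- (Re (\<Sum>j\<in>UNIV. \<Sum>k\<in>UNIV. dbar k (\<gamma> j) x * cnj (dbar j (\<gamma> k) x)) * wtr x) \<le> 2 * (n2 x * bb x * wtr x)"
      using mult_right_mono[of "- 2 * (n2 x * bb x)" _ "wtr x"] wtr_pos[of x] by fastforce
  qed (use i3 iN in auto)
  have f3: "wnorm2 (\<lambda>x. \<Sum>j\<in>UNIV. delta j (\<gamma> j) x) \<le> (\<integral>x. 2 * ((ch x)\<^sup>2 * (cmod (\<Sum>j\<in>UNIV. delta j (\<beta> j) x))\<^sup>2 * wtr x) + 2 * (n2 x * bb x * wtr x) \<partial>lborel)"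
    unfolding wnorm2_def
  proof (rule integral_mono)
    have dc\<gamma>: "C0c (delta j (\<gamma> j))" for j
      unfolding delta_def[abs_def] by (intro C0c_diff C1c_dz_C0c \<gamma>1 C0c_mult2 \<gamma> C1_on_continuous C1_dPhi)
    show "integrable lborel (\<lambda>x. (cmod (\<Sum>j\<in>UNIV. delta j (\<gamma> j) x))\<^sup>2 * wtr x)" by (intro wnorm2_integrable C0c_sum dc\<gamma>)
    fix x
    have "(cmod (\<Sum>j\<in>UNIV. dz j ?c x * \<beta> j x))\<^sup>2 \<le> n2 x * bb x"
      using cmod_sum_sq_le[of "\<lambda>j. dz j ?c x" "\<lambda>j. \<beta> j x"] by (simp add: n2_def bb_def cdz)
    then have "(cmod (\<Sum>j\<in>UNIV. delta j (\<gamma> j) x))\<^sup>2 \<le> 2 * ((ch x)\<^sup>2 * (cmod (\<Sum>j\<in>UNIV. delta j (\<beta> j) x))\<^sup>2) + 2 * (n2 x * bb x)"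
      using cmod_sq_add_le[of "?c x * (\<Sum>j\<in>UNIV. delta j (\<beta> j) x)" "\<Sum>j\<in>UNIV. dz j ?c x * \<beta> j x"]
      unfolding sum\<delta> by (simp add: norm_mult power_mult_distrib)
    then show "(cmod (\<Sum>j\<in>UNIV. delta j (\<gamma> j) x))\<^sup>2 * wtr x \<le> 2 * ((ch x)\<^sup>2 * (cmod (\<Sum>j\<in>UNIV. delta j (\<beta> j) x))\<^sup>2 * wtr x) + 2 * (n2 x * bb x * wtr x)"
      using mult_right_mono[of _ _ "wtr x"] wtr_pos[of x] by (fastforce simp: algebra_simps)
  qed (use iD iN in auto)
  have e3: "(\<integral>x. 2 * ((ch x)\<^sup>2 * (cmod (\<Sum>j\<in>UNIV. delta j (\<beta> j) x))\<^sup>2 * wtr x) + 2 * (n2 x * bb x * wtr x) \<partial>lborel)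
     = 2 * (\<integral>x. (ch x)\<^sup>2 * (cmod (\<Sum>j\<in>UNIV. delta j (\<beta> j) x))\<^sup>2 * wtr x \<partial>lborel) + 2 * (\<integral>x. n2 x * bb x * wtr x \<partial>lborel)"
    using iD iN by simp
  have e2: "(\<integral>x. 2 * (n2 x * bb x * wtr x) \<partial>lborel) = 2 * (\<integral>x. n2 x * bb x * wtr x \<partial>lborel)" by simp
  show ?thesis unfolding n2_def[symmetric] bb_def[symmetric] using f1 f2 f3 unfolding e2 e3 by linarith
qed

end

section \<open>Approximate solutions of the dbar-equation\<close>

lemma continuous_bounded_cball:
  fixes f :: "'a::euclidean_space \<Rightarrow> 'b::real_normed_vector"
  assumes "continuous_on UNIV f" obtains M where "M > 0" "\<And>x. norm x \<le> R \<Longrightarrow> norm (f x) \<le> M"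
proof -
  have "compact (f ` cball 0 R)"
    using assms by (intro compact_continuous_image) (auto intro: continuous_on_subset)
  then obtain M where "M > 0" "\<And>y. y \<in> f ` cball 0 R \<Longrightarrow> norm y \<le> M"
    using compact_imp_bounded bounded_pos by metis
  then show ?thesis using that by auto
qed

lemma eventually_uniform_continuity:
  fixes f :: "'a::euclidean_space \<Rightarrow> 'b::real_normed_vector"
  assumes "continuous_on UNIV f" "\<omega> > 0"
  shows "\<forall>\<^sub>F \<sigma> in at_right (0::real). \<forall>u y. norm u \<le> \<sigma> \<longrightarrow> norm (u + y) \<le> R \<longrightarrow> norm (f (u + y) - f y) \<le> \<omega>"
proof -
  have "uniformly_continuous_on (cball 0 (R + 1)) f"
    using assms by (intro compact_uniformly_continuous) (auto intro: continuous_on_subset)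
  then obtain d where d: "d > 0" "\<And>x y. x \<in> cball 0 (R + 1) \<Longrightarrow> y \<in> cball 0 (R + 1) \<Longrightarrow> dist y x < d \<Longrightarrow> dist (f y) (f x) < \<omega>"
    using assms(2) unfolding uniformly_continuous_on_def by metis
  have "norm (f (u + y) - f y) \<le> \<omega>" if "\<sigma> < min 1 d" "norm u \<le> \<sigma>" "norm (u + y) \<le> R" for \<sigma> u y
  proof -
    have "norm y \<le> R + 1" using that norm_triangle_ineq[of "u + y" "- u"] by auto
    moreover have "norm (u + y) \<le> R + 1" using that by simp
    moreover have "dist (u + y) y < d" using that by (simp add: dist_norm)
    ultimately show ?thesis using d(2)[of y "u + y"] unfolding mem_cball_0 by (simp add: dist_norm less_imp_le)
  qed
  then show ?thesis unfolding eventually_at_right_field using d by (intro exI[of _ "min 1 d"]) auto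
qed

text \<open>The plateau factor is 1 up to norm R + 3 and 0 beyond R + 4. It turns the modulus of
  continuity into a continuous, compactly supported majorant, the shape in which
  \<open>conv_pairing\<close> takes Z.\<close>

lemma eventually_uniform_continuity_C0c:
  fixes f :: "'a::euclidean_space \<Rightarrow> 'b::real_normed_vector"
  assumes "continuous_on UNIV f" "\<And>x. R \<le> norm x \<Longrightarrow> f x = 0" "\<omega> > 0"
  shows "\<forall>\<^sub>F \<sigma> in at_right (0::real). \<forall>u y. norm u \<le> \<sigma> \<longrightarrow> norm (f (u + y) - f y) \<le> \<omega> * max 0 (min 1 (R + 4 - norm y))"
proof -
  have "\<forall>\<^sub>F \<sigma> in at_right (0::real). \<sigma> < 1"
    unfolding eventually_at_right_field by (auto intro!: exI[of _ 1])
  with eventually_uniform_continuity[OF assms(1,3), of "R + 2"] show ?thesis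
  proof eventually_elim
    case (elim \<sigma>)
    show ?case
    proof (intro allI impI)
      fix u y :: 'a assume u: "norm u \<le> \<sigma>"
      show "norm (f (u + y) - f y) \<le> \<omega> * max 0 (min 1 (R + 4 - norm y))"
      proof (cases "norm (u + y) \<le> R + 2")
        case True
        have "norm y \<le> norm (u + y) + norm u" using norm_triangle_ineq[of "u + y" "- u"] by simp
        then have "max 0 (min 1 (R + 4 - norm y)) = 1" using True u elim by (auto simp: max_def min_def)
        then show ?thesis using elim u True by auto
      next
        case False
        have "norm (u + y) \<le> norm u + norm y" by (rule norm_triangle_ineq)
        then have "f (u + y) = 0" "f y = 0" using False u elim by (auto intro!: assms(2))
        then show ?thesis using assms(3) by simp
      qed
    qed
  qed
qed

text \<open>The commutator of mollification with multiplication by f involves f y - f x at distance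
  at most \<sigma>, so the oscillation of f makes it small relative to the mollification of
  |b|.\<close>

lemma conv_commutator_bound:
  fixes b f :: "'a::euclidean_space \<Rightarrow> complex"
  assumes b: "C0c b" and f: "continuous_on UNIV f" and \<sigma>: "\<sigma> > 0" and \<omega>: "\<And>y. norm (x - y) \<le> \<sigma> \<Longrightarrow> cmod (f y - f x) \<le> \<omega>"
  shows "cmod (conv (\<lambda>y. b y * f y) (moll \<sigma>) x - f x * conv b (moll \<sigma>) x) \<le> \<omega> * cmod (conv (\<lambda>y. of_real (cmod (b y))) (moll \<sigma>) x)"
proof -
  have cb: "C0c (\<lambda>y. complex_of_real (cmod (b y)))" by (rule C0c_comp[OF b]) (auto intro!: continuous_intros)
  have i: "integrable lborel (\<lambda>y. b y * f y * moll \<sigma> (x - y))" "integrable lborel (\<lambda>y. b y * moll \<sigma> (x - y))"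
    by (intro conv_integrable C0c_mult1 b f moll_continuous)+
  have ir: "integrable lborel (\<lambda>y. cmod (b y) * mollr \<sigma> (x - y))"
    by (intro C0c_integrable C0c_mult1 C0c_comp[OF b] continuous_on_translate C0c_continuous[OF mollr_C0c[OF \<sigma>]]) (auto intro!: continuous_intros)
  have "conv (\<lambda>y. b y * f y) (moll \<sigma>) x - f x * conv b (moll \<sigma>) x = (\<integral>y. b y * f y * moll \<sigma> (x - y) - f x * (b y * moll \<sigma> (x - y)) \<partial>lborel)"
    unfolding conv_def using i by simp
  also have "cmod \<dots> \<le> (\<integral>y. \<omega> * (cmod (b y) * mollr \<sigma> (x - y)) \<partial>lborel)"
  proof (rule Bochner_Integration.integral_norm_bound_integral)
    show "integrable lborel (\<lambda>y. b y * f y * moll \<sigma> (x - y) - f x * (b y * moll \<sigma> (x - y)))" using i by simp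
    show "integrable lborel (\<lambda>y. \<omega> * (cmod (b y) * mollr \<sigma> (x - y)))" using ir by simp
    fix y
    have e: "b y * f y * moll \<sigma> (x - y) - f x * (b y * moll \<sigma> (x - y)) = (f y - f x) * (b y * moll \<sigma> (x - y))"
      by (simp add: algebra_simps)
    show "norm (b y * f y * moll \<sigma> (x - y) - f x * (b y * moll \<sigma> (x - y))) \<le> \<omega> * (cmod (b y) * mollr \<sigma> (x - y))"
    proof (cases "norm (x - y) \<le> \<sigma>")
      case True
      then show ?thesis unfolding e norm_mult using mult_right_mono[OF \<omega>[OF True], of "cmod (b y) * mollr \<sigma> (x - y)"]
        by (simp add: mollr_nonneg)
    next
      case False then show ?thesis using mollr_eq_0[OF \<sigma>, of "x - y"] by simp
    qed
  qed
  also have "(\<integral>y. \<omega> * (cmod (b y) * mollr \<sigma> (x - y)) \<partial>lborel) = \<omega> * (\<integral>y. cmod (b y) * mollr \<sigma> (x - y) \<partial>lborel)" by simp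
  also have "(\<integral>y. cmod (b y) * mollr \<sigma> (x - y) \<partial>lborel) = cmod (conv (\<lambda>y. of_real (cmod (b y))) (moll \<sigma>) x)"
  proof -
    have "conv (\<lambda>y. of_real (cmod (b y))) (moll \<sigma>) x = of_real (\<integral>y. cmod (b y) * mollr \<sigma> (x - y) \<partial>lborel)"
      unfolding conv_def integral_complex_of_real[symmetric] by simp
    moreover have "(\<integral>y. cmod (b y) * mollr \<sigma> (x - y) \<partial>lborel) \<ge> 0"
      by (rule Bochner_Integration.integral_nonneg) (simp add: mollr_nonneg)
    ultimately show ?thesis by simp
  qed
  finally show ?thesis .
qed

context weight begin

text \<open>Tested against \<open>test_fn \<sigma> x\<close>, the Euler-Lagrange equation becomes the equation for the mollified \<open>dbar j F\<close>.\<close>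

definition "test_fn \<sigma> x y = complex_of_real (inverse (wtr y) * mollr \<sigma> (x - y))"

lemma C1_inv: "C1_on UNIV (\<lambda>y. inverse (wtr y))"
proof -
  have e: "(\<lambda>y. inverse (wtr y)) = (\<lambda>y. exp (\<Phi> y))" by (auto simp: wtr_def exp_minus)
  show ?thesis unfolding e
    by (rule C1_on_compose[OF C2_on_C1[OF \<Phi>], where T=UNIV and m'=exp]) (auto intro!: continuous_intros)
qed

lemma C1c_test_fn: "\<sigma> > 0 \<Longrightarrow> C1c (test_fn \<sigma> x)"
proof -
  assume \<sigma>: "\<sigma> > 0"
  have "C1c (\<lambda>y. mollr \<sigma> (x - y))"
    unfolding C1c_iff using pd_translate(2)[OF C2_on_C1[OF C2_on_mollr]] C0c_translate[OF mollr_C0c[OF \<sigma>]] by blast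
  then have "C1c (\<lambda>y. inverse (wtr y) * mollr \<sigma> (x - y))" by (rule C1c_mult2[OF _ C1_inv])
  then show ?thesis unfolding test_fn_def[abs_def] C1c_iff
    by (intro conjI C1_on_bounded_linear[OF bounded_linear_of_real] C0c_comp[where h=complex_of_real] continuous_intros) auto
qed

lemma dz_test_fn:
  "dz j (test_fn \<sigma> x) y * wt y = dPhi j y * moll \<sigma> (x - y) - dz j (\<lambda>x. moll \<sigma> x) (x - y)"
  "dbar j (test_fn \<sigma> x) y = cnj (dz j (test_fn \<sigma> x) y)"
proof -
  let ?m = "\<lambda>y. moll \<sigma> (x - y)" and ?i = "\<lambda>y. complex_of_real (inverse (wtr y))"
  have m: "pd v ?m y = - pd v (\<lambda>x. moll \<sigma> x) (x - y)" "C1_on UNIV ?m" for v y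
    using pd_translate[OF C2_on_C1[OF C2_on_moll]] by auto
  have dm: "dz j ?m y = - dz j (\<lambda>x. moll \<sigma> x) (x - y)" unfolding dz_def m by (simp add: field_simps)
  have i1: "C1_on UNIV ?i" by (rule C1_on_bounded_linear[OF bounded_linear_of_real C1_inv])
  have ie: "?i = (\<lambda>y. of_real (exp (\<Phi> y)))" by (auto simp: wtr_def exp_minus)
  have di: "dz j ?i y = of_real (exp (\<Phi> y)) * dPhi j y"
    unfolding ie dPhi_def by (rule dz_compose[OF Phi_diff]) (auto intro!: derivative_eq_intros)
  have "test_fn \<sigma> x = (\<lambda>y. ?i y * ?m y)" by (auto simp: test_fn_def)
  then have "dz j (test_fn \<sigma> x) y = ?i y * dz j ?m y + dz j ?i y * ?m y"
    using dz_mult[OF C1_on_differentiable[OF i1 UNIV_I] C1_on_differentiable[OF m(2) UNIV_I]] by simp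
  then show "dz j (test_fn \<sigma> x) y * wt y = dPhi j y * moll \<sigma> (x - y) - dz j (\<lambda>x. moll \<sigma> x) (x - y)"
    unfolding dm di wt_of_real using wtr_pos[of y]
    by (simp add: wtr_def exp_minus field_simps)
  have "(\<lambda>y. inverse (wtr y) * mollr \<sigma> (x - y)) differentiable at y"
    by (intro differentiable_mult C1_on_differentiable[OF C1_inv] C1_on_differentiable[OF pd_translate(2)[OF C2_on_C1[OF C2_on_mollr]]] UNIV_I)
  from dbar_eq_cnj_dz_real[OF this] show "dbar j (test_fn \<sigma> x) y = cnj (dz j (test_fn \<sigma> x) y)"
    by (simp only: test_fn_def[abs_def])
qed

text \<open>Since \<open>test_fn \<sigma> x\<close> carries the inverse weight, pairing with it is
  plain convolution at x. The Euler-Lagrange form thus becomes a divergence equation for the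
  mollified \<open>dbar j F\<close>, up to the commutators of \<open>dPhi j\<close> with
  mollification and the Euler-Lagrange error.\<close>

lemma mollified_equation:
  assumes h: "C1c h" and F: "C1c F" and \<sigma>: "\<sigma> > 0" and \<mu>: "\<mu> > 0"
  shows "(\<Sum>j\<in>UNIV. delta j (conv (dbar j F) (moll \<sigma>)) x) =
    (\<Sum>j\<in>UNIV. conv (\<lambda>y. dbar j F y * dPhi j y) (moll \<sigma>) x - dPhi j x * conv (dbar j F) (moll \<sigma>) x)
    + of_real (1 / \<mu>) * EL \<mu> h F (test_fn \<sigma> x) - of_real (1 / \<mu>) * conv (\<lambda>y. h y - F y) (moll \<sigma>) x"
proof -
  note cb = C1c_dbar_C0c[OF F]
  have 1: "wprod (\<lambda>y. h y - F y) (test_fn \<sigma> x) = conv (\<lambda>y. h y - F y) (moll \<sigma>) x"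
    unfolding wprod_def conv_def
    by (rule Bochner_Integration.integral_cong) (auto simp: test_fn_def wt_of_real wtr_def)
  have 2: "wprod (dbar j F) (dbar j (test_fn \<sigma> x)) = conv (\<lambda>y. dbar j F y * dPhi j y) (moll \<sigma>) x - conv (dbar j F) (dz j (\<lambda>x. moll \<sigma> x)) x" for j
  proof -
    have "wprod (dbar j F) (dbar j (test_fn \<sigma> x)) = (\<integral>y. dbar j F y * dPhi j y * moll \<sigma> (x - y) - dbar j F y * dz j (\<lambda>x. moll \<sigma> x) (x - y) \<partial>lborel)"
      unfolding wprod_def
    proof (rule Bochner_Integration.integral_cong[OF refl])
      fix y
      have "dbar j F y * cnj (dbar j (test_fn \<sigma> x) y) * wt y = dbar j F y * (dz j (test_fn \<sigma> x) y * wt y)"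
        by (simp add: dz_test_fn(2))
      then show "dbar j F y * cnj (dbar j (test_fn \<sigma> x) y) * wt y = dbar j F y * dPhi j y * moll \<sigma> (x - y) - dbar j F y * dz j (\<lambda>x. moll \<sigma> x) (x - y)"
        unfolding dz_test_fn(1) by (simp add: algebra_simps)
    qed
    also have "\<dots> = conv (\<lambda>y. dbar j F y * dPhi j y) (moll \<sigma>) x - conv (dbar j F) (dz j (\<lambda>x. moll \<sigma> x)) x"
      unfolding conv_def
      by (rule Bochner_Integration.integral_diff; intro conv_integrable C0c_mult1 cb C1_on_continuous[OF C1_dPhi] moll_continuous continuous_on_dz C2_on_C1[OF C2_on_moll])
    finally show ?thesis .
  qed
  have 3: "delta j (conv (dbar j F) (moll \<sigma>)) x = conv (dbar j F) (dz j (\<lambda>x. moll \<sigma> x)) x - dPhi j x * conv (dbar j F) (moll \<sigma>) x" for j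
    unfolding delta_def dz_conv[OF cb C2_on_C1[OF C2_on_moll]] ..
  show ?thesis unfolding EL_def 1 2 3 using \<mu>
    by (simp add: sum_subtractf sum_distrib_left field_simps)
qed

lemma wnorm2_le_measure:
  assumes "\<And>y. (cmod (a y))\<^sup>2 * wtr y \<le> C * indicator (cball 0 S) y" "C0c a"
  shows "wnorm2 a \<le> C * measure lborel (cball (0::complex^'n) S)"
proof -
  have "wnorm2 a \<le> (\<integral>y. C * indicator (cball 0 S) y \<partial>(lborel::(complex^'n) measure))"
    unfolding wnorm2_def
  proof (rule integral_mono[OF wnorm2_integrable[OF assms(2)]])
    show "integrable lborel (\<lambda>y::complex^'n. C * indicator (cball 0 S) y)"
      by (intro integrable_mult_right integrable_real_indicator)
         (use emeasure_lborel_cball_finite[of "0::complex^'n" S] in \<open>auto simp: less_top[symmetric]\<close>)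
  qed (use assms in auto)
  then show ?thesis by simp
qed

text \<open>Uniformity over the ball is what allows the accuracy \<epsilon> to be chosen once
  \<sigma> is fixed. The test functions live in the ball of radius R + \<sigma>, where the inverse
  weight and \<open>dPhi j\<close> are bounded.\<close>

lemma enorm_test_fn_bounded:
  assumes \<sigma>: "\<sigma> > 0" and \<mu>: "\<mu> > 0"
  obtains C where "C \<ge> 0" "\<And>x. norm x \<le> R \<Longrightarrow> enorm \<mu> (test_fn \<sigma> x) \<le> C"
proof -
  define S where "S = R + \<sigma>"
  define V where "V = measure lborel (cball (0::complex^'n) S)"
  have V: "V \<ge> 0" by (simp add: V_def)
  obtain M1 where M1: "M1 > 0" "\<And>x. norm (mollr \<sigma> (x::complex^'n)) \<le> M1" using C0c_bounded[OF mollr_C0c[OF \<sigma>]] by blast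
  have mC: "C1c (\<lambda>x::complex^'n. moll \<sigma> x)" unfolding C1c_iff by (intro conjI C2_on_C1[OF C2_on_moll] moll_C0c \<sigma>)
  obtain Cw where Cw: "Cw > 0" "\<And>y. norm y \<le> S \<Longrightarrow> norm (inverse (wtr y)) \<le> Cw"
    using continuous_bounded_cball[OF C1_on_continuous[OF C1_inv]] by metis
  have 0: "mollr \<sigma> (x - y) = 0" if "norm x \<le> R" "\<not> norm y \<le> S" for x y :: "complex^'n"
    by (rule mollr_eq_0[OF \<sigma>]) (use that norm_triangle_ineq2[of y x] in \<open>auto simp: S_def norm_minus_commute\<close>)
  have dz0: "dz j (\<lambda>x. moll \<sigma> x) (x - y) = 0" if "norm x \<le> R" "\<not> norm y \<le> S" for x y :: "complex^'n" and j
  proof -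
    have "open {u::complex^'n. \<sigma> < norm u}" by (intro open_Collect_less continuous_intros)
    moreover have "x - y \<in> {u. \<sigma> < norm u}" using that norm_triangle_ineq2[of y x] by (auto simp: S_def norm_minus_commute)
    ultimately have "dz j (\<lambda>x. moll \<sigma> x) (x - y) = dz j (\<lambda>x. 0) (x - y)"
      by (rule dz_cong_open) (auto intro!: mollr_eq_0 \<sigma>)
    then show ?thesis by simp
  qed
  have b0: "wnorm2 (test_fn \<sigma> x) \<le> M1\<^sup>2 * Cw * V" if "norm x \<le> R" for x
    unfolding V_def
  proof (rule wnorm2_le_measure[OF _ C1c_C0c[OF C1c_test_fn[OF \<sigma>]]])
    fix y
    have e: "(cmod (test_fn \<sigma> x y))\<^sup>2 * wtr y = (mollr \<sigma> (x - y))\<^sup>2 * inverse (wtr y)"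
      unfolding test_fn_def norm_of_real power2_abs using wtr_pos[of y] by (simp add: power2_eq_square field_simps)
    show "(cmod (test_fn \<sigma> x y))\<^sup>2 * wtr y \<le> M1\<^sup>2 * Cw * indicator (cball 0 S) y"
    proof (cases "norm y \<le> S")
      case True
      have "(mollr \<sigma> (x - y))\<^sup>2 * inverse (wtr y) \<le> M1\<^sup>2 * Cw"
        using M1(2)[of "x - y"] Cw(2)[OF True] M1(1) Cw(1) wtr_pos[of y]
        by (intro mult_mono) (auto simp: abs_le_square_iff[symmetric])
      then show ?thesis using True e by simp
    qed (use 0[OF that] e in auto)
  qed
  have bj: "\<exists>C\<ge>0. \<forall>x. norm x \<le> R \<longrightarrow> wnorm2 (dbar j (test_fn \<sigma> x)) \<le> C" for j
  proof -
    obtain M2 where M2: "M2 > 0" "\<And>x. norm (dz j (\<lambda>x::complex^'n. moll \<sigma> x) x) \<le> M2" using C0c_bounded[OF C1c_dz_C0c[OF mC]] by blast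
    obtain M3 where M3: "M3 > 0" "\<And>y. norm y \<le> S \<Longrightarrow> norm (dPhi j y) \<le> M3"
      using continuous_bounded_cball[OF C1_on_continuous[OF C1_dPhi]] by metis
    have "wnorm2 (dbar j (test_fn \<sigma> x)) \<le> (M3 * M1 + M2)\<^sup>2 * Cw * V" if x: "norm x \<le> R" for x
      unfolding V_def
    proof (rule wnorm2_le_measure[OF _ C1c_dbar_C0c[OF C1c_test_fn[OF \<sigma>]]])
      fix y
      define D where "D = dPhi j y * moll \<sigma> (x - y) - dz j (\<lambda>x. moll \<sigma> x) (x - y)"
      have "dz j (test_fn \<sigma> x) y = D * of_real (inverse (wtr y))"
        using dz_test_fn(1)[of j \<sigma> x y] wtr_pos[of y] by (simp add: D_def wt_of_real field_simps)
      then have nb: "cmod (dbar j (test_fn \<sigma> x) y) = cmod D * \<bar>inverse (wtr y)\<bar>"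
        by (simp only: dz_test_fn(2) complex_mod_cnj norm_mult norm_of_real)
      have e: "(cmod (dbar j (test_fn \<sigma> x) y))\<^sup>2 * wtr y = (cmod D)\<^sup>2 * inverse (wtr y)"
        unfolding nb using wtr_pos[of y] by (simp add: power2_eq_square field_simps)
      show "(cmod (dbar j (test_fn \<sigma> x) y))\<^sup>2 * wtr y \<le> (M3 * M1 + M2)\<^sup>2 * Cw * indicator (cball 0 S) y"
      proof (cases "norm y \<le> S")
        case True
        have "cmod D \<le> cmod (dPhi j y) * \<bar>mollr \<sigma> (x - y)\<bar> + cmod (dz j (\<lambda>x. moll \<sigma> x) (x - y))"
          unfolding D_def by (rule order_trans[OF norm_triangle_ineq4]) (simp add: norm_mult)
        also have "\<dots> \<le> M3 * M1 + M2"
          using M3(2)[OF True] M1(2)[of "x - y"] M2(2)[of "x - y"] M3(1) M1(1) by (intro add_mono mult_mono) auto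
        finally have "(cmod D)\<^sup>2 * inverse (wtr y) \<le> (M3 * M1 + M2)\<^sup>2 * Cw"
          using Cw(2)[OF True] Cw(1) wtr_pos[of y] by (intro mult_mono power_mono) auto
        then show ?thesis using True e by simp
      next
        case False
        then have "D = 0" unfolding D_def using 0[OF x False] dz0[OF x False] by simp
        then show ?thesis using e False by auto
      qed
    qed
    then show ?thesis using V Cw(1) by (intro exI[of _ "(M3 * M1 + M2)\<^sup>2 * Cw * V"]) auto
  qed
  then obtain Cj where Cj: "\<And>j. Cj j \<ge> 0" "\<And>j x. norm x \<le> R \<Longrightarrow> wnorm2 (dbar j (test_fn \<sigma> x)) \<le> Cj j" by metis
  show ?thesis
  proof (rule that[of "M1\<^sup>2 * Cw * V + \<mu> * (\<Sum>j\<in>UNIV. Cj j)"])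
    show "0 \<le> M1\<^sup>2 * Cw * V + \<mu> * (\<Sum>j\<in>UNIV. Cj j)"
      using V Cw(1) \<mu> Cj(1) by (auto intro!: add_nonneg_nonneg mult_nonneg_nonneg sum_nonneg)
    fix x :: "complex^'n" assume "norm x \<le> R"
    then show "enorm \<mu> (test_fn \<sigma> x) \<le> M1\<^sup>2 * Cw * V + \<mu> * (\<Sum>j\<in>UNIV. Cj j)"
      unfolding enorm_def using b0 Cj(2) \<mu> by (intro add_mono mult_left_mono sum_mono) auto
  qed
qed

text \<open>Uniform continuity of \<Phi> with tolerance ln 2. The resulting 2 reappears in every
  comparison of a mollified with an unmollified norm.\<close>

lemma eventually_wtr_double:
  "\<forall>\<^sub>F \<sigma> in at_right (0::real). \<forall>u y. norm u \<le> \<sigma> \<longrightarrow> norm (u + y) \<le> R \<longrightarrow> wtr (u + y) \<le> 2 * wtr y"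
proof -
  have "0 < ln (2::real)" by simp
  from eventually_uniform_continuity[OF C1_on_continuous[OF C2_on_C1[OF \<Phi>]] this, of R]
  show ?thesis
proof eventually_elim
  case (elim \<sigma>)
  show ?case
  proof (intro allI impI)
    fix u y :: "complex^'n" assume "norm u \<le> \<sigma>" "norm (u + y) \<le> R"
    then have "norm (\<Phi> (u + y) - \<Phi> y) \<le> ln 2" using elim by blast
    then have "- \<Phi> (u + y) \<le> ln 2 + - \<Phi> y" by (simp add: abs_le_iff)
    then have "exp (- \<Phi> (u + y)) \<le> exp (ln 2 + - \<Phi> y)" by simp
    also have "\<dots> = 2 * exp (- \<Phi> y)" by (simp only: exp_add) simp
    finally show "wtr (u + y) \<le> 2 * wtr y" by (simp only: wtr_def)
  qed
qed
qed

end

lemma cmod_sq_add3_le: "(cmod (a + b - c))\<^sup>2 \<le> 3 * ((cmod a)\<^sup>2 + (cmod b)\<^sup>2 + (cmod c)\<^sup>2)"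
proof -
  have "cmod (a + b - c) \<le> cmod a + cmod b + cmod c"
    using norm_triangle_ineq4[of "a + b" c] norm_triangle_ineq[of a b] by linarith
  then have "(cmod (a + b - c))\<^sup>2 \<le> (cmod a + cmod b + cmod c)\<^sup>2" by (intro power_mono) auto
  also have "\<dots> \<le> 3 * ((cmod a)\<^sup>2 + (cmod b)\<^sup>2 + (cmod c)\<^sup>2)"
    using sum_squares_bound[of "cmod a" "cmod b"] sum_squares_bound[of "cmod a" "cmod c"] sum_squares_bound[of "cmod b" "cmod c"]
    by (simp add: power2_eq_square algebra_simps)
  finally show ?thesis .
qed

lemma sym2_const: "sym2 (\<lambda>x. c)"
proof -
  have "pd v (\<lambda>x. c) = (\<lambda>x. 0)" for v :: 'a by auto
  then show ?thesis by (simp add: sym2_def)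
qed

lemma integral_lin3:
  fixes f1 f2 f3 :: "'a \<Rightarrow> real"
  assumes "integrable M f1" "integrable M f2" "integrable M f3"
  shows "(\<integral>x. 3 * (a * f1 x + b * f2 x + c * f3 x) \<partial>M) = 3 * (a * (\<integral>x. f1 x \<partial>M) + b * (\<integral>x. f2 x \<partial>M) + c * (\<integral>x. f3 x \<partial>M))"
  using assms by simp

context weight begin

text \<open>An almost minimiser of \<open>energy\<close> satisfies the Euler-Lagrange equation up to a small error. The pairing of
  \<open>h - F\<close> with \<open>dbar h = p cnj el\<close> is bounded through the Bochner inequality applied to the mollified and cut off
  \<open>dbar j F\<close>, so no existence theorem for minimisers is needed.\<close>

lemma dbar_estimate_L2:
  assumes h: "C1c h" and p: "C0c p" and el: "\<And>j. continuous_on UNIV (el j)"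
    and hp: "\<And>j x. dbar j h x = p x * cnj (el j x)"
    and levi: "\<And>x \<xi>. (cmod (\<Sum>j\<in>UNIV. el j x * \<xi> j))\<^sup>2 \<le> Re (\<Sum>j\<in>UNIV. \<Sum>k\<in>UNIV. dbar k (dPhi j) x * \<xi> j * cnj (\<xi> k))"
    and lam: "lam > 0" and \<tau>: "\<tau> > 0"
  obtains F where "C1c F" "wnorm2 (\<lambda>x. h x - F x) \<le> 48 * wnorm2 p + \<tau>" "(\<Sum>j\<in>UNIV. wnorm2 (dbar j F)) \<le> lam * (wnorm2 h + 1)"
proof -
  \<comment> \<open>An energy of at most \<open>wnorm2 h + 1\<close> with penalty 1 / lam bounds the
    norms of dbar F by lam times that, the last claim of the lemma.\<close>
  define \<mu> where "\<mu> = 1 / lam"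
  have \<mu>: "\<mu> > 0" using lam by (simp add: \<mu>_def)
  have \<mu>l: "\<mu> * lam = 1" "1 / \<mu> = lam" using lam by (auto simp: \<mu>_def)
  define n where "n = real CARD('n)"
  have n: "n \<ge> 1" unfolding n_def by (simp add: Suc_leI)
  define K0 where "K0 = wnorm2 h + 1"
  have K0: "K0 \<ge> 1" using wnorm2_nonneg by (simp add: K0_def)
  define Kd where "Kd = (\<Sum>j\<in>UNIV. wnorm2 (dbar j h))"
  have Kd: "Kd \<ge> 0" unfolding Kd_def by (intro sum_nonneg wnorm2_nonneg)
  \<comment> \<open>A bound for \<open>enorm \<mu> (h - F)\<close> that is available before F
    is.\<close>
  define K1 where "K1 = 3 * K0 + 2 * \<mu> * Kd"
  have K1: "K1 > 0" unfolding K1_def using K0 Kd \<mu> by (intro add_pos_nonneg mult_nonneg_nonneg) auto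
  obtain Rp where Rp: "Rp > 0" "\<And>x. Rp \<le> norm x \<Longrightarrow> p x = 0" using C0c_support[OF p] by blast
  \<comment> \<open>The conjugate of \<open>dbar j h\<close> times the weight: pairing
    \<open>dbar j F\<close> with \<open>dbar j h\<close> becomes an unweighted integral against a
    fixed continuous function of compact support.\<close>
  define P where "P j x = cnj (p x) * el j x * wt x" for j x
  have P: "C0c (P j)" for j unfolding P_def[abs_def] by (intro C0c_mult1 C0c_cnj p el wt_continuous)
  \<comment> \<open>The plateau of \<open>eventually_uniform_continuity_C0c\<close> for the support
    radius of p.\<close>
  define \<zeta> where "\<zeta> y = max 0 (min 1 (Rp + 4 - norm (y::complex^'n)))" for y
  have \<zeta>c: "C0c \<zeta>" unfolding C0c_def \<zeta>_def[abs_def] by (intro conjI exI[of _ "Rp + 4"] continuous_intros) auto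
  have \<zeta>2: "C0c (\<lambda>y. (\<zeta> y)\<^sup>2 * inverse (wtr y))"
    by (rule C0c_mult1[OF C0c_comp[OF \<zeta>c] C1_on_continuous[OF C1_inv]]) (auto intro!: continuous_intros)
  define C\<zeta> where "C\<zeta> = (\<integral>y. (\<zeta> y)\<^sup>2 * inverse (wtr y) \<partial>lborel)"
  have C\<zeta>: "C\<zeta> \<ge> 0" unfolding C\<zeta>_def by (rule Bochner_Integration.integral_nonneg) (simp add: wtr_pos less_imp_le)
  \<comment> \<open>Parameter of a weighted arithmetic-geometric inequality. Against the coefficient
    12 lam^2 of the Bochner bound it gives \<mu> (s / 2) 12 lam^2 = 1/2, so half of y can be
    absorbed; and 2 \<mu> / s = 24, which doubles to the 48 of the claim.\<close>
  define s where "s = 1 / (12 * lam)"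
  have s: "s > 0" using lam by (simp add: s_def)
  \<comment> \<open>The error budget: each approximation below costs at most e, and the coefficients
    with which these costs enter the final inequality are bounded so that they add up to at most
    \<tau>.\<close>
  define e where "e = \<tau> / (2 * (2 * \<mu> * s + \<mu> + 1))"
  have den: "2 * \<mu> * s + \<mu> + 1 > 0" using \<mu> s by (intro add_pos_pos) auto
  have e: "e > 0" unfolding e_def using den \<tau> by simp
  have e2: "2 * (2 * \<mu> * s + \<mu> + 1) * e = \<tau>" unfolding e_def using den by simp
  \<comment> \<open>3 Rp keeps the cutoff above 1/2 on the support of p. The last summand makes the
    price of the cutoff at most e: 72 is the product of the constant 4 of
    \<open>bochner_cutoff\<close>, the 9 from dbar of the cutoff and the 2 from the doubling of the
    weight, and lam K0 bounds the norms of dbar F.\<close>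
  define R where "R = 3 * Rp + 1 + 72 * lam * K0 / e"
  have Rr: "R \<ge> 1" "R \<ge> 3 * Rp" unfolding R_def using Rp lam K0 e by (auto simp: add_nonneg_nonneg)
  have R72: "72 / R\<^sup>2 * (lam * K0) \<le> e"
  proof -
    have "72 * lam * K0 / e \<le> R" unfolding R_def using Rp by simp
    also have "R \<le> R\<^sup>2" using Rr(1) by (simp add: power2_eq_square)
    finally show ?thesis using e Rr(1) by (simp add: field_simps)
  qed
  \<comment> \<open>Oscillation allowed for P: replacing dbar F by its mollification costs \<omega>
    times the norms of dbar F plus n C\<zeta>.\<close>
  define \<omega> where "\<omega> = e / (lam * K0 + n * C\<zeta> + 1)"
  have \<omega>d: "lam * K0 + n * C\<zeta> + 1 > 0" using lam K0 n C\<zeta> by (intro add_nonneg_pos add_nonneg_nonneg mult_nonneg_nonneg) auto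
  have \<omega>: "\<omega> > 0" "\<omega> * (lam * K0 + n * C\<zeta>) \<le> e"
  proof -
    show "\<omega> > 0" unfolding \<omega>_def using e \<omega>d by simp
    have "\<omega> * (lam * K0 + n * C\<zeta>) \<le> \<omega> * (lam * K0 + n * C\<zeta> + 1)" using \<open>\<omega> > 0\<close> by simp
    also have "\<dots> = e" unfolding \<omega>_def using \<omega>d by simp
    finally show "\<omega> * (lam * K0 + n * C\<zeta>) \<le> e" .
  qed
  \<comment> \<open>A bound for 12 n Dd, the coefficient of the squared oscillation \<omega>' of
    \<open>dPhi j\<close> in the Bochner bound; 12 = 2 * 3 * 2 from \<open>bochner_cutoff\<close>,
    the three-term square and the doubling of the weight.\<close>
  define A where "A = 12 * n * (lam * K0)"
  have A: "A \<ge> 0" unfolding A_def using n lam K0 by auto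
  define \<omega>' where "\<omega>' = min 1 (e / (A + 1))"
  have \<omega>': "\<omega>' > 0" "\<omega>'\<^sup>2 * A \<le> e"
  proof -
    show *: "\<omega>' > 0" unfolding \<omega>'_def using e A by simp
    have "\<omega>' \<le> 1" unfolding \<omega>'_def by simp
    then have "\<omega>'\<^sup>2 \<le> \<omega>'" using * by (simp add: power2_eq_square mult_left_le_one_le)
    then have "\<omega>'\<^sup>2 * A \<le> \<omega>' * A" using A by (rule mult_right_mono)
    also have "\<dots> \<le> e / (A + 1) * (A + 1)" using A e unfolding \<omega>'_def by (intro mult_mono) auto
    also have "\<dots> = e" using A by simp
    finally show "\<omega>'\<^sup>2 * A \<le> e" .
  qed
  have "\<forall>\<^sub>F \<sigma> in at_right (0::real). \<sigma> > 0 \<and> (\<forall>u y. norm u \<le> \<sigma> \<longrightarrow> norm (u + y) \<le> R \<longrightarrow> wtr (u + y) \<le> 2 * wtr y)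
     \<and> (\<forall>j u y. norm u \<le> \<sigma> \<longrightarrow> norm (P j (u + y) - P j y) \<le> \<omega> * max 0 (min 1 (Rp + 4 - norm y)))
     \<and> (\<forall>j u y. norm u \<le> \<sigma> \<longrightarrow> norm (u + y) \<le> R \<longrightarrow> norm (dPhi j (u + y) - dPhi j y) \<le> \<omega>')"
  proof (intro eventually_conj eventually_at_right_less eventually_wtr_double eventually_all_finite)
    fix j
    show "\<forall>\<^sub>F \<sigma> in at_right (0::real). \<forall>u y. norm u \<le> \<sigma> \<longrightarrow> norm (P j (u + y) - P j y) \<le> \<omega> * max 0 (min 1 (Rp + 4 - norm y))"
      by (rule eventually_uniform_continuity_C0c[OF C0c_continuous[OF P] _ \<omega>(1)]) (use Rp in \<open>auto simp: P_def\<close>)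
    show "\<forall>\<^sub>F \<sigma> in at_right (0::real). \<forall>u y. norm u \<le> \<sigma> \<longrightarrow> norm (u + y) \<le> R \<longrightarrow> norm (dPhi j (u + y) - dPhi j y) \<le> \<omega>'"
      by (rule eventually_uniform_continuity[OF C1_on_continuous[OF C1_dPhi] \<omega>'(1)])
  qed
  \<comment> \<open>These conditions involve only the weight, P and R, so the scale is fixed before
    F is known.\<close>
  then obtain \<sigma> where \<sigma>: "\<sigma> > 0" "\<And>u y. norm u \<le> \<sigma> \<Longrightarrow> norm (u + y) \<le> R \<Longrightarrow> wtr (u + y) \<le> 2 * wtr y"
     "\<And>j u y. norm u \<le> \<sigma> \<Longrightarrow> norm (P j (u + y) - P j y) \<le> \<omega> * \<zeta> y"
     "\<And>j u y. norm u \<le> \<sigma> \<Longrightarrow> norm (u + y) \<le> R \<Longrightarrow> norm (dPhi j (u + y) - dPhi j y) \<le> \<omega>'"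
    unfolding \<zeta>_def by (auto dest!: eventually_happens'[OF trivial_limit_at_right_real])
  obtain C2 where C2: "C2 \<ge> 0" "\<And>x. norm x \<le> R \<Longrightarrow> enorm \<mu> (test_fn \<sigma> x) \<le> C2" using enorm_test_fn_bounded[OF \<sigma>(1) \<mu>] by metis
  \<comment> \<open>Normalised by the maximum R^6 of the bump.\<close>
  define ch where "ch x = inverse (R ^ 6) * bump R (x::complex^'n)" for x
  have R0: "R > 0" using Rr by simp
  have chC2: "C2_on UNIV ch" unfolding ch_def[abs_def] by (intro C2_on_mult C2_on_bump C2_on_const) auto
  have ch0: "ch x = 0" if "R \<le> norm x" for x using bump_eq_0[OF R0 that] by (simp add: ch_def)
  have chcc: "C0c ch" unfolding C0c_def using C1_on_continuous[OF C2_on_C1[OF chC2]] ch0 by (auto intro!: exI[of _ R])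
  have chge: "ch x \<ge> 0" for x unfolding ch_def using R0 bump_nonneg[of R x] by simp
  have ch1: "ch x \<le> 1" for x
  proof -
    have "max 0 (R\<^sup>2 - (norm x)\<^sup>2) \<le> R\<^sup>2" by simp
    then have "bump R x \<le> (R\<^sup>2) ^ 3" unfolding bump_def by (intro power_mono) auto
    also have "(R\<^sup>2) ^ 3 = R ^ 6" by (simp flip: power_mult)
    finally show ?thesis unfolding ch_def using R0 by (simp add: field_simps)
  qed
  \<comment> \<open>Rp \<le> R / 3, where the bump keeps at least (8/9)^3 > 1/2 of its
    maximum.\<close>
  have ch2: "ch x \<ge> 1 / 2" if "norm x \<le> Rp" for x
  proof -
    have "(norm x)\<^sup>2 \<le> (R / 3)\<^sup>2" using that Rr(2) by (intro power_mono) auto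
    then have "(8/9) * R\<^sup>2 \<le> R\<^sup>2 - (norm x)\<^sup>2" by (simp add: power_divide)
    then have "(8/9) * R\<^sup>2 \<le> max 0 (R\<^sup>2 - (norm x)\<^sup>2)" by (rule max.coboundedI2)
    then have "((8/9) * R\<^sup>2) ^ 3 \<le> bump R x" unfolding bump_def by (intro power_mono) auto
    moreover have "((8/9) * R\<^sup>2) ^ 3 = (8/9)^3 * R ^ 6" by (simp only: power_mult_distrib flip: power_mult) simp
    ultimately have "(8/9)^3 * R ^ 6 \<le> bump R x" by simp
    moreover have "1/2 * R ^ 6 \<le> (8/9)^3 * R ^ 6" using R0 by (intro mult_right_mono) (auto simp: power3_eq_cube)
    ultimately have "1/2 * R ^ 6 \<le> bump R x" by linarith
    then show ?thesis unfolding ch_def using R0 by (simp add: field_simps)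
  qed
  have chsym: "sym2 (\<lambda>x. complex_of_real (ch x))"
  proof -
    have "sym2 (\<lambda>x. complex_of_real (inverse (R ^ 6)) * complex_of_real (bump R x))"
      by (intro sym2_mult C2_on_const C2_on_of_real C2_on_bump open_UNIV sym2_const sym2_of_real sym2_bump)
    then show ?thesis by (simp add: ch_def[abs_def])
  qed
  define W where "W = (\<integral>x. (ch x)\<^sup>2 * wtr x \<partial>lborel)"
  have Wcc: "C0c (\<lambda>x. (ch x)\<^sup>2 * wtr x)"
    by (rule C0c_mult1[OF C0c_comp[OF chcc] wtr_continuous]) (auto intro!: continuous_intros)
  have W: "W \<ge> 0" unfolding W_def by (rule Bochner_Integration.integral_nonneg) (simp add: wtr_pos less_imp_le)
  \<comment> \<open>The coefficient of \<epsilon>^2 in the Bochner bound, 6 being 2 * 3. It depends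
    on \<sigma> through C2, which is why \<epsilon> is chosen last.\<close>
  define B1 where "B1 = 6 * lam\<^sup>2 * C2 * W"
  have B1: "B1 \<ge> 0" unfolding B1_def using C2 W by auto
  define \<epsilon> where "\<epsilon> = min 1 (min (e / (B1 + 1)) (e / (sqrt K1 + 1)))"
  have sK: "sqrt K1 \<ge> 0" using K1 by simp
  have \<epsilon>: "\<epsilon> > 0" "\<epsilon> \<le> 1" "\<epsilon>\<^sup>2 * B1 \<le> e" "\<epsilon> * sqrt K1 \<le> e"
  proof -
    show *: "\<epsilon> > 0" unfolding \<epsilon>_def using e B1 sK by (auto simp: add_nonneg_pos)
    show **: "\<epsilon> \<le> 1" unfolding \<epsilon>_def by simp
    have "\<epsilon>\<^sup>2 \<le> \<epsilon>" using * ** by (simp add: power2_eq_square mult_left_le_one_le)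
    then have "\<epsilon>\<^sup>2 * B1 \<le> \<epsilon> * B1" using B1 by (rule mult_right_mono)
    also have "\<dots> \<le> e / (B1 + 1) * (B1 + 1)" using B1 e unfolding \<epsilon>_def by (intro mult_mono) auto
    also have "\<dots> = e" using B1 by simp
    finally show "\<epsilon>\<^sup>2 * B1 \<le> e" .
    have "\<epsilon> * sqrt K1 \<le> e / (sqrt K1 + 1) * (sqrt K1 + 1)" using sK e unfolding \<epsilon>_def by (intro mult_mono) auto
    also have "\<dots> = e" using sK by (simp add: add_nonneg_eq_0_iff)
    finally show "\<epsilon> * sqrt K1 \<le> e" .
  qed
  obtain F where F: "C1c F" "energy \<mu> h F \<le> wnorm2 h + \<epsilon>\<^sup>2" "\<And>g. C1c g \<Longrightarrow> (cmod (EL \<mu> h F g))\<^sup>2 \<le> \<epsilon>\<^sup>2 * enorm \<mu> g"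
    using almost_minimiser[OF h \<mu> \<epsilon>(1)] by blast
  define v where "v x = h x - F x" for x
  have v: "C1c v" unfolding v_def[abs_def] by (rule C1c_diff[OF h F(1)])
  define b where "b j = dbar j F" for j
  have b: "C0c (b j)" for j unfolding b_def by (rule C1c_dbar_C0c[OF F(1)])
  define y where "y = wnorm2 v"
  define Dd where "Dd = (\<Sum>j\<in>UNIV. wnorm2 (b j))"
  have Dd0: "Dd \<ge> 0" unfolding Dd_def by (intro sum_nonneg wnorm2_nonneg)
  have y0: "y \<ge> 0" unfolding y_def by (rule wnorm2_nonneg)
  have en: "y + \<mu> * Dd \<le> K0"
    using F(2) \<epsilon>(1,2) power_le_one[of \<epsilon> 2] unfolding energy_def y_def Dd_def b_def v_def K0_def by simp
  have yK: "y \<le> K0" using en \<mu> Dd0 mult_nonneg_nonneg[of \<mu> Dd] by linarith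
  have DK: "Dd \<le> lam * K0"
  proof -
    have "\<mu> * Dd \<le> K0" using en y0 by linarith
    then have "lam * (\<mu> * Dd) \<le> lam * K0" using lam by simp
    then show ?thesis using \<mu>l by (simp add: algebra_simps)
  qed
  have dv: "dbar j v = (\<lambda>x. dbar j h x + - b j x)" for j
    unfolding v_def[abs_def] b_def using dbar_diff[OF C1c_differentiable[OF h] C1c_differentiable[OF F(1)]] by auto
  have qm: "wnorm2 (\<lambda>x. - a x) = wnorm2 a" for a by (simp add: wnorm2_def)
  have env: "enorm \<mu> v \<le> K1"
  proof -
    have "wnorm2 (dbar j v) \<le> 2 * wnorm2 (dbar j h) + 2 * wnorm2 (b j)" for j
      unfolding dv using wnorm2_add_le[OF C1c_dbar_C0c[OF h, of j] C0c_minus[OF b[of j]]] unfolding qm .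
    then have "(\<Sum>j\<in>UNIV. wnorm2 (dbar j v)) \<le> (\<Sum>j\<in>UNIV. 2 * wnorm2 (dbar j h) + 2 * wnorm2 (b j))" by (intro sum_mono)
    also have "\<dots> = 2 * Kd + 2 * Dd" by (simp add: Kd_def Dd_def sum.distrib sum_distrib_left)
    finally have "\<mu> * (\<Sum>j\<in>UNIV. wnorm2 (dbar j v)) \<le> \<mu> * (2 * Kd + 2 * Dd)" using \<mu> by simp
    then show ?thesis unfolding enorm_def K1_def y_def[symmetric] using yK en y0 by (simp add: algebra_simps)
  qed
  define T where "T = (\<Sum>j\<in>UNIV. (\<integral>x. b j x * P j x \<partial>lborel))"
  \<comment> \<open>The Euler-Lagrange form tested with v = h - F itself: y appears, and dbar v =
    dbar h - dbar F splits the penalty into T and Dd, the latter with a favourable sign.\<close>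
  have ELv: "EL \<mu> h F v = of_real y - of_real \<mu> * (T - of_real Dd)"
  proof -
    have ii: "wprod a a = of_real (wnorm2 a)" for a
      unfolding wprod_def wnorm2_def integral_complex_of_real[symmetric]
      by (rule Bochner_Integration.integral_cong) (auto simp: wt_of_real complex_norm_square simp del: of_real_power)
    have "wprod (b j) (dbar j v) = (\<integral>x. b j x * P j x \<partial>lborel) - of_real (wnorm2 (b j))" for j
    proof -
      have "wprod (b j) (dbar j v) = (\<integral>x. b j x * P j x - b j x * cnj (b j x) * wt x \<partial>lborel)"
        unfolding wprod_def dv by (rule Bochner_Integration.integral_cong) (auto simp: hp P_def algebra_simps)
      also have "\<dots> = (\<integral>x. b j x * P j x \<partial>lborel) - wprod (b j) (b j)"
        unfolding wprod_def using wprod_integrable[OF b b] C0c_integrable[OF C0c_mult1[OF b C0c_continuous[OF P]]]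
        by (rule Bochner_Integration.integral_diff[rotated])
      finally show ?thesis unfolding ii .
    qed
    then show ?thesis unfolding EL_def v_def[symmetric] b_def[symmetric] ii y_def T_def Dd_def by (simp add: sum_subtractf)
  qed
  have step1: "y \<le> \<mu> * cmod T + e"
  proof -
    have "(cmod (EL \<mu> h F v))\<^sup>2 \<le> \<epsilon>\<^sup>2 * K1"
      using F(3)[OF v] mult_left_mono[OF env, of "\<epsilon>\<^sup>2"] by simp
    then have "(cmod (EL \<mu> h F v))\<^sup>2 \<le> (\<epsilon> * sqrt K1)\<^sup>2" using K1 by (simp add: power_mult_distrib)
    then have "cmod (EL \<mu> h F v) \<le> \<epsilon> * sqrt K1"
      using \<epsilon>(1) sK by (meson mult_nonneg_nonneg less_imp_le power2_le_imp_le)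
    then have "Re (EL \<mu> h F v) \<le> e" using complex_Re_le_cmod[of "EL \<mu> h F v"] \<epsilon>(4) by linarith
    then have "y - \<mu> * (Re T - Dd) \<le> e" unfolding ELv by simp
    moreover have "\<mu> * Re T \<le> \<mu> * cmod T" using complex_Re_le_cmod \<mu> by (intro mult_left_mono) auto
    moreover have "0 \<le> \<mu> * Dd" using \<mu> Dd0 by simp
    ultimately show ?thesis by (simp add: algebra_simps)
  qed
  define \<beta> where "\<beta> j = conv (b j) (moll \<sigma>)" for j
  have \<beta>2: "C2_on UNIV (\<beta> j)" "sym2 (\<beta> j)" "C0c (\<beta> j)" for j
    unfolding \<beta>_def by (intro C2_on_conv b C2_on_moll sym2_conv sym2_moll conv_moll_C0c \<sigma>)+
  \<comment> \<open>F is only C^1, so the second derivatives are placed on the mollifier: \<beta> j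
    is F convolved with \<open>dbar j\<close> of it, and closedness becomes the symmetry of its
    second derivatives.\<close>
  have \<beta>s: "dbar k (\<beta> j) x = dbar j (\<beta> k) x" for j k x
  proof -
    have e1: "\<beta> j = conv F (dbar j (\<lambda>x. moll \<sigma> x))" for j
      unfolding \<beta>_def b_def using conv_dbar_left[OF F(1) C2_on_C1[OF C2_on_moll]] by auto
    have e2: "dbar k (\<beta> j) x = conv F (dbar k (dbar j (\<lambda>x. moll \<sigma> x))) x" for j k
      unfolding e1 by (rule dbar_conv[OF C1c_C0c[OF F(1)] C1_on_dbar[OF C2_on_moll]])
    have "dbar k (dbar j (\<lambda>x. moll \<sigma> x)) z = dbar j (dbar k (\<lambda>x. moll \<sigma> x)) z" for z :: "complex^'n"
    proof -
      let ?f = "\<lambda>x::complex^'n. moll \<sigma> x"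
      have d: "pd v ?f differentiable at x" for v x
        using C2_on_moll[of \<sigma>, where 'a="complex^'n"] by (auto simp: C2_on_def C1_on_def)
      have d2: "(\<lambda>x. \<i> * pd v ?f x) differentiable at x" for v x by (intro differentiable_mult d) auto
      have e': "pd u (dbar k ?f) x = (pd u (pd (axis k 1) ?f) x + \<i> * pd u (pd (axis k \<i>) ?f) x) / 2" for u k x
      proof -
        have "dbar k ?f = (\<lambda>x. (1/2) * (pd (axis k 1) ?f x + \<i> * pd (axis k \<i>) ?f x))" by (auto simp: dbar_def fun_eq_iff)
        then show ?thesis
          using pd_bounded_linear[OF bounded_linear_mult_right[of "1/2"] differentiable_add[OF d d2], of u "axis k 1" "axis k \<i>"]
          by (simp add: pd_add[OF d d2] pd_bounded_linear[OF bounded_linear_mult_right d])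
      qed
      have sy: "pd u (pd v ?f) x = pd v (pd u ?f) x" for u v x using sym2_moll[of \<sigma>, where 'a="complex^'n"] by (simp add: sym2_def)
      show ?thesis unfolding dbar_def[of k "dbar j ?f"] dbar_def[of j "dbar k ?f"] e'
        by (simp add: sy[of "axis k 1"] sy[of "axis k \<i>"] field_simps)
    qed
    then have "dbar k (dbar j (\<lambda>x::complex^'n. moll \<sigma> x)) = dbar j (dbar k (\<lambda>x. moll \<sigma> x))" by auto
    then show ?thesis unfolding e2 by simp
  qed
  define Tm where "Tm = (\<Sum>j\<in>UNIV. (\<integral>x. \<beta> j x * P j x \<partial>lborel))"
  \<comment> \<open>Mollifying dbar F inside T is paid for by the oscillation of P; the product
    \<zeta> |dbar F| is then split into squares, weighted so that the a priori bound of Dd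
    applies.\<close>
  have step2: "cmod T \<le> cmod Tm + e"
  proof -
    have "cmod ((\<integral>x. \<beta> j x * P j x \<partial>lborel) - (\<integral>x. b j x * P j x \<partial>lborel)) \<le> \<omega> * (wnorm2 (b j) + C\<zeta>)" for j
    proof -
      have "cmod ((\<integral>x. \<beta> j x * P j x \<partial>lborel) - (\<integral>x. b j x * P j x \<partial>lborel)) \<le> (\<integral>y. \<omega> * \<zeta> y * cmod (b j y) \<partial>lborel)"
        unfolding \<beta>_def by (rule conv_pairing[OF b \<sigma>(1) P _ \<sigma>(3)]) (intro continuous_intros C0c_continuous[OF \<zeta>c])
      also have "\<dots> \<le> (\<integral>y. \<omega> * ((cmod (b j y))\<^sup>2 * wtr y + (\<zeta> y)\<^sup>2 * inverse (wtr y)) \<partial>lborel)"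
      proof (rule integral_mono)
        show "integrable lborel (\<lambda>y. \<omega> * \<zeta> y * cmod (b j y))"
          by (intro C0c_integrable C0c_mult1 C0c_mult2[OF \<zeta>c] continuous_intros C0c_continuous[OF b])
        show "integrable lborel (\<lambda>y. \<omega> * ((cmod (b j y))\<^sup>2 * wtr y + (\<zeta> y)\<^sup>2 * inverse (wtr y)))"
          by (intro integrable_mult_right Bochner_Integration.integrable_add wnorm2_integrable b C0c_integrable \<zeta>2)
        fix z
        have w: "sqrt (wtr z) > 0" using wtr_pos by simp
        have "2 * (cmod (b j z) * sqrt (wtr z)) * (\<zeta> z / sqrt (wtr z)) \<le> (cmod (b j z) * sqrt (wtr z))\<^sup>2 + (\<zeta> z / sqrt (wtr z))\<^sup>2"
          by (rule sum_squares_bound)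
        then have "2 * (\<zeta> z * cmod (b j z)) \<le> (cmod (b j z))\<^sup>2 * wtr z + (\<zeta> z)\<^sup>2 * inverse (wtr z)"
          using w wtr_pos[of z] by (simp add: power_mult_distrib power_divide field_simps)
        moreover have "\<zeta> z * cmod (b j z) \<ge> 0" unfolding \<zeta>_def by simp
        ultimately have "\<zeta> z * cmod (b j z) \<le> (cmod (b j z))\<^sup>2 * wtr z + (\<zeta> z)\<^sup>2 * inverse (wtr z)" by linarith
        then show "\<omega> * \<zeta> z * cmod (b j z) \<le> \<omega> * ((cmod (b j z))\<^sup>2 * wtr z + (\<zeta> z)\<^sup>2 * inverse (wtr z))"
          using \<omega>(1) by (simp add: mult.assoc)
      qed
      also have "\<dots> = \<omega> * (wnorm2 (b j) + C\<zeta>)"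
        using wnorm2_integrable[OF b] C0c_integrable[OF \<zeta>2] by (simp add: wnorm2_def C\<zeta>_def)
      finally show ?thesis .
    qed
    then have "(\<Sum>j\<in>UNIV. cmod ((\<integral>x. \<beta> j x * P j x \<partial>lborel) - (\<integral>x. b j x * P j x \<partial>lborel))) \<le> (\<Sum>j\<in>UNIV. \<omega> * (wnorm2 (b j) + C\<zeta>))"
      by (intro sum_mono)
    also have "\<dots> = \<omega> * (Dd + n * C\<zeta>)" by (simp add: sum_distrib_left[symmetric] sum.distrib Dd_def n_def)
    also have "\<dots> \<le> \<omega> * (lam * K0 + n * C\<zeta>)" using DK \<omega>(1) by simp
    also have "\<dots> \<le> e" by (rule \<omega>(2))
    finally have "cmod (Tm - T) \<le> e"
      using norm_sum[of "\<lambda>j. (\<integral>x. \<beta> j x * P j x \<partial>lborel) - (\<integral>x. b j x * P j x \<partial>lborel)" UNIV]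
      by (simp add: Tm_def T_def sum_subtractf)
    then show ?thesis using norm_triangle_ineq4[of Tm "Tm - T"] by simp
  qed
  define Q where "Q = wnorm2 p"
  define B where "B = (\<integral>x. (ch x)\<^sup>2 * (cmod (\<Sum>j\<in>UNIV. el j x * \<beta> j x))\<^sup>2 * wtr x \<partial>lborel)"
  have chcont: "continuous_on UNIV ch" using chcc by (simp add: C0c_def)
  have cel: "C0c (\<lambda>x. \<Sum>j\<in>UNIV. el j x * \<beta> j x)" by (intro C0c_sum C0c_mult2 \<beta>2 el)
  have iB: "integrable lborel (\<lambda>x. (ch x)\<^sup>2 * (cmod (\<Sum>j\<in>UNIV. el j x * \<beta> j x))\<^sup>2 * wtr x)"
    by (intro C0c_integrable C0c_mult1 C0c_mult2 C0c_comp[OF cel, of "\<lambda>z. (cmod z)\<^sup>2"] continuous_intros chcont wtr_continuous) auto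
  \<comment> \<open>Where p is nonzero 2 ch \<ge> 1, so the cutoff can be inserted before the
    arithmetic-geometric inequality with parameter s / 2.\<close>
  have step3: "cmod Tm \<le> s / 2 * B + 2 / s * Q"
  proof -
    have "Tm = (\<integral>x. (\<Sum>j\<in>UNIV. el j x * \<beta> j x) * cnj (p x) * wt x \<partial>lborel)"
    proof -
      have "Tm = (\<integral>x. (\<Sum>j\<in>UNIV. \<beta> j x * P j x) \<partial>lborel)"
        unfolding Tm_def by (rule Bochner_Integration.integral_sum[symmetric]) (intro C0c_integrable C0c_mult1 \<beta>2 C0c_continuous P)
      also have "\<dots> = (\<integral>x. (\<Sum>j\<in>UNIV. el j x * \<beta> j x) * cnj (p x) * wt x \<partial>lborel)"
        by (rule Bochner_Integration.integral_cong) (auto simp: P_def sum_distrib_left sum_distrib_right mult_ac)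
      finally show ?thesis .
    qed
    also have "cmod \<dots> \<le> (\<integral>x. s / 2 * ((ch x)\<^sup>2 * (cmod (\<Sum>j\<in>UNIV. el j x * \<beta> j x))\<^sup>2 * wtr x) + 2 / s * ((cmod (p x))\<^sup>2 * wtr x) \<partial>lborel)"
    proof (rule Bochner_Integration.integral_norm_bound_integral)
      show "integrable lborel (\<lambda>x. (\<Sum>j\<in>UNIV. el j x * \<beta> j x) * cnj (p x) * wt x)" by (intro wprod_integrable cel p)
      show "integrable lborel (\<lambda>x. s / 2 * ((ch x)\<^sup>2 * (cmod (\<Sum>j\<in>UNIV. el j x * \<beta> j x))\<^sup>2 * wtr x) + 2 / s * ((cmod (p x))\<^sup>2 * wtr x))"
        by (intro Bochner_Integration.integrable_add integrable_mult_right iB wnorm2_integrable p)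
      fix x
      define a where "a = cmod (\<Sum>j\<in>UNIV. el j x * \<beta> j x)"
      have a0: "a \<ge> 0" by (simp add: a_def)
      have "a * cmod (p x) \<le> s / 2 * ((ch x)\<^sup>2 * a\<^sup>2) + 2 / s * (cmod (p x))\<^sup>2"
      proof (cases "Rp \<le> norm x")
        case True then show ?thesis using Rp(2) s by simp
      next
        case False
        then have c: "ch x \<ge> 1/2" using ch2 by simp
        have "a * cmod (p x) \<le> 2 * ch x * a * cmod (p x)" using mult_right_mono[of 1 "2 * ch x" "a * cmod (p x)"] c a0 by (simp add: mult.assoc)
        also have "\<dots> = 2 * (sqrt (s/2) * ch x * a) * (cmod (p x) / sqrt (s/2)) " using s by simp
        also have "\<dots> \<le> (sqrt (s/2) * ch x * a)\<^sup>2 + (cmod (p x) / sqrt (s/2))\<^sup>2" by (rule sum_squares_bound)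
        also have "\<dots> = s / 2 * ((ch x)\<^sup>2 * a\<^sup>2) + 2 / s * (cmod (p x))\<^sup>2" using s by (simp add: power_mult_distrib power_divide)
        finally show ?thesis .
      qed
      from mult_right_mono[OF this, of "wtr x"] show "norm ((\<Sum>j\<in>UNIV. el j x * \<beta> j x) * cnj (p x) * wt x) \<le> s / 2 * ((ch x)\<^sup>2 * (cmod (\<Sum>j\<in>UNIV. el j x * \<beta> j x))\<^sup>2 * wtr x) + 2 / s * ((cmod (p x))\<^sup>2 * wtr x)"
        unfolding a_def[symmetric] norm_mult using wtr_pos[of x] by (simp add: a_def[symmetric] wt_of_real algebra_simps)
    qed
    also have "\<dots> = s / 2 * B + 2 / s * Q" using iB wnorm2_integrable[OF p] by (simp add: B_def Q_def wnorm2_def)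
    finally show ?thesis .
  qed
  define n2 where "n2 x = (\<Sum>k\<in>UNIV. (cmod (dbar k (\<lambda>x. of_real (ch x)) x))\<^sup>2)" for x
  have gG: "(ch (u + z))\<^sup>2 * wtr (u + z) \<le> 2 * wtr z" if "norm u \<le> \<sigma>" for u z
  proof (cases "R \<le> norm (u + z)")
    case True then show ?thesis using ch0 wtr_pos[of z] by (simp add: less_imp_le)
  next
    case False
    have "(ch (u + z))\<^sup>2 * wtr (u + z) \<le> 1 * wtr (u + z)"
      using ch1[of "u + z"] chge[of "u + z"] wtr_pos[of "u + z"] by (intro mult_right_mono power_le_one) auto
    also have "\<dots> \<le> 2 * wtr z" using \<sigma>(2)[OF that, of z] False by simp
    finally show ?thesis .
  qed
  have gc: "continuous_on UNIV (\<lambda>x. (ch x)\<^sup>2 * wtr x)" by (intro continuous_intros chcont wtr_continuous)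
  have Gc: "continuous_on UNIV (\<lambda>x. c * wtr x)" for c by (intro continuous_intros wtr_continuous)
  have wc: "(\<integral>x. (ch x)\<^sup>2 * wtr x * (cmod (conv a (moll \<sigma>) x))\<^sup>2 \<partial>lborel) \<le> 2 * wnorm2 a" if "C0c a" for a
  proof -
    have "(\<integral>x. (ch x)\<^sup>2 * wtr x * (cmod (conv a (moll \<sigma>) x))\<^sup>2 \<partial>lborel) \<le> (\<integral>z. 2 * wtr z * (cmod (a z))\<^sup>2 \<partial>lborel)"
      by (rule weighted_conv_le[OF that \<sigma>(1) gc _ Gc gG]) (use wtr_pos in \<open>auto simp: less_imp_le\<close>)
    also have "\<dots> = 2 * wnorm2 a" by (simp add: wnorm2_def algebra_simps flip: integral_mult_right_zero)
    finally show ?thesis .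
  qed
  \<comment> \<open>The norm of dbar of the cutoff is at most 3 / R, its square 9 / R^2, and the
    doubling of the weight gives 18.\<close>
  have step5: "(\<integral>x. n2 x * (\<Sum>j\<in>UNIV. (cmod (\<beta> j x))\<^sup>2) * wtr x \<partial>lborel) \<le> 18 / R\<^sup>2 * Dd"
  proof -
    have dch: "dbar k (\<lambda>x. complex_of_real (ch x)) x = of_real (inverse (R^6)) * - (of_real (3 * (max 0 (R\<^sup>2 - (norm x)\<^sup>2)) ^ 2) * x $ k)" for k x
      unfolding ch_def of_real_mult
      by (subst dbar_cmult[OF differentiable_of_real[OF C1_on_differentiable[OF C2_on_C1[OF C2_on_bump] UNIV_I]]]) (simp only: dbar_bump of_real_mult)
    have n2e: "n2 x = (inverse (R^6) * (3 * (max 0 (R\<^sup>2 - (norm x)\<^sup>2)) ^ 2))\<^sup>2 * (norm x)\<^sup>2" for x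
    proof -
      have "(norm x)\<^sup>2 = (\<Sum>k\<in>UNIV. (cmod (x $ k))\<^sup>2)" by (simp add: norm_vec_def L2_set_def sum_nonneg)
      moreover have "cmod (dbar k (\<lambda>x. complex_of_real (ch x)) x) = \<bar>inverse (R^6) * (3 * (max 0 (R\<^sup>2 - (norm x)\<^sup>2)) ^ 2)\<bar> * cmod (x $ k)" for k
        by (simp only: dch norm_mult norm_minus_cancel norm_of_real abs_mult mult.assoc)
      ultimately show ?thesis unfolding n2_def by (simp only: power_mult_distrib power2_abs sum_distrib_left)
    qed
    have n20: "n2 x = 0" if "R \<le> norm x" for x
    proof -
      have "R\<^sup>2 \<le> (norm x)\<^sup>2" using that R0 by (intro power_mono) auto
      then show ?thesis unfolding n2e by simp
    qed
    have n2le: "n2 x \<le> 9 / R\<^sup>2" if "norm x \<le> R" for x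
    proof -
      have "(max 0 (R\<^sup>2 - (norm x)\<^sup>2)) ^ 2 \<le> (R\<^sup>2) ^ 2" by (intro power_mono) auto
      then have "inverse (R^6) * (3 * (max 0 (R\<^sup>2 - (norm x)\<^sup>2)) ^ 2) \<le> inverse (R^6) * (3 * (R\<^sup>2) ^ 2)"
        using R0 by (intro mult_left_mono) auto
      also have "\<dots> = 3 / R\<^sup>2" using R0 by (simp add: field_simps flip: power_mult power_add)
      finally have "(inverse (R^6) * (3 * (max 0 (R\<^sup>2 - (norm x)\<^sup>2)) ^ 2))\<^sup>2 \<le> (3 / R\<^sup>2)\<^sup>2"
        using R0 by (intro power_mono) auto
      moreover have "(norm x)\<^sup>2 \<le> R\<^sup>2" using that by (intro power_mono) auto
      ultimately have "n2 x \<le> (3 / R\<^sup>2)\<^sup>2 * R\<^sup>2" unfolding n2e by (intro mult_mono) auto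
      also have "\<dots> = 9 / R\<^sup>2" using R0 by (simp add: power2_eq_square field_simps)
      finally show ?thesis .
    qed
    have n2pos: "n2 x \<ge> 0" for x unfolding n2_def by (intro sum_nonneg) auto
    have n2c: "continuous_on UNIV n2" unfolding n2_def[abs_def]
      by (intro continuous_intros continuous_on_dbar C2_on_C1[OF C2_on_of_real[OF open_UNIV chC2]])
    have gG2: "n2 (u + z) * wtr (u + z) \<le> 18 / R\<^sup>2 * wtr z" if "norm u \<le> \<sigma>" for u z
    proof (cases "R \<le> norm (u + z)")
      case True then show ?thesis using n20 wtr_pos[of z] by (simp add: less_imp_le)
    next
      case False
      have "n2 (u + z) * wtr (u + z) \<le> 9 / R\<^sup>2 * (2 * wtr z)"
        using n2le[of "u + z"] \<sigma>(2)[OF that, of z] False wtr_pos[of "u + z"] by (intro mult_mono) auto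
      then show ?thesis by simp
    qed
    have i: "integrable lborel (\<lambda>x. n2 x * wtr x * (cmod (\<beta> j x))\<^sup>2)" for j
      by (intro C0c_integrable C0c_mult2 C0c_comp[OF \<beta>2(3), of "\<lambda>z. (cmod z)\<^sup>2"] continuous_intros n2c wtr_continuous) auto
    have "(\<integral>x. n2 x * (\<Sum>j\<in>UNIV. (cmod (\<beta> j x))\<^sup>2) * wtr x \<partial>lborel) = (\<integral>x. (\<Sum>j\<in>UNIV. n2 x * wtr x * (cmod (\<beta> j x))\<^sup>2) \<partial>lborel)"
      by (simp add: sum_distrib_left algebra_simps)
    also have "\<dots> = (\<Sum>j\<in>UNIV. (\<integral>x. n2 x * wtr x * (cmod (\<beta> j x))\<^sup>2 \<partial>lborel))"
      by (rule Bochner_Integration.integral_sum) (rule i)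
    also have "\<dots> \<le> (\<Sum>j\<in>UNIV. 18 / R\<^sup>2 * wnorm2 (b j))"
    proof (rule sum_mono)
      fix j
      have "(\<integral>x. n2 x * wtr x * (cmod (\<beta> j x))\<^sup>2 \<partial>lborel) \<le> (\<integral>z. 18 / R\<^sup>2 * wtr z * (cmod (b j z))\<^sup>2 \<partial>lborel)"
        unfolding \<beta>_def by (rule weighted_conv_le[OF b \<sigma>(1) _ _ Gc gG2]) (use wtr_pos n2pos in \<open>auto simp: less_imp_le intro!: continuous_intros n2c wtr_continuous\<close>)
      also have "\<dots> = 18 / R\<^sup>2 * wnorm2 (b j)" by (simp add: wnorm2_def algebra_simps flip: integral_mult_right_zero)
      finally show "(\<integral>x. n2 x * wtr x * (cmod (\<beta> j x))\<^sup>2 \<partial>lborel) \<le> 18 / R\<^sup>2 * wnorm2 (b j)" .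
    qed
    finally show ?thesis by (simp add: Dd_def sum_distrib_left)
  qed
  \<comment> \<open>The three groups in the mollified equation are lam times the mollified v, the
    Euler-Lagrange error and the commutators; 3 comes from squaring a sum of three terms and the
    inner 2s from the doubling of the weight.\<close>
  have step4: "(\<integral>x. (ch x)\<^sup>2 * (cmod (\<Sum>j\<in>UNIV. delta j (\<beta> j) x))\<^sup>2 * wtr x \<partial>lborel)
      \<le> 3 * (2 * lam\<^sup>2 * y + lam\<^sup>2 * \<epsilon>\<^sup>2 * C2 * W + \<omega>'\<^sup>2 * n * (2 * Dd))"
  proof -
    define ab where "ab j x = complex_of_real (cmod (b j x))" for j x
    have ab: "C0c (ab j)" for j unfolding ab_def[abs_def] by (rule C0c_comp[OF b]) (auto intro!: continuous_intros)
    have qab: "wnorm2 (ab j) = wnorm2 (b j)" for j by (simp add: wnorm2_def ab_def)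
    define g where "g x = (ch x)\<^sup>2 * wtr x" for x
    have g0: "g x \<ge> 0" for x unfolding g_def using wtr_pos[of x] by (simp add: less_imp_le)
    have gcc: "C0c g" unfolding g_def[abs_def] by (rule Wcc)
    have pw: "(cmod (\<Sum>j\<in>UNIV. delta j (\<beta> j) x))\<^sup>2 \<le> 3 * (lam\<^sup>2 * (cmod (conv v (moll \<sigma>) x))\<^sup>2 + lam\<^sup>2 * \<epsilon>\<^sup>2 * C2 + \<omega>'\<^sup>2 * n * (\<Sum>j\<in>UNIV. (cmod (conv (ab j) (moll \<sigma>) x))\<^sup>2))"
      if x: "norm x \<le> R" for x
    proof -
      define cm where "cm j = conv (\<lambda>y. b j y * dPhi j y) (moll \<sigma>) x - dPhi j x * conv (b j) (moll \<sigma>) x" for j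
      have eq: "(\<Sum>j\<in>UNIV. delta j (\<beta> j) x) = (\<Sum>j\<in>UNIV. cm j) + of_real lam * EL \<mu> h F (test_fn \<sigma> x) - of_real lam * conv v (moll \<sigma>) x"
        using mollified_equation[OF h F(1) \<sigma>(1) \<mu>, of x] \<mu>l(2) unfolding \<beta>_def b_def cm_def v_def[abs_def] by simp
      have cmj: "cmod (cm j) \<le> \<omega>' * cmod (conv (ab j) (moll \<sigma>) x)" for j
        unfolding cm_def ab_def[abs_def]
      proof (rule conv_commutator_bound[OF b C1_on_continuous[OF C1_dPhi] \<sigma>(1)])
        fix z assume "norm (x - z) \<le> \<sigma>"
        then show "cmod (dPhi j z - dPhi j x) \<le> \<omega>'" using \<sigma>(4)[of "x - z" z j] x by (simp add: norm_minus_commute)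
      qed
      have "(cmod (\<Sum>j\<in>UNIV. cm j))\<^sup>2 \<le> n * (\<Sum>j\<in>UNIV. (cmod (cm j))\<^sup>2)"
        using cmod_sum_sq_le[of "\<lambda>j. 1" cm] by (simp add: n_def)
      also have "\<dots> \<le> n * (\<Sum>j\<in>UNIV. (\<omega>' * cmod (conv (ab j) (moll \<sigma>) x))\<^sup>2)"
        using n cmj by (intro mult_left_mono sum_mono power_mono) auto
      also have "\<dots> = \<omega>'\<^sup>2 * n * (\<Sum>j\<in>UNIV. (cmod (conv (ab j) (moll \<sigma>) x))\<^sup>2)"
        by (simp add: power_mult_distrib sum_distrib_left algebra_simps)
      finally have c1: "(cmod (\<Sum>j\<in>UNIV. cm j))\<^sup>2 \<le> \<omega>'\<^sup>2 * n * (\<Sum>j\<in>UNIV. (cmod (conv (ab j) (moll \<sigma>) x))\<^sup>2)" .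
      have "(cmod (EL \<mu> h F (test_fn \<sigma> x)))\<^sup>2 \<le> \<epsilon>\<^sup>2 * C2"
        using F(3)[OF C1c_test_fn[OF \<sigma>(1)], of x] mult_left_mono[OF C2(2)[OF x], of "\<epsilon>\<^sup>2"] by simp
      then have c2: "(cmod (of_real lam * EL \<mu> h F (test_fn \<sigma> x)))\<^sup>2 \<le> lam\<^sup>2 * \<epsilon>\<^sup>2 * C2"
        using mult_left_mono[of "(cmod (EL \<mu> h F (test_fn \<sigma> x)))\<^sup>2" "\<epsilon>\<^sup>2 * C2" "lam\<^sup>2"] by (simp add: norm_mult power_mult_distrib)
      have c3: "(cmod (of_real lam * conv v (moll \<sigma>) x))\<^sup>2 = lam\<^sup>2 * (cmod (conv v (moll \<sigma>) x))\<^sup>2"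
        by (simp add: norm_mult power_mult_distrib)
      have "(cmod (\<Sum>j\<in>UNIV. delta j (\<beta> j) x))\<^sup>2 \<le> 3 * ((cmod (\<Sum>j\<in>UNIV. cm j))\<^sup>2 + (cmod (of_real lam * EL \<mu> h F (test_fn \<sigma> x)))\<^sup>2 + (cmod (of_real lam * conv v (moll \<sigma>) x))\<^sup>2)"
        unfolding eq by (rule cmod_sq_add3_le)
      also have "\<dots> \<le> 3 * (\<omega>'\<^sup>2 * n * (\<Sum>j\<in>UNIV. (cmod (conv (ab j) (moll \<sigma>) x))\<^sup>2) + lam\<^sup>2 * \<epsilon>\<^sup>2 * C2 + lam\<^sup>2 * (cmod (conv v (moll \<sigma>) x))\<^sup>2)"
        by (intro mult_left_mono add_mono c1 c2 eq_refl[OF c3]) simp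
      finally show ?thesis by (simp only: add_ac)
    qed
    have \<beta>1: "C1c (\<beta> j)" for j using \<beta>2 by (auto simp: C1c_iff C2_on_def)
    have dc: "C0c (delta j (\<beta> j))" for j
      unfolding delta_def[abs_def] by (intro C0c_diff C1c_dz_C0c \<beta>1 C0c_mult2 \<beta>2 C1_on_continuous C1_dPhi)
    have i0: "integrable lborel (\<lambda>x. g x * (cmod (conv a (moll \<sigma>) x))\<^sup>2)" if "C0c a" for a
      by (intro C0c_integrable C0c_mult1[OF gcc] continuous_intros C0c_continuous[OF conv_moll_C0c[OF that \<sigma>(1)]])
    have ig: "integrable lborel g" by (rule C0c_integrable[OF gcc])
    have "(\<integral>x. (ch x)\<^sup>2 * (cmod (\<Sum>j\<in>UNIV. delta j (\<beta> j) x))\<^sup>2 * wtr x \<partial>lborel)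
      \<le> (\<integral>x. 3 * (lam\<^sup>2 * (g x * (cmod (conv v (moll \<sigma>) x))\<^sup>2) + lam\<^sup>2 * \<epsilon>\<^sup>2 * C2 * g x + \<omega>'\<^sup>2 * n * (\<Sum>j\<in>UNIV. g x * (cmod (conv (ab j) (moll \<sigma>) x))\<^sup>2)) \<partial>lborel)"
    proof (rule integral_mono)
      show "integrable lborel (\<lambda>x. (ch x)\<^sup>2 * (cmod (\<Sum>j\<in>UNIV. delta j (\<beta> j) x))\<^sup>2 * wtr x)"
        by (intro C0c_integrable C0c_mult1 C0c_mult2 C0c_comp[OF C0c_sum[OF dc], of "\<lambda>z. (cmod z)\<^sup>2"] continuous_intros chcont wtr_continuous) auto
      show "integrable lborel (\<lambda>x. 3 * (lam\<^sup>2 * (g x * (cmod (conv v (moll \<sigma>) x))\<^sup>2) + lam\<^sup>2 * \<epsilon>\<^sup>2 * C2 * g x + \<omega>'\<^sup>2 * n * (\<Sum>j\<in>UNIV. g x * (cmod (conv (ab j) (moll \<sigma>) x))\<^sup>2)))"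
        by (intro integrable_mult_right Bochner_Integration.integrable_add Bochner_Integration.integrable_sum i0 ab ig C1c_C0c[OF v])
      fix x
      show "(ch x)\<^sup>2 * (cmod (\<Sum>j\<in>UNIV. delta j (\<beta> j) x))\<^sup>2 * wtr x \<le> 3 * (lam\<^sup>2 * (g x * (cmod (conv v (moll \<sigma>) x))\<^sup>2) + lam\<^sup>2 * \<epsilon>\<^sup>2 * C2 * g x + \<omega>'\<^sup>2 * n * (\<Sum>j\<in>UNIV. g x * (cmod (conv (ab j) (moll \<sigma>) x))\<^sup>2))"
      proof (cases "norm x \<le> R")
        case True
        have "g x * (cmod (\<Sum>j\<in>UNIV. delta j (\<beta> j) x))\<^sup>2 \<le> g x * (3 * (lam\<^sup>2 * (cmod (conv v (moll \<sigma>) x))\<^sup>2 + lam\<^sup>2 * \<epsilon>\<^sup>2 * C2 + \<omega>'\<^sup>2 * n * (\<Sum>j\<in>UNIV. (cmod (conv (ab j) (moll \<sigma>) x))\<^sup>2)))"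
          by (rule mult_left_mono[OF pw[OF True] g0])
        then show ?thesis unfolding g_def by (simp add: sum_distrib_left algebra_simps)
      next
        case False
        then show ?thesis using ch0[of x] by (simp add: g_def)
      qed
    qed
    also have "\<dots> = 3 * (lam\<^sup>2 * (\<integral>x. g x * (cmod (conv v (moll \<sigma>) x))\<^sup>2 \<partial>lborel) + lam\<^sup>2 * \<epsilon>\<^sup>2 * C2 * W + \<omega>'\<^sup>2 * n * (\<Sum>j\<in>UNIV. (\<integral>x. g x * (cmod (conv (ab j) (moll \<sigma>) x))\<^sup>2 \<partial>lborel)))"
      unfolding integral_lin3[OF i0[OF C1c_C0c[OF v]] ig Bochner_Integration.integrable_sum[OF i0[OF ab]]]
        Bochner_Integration.integral_sum[OF i0[OF ab]] W_def g_def[symmetric] ..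
    also have "\<dots> \<le> 3 * (lam\<^sup>2 * (2 * y) + lam\<^sup>2 * \<epsilon>\<^sup>2 * C2 * W + \<omega>'\<^sup>2 * n * (\<Sum>j\<in>UNIV. 2 * wnorm2 (b j)))"
    proof -
      have a1: "lam\<^sup>2 * (\<integral>x. g x * (cmod (conv v (moll \<sigma>) x))\<^sup>2 \<partial>lborel) \<le> lam\<^sup>2 * (2 * y)"
        unfolding g_def y_def by (rule mult_left_mono[OF wc[OF C1c_C0c[OF v]]]) simp
      have "(\<Sum>j\<in>UNIV. (\<integral>x. g x * (cmod (conv (ab j) (moll \<sigma>) x))\<^sup>2 \<partial>lborel)) \<le> (\<Sum>j\<in>UNIV. 2 * wnorm2 (b j))"
        unfolding g_def by (rule sum_mono) (rule wc[OF ab, unfolded qab])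
      then have a3: "\<omega>'\<^sup>2 * n * (\<Sum>j\<in>UNIV. (\<integral>x. g x * (cmod (conv (ab j) (moll \<sigma>) x))\<^sup>2 \<partial>lborel)) \<le> \<omega>'\<^sup>2 * n * (\<Sum>j\<in>UNIV. 2 * wnorm2 (b j))"
        using n by (intro mult_left_mono) auto
      show ?thesis by (rule mult_left_mono[OF add_mono[OF add_mono[OF a1 order_refl] a3]]) simp
    qed
    also have "(\<Sum>j\<in>UNIV. 2 * wnorm2 (b j)) = 2 * Dd" by (simp add: Dd_def sum_distrib_left)
    finally show ?thesis by (simp add: algebra_simps)
  qed
  have Bb: "B \<le> 12 * lam\<^sup>2 * y + 3 * e"
  proof -
    have "B \<le> 2 * (3 * (2 * lam\<^sup>2 * y + lam\<^sup>2 * \<epsilon>\<^sup>2 * C2 * W + \<omega>'\<^sup>2 * n * (2 * Dd))) + 4 * (18 / R\<^sup>2 * Dd)"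
      using bochner_cutoff[of \<beta> ch el, OF \<beta>2 \<beta>s chC2 chsym el levi] step4 step5 unfolding B_def n2_def by linarith
    also have "\<dots> = 12 * lam\<^sup>2 * y + \<epsilon>\<^sup>2 * B1 + \<omega>'\<^sup>2 * (12 * n * Dd) + 72 / R\<^sup>2 * Dd"
      by (simp add: B1_def algebra_simps)
    also have "\<dots> \<le> 12 * lam\<^sup>2 * y + e + e + e"
    proof (intro add_mono order_refl \<epsilon>(3))
      have "\<omega>'\<^sup>2 * (12 * n * Dd) \<le> \<omega>'\<^sup>2 * A" unfolding A_def using DK n by (intro mult_left_mono) auto
      then show "\<omega>'\<^sup>2 * (12 * n * Dd) \<le> e" using \<omega>'(2) by linarith
      have "72 / R\<^sup>2 * Dd \<le> 72 / R\<^sup>2 * (lam * K0)" using DK by (intro mult_left_mono) auto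
      then show "72 / R\<^sup>2 * Dd \<le> e" using R72 by linarith
    qed
    finally show ?thesis by simp
  qed
  \<comment> \<open>B is bounded in terms of y, which closes the loop: by the choice of s the
    coefficient of y on the right is 1/2.\<close>
  have "y \<le> \<mu> * (s / 2 * (12 * lam\<^sup>2 * y + 3 * e) + 2 / s * Q + e) + e"
  proof -
    have "cmod T \<le> s / 2 * (12 * lam\<^sup>2 * y + 3 * e) + 2 / s * Q + e"
      using step2 step3 mult_left_mono[OF Bb, of "s / 2"] s by linarith
    then have "\<mu> * cmod T \<le> \<mu> * (s / 2 * (12 * lam\<^sup>2 * y + 3 * e) + 2 / s * Q + e)" using \<mu> by simp
    then show ?thesis using step1 by linarith
  qed
  also have "\<dots> = y / 2 + 24 * Q + (3 / 2 * \<mu> * s + \<mu> + 1) * e"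
    unfolding s_def \<mu>_def using lam by (simp add: field_simps power2_eq_square)
  finally have "y \<le> 48 * Q + 2 * ((3 / 2 * \<mu> * s + \<mu> + 1) * e)" by linarith
  also have "\<dots> \<le> 48 * Q + 2 * ((2 * \<mu> * s + \<mu> + 1) * e)" using \<mu> s e by simp
  also have "\<dots> = 48 * Q + \<tau>" using e2 by (simp add: algebra_simps)
  finally have fin: "y \<le> 48 * Q + \<tau>" .
  show ?thesis
    by (rule that[OF F(1)]) (use fin DK in \<open>simp_all add: y_def v_def[abs_def] Q_def Dd_def b_def K0_def\<close>)
qed

end

section \<open>Uniform smallness of dbar F and an approximate mean value property\<close>

lemma conv_moll_close:
  fixes h :: "'a::euclidean_space \<Rightarrow> complex"
  assumes h: "C0c h" and \<sigma>: "\<sigma> > 0" and \<omega>: "\<And>u y. norm u \<le> \<sigma> \<Longrightarrow> cmod (h (u + y) - h y) \<le> \<omega>"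
  shows "cmod (conv h (moll \<sigma>) x - h x) \<le> \<omega>"
proof -
  have i: "integrable lborel (\<lambda>u. h (x - u) * moll \<sigma> u)"
    by (intro C0c_integrable C0c_mult2 moll_C0c \<sigma> continuous_on_translate C0c_continuous[OF h])
  have i2: "integrable lborel (\<lambda>u::'a. h x * moll \<sigma> u)" by (intro integrable_mult_right C0c_integrable moll_C0c \<sigma>)
  have "conv h (moll \<sigma>) x - h x = (\<integral>u. h (x - u) * moll \<sigma> u \<partial>lborel) - (\<integral>u. h x * moll \<sigma> u \<partial>(lborel::'a measure))"
    unfolding conv_flip[OF h moll_continuous] by (simp add: integral_mollr[OF \<sigma>])
  also have "\<dots> = (\<integral>u. h (x - u) * moll \<sigma> u - h x * moll \<sigma> u \<partial>lborel)"
    by (rule Bochner_Integration.integral_diff[OF i i2, symmetric])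
  also have "cmod \<dots> \<le> (\<integral>u. \<omega> * mollr \<sigma> u \<partial>(lborel::'a measure))"
  proof (rule Bochner_Integration.integral_norm_bound_integral)
    show "integrable lborel (\<lambda>u. h (x - u) * moll \<sigma> u - h x * moll \<sigma> u)" by (rule Bochner_Integration.integrable_diff[OF i i2])
    show "integrable lborel (\<lambda>u::'a. \<omega> * mollr \<sigma> u)" by (intro integrable_mult_right C0c_integrable mollr_C0c \<sigma>)
    fix u :: 'a
    show "norm (h (x - u) * moll \<sigma> u - h x * moll \<sigma> u) \<le> \<omega> * mollr \<sigma> u"
    proof (cases "norm u \<le> \<sigma>")
      case True
      have "norm (h (x - u) * moll \<sigma> u - h x * moll \<sigma> u) = cmod (h (x - u) - h x) * mollr \<sigma> u"
        by (simp add: norm_mult mollr_nonneg flip: left_diff_distrib)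
      also have "\<dots> \<le> \<omega> * mollr \<sigma> u" using \<omega>[of "-u" x] True by (intro mult_right_mono) (auto simp: mollr_nonneg)
      finally show ?thesis .
    next
      case False then show ?thesis using mollr_eq_0[OF \<sigma>, of u] by simp
    qed
  qed
  also have "\<dots> = \<omega>" by (simp add: integral_mollr[OF \<sigma>])
  finally show ?thesis .
qed

context weight begin

text \<open>One further mollification of F turns the L^2 bound on dbar F into a pointwise one: at a
  fixed scale the mollifier and the inverse weight are bounded near the ball of radius K, and lam is
  chosen small enough to beat them. The splitting into two squares and the doubling of the weight
  multiply 48 by 4.\<close>

lemma dbar_estimate:
  assumes h: "C1c h" and p: "C0c p" and el: "\<And>j. continuous_on UNIV (el j)"
    and hp: "\<And>j x. dbar j h x = p x * cnj (el j x)"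
    and levi: "\<And>x \<xi>. (cmod (\<Sum>j\<in>UNIV. el j x * \<xi> j))\<^sup>2 \<le> Re (\<Sum>j\<in>UNIV. \<Sum>k\<in>UNIV. dbar k (dPhi j) x * \<xi> j * cnj (\<xi> k))"
    and \<tau>: "\<tau> > 0"
  obtains F where "C1c F" "(\<integral>x. indicator (cball 0 K) x * ((cmod (h x - F x))\<^sup>2 * wtr x) \<partial>lborel) \<le> 192 * wnorm2 p + \<tau>"
    "\<And>x j. norm x \<le> K \<Longrightarrow> cmod (dbar j F x) \<le> \<tau>"
proof -
  \<comment> \<open>A continuous majorant of the indicator of the ball, since
    \<open>weighted_conv_le\<close> takes continuous weights.\<close>
  define \<kappa> where "\<kappa> x = max 0 (min 1 (K + 1 - norm (x::complex^'n)))" for x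
  have \<kappa>c: "C0c \<kappa>" unfolding C0c_def \<kappa>_def[abs_def] by (intro conjI exI[of _ "K + 1"] continuous_intros) auto
  have \<kappa>0: "0 \<le> \<kappa> x" "\<kappa> x \<le> 1" for x by (auto simp: \<kappa>_def)
  define g where "g x = \<kappa> x * wtr x" for x
  have gcc: "C0c g" unfolding g_def[abs_def] by (rule C0c_mult1[OF \<kappa>c wtr_continuous])
  have g0: "g x \<ge> 0" for x unfolding g_def using \<kappa>0 wtr_pos[of x] by simp
  define G where "G = (\<integral>x. g x \<partial>lborel)"
  have G: "G \<ge> 0" unfolding G_def by (rule Bochner_Integration.integral_nonneg) (rule g0)
  define \<omega> where "\<omega> = min 1 (\<tau> / (4 * (G + 1)))"
  have \<omega>: "\<omega> > 0" unfolding \<omega>_def using \<tau> G by simp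
  have \<omega>G: "2 * \<omega>\<^sup>2 * G \<le> \<tau> / 2"
  proof -
    have "\<omega> \<le> 1" unfolding \<omega>_def by simp
    then have "\<omega>\<^sup>2 \<le> \<omega>" using \<omega> by (simp add: power2_eq_square mult_left_le_one_le)
    then have "\<omega>\<^sup>2 * G \<le> \<omega> * G" using G by (rule mult_right_mono)
    also have "\<dots> \<le> \<tau> / (4 * (G + 1)) * (G + 1)" using G \<tau> unfolding \<omega>_def by (intro mult_mono) auto
    also have "\<dots> = \<tau> / 4" using G by (simp add: field_simps)
    finally show ?thesis by simp
  qed
  obtain Rh where Rh: "Rh > 0" "\<And>x. Rh \<le> norm x \<Longrightarrow> h x = 0" using C0c_support[OF C1c_C0c[OF h]] by blast
  have lt1: "\<forall>\<^sub>F \<sigma> in at_right (0::real). \<sigma> < 1"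
    unfolding eventually_at_right_field by (auto intro!: exI[of _ 1])
  have "\<forall>\<^sub>F \<sigma> in at_right (0::real). \<sigma> > 0 \<and> \<sigma> < 1 \<and> (\<forall>u y. norm u \<le> \<sigma> \<longrightarrow> norm (u + y) \<le> K + 1 \<longrightarrow> wtr (u + y) \<le> 2 * wtr y)
     \<and> (\<forall>u y. norm u \<le> \<sigma> \<longrightarrow> norm (h (u + y) - h y) \<le> \<omega> * max 0 (min 1 (Rh + 4 - norm y)))"
    by (intro eventually_conj eventually_at_right_less lt1 eventually_wtr_double
        eventually_uniform_continuity_C0c[OF C0c_continuous[OF C1c_C0c[OF h]] Rh(2) \<omega>])
  then obtain \<sigma> where \<sigma>: "\<sigma> > 0" "\<sigma> < 1" "\<And>u y. norm u \<le> \<sigma> \<Longrightarrow> norm (u + y) \<le> K + 1 \<Longrightarrow> wtr (u + y) \<le> 2 * wtr y"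
     "\<And>u y. norm u \<le> \<sigma> \<Longrightarrow> norm (h (u + y) - h y) \<le> \<omega> * max 0 (min 1 (Rh + 4 - norm y))"
    by (auto dest!: eventually_happens'[OF trivial_limit_at_right_real])
  have h\<omega>: "cmod (h (u + y) - h y) \<le> \<omega>" if "norm u \<le> \<sigma>" for u y
  proof -
    have "\<omega> * max 0 (min 1 (Rh + 4 - norm y)) \<le> \<omega> * 1" using \<omega> by (intro mult_left_mono) auto
    then show ?thesis using \<sigma>(4)[OF that, of y] by simp
  qed
  obtain M1 where M1: "M1 > 0" "\<And>x. norm (mollr \<sigma> (x::complex^'n)) \<le> M1" using C0c_bounded[OF mollr_C0c[OF \<sigma>(1)]] by blast
  obtain Cw where Cw: "Cw > 0" "\<And>y. norm y \<le> K + 1 \<Longrightarrow> norm (inverse (wtr y)) \<le> Cw"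
    using continuous_bounded_cball[OF C1_on_continuous[OF C1_inv]] by metis
  \<comment> \<open>Solves the equation in which the final bound for |dbar F'|^2 equals
    \<tau>^2.\<close>
  define lam where "lam = \<tau>\<^sup>2 / (M1 * Cw * (wnorm2 h + 1))"
  have qh: "wnorm2 h + 1 > 0" using wnorm2_nonneg[of h] by linarith
  have lam: "lam > 0" unfolding lam_def using \<tau> M1 Cw qh by simp
  have lam2: "M1 * Cw * (lam * (wnorm2 h + 1)) = \<tau>\<^sup>2" unfolding lam_def using M1 Cw qh by simp
  obtain F where F: "C1c F" "wnorm2 (\<lambda>x. h x - F x) \<le> 48 * wnorm2 p + \<tau> / 8" "(\<Sum>j\<in>UNIV. wnorm2 (dbar j F)) \<le> lam * (wnorm2 h + 1)"
    using dbar_estimate_L2[OF h p el hp levi lam, of "\<tau> / 8"] \<tau> by auto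
  define v where "v x = h x - F x" for x
  have v: "C0c v" unfolding v_def[abs_def] by (intro C0c_diff C1c_C0c h F)
  define F' where "F' = conv F (moll \<sigma>)"
  have F'1: "C1c F'" unfolding F'_def C1c_iff by (intro conjI C1_on_conv conv_moll_C0c C1c_C0c[OF F(1)] C2_on_C1[OF C2_on_moll] \<sigma>)
  have cv: "conv v (moll \<sigma>) x = conv h (moll \<sigma>) x - F' x" for x
    unfolding F'_def conv_def v_def left_diff_distrib
    by (rule Bochner_Integration.integral_diff; intro conv_integrable C1c_C0c h F moll_continuous)
  have pw: "indicator (cball 0 K) x * ((cmod (h x - F' x))\<^sup>2 * wtr x) \<le> 2 * (g x * (cmod (conv v (moll \<sigma>) x))\<^sup>2) + 2 * \<omega>\<^sup>2 * g x" for x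
  proof (cases "norm x \<le> K")
    case True
    then have gx: "g x = wtr x" by (simp add: g_def \<kappa>_def)
    have "h x - F' x = conv v (moll \<sigma>) x + (h x - conv h (moll \<sigma>) x)" by (simp add: cv)
    then have "(cmod (h x - F' x))\<^sup>2 \<le> 2 * (cmod (conv v (moll \<sigma>) x))\<^sup>2 + 2 * (cmod (h x - conv h (moll \<sigma>) x))\<^sup>2"
      using cmod_sq_add_le by metis
    also have "(cmod (h x - conv h (moll \<sigma>) x))\<^sup>2 \<le> \<omega>\<^sup>2"
      using conv_moll_close[OF C1c_C0c[OF h] \<sigma>(1) h\<omega>, of x] by (intro power_mono) (auto simp: norm_minus_commute)
    finally have "(cmod (h x - F' x))\<^sup>2 \<le> 2 * (cmod (conv v (moll \<sigma>) x))\<^sup>2 + 2 * \<omega>\<^sup>2" by simp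
    from mult_right_mono[OF this, of "wtr x"] show ?thesis using True wtr_pos[of x] by (simp add: gx algebra_simps)
  next
    case False
    then show ?thesis using g0[of x] by simp
  qed
  have icv: "integrable lborel (\<lambda>x. g x * (cmod (conv v (moll \<sigma>) x))\<^sup>2)"
    by (intro C0c_integrable C0c_mult1[OF gcc] continuous_intros C0c_continuous[OF conv_moll_C0c[OF v \<sigma>(1)]])
  have "(\<integral>x. g x * (cmod (conv v (moll \<sigma>) x))\<^sup>2 \<partial>lborel) \<le> (\<integral>y. 2 * wtr y * (cmod (v y))\<^sup>2 \<partial>lborel)"
  proof (rule weighted_conv_le[OF v \<sigma>(1) C0c_continuous[OF gcc] g0])
    show "continuous_on UNIV (\<lambda>y. 2 * wtr y)" by (intro continuous_intros wtr_continuous)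
    fix y u :: "complex^'n" assume u: "norm u \<le> \<sigma>"
    show "g (u + y) \<le> 2 * wtr y"
    proof (cases "norm (u + y) \<le> K + 1")
      case True
      have "g (u + y) \<le> 1 * wtr (u + y)" unfolding g_def using \<kappa>0 wtr_pos[of "u + y"] by (intro mult_right_mono) auto
      then show ?thesis using \<sigma>(3)[OF u True] by simp
    next
      case False
      then show ?thesis using wtr_pos[of y] by (simp add: g_def \<kappa>_def)
    qed
  qed
  also have "\<dots> = 2 * wnorm2 v" by (simp add: wnorm2_def algebra_simps flip: integral_mult_right_zero)
  also have "\<dots> \<le> 96 * wnorm2 p + \<tau> / 4" using F(2) unfolding v_def by simp
  finally have iv: "(\<integral>x. g x * (cmod (conv v (moll \<sigma>) x))\<^sup>2 \<partial>lborel) \<le> 96 * wnorm2 p + \<tau> / 4" .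
  have "(\<integral>x. indicator (cball 0 K) x * ((cmod (h x - F' x))\<^sup>2 * wtr x) \<partial>lborel) \<le> (\<integral>x. 2 * (g x * (cmod (conv v (moll \<sigma>) x))\<^sup>2) + 2 * \<omega>\<^sup>2 * g x \<partial>lborel)"
  proof (rule integral_mono)
    have "integrable lborel (\<lambda>x. indicator (cball 0 K) x *\<^sub>R ((cmod (h x - F' x))\<^sup>2 * wtr x))"
      by (rule borel_integrable_compact[OF compact_cball])
         (intro continuous_on_subset[OF C0c_continuous[OF wnorm2_C0c[OF C0c_diff[OF C1c_C0c[OF h] C1c_C0c[OF F'1]]]]] subset_UNIV)
    then show "integrable lborel (\<lambda>x. indicator (cball 0 K) x * ((cmod (h x - F' x))\<^sup>2 * wtr x))" by simp
    show "integrable lborel (\<lambda>x. 2 * (g x * (cmod (conv v (moll \<sigma>) x))\<^sup>2) + 2 * \<omega>\<^sup>2 * g x)"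
      by (intro Bochner_Integration.integrable_add integrable_mult_right icv C0c_integrable gcc)
  qed (use pw in auto)
  also have "\<dots> = 2 * (\<integral>x. g x * (cmod (conv v (moll \<sigma>) x))\<^sup>2 \<partial>lborel) + 2 * \<omega>\<^sup>2 * G"
    using icv C0c_integrable[OF gcc] by (simp add: G_def)
  also have "\<dots> \<le> 192 * wnorm2 p + \<tau>" using iv \<omega>G by linarith
  finally have res: "(\<integral>x. indicator (cball 0 K) x * ((cmod (h x - F' x))\<^sup>2 * wtr x) \<partial>lborel) \<le> 192 * wnorm2 p + \<tau>" .
  have "cmod (dbar j F' x) \<le> \<tau>" if x: "norm x \<le> K" for x j
  proof -
    define b where "b = dbar j F"
    have b: "C0c b" unfolding b_def by (rule C1c_dbar_C0c[OF F(1)])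
    have e: "dbar j F' x = conv b (moll \<sigma>) x"
      unfolding F'_def b_def using dbar_conv[OF C1c_C0c[OF F(1)] C2_on_C1[OF C2_on_moll]] conv_dbar_left[OF F(1) C2_on_C1[OF C2_on_moll]] by metis
    have m: "(\<lambda>y. (cmod (b y))\<^sup>2 * wtr y) \<in> borel_measurable borel"
      using borel_measurable_integrable[OF wnorm2_integrable[OF b]] by simp
    have "(cmod (conv b (moll \<sigma>) x))\<^sup>2 \<le> (\<integral>u. (cmod (b (x - u)))\<^sup>2 * mollr \<sigma> u \<partial>lborel)"
      by (rule conv_moll_sq_le[OF b \<sigma>(1)])
    also have "\<dots> \<le> (\<integral>u. M1 * Cw * ((cmod (b (x - u)))\<^sup>2 * wtr (x - u)) \<partial>lborel)"
    proof (rule integral_mono)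
      show "integrable lborel (\<lambda>u. (cmod (b (x - u)))\<^sup>2 * mollr \<sigma> u)"
        by (intro C0c_integrable C0c_mult2 mollr_C0c \<sigma> continuous_intros continuous_on_translate C0c_continuous[OF b])
      show "integrable lborel (\<lambda>u. M1 * Cw * ((cmod (b (x - u)))\<^sup>2 * wtr (x - u)))"
        using C0c_integrable[OF C0c_translate[OF wnorm2_C0c[OF b], of x]] by simp
      fix u
      show "(cmod (b (x - u)))\<^sup>2 * mollr \<sigma> u \<le> M1 * Cw * ((cmod (b (x - u)))\<^sup>2 * wtr (x - u))"
      proof (cases "norm u \<le> \<sigma>")
        case True
        then have "norm (x - u) \<le> K + 1" using x \<sigma>(2) norm_triangle_ineq4[of x u] by linarith
        then have "1 \<le> Cw * wtr (x - u)" using Cw(2) wtr_pos[of "x - u"] by (fastforce simp: field_simps)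
        moreover have "mollr \<sigma> u \<le> M1" using M1(2)[of u] by simp
        ultimately have "mollr \<sigma> u * 1 \<le> M1 * (Cw * wtr (x - u))" using M1(1) by (intro mult_mono) auto
        from mult_left_mono[OF this, of "(cmod (b (x - u)))\<^sup>2"] show ?thesis by (simp add: algebra_simps)
      next
        case False then show ?thesis using mollr_eq_0[OF \<sigma>(1), of u] M1 Cw wtr_pos[of "x - u"] by simp
      qed
    qed
    also have "\<dots> = M1 * Cw * wnorm2 b" unfolding wnorm2_def using lborel_integral_reflect[OF m, of x] by simp
    also have "\<dots> \<le> M1 * Cw * (lam * (wnorm2 h + 1))"
    proof -
      have "wnorm2 b \<le> (\<Sum>j\<in>UNIV. wnorm2 (dbar j F))" unfolding b_def by (rule member_le_sum) (auto simp: wnorm2_nonneg)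
      then show ?thesis using F(3) M1(1) Cw(1) by (intro mult_left_mono) auto
    qed
    also have "\<dots> = \<tau>\<^sup>2" by (rule lam2)
    finally show ?thesis unfolding e using \<tau> by (meson less_imp_le power2_le_imp_le)
  qed
  then show ?thesis using that[OF F'1 res] by blast
qed

end

text \<open>The averages M \<theta> over the mollifier shrunk by \<theta> join F z at \<theta> = 0
  to the mollification at \<theta> = 1. Their derivative pairs the mollifier with the differential
  of F along u. For a radial mollifier, integration by parts turns the \<partial> part into a second
  copy of the dbar part, hence the factor 2.\<close>

lemma mean_value_moll:
  fixes F :: "complex^'n::finite \<Rightarrow> complex"
  assumes F: "C1c F" and \<sigma>: "\<sigma> > 0" and \<tau>: "\<And>x j. norm (x - z) \<le> \<sigma> \<Longrightarrow> cmod (dbar j F x) \<le> \<tau>"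
  shows "cmod (conv F (moll \<sigma>) z - F z) \<le> 2 * real CARD('n) * \<sigma> * \<tau>"
proof -
  define M where "M \<theta> = (\<integral>u. moll \<sigma> u * F (z - \<theta> *\<^sub>R u) \<partial>lborel)" for \<theta> :: real
  define D where "D \<theta> u = - (\<Sum>j\<in>UNIV. u $ j * dz j F (z - \<theta> *\<^sub>R u) + cnj (u $ j) * dbar j F (z - \<theta> *\<^sub>R u))" for \<theta> :: real and u
  have dF: "F differentiable at x" for x by (rule C1c_differentiable[OF F])
  obtain l r where lr: "\<And>x::complex^'n. x \<notin> cbox l r \<Longrightarrow> moll \<sigma> x = 0" using C0c_cbox[OF moll_C0c[OF \<sigma>]] by blast
  have cF: "continuous_on UNIV F" "continuous_on UNIV (dz j F)" "continuous_on UNIV (dbar j F)" for j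
    using C1_on_continuous[OF C1c_C1[OF F]] continuous_on_dz[OF C1c_C1[OF F]] continuous_on_dbar[OF C1c_C1[OF F]] by auto
  have cFt: "continuous_on UNIV (\<lambda>u. F (z - \<theta> *\<^sub>R u))" "continuous_on UNIV (\<lambda>u. dz j F (z - \<theta> *\<^sub>R u))" "continuous_on UNIV (\<lambda>u. dbar j F (z - \<theta> *\<^sub>R u))" for \<theta> j
    by (rule continuous_on_compose2[OF cF(1)] continuous_on_compose2[OF cF(2)] continuous_on_compose2[OF cF(3)]; auto intro!: continuous_intros)+
  have cFp: "continuous_on S (\<lambda>p. dz j F (z - fst p *\<^sub>R snd p))" "continuous_on S (\<lambda>p. dbar j F (z - fst p *\<^sub>R snd p))" for S j
    by (rule continuous_on_compose2[OF cF(2)] continuous_on_compose2[OF cF(3)]; auto intro!: continuous_intros)+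
  have contD: "continuous_on UNIV (D \<theta>)" for \<theta> unfolding D_def[abs_def]
    by (intro continuous_intros cFt)
  have Mi: "integrable lborel (\<lambda>u. moll \<sigma> u * g u)" if "continuous_on UNIV g" for g :: "complex^'n \<Rightarrow> complex"
    by (intro C0c_integrable C0c_mult1 moll_C0c \<sigma> that)
  have Mcb: "(\<integral>u. moll \<sigma> u * g u \<partial>lborel) = integral (cbox l r) (\<lambda>u. moll \<sigma> u * g u)" if "continuous_on UNIV g" for g
    by (rule lborel_integral_cbox[OF Mi[OF that]]) (use lr in auto)
  have Me: "M = (\<lambda>\<theta>. integral (cbox l r) (\<lambda>u. moll \<sigma> u * F (z - \<theta> *\<^sub>R u)))" unfolding M_def using Mcb[OF cFt(1)] by auto
  have deriv: "(M has_vector_derivative (\<integral>u. moll \<sigma> u * D \<theta> u \<partial>lborel)) (at \<theta>)" for \<theta>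
  proof -
    have "((\<lambda>\<theta>. integral (cbox l r) (\<lambda>u. moll \<sigma> u * F (z - \<theta> *\<^sub>R u))) has_vector_derivative integral (cbox l r) (\<lambda>u. moll \<sigma> u * D \<theta> u)) (at \<theta> within UNIV)"
    proof (rule leibniz_rule_vector_derivative)
      fix \<theta> u
      have "((\<lambda>\<theta>. F (z + \<theta> *\<^sub>R (- u))) has_vector_derivative pd (- u) F (z + \<theta> *\<^sub>R (- u))) (at \<theta>)"
        by (rule line_has_vector_derivative[OF dF])
      moreover have "pd (- u) F (z + \<theta> *\<^sub>R (- u)) = D \<theta> u"
        unfolding pd_expand[OF dF] D_def by (simp add: sum_negf[symmetric])
      ultimately have "((\<lambda>\<theta>. F (z - \<theta> *\<^sub>R u)) has_vector_derivative D \<theta> u) (at \<theta>)" by simp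
      then show "((\<lambda>\<theta>. moll \<sigma> u * F (z - \<theta> *\<^sub>R u)) has_vector_derivative moll \<sigma> u * D \<theta> u) (at \<theta> within UNIV)"
        by (rule has_vector_derivative_mult_right)
    next
      show "(\<lambda>u. moll \<sigma> u * F (z - \<theta> *\<^sub>R u)) integrable_on cbox l r" for \<theta>
        by (rule integrable_continuous) (intro continuous_intros continuous_on_subset[OF moll_continuous] continuous_on_subset[OF cFt(1)] subset_UNIV)
      show "continuous_on (UNIV \<times> cbox l r) (\<lambda>(\<theta>, u). moll \<sigma> u * D \<theta> u)"
        unfolding split_def D_def
        by (intro continuous_intros continuous_on_compose2[OF moll_continuous] cFp) auto
    qed auto
    then show ?thesis unfolding Me Mcb[OF contD] by simp
  qed
  have bound: "norm (\<integral>u. moll \<sigma> u * D \<theta> u \<partial>lborel) \<le> 2 * real CARD('n) * \<sigma> * \<tau>" if \<theta>: "0 < \<theta>" "\<theta> < 1" for \<theta>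
  proof -
    have "(\<integral>u. moll \<sigma> u * (u $ j * dz j F (z - \<theta> *\<^sub>R u)) \<partial>lborel) = (\<integral>u. moll \<sigma> u * (cnj (u $ j) * dbar j F (z - \<theta> *\<^sub>R u)) \<partial>lborel)" for j
    proof -
      define G where "G u = F (z - \<theta> *\<^sub>R u)" for u
      have Ge: "G = (\<lambda>u. F (z + (- \<theta>) *\<^sub>R u))" by (simp add: G_def[abs_def])
      have pG: "pd w G u = - \<theta> *\<^sub>R pd w F (z - \<theta> *\<^sub>R u)" for w u
        unfolding Ge using pd_shift[OF dF, of w z "- \<theta>" u] by simp
      have G1: "C1_on UNIV G"
      proof -
        have "continuous_on UNIV (\<lambda>u. - \<theta> *\<^sub>R pd w F (z - \<theta> *\<^sub>R u))" for w
          by (intro continuous_intros continuous_on_compose2[OF C0c_continuous[OF C1c_pd_C0c[OF F]]]) auto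
        then have "continuous_on UNIV (pd w G)" for w using pG by (subst continuous_on_cong[OF refl pG]) auto
        moreover have "G differentiable at u" for u unfolding Ge by (rule differentiable_shift[OF dF])
        ultimately show ?thesis by (simp add: C1_on_def)
      qed
      have dG: "dz j G u = - of_real \<theta> * dz j F (z - \<theta> *\<^sub>R u)" "dbar j G u = - of_real \<theta> * dbar j F (z - \<theta> *\<^sub>R u)" for u
        unfolding dz_def dbar_def pG by (simp_all add: scaleR_conv_of_real algebra_simps)
      let ?c = "\<lambda>u::complex^'n. u $ j" and ?d = "\<lambda>u::complex^'n. cnj (u $ j)"
      have hc: "(?c has_derivative (\<lambda>v. v $ j)) (at u)" "(?d has_derivative (\<lambda>v. cnj (v $ j))) (at u)" for u
        by (rule bounded_linear_imp_has_derivative, rule bounded_linear_vec_nth)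
           (rule bounded_linear_imp_has_derivative, rule bounded_linear_compose[OF bounded_linear_cnj bounded_linear_vec_nth])
      have pc: "pd w ?c = (\<lambda>u. w $ j)" "pd w ?d = (\<lambda>u. cnj (w $ j))" for w using pd_eqI[OF hc(1)] pd_eqI[OF hc(2)] by auto
      have c1: "C1_on UNIV ?c" "C1_on UNIV ?d" unfolding C1_on_def pc differentiable_def using hc(1) hc(2) by (blast intro: continuous_on_const)+
      have mC: "C1c (\<lambda>u::complex^'n. moll \<sigma> u)" unfolding C1c_iff by (intro conjI C2_on_C1[OF C2_on_moll] moll_C0c \<sigma>)
      have dd: "(\<lambda>u::complex^'n. moll \<sigma> u) differentiable at u" "?c differentiable at u" "?d differentiable at u" for u
        using C1c_differentiable[OF mC] c1 by (auto simp: C1_on_def)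
      have e1: "dz j (\<lambda>u. moll \<sigma> u * u $ j) u = moll \<sigma> u + u $ j * dz j (\<lambda>u. moll \<sigma> u) u" for u
        by (subst dz_mult[OF dd(1,2)]) (simp add: dz_def[of j ?c] pc)
      have e2: "dbar j (\<lambda>u. moll \<sigma> u * cnj (u $ j)) u = moll \<sigma> u + cnj (u $ j) * dbar j (\<lambda>u. moll \<sigma> u) u" for u
        by (subst dbar_mult[OF dd(1,3)]) (simp add: dbar_def[of j ?d] pc)
      \<comment> \<open>Radial symmetry enters here: after integration by parts both integrals
        contain this one derivative of the mollifier times a coordinate.\<close>
      have eq: "dz j (\<lambda>u. moll \<sigma> u * u $ j) u = dbar j (\<lambda>u. moll \<sigma> u * cnj (u $ j)) u" for u
        unfolding e1 e2 moll_rotation ..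
      have "(\<integral>u. (moll \<sigma> u * u $ j) * dz j G u \<partial>lborel) = (\<integral>u. (moll \<sigma> u * cnj (u $ j)) * dbar j G u \<partial>lborel)"
        using integral_by_parts_dz[OF C1c_mult1[OF mC c1(1)] G1, of j] integral_by_parts_dbar[OF C1c_mult1[OF mC c1(2)] G1, of j]
        unfolding eq by simp
      then have "of_real \<theta> * (\<integral>u. moll \<sigma> u * (u $ j * dz j F (z - \<theta> *\<^sub>R u)) \<partial>lborel) = of_real \<theta> * (\<integral>u. moll \<sigma> u * (cnj (u $ j) * dbar j F (z - \<theta> *\<^sub>R u)) \<partial>lborel)"
        unfolding dG by (simp add: mult_ac flip: integral_mult_right_zero)
      then show ?thesis using \<theta> by simp
    qed
    note swap = this
    have i1: "integrable lborel (\<lambda>u. moll \<sigma> u * (u $ j * dz j F (z - \<theta> *\<^sub>R u)))" "integrable lborel (\<lambda>u. moll \<sigma> u * (cnj (u $ j) * dbar j F (z - \<theta> *\<^sub>R u)))" for j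
      by (intro Mi continuous_intros cFt)+
    have "(\<integral>u. moll \<sigma> u * D \<theta> u \<partial>lborel) = (\<integral>u. - (\<Sum>j\<in>UNIV. moll \<sigma> u * (u $ j * dz j F (z - \<theta> *\<^sub>R u)) + moll \<sigma> u * (cnj (u $ j) * dbar j F (z - \<theta> *\<^sub>R u))) \<partial>lborel)"
      by (rule Bochner_Integration.integral_cong) (auto simp: D_def sum_distrib_left algebra_simps)
    also have "\<dots> = - (\<Sum>j\<in>UNIV. (\<integral>u. moll \<sigma> u * (u $ j * dz j F (z - \<theta> *\<^sub>R u)) \<partial>lborel) + (\<integral>u. moll \<sigma> u * (cnj (u $ j) * dbar j F (z - \<theta> *\<^sub>R u)) \<partial>lborel))"
      using i1 by (simp add: Bochner_Integration.integral_sum)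
    also have "\<dots> = - (\<Sum>j\<in>UNIV. 2 * (\<integral>u. moll \<sigma> u * (cnj (u $ j) * dbar j F (z - \<theta> *\<^sub>R u)) \<partial>lborel))"
      unfolding swap by (simp only: mult_2)
    also have "norm \<dots> \<le> (\<Sum>j\<in>(UNIV::'n set). 2 * (\<sigma> * \<tau>))"
      unfolding norm_minus_cancel
    proof (rule sum_norm_le)
      fix j :: 'n
      have "cmod (\<integral>u. moll \<sigma> u * (cnj (u $ j) * dbar j F (z - \<theta> *\<^sub>R u)) \<partial>lborel) \<le> (\<integral>u. \<sigma> * \<tau> * mollr \<sigma> u \<partial>(lborel::(complex^'n) measure))"
      proof (rule Bochner_Integration.integral_norm_bound_integral[OF i1(2)])
        show "integrable lborel (\<lambda>u::complex^'n. \<sigma> * \<tau> * mollr \<sigma> u)" by (intro integrable_mult_right C0c_integrable mollr_C0c \<sigma>)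
        fix u :: "complex^'n"
        show "norm (moll \<sigma> u * (cnj (u $ j) * dbar j F (z - \<theta> *\<^sub>R u))) \<le> \<sigma> * \<tau> * mollr \<sigma> u"
        proof (cases "norm u \<le> \<sigma>")
          case True
          have "norm (u $ j) \<le> \<sigma>" using True Finite_Cartesian_Product.norm_nth_le order_trans by blast
          moreover have "cmod (dbar j F (z - \<theta> *\<^sub>R u)) \<le> \<tau>"
          proof (rule \<tau>)
            have "\<theta> * norm u \<le> 1 * \<sigma>" using True \<theta> by (intro mult_mono) auto
            then show "norm (z - \<theta> *\<^sub>R u - z) \<le> \<sigma>" using \<theta> by simp
          qed
          ultimately have "norm (u $ j) * cmod (dbar j F (z - \<theta> *\<^sub>R u)) \<le> \<sigma> * \<tau>" using \<sigma> by (intro mult_mono) auto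
          from mult_right_mono[OF this mollr_nonneg[of \<sigma> u]] show ?thesis by (simp add: norm_mult mollr_nonneg mult_ac)
        next
          case False then show ?thesis using mollr_eq_0[OF \<sigma>, of u] by simp
        qed
      qed
      also have "\<dots> = \<sigma> * \<tau>" by (simp add: integral_mollr[OF \<sigma>])
      finally show "norm (2 * (\<integral>u. moll \<sigma> u * (cnj (u $ j) * dbar j F (z - \<theta> *\<^sub>R u)) \<partial>lborel)) \<le> 2 * (\<sigma> * \<tau>)"
        by (simp add: norm_mult)
    qed
    finally show ?thesis by (simp add: algebra_simps)
  qed
  have "norm (M 1 - M 0) \<le> 2 * real CARD('n) * \<sigma> * \<tau> * 1 - 2 * real CARD('n) * \<sigma> * \<tau> * 0"
  proof (rule differentiable_bound_general[where f' = "\<lambda>\<theta>. \<integral>u. moll \<sigma> u * D \<theta> u \<partial>lborel" and \<phi>' = "\<lambda>_. 2 * real CARD('n) * \<sigma> * \<tau>"])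
    show "continuous_on {0..1} M" using deriv by (meson continuous_at_imp_continuous_on has_vector_derivative_continuous)
    show "continuous_on {0..1} (\<lambda>x. 2 * real CARD('n) * \<sigma> * \<tau> * x)" by (intro continuous_intros)
    fix x :: real assume "0 < x" "x < 1"
    then show "norm (\<integral>u. moll \<sigma> u * D x u \<partial>lborel) \<le> 2 * real CARD('n) * \<sigma> * \<tau>" by (rule bound)
    show "((\<lambda>x. 2 * real CARD('n) * \<sigma> * \<tau> * x) has_vector_derivative 2 * real CARD('n) * \<sigma> * \<tau>) (at x)"
      unfolding has_real_derivative_iff_has_vector_derivative[symmetric] by (auto intro!: derivative_eq_intros)
  qed (use deriv in auto)
  moreover have "M 0 = F z" unfolding M_def by (simp add: integral_mollr[OF \<sigma>])
  moreover have "M 1 = conv F (moll \<sigma>) z" unfolding M_def conv_flip[OF C1c_C0c[OF F] moll_continuous] by (simp add: mult.commute)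
  ultimately show ?thesis by simp
qed

section \<open>Levi forms and sublevel sets\<close>

text \<open>Four times the Levi form of \<open>f\<close> at \<open>x\<close> in direction \<open>\<xi>\<close>, as the Laplacian along the complex line through \<open>x\<close>.\<close>

definition lap :: "(complex^'n::finite \<Rightarrow> real) \<Rightarrow> complex^'n \<Rightarrow> complex^'n \<Rightarrow> real" where
  "lap f x \<xi> = pd \<xi> (pd \<xi> f) x + pd (\<i> *s \<xi>) (pd (\<i> *s \<xi>) f) x"

lemma
  fixes g :: "complex^'n::finite \<Rightarrow> complex"
  assumes "g differentiable at x"
  shows sum_dz: "(\<Sum>j\<in>UNIV. v $ j * dz j g x) = (pd v g x - \<i> * pd (\<i> *s v) g x) / 2"
    and sum_dbar: "(\<Sum>k\<in>UNIV. cnj (v $ k) * dbar k g x) = (pd v g x + \<i> * pd (\<i> *s v) g x) / 2"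
proof -
  have 1: "pd v g x = (\<Sum>j\<in>UNIV. v $ j * dz j g x) + (\<Sum>k\<in>UNIV. cnj (v $ k) * dbar k g x)"
    unfolding pd_expand[OF assms] by (simp add: sum.distrib)
  have 2: "pd (\<i> *s v) g x = \<i> * (\<Sum>j\<in>UNIV. v $ j * dz j g x) - \<i> * (\<Sum>k\<in>UNIV. cnj (v $ k) * dbar k g x)"
    unfolding pd_expand[OF assms] by (simp add: sum.distrib sum_subtractf sum_distrib_left sum_negf mult.assoc)
  show "(\<Sum>j\<in>UNIV. v $ j * dz j g x) = (pd v g x - \<i> * pd (\<i> *s v) g x) / 2"
    "(\<Sum>k\<in>UNIV. cnj (v $ k) * dbar k g x) = (pd v g x + \<i> * pd (\<i> *s v) g x) / 2"
    unfolding 1 2 by (simp_all add: algebra_simps)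
qed

lemma pd_of_real: "f differentiable at x \<Longrightarrow> pd v (\<lambda>x. complex_of_real (f x)) x = of_real (pd v f x)"
  by (rule pd_bounded_linear[OF bounded_linear_of_real])

lemma dz_sum_norm:
  fixes f :: "complex^'n::finite \<Rightarrow> real"
  assumes "f differentiable at x"
  shows "(cmod (\<Sum>j\<in>UNIV. dz j (\<lambda>x. complex_of_real (f x)) x * v $ j))\<^sup>2 = ((pd v f x)\<^sup>2 + (pd (\<i> *s v) f x)\<^sup>2) / 4"
proof -
  have "(\<Sum>j\<in>UNIV. dz j (\<lambda>x. complex_of_real (f x)) x * v $ j) = (of_real (pd v f x) - \<i> * of_real (pd (\<i> *s v) f x)) / 2"
    using sum_dz[OF differentiable_of_real[OF assms], of v] by (simp add: pd_of_real[OF assms] mult.commute)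
  note e = this
  show ?thesis unfolding e by (simp add: cmod_power2 power_divide)
qed

text \<open>Contraction of \<partial>f with v is half of the derivative along v minus \<i> times the
  one along \<i> v. The conjugate contraction of its dbar leaves the second derivatives along v and
  \<i> v in the real part, the mixed ones in the imaginary part.\<close>

lemma levi_lap:
  fixes f :: "complex^'n::finite \<Rightarrow> real"
  assumes f: "C2_on UNIV f"
  shows "Re (\<Sum>j\<in>UNIV. \<Sum>k\<in>UNIV. dbar k (dz j (\<lambda>x. complex_of_real (f x))) x * \<xi> j * cnj (\<xi> k)) = lap f x (vec_lambda \<xi>) / 4"
proof -
  define v where "v = vec_lambda \<xi>"
  let ?fc = "\<lambda>x. complex_of_real (f x)"
  have fc: "C2_on UNIV ?fc" by (rule C2_on_of_real[OF open_UNIV f])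
  have d: "f differentiable at y" "pd u f differentiable at y" "?fc differentiable at y" "dz j ?fc differentiable at y" for y u j
    using f fc C1_on_dz[OF fc] by (auto simp: C2_on_def C1_on_def)
  define g where "g y = (\<Sum>j\<in>UNIV. v $ j * dz j ?fc y)" for y
  have gd: "g differentiable at y" for y unfolding g_def[abs_def] by (simp add: d)
  have ge: "g = (\<lambda>y. (1/2) * (of_real (pd v f y) - \<i> * of_real (pd (\<i> *s v) f y)))"
    unfolding g_def using sum_dz[OF d(3), of v] by (auto simp: pd_of_real d)
  have di: "(\<lambda>y. \<i> * complex_of_real (pd u f y)) differentiable at y" for u y
    by (intro differentiable_mult differentiable_of_real d) auto
  have pg: "pd u g y = (of_real (pd u (pd v f) y) - \<i> * of_real (pd u (pd (\<i> *s v) f) y)) / 2" for u y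
    unfolding ge
    using pd_bounded_linear[OF bounded_linear_mult_right[of "1/2"] differentiable_diff[OF differentiable_of_real[OF d(2)] di], of u v "\<i> *s v"]
    by (simp add: pd_diff[OF differentiable_of_real[OF d(2)] di] pd_bounded_linear[OF bounded_linear_mult_right differentiable_of_real[OF d(2)]] pd_of_real[OF d(2)])
  have "(\<Sum>j\<in>UNIV. \<Sum>k\<in>UNIV. dbar k (dz j ?fc) x * \<xi> j * cnj (\<xi> k)) = (\<Sum>k\<in>UNIV. cnj (v $ k) * dbar k g x)"
  proof -
    have "dbar k g x = (\<Sum>j\<in>UNIV. v $ j * dbar k (dz j ?fc) x)" for k
      unfolding g_def[abs_def] by (subst dbar_sum) (auto intro!: differentiable_mult d simp: dbar_cmult d)
    then show ?thesis by (subst sum.swap) (simp add: v_def sum_distrib_left mult_ac)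
  qed
  also have "\<dots> = (pd v g x + \<i> * pd (\<i> *s v) g x) / 2" by (rule sum_dbar[OF gd])
  finally have E: "(\<Sum>j\<in>UNIV. \<Sum>k\<in>UNIV. dbar k (dz j ?fc) x * \<xi> j * cnj (\<xi> k)) = (pd v g x + \<i> * pd (\<i> *s v) g x) / 2" .
  show ?thesis unfolding E pg by (simp add: lap_def v_def[symmetric])
qed

lemma lap_cong:
  assumes "open S" "x \<in> S" "\<And>y. y \<in> S \<Longrightarrow> f y = g y"
  shows "lap f x \<xi> = lap g x \<xi>"
proof -
  have "pd v f y = pd v g y" if "y \<in> S" for v y by (rule pd_cong_open[OF assms(1) that assms(3)])
  then have "pd u (pd v f) x = pd u (pd v g) x" for u v by (rule pd_cong_open[OF assms(1,2)])
  then show ?thesis by (simp add: lap_def)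
qed

lemma lap_add:
  assumes S: "open S" "x \<in> S" and f: "C2_on S f" and g: "C2_on S g"
  shows "lap (\<lambda>x. f x + g x) x \<xi> = lap f x \<xi> + lap g x \<xi>"
proof -
  have d: "f differentiable at y" "g differentiable at y" "pd u f differentiable at y" "pd u g differentiable at y" if "y \<in> S" for y u
    using f g that by (auto simp: C2_on_def C1_on_def)
  have "pd u (pd v (\<lambda>x. f x + g x)) x = pd u (\<lambda>x. pd v f x + pd v g x) x" for u v
    by (rule pd_cong_open[OF S]) (rule pd_add[OF d(1,2)])
  then show ?thesis unfolding lap_def by (simp add: pd_add[OF d(3,4)] S)
qed

lemma lap_cmult:
  assumes S: "open S" "x \<in> S" and f: "C2_on S f"
  shows "lap (\<lambda>x. c * f x) x \<xi> = c * lap f x \<xi>"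
proof -
  have d: "f differentiable at y" "pd u f differentiable at y" if "y \<in> S" for y u
    using f that by (auto simp: C2_on_def C1_on_def)
  have "pd u (pd v (\<lambda>x. c * f x)) x = pd u (\<lambda>x. c * pd v f x) x" for u v
    by (rule pd_cong_open[OF S]) (rule pd_bounded_linear[OF bounded_linear_mult_right d(1)])
  then show ?thesis unfolding lap_def
    by (simp add: pd_bounded_linear[OF bounded_linear_mult_right d(2)] S algebra_simps)
qed

lemma lap_const: "lap (\<lambda>x. c) x \<xi> = 0"
proof -
  have "pd v (\<lambda>x::complex^'a. c) = (\<lambda>x. 0)" for v by auto
  then show ?thesis by (simp add: lap_def)
qed

lemma lap_compose:
  assumes S: "open S" "x \<in> S" and f: "C2_on S f"
    and m: "\<And>y. y \<in> S \<Longrightarrow> (m has_real_derivative m' (f y)) (at (f y))" "\<And>y. y \<in> S \<Longrightarrow> (m' has_real_derivative m'' (f y)) (at (f y))"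
  shows "lap (\<lambda>x. m (f x)) x \<xi> = m' (f x) * lap f x \<xi> + m'' (f x) * ((pd \<xi> f x)\<^sup>2 + (pd (\<i> *s \<xi>) f x)\<^sup>2)"
proof -
  have d: "f differentiable at y" "pd u f differentiable at y" if "y \<in> S" for y u
    using f that by (auto simp: C2_on_def C1_on_def)
  have dm: "(\<lambda>x. m' (f x)) differentiable at x"
    using has_derivative_compose[OF has_derivative_pd[OF d(1)[OF S(2)]], of m' "(*) (m'' (f x))"] m(2)[OF S(2)]
    by (auto simp: has_field_derivative_def differentiable_def)
  have "pd u (pd v (\<lambda>x. m (f x))) x = pd u (\<lambda>x. m' (f x) * pd v f x) x" for u v
    by (rule pd_cong_open[OF S]) (rule pd_compose[OF d(1) m(1)])
  then have "pd u (pd v (\<lambda>x. m (f x))) x = m' (f x) * pd u (pd v f) x + m'' (f x) * pd u f x * pd v f x" for u v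
    by (simp add: pd_mult[OF dm d(2)] S pd_compose[OF d(1) m(2)])
  then show ?thesis unfolding lap_def by (simp add: power2_eq_square algebra_simps)
qed

text \<open>A \<open>C\<^sup>2\<close> convex regularisation of \<open>max 0\<close>: the second antiderivative of the hat function on \<open>[-1, 1]\<close>.\<close>

definition "soft_pos y = ((max 0 (y + 1)) ^ 3 - 2 * (max 0 y) ^ 3 + (max 0 (y - 1)) ^ 3) / (6::real)"
definition "soft_pos' y = ((max 0 (y + 1)) ^ 2 - 2 * (max 0 y) ^ 2 + (max 0 (y - 1)) ^ 2) / (2::real)"
definition "soft_pos'' y = (max 0 (y + 1)) - 2 * (max 0 y) + (max 0 (y - 1)) " for y :: real

lemma tpow_chain: "((\<lambda>y::real. (max 0 (y + c)) ^ 3) has_real_derivative 3 * (max 0 (y + c)) ^ 2) (at y)"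
  "((\<lambda>y::real. (max 0 (y + c)) ^ 2) has_real_derivative 2 * (max 0 (y + c))) (at y)"
proof -
  have 2: "((\<lambda>y::real. (max 0 y) ^ 2) has_real_derivative 2 * max 0 y) (at y)" for y
    using tpow_deriv[of 1 y] by (simp add: numeral_2_eq_2)
  show "((\<lambda>y::real. (max 0 (y + c)) ^ 3) has_real_derivative 3 * (max 0 (y + c)) ^ 2) (at y)"
    using DERIV_shift[of "\<lambda>y. (max 0 y) ^ 3" _ y c] tpow_derivs(1)[of "y + c"] by blast
  show "((\<lambda>y::real. (max 0 (y + c)) ^ 2) has_real_derivative 2 * (max 0 (y + c))) (at y)"
    using DERIV_shift[of "\<lambda>y. (max 0 y) ^ 2" _ y c] 2[of "y + c"] by blast
qed

lemma soft_pos_deriv: "(soft_pos has_real_derivative soft_pos' y) (at y)" "(soft_pos' has_real_derivative soft_pos'' y) (at y)"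
proof -
  have t0: "((\<lambda>y::real. (max 0 y) ^ 3) has_real_derivative 3 * (max 0 y) ^ 2) (at y)" "((\<lambda>y::real. (max 0 y) ^ 2) has_real_derivative 2 * (max 0 y)) (at y)"
    using tpow_chain[of 0 y] by simp_all
  have t1: "((\<lambda>y::real. (max 0 (y - 1)) ^ 3) has_real_derivative 3 * (max 0 (y - 1)) ^ 2) (at y)" "((\<lambda>y::real. (max 0 (y - 1)) ^ 2) has_real_derivative 2 * (max 0 (y - 1))) (at y)"
    using tpow_chain[of "-1" y] by simp_all
  show "(soft_pos has_real_derivative soft_pos' y) (at y)"
    unfolding soft_pos_def[abs_def] soft_pos'_def
    by (rule DERIV_cong[OF DERIV_cdivide[OF DERIV_add[OF DERIV_diff[OF tpow_chain(1) DERIV_cmult[OF t0(1)]] t1(1)]]]) (simp add: field_simps)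
  show "(soft_pos' has_real_derivative soft_pos'' y) (at y)"
    unfolding soft_pos'_def[abs_def] soft_pos''_def
    by (rule DERIV_cong[OF DERIV_cdivide[OF DERIV_add[OF DERIV_diff[OF tpow_chain(2) DERIV_cmult[OF t0(2)]] t1(2)]]]) (simp add: field_simps)
qed

lemma soft_pos''_cont: "continuous_on S soft_pos''" unfolding soft_pos''_def[abs_def] by (intro continuous_intros)

lemma soft_pos''_nonneg: "soft_pos'' y \<ge> 0" by (auto simp: soft_pos''_def max_def)

lemma soft_pos_low: "y \<le> -1 \<Longrightarrow> soft_pos y = 0" by (simp add: soft_pos_def max_def)

lemma soft_pos_high: "y \<ge> 1 \<Longrightarrow> soft_pos y = y"
  by (simp add: soft_pos_def max_def power3_eq_cube algebra_simps)

lemma soft_pos'_bounds: "0 \<le> soft_pos' y" "soft_pos' y \<le> 1"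
proof -
  have inc: "soft_pos' x \<le> soft_pos' y" if "x \<le> y" for x y
    by (rule DERIV_nonneg_imp_nondecreasing[OF that]) (use soft_pos_deriv(2) soft_pos''_nonneg in blast)
  have l: "soft_pos' (min y (-1)) = 0" by (simp add: soft_pos'_def max_def)
  have h: "soft_pos' (max y 1) = 1" by (simp add: soft_pos'_def power2_eq_square algebra_simps)
  show "0 \<le> soft_pos' y" using inc[of "min y (-1)" y] l by simp
  show "soft_pos' y \<le> 1" using inc[of y "max y 1"] h by simp
qed

lemma soft_pos_nonneg: "soft_pos y \<ge> 0"
proof -
  have "soft_pos (min y (-1)) \<le> soft_pos y"
    by (rule DERIV_nonneg_imp_nondecreasing) (use soft_pos_deriv(1) soft_pos'_bounds in auto)
  then show ?thesis by (simp add: soft_pos_low)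
qed

lemma soft_pos_ge: "soft_pos y \<ge> y"
proof -
  have "soft_pos y - y \<ge> soft_pos (max y 1) - max y 1"
  proof (rule DERIV_nonpos_imp_nonincreasing[of y "max y 1" "\<lambda>y. soft_pos y - y"])
    fix x show "\<exists>z. ((\<lambda>y. soft_pos y - y) has_real_derivative z) (at x) \<and> z \<le> 0"
      using soft_pos'_bounds[of x] by (intro exI[of _ "soft_pos' x - 1"]) (auto intro!: derivative_eq_intros soft_pos_deriv)
  qed auto
  then show ?thesis using soft_pos_high[of "max y 1"] by simp
qed

lemma soft_pos_le: "soft_pos y \<le> max 0 y + 1"
proof (cases "y \<ge> 1")
  case False
  have "soft_pos y \<le> soft_pos 1"
    by (rule DERIV_nonneg_imp_nondecreasing) (use soft_pos_deriv(1) soft_pos'_bounds False in auto)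
  then show ?thesis using soft_pos_high[of 1] by (simp add: max_def)
qed (simp add: soft_pos_high)

text \<open>A C^1 cutoff made of parabolas: its derivative is minus the hat function on [-2, -1] of
  height 2. It is evaluated at \<Psi> / t.\<close>

definition "step_down y = 1 - (2 * (max 0 (y + 2)) ^ 2 - 4 * (max 0 (y + 3/2)) ^ 2 + 2 * (max 0 (y + 1)) ^ 2)" for y :: real
definition "step_down' y = - (4 * (max 0 (y + 2)) - 8 * (max 0 (y + 3/2)) + 4 * (max 0 (y + 1)))" for y :: real

lemma step_down_deriv: "(step_down has_real_derivative step_down' y) (at y)"
  unfolding step_down_def[abs_def] step_down'_def
  by (rule DERIV_cong[OF DERIV_diff[OF DERIV_const DERIV_add[OF DERIV_diff[OF DERIV_cmult[OF tpow_chain(2)] DERIV_cmult[OF tpow_chain(2)]] DERIV_cmult[OF tpow_chain(2)]]]]) simp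

lemma step_down'_cont: "continuous_on S step_down'" unfolding step_down'_def[abs_def] by (intro continuous_intros)

lemma step_down_low: "y \<le> -2 \<Longrightarrow> step_down y = 1" by (simp add: step_down_def max_def)

lemma step_down_high: "y \<ge> -1 \<Longrightarrow> step_down y = 0"
  by (simp add: step_down_def max_def power2_eq_square algebra_simps)

lemma step_down'_bound: "\<bar>step_down' y\<bar> \<le> 2" by (auto simp: step_down'_def max_def)

lemma step_down'_nonpos: "step_down' y \<le> 0" by (auto simp: step_down'_def max_def)

lemma step_down'_zero: "y \<le> -2 \<or> y \<ge> -1 \<Longrightarrow> step_down' y = 0" by (auto simp: step_down'_def max_def)

lemma step_down_range: "0 \<le> step_down y" "step_down y \<le> 1"
proof -
  have dec: "step_down y \<le> step_down x" if "x \<le> y" for x y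
    by (rule DERIV_nonpos_imp_nonincreasing[OF that]) (use step_down_deriv step_down'_nonpos in blast)
  show "0 \<le> step_down y" using dec[of y "max y (-1)"] step_down_high[of "max y (-1)"] by simp
  show "step_down y \<le> 1" using dec[of "min y (-2)" y] step_down_low[of "min y (-2)"] by simp
qed

text \<open>The weight is \<open>\<Psi> + exp (\<Psi> / t)\<close>; its Levi form dominates the square of \<open>exp (\<Psi> / 2t) / t\<close> times the
  derivative of \<open>\<Psi>\<close>, which is what \<open>dbar\<close> of the cutoff of \<open>\<Psi> / t\<close> is compared with. The almost holomorphic
  approximation \<open>F\<close> of the cutoff is at most \<open>1/2\<close> on the half ball by the mean value property, so the cutoff and \<open>F\<close>
  differ by at least \<open>1/2\<close> on \<open>\<Psi> \<le> - 2t\<close>.\<close>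

lemma sublevel_estimate:
  fixes \<Psi> :: "complex^'n::finite \<Rightarrow> real" and a :: "complex^'n"
  assumes \<Psi>: "C2_on UNIV \<Psi>" and lap\<Psi>: "\<And>x \<xi>. lap \<Psi> x \<xi> \<ge> 0" and t: "t \<ge> 1" and s: "s > 0"
    and sub: "\<And>x. \<Psi> x \<le> - t \<Longrightarrow> x \<in> ball a s" and up: "\<And>x. x \<in> ball a s \<Longrightarrow> \<Psi> x \<le> 3"
    and M1: "M1 > 0" "\<And>x::complex^'n. mollr (s / 2) x \<le> M1"
    and X: "X \<ge> 0" "(\<integral>\<^sup>+x. indicator {x. \<Psi> x \<le> - t} x * ennreal (min (exp (- \<Psi> x)) (exp (2 * t))) \<partial>lborel) \<le> ennreal X"
    and small: "32 * M1 * (2 + 1536 * exp 2 * exp (3 + exp 3)) * X \<le> 1"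
  shows "(\<integral>\<^sup>+x. indicator {x \<in> ball a (s / 2). \<Psi> x \<le> - 2 * t} x * ennreal (exp (- \<Psi> x)) \<partial>lborel) \<le> ennreal (3072 * exp 3 * X)"
proof -
  have t0: "t > 0" using t by simp
  let ?\<Psi>c = "\<lambda>x. complex_of_real (\<Psi> x)"
  define \<Phi> where "\<Phi> x = \<Psi> x + exp (\<Psi> x / t)" for x
  have der: "((\<lambda>y. y + exp (y / t)) has_real_derivative 1 + exp (y / t) / t) (at y)"
    "((\<lambda>y. 1 + exp (y / t) / t) has_real_derivative exp (y / t) / t\<^sup>2) (at y)" for y
    using t0 by (auto intro!: derivative_eq_intros simp: power2_eq_square)
  have \<Phi>: "C2_on UNIV \<Phi>" unfolding \<Phi>_def[abs_def]
    by (rule C2_on_compose[where T=UNIV, OF open_UNIV \<Psi> _ der]) (use t0 in \<open>auto intro!: continuous_intros\<close>)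
  interpret W: weight \<Phi> by unfold_locales (rule \<Phi>)
  have d\<Psi>: "\<Psi> differentiable at x" for x using \<Psi> by (auto simp: C2_on_def C1_on_def)
  have \<Psi>c: "continuous_on UNIV \<Psi>" using C1_on_continuous[OF C2_on_C1[OF \<Psi>]] .
  have wtr: "W.wtr x = exp (- \<Phi> x)" for x by (simp add: W.wtr_def)
  define el where "el j x = complex_of_real (exp (\<Psi> x / (2 * t)) / t) * dz j ?\<Psi>c x" for j x
  have elc: "continuous_on UNIV (el j)" for j unfolding el_def[abs_def]
    by (intro continuous_intros continuous_on_dz C2_on_C1[OF C2_on_of_real[OF open_UNIV \<Psi>]] \<Psi>c) (use t0 in auto)
  have levi: "(cmod (\<Sum>j\<in>UNIV. el j x * \<xi> j))\<^sup>2 \<le> Re (\<Sum>j\<in>UNIV. \<Sum>k\<in>UNIV. dbar k (W.dPhi j) x * \<xi> j * cnj (\<xi> k))" for x \<xi>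
  proof -
    define v where "v = vec_lambda \<xi>"
    have "lap \<Phi> x v = (1 + exp (\<Psi> x / t) / t) * lap \<Psi> x v + exp (\<Psi> x / t) / t\<^sup>2 * ((pd v \<Psi> x)\<^sup>2 + (pd (\<i> *s v) \<Psi> x)\<^sup>2)"
      unfolding \<Phi>_def[abs_def] by (rule lap_compose[OF open_UNIV UNIV_I \<Psi> der])
    moreover have "(1 + exp (\<Psi> x / t) / t) * lap \<Psi> x v \<ge> 0" using lap\<Psi> t0 by (intro mult_nonneg_nonneg add_nonneg_nonneg) auto
    ultimately have l: "lap \<Phi> x v \<ge> exp (\<Psi> x / t) / t\<^sup>2 * ((pd v \<Psi> x)\<^sup>2 + (pd (\<i> *s v) \<Psi> x)\<^sup>2)" by linarith
    have "(\<Sum>j\<in>UNIV. el j x * \<xi> j) = complex_of_real (exp (\<Psi> x / (2 * t)) / t) * (\<Sum>j\<in>UNIV. dz j ?\<Psi>c x * v $ j)"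
      unfolding el_def sum_distrib_left by (rule sum.cong) (simp_all add: v_def)
    then have "(cmod (\<Sum>j\<in>UNIV. el j x * \<xi> j))\<^sup>2 = (exp (\<Psi> x / (2 * t)) / t)\<^sup>2 * (((pd v \<Psi> x)\<^sup>2 + (pd (\<i> *s v) \<Psi> x)\<^sup>2) / 4)"
      using dz_sum_norm[OF d\<Psi>, of x v] by (simp only: norm_mult norm_of_real power_mult_distrib power2_abs)
    also have "(exp (\<Psi> x / (2 * t)) / t)\<^sup>2 = exp (\<Psi> x / t) / t\<^sup>2"
      by (simp add: power_divide flip: exp_double)
    finally have "(cmod (\<Sum>j\<in>UNIV. el j x * \<xi> j))\<^sup>2 \<le> lap \<Phi> x v / 4" using l by simp
    then show ?thesis using levi_lap[OF \<Phi>, of x \<xi>] by (simp add: W.dPhi_def v_def)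
  qed
  define h where "h x = complex_of_real (step_down (\<Psi> x / t))" for x
  have kd: "((\<lambda>y. step_down (y / t)) has_real_derivative step_down' (y / t) / t) (at y)" for y
  proof -
    have "((\<lambda>y. y / t) has_real_derivative 1 / t) (at y)" using t0 by (auto intro!: derivative_eq_intros)
    from DERIV_chain2[OF step_down_deriv this] show ?thesis by simp
  qed
  have h0: "h x = 0" if "\<Psi> x > - t" for x using that t0 by (simp add: h_def step_down_high field_simps)
  have hcc: "C1c h"
    unfolding C1c_def
  proof (intro conjI exI[of _ "norm a + s"] allI impI)
    show "C1_on UNIV h" unfolding h_def[abs_def]
      by (rule C1_on_bounded_linear[OF bounded_linear_of_real C1_on_compose[where T=UNIV, OF C2_on_C1[OF \<Psi>] _ kd]])
         (use t0 in \<open>auto intro!: continuous_intros continuous_on_compose2[OF step_down'_cont[of UNIV]]\<close>)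
    fix x :: "complex^'n" assume "norm a + s < norm x"
    then have "x \<notin> ball a s" using norm_triangle_ineq2[of x a] by (auto simp: dist_norm norm_minus_commute)
    then show "h x = 0" using sub[of x] h0[of x] by linarith
  qed
  \<comment> \<open>The exponential undoes the one in \<open>el\<close>, so that dbar h = p cnj el.
    On the transition region it is at most exp 1.\<close>
  define p where "p x = complex_of_real (step_down' (\<Psi> x / t) * exp (- \<Psi> x / (2 * t)))" for x
  have p0: "p x = 0" if "\<not> (- 2 * t \<le> \<Psi> x \<and> \<Psi> x \<le> - t)" for x
  proof -
    have "\<Psi> x / t \<le> -2 \<or> \<Psi> x / t \<ge> -1" using that t0 by (auto simp: field_simps)
    then show ?thesis by (simp add: p_def step_down'_zero)
  qed
  have pcc: "C0c p"
    unfolding C0c_def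
  proof (intro conjI exI[of _ "norm a + s"] allI impI)
    show "continuous_on UNIV p" unfolding p_def[abs_def]
      by (intro continuous_intros continuous_on_compose2[OF step_down'_cont[of UNIV]] \<Psi>c) (use t0 in auto)
    fix x :: "complex^'n" assume "norm a + s < norm x"
    then have "x \<notin> ball a s" using norm_triangle_ineq2[of x a] by (auto simp: dist_norm norm_minus_commute)
    then show "p x = 0" using sub[of x] p0[of x] by blast
  qed
  have hp: "dbar j h x = p x * cnj (el j x)" for j x
  proof -
    have 1: "dbar j h x = of_real (step_down' (\<Psi> x / t) / t) * dbar j ?\<Psi>c x"
      unfolding h_def[abs_def] by (rule dbar_compose[OF d\<Psi> kd])
    have "exp (- \<Psi> x / (2 * t)) * exp (\<Psi> x / (2 * t)) = 1" by (simp flip: exp_add)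
    then have "step_down' (\<Psi> x / t) * exp (- \<Psi> x / (2 * t)) * (exp (\<Psi> x / (2 * t)) / t) = step_down' (\<Psi> x / t) / t" by simp
    then have "complex_of_real (step_down' (\<Psi> x / t) * exp (- \<Psi> x / (2 * t))) * complex_of_real (exp (\<Psi> x / (2 * t)) / t) = of_real (step_down' (\<Psi> x / t) / t)"
      by (simp only: of_real_mult[symmetric])
    then show ?thesis unfolding 1 p_def el_def dbar_eq_cnj_dz_real[OF d\<Psi>] complex_cnj_mult complex_cnj_complex_of_real
      by (simp only: mult.assoc[symmetric])
  qed
  define V where "V x = indicator {x. \<Psi> x \<le> - t} x * ennreal (min (exp (- \<Psi> x)) (exp (2 * t)))" for x
  have \<Psi>m[measurable]: "\<Psi> \<in> borel_measurable borel" by (rule borel_measurable_continuous_onI[OF \<Psi>c])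
  have Vm[measurable]: "V \<in> borel_measurable lborel" unfolding V_def[abs_def] by measurable
  \<comment> \<open>4 is the squared slope of the step and exp 2 the squared exponential in p. Where
    p is nonzero the truncated integrand is exp (- \<Psi>) itself, which dominates the
    weight.\<close>
  have qp: "W.wnorm2 p \<le> 4 * exp 2 * X"
  proof -
    have "ennreal (W.wnorm2 p) = (\<integral>\<^sup>+x. ennreal ((cmod (p x))\<^sup>2 * W.wtr x) \<partial>lborel)"
      unfolding W.wnorm2_def by (rule nn_integral_eq_integral[symmetric, OF W.wnorm2_integrable[OF pcc]]) (simp add: W.wtr_pos less_imp_le)
    also have "\<dots> \<le> (\<integral>\<^sup>+x. ennreal (4 * exp 2) * V x \<partial>lborel)"
    proof (rule nn_integral_mono)
      fix x
      show "ennreal ((cmod (p x))\<^sup>2 * W.wtr x) \<le> ennreal (4 * exp 2) * V x"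
      proof (cases "- 2 * t \<le> \<Psi> x \<and> \<Psi> x \<le> - t")
        case True
        have "(cmod (p x))\<^sup>2 = (step_down' (\<Psi> x / t))\<^sup>2 * exp (- \<Psi> x / t)"
          unfolding p_def norm_of_real power2_abs power_mult_distrib by (simp flip: exp_double)
        also have "\<dots> \<le> 2\<^sup>2 * exp 2"
        proof (intro mult_mono)
          show "(step_down' (\<Psi> x / t))\<^sup>2 \<le> 2\<^sup>2" using step_down'_bound[of "\<Psi> x / t"] abs_le_square_iff[of "step_down' (\<Psi> x / t)" 2] by simp
          show "exp (- \<Psi> x / t) \<le> exp 2" using True t0 by (simp add: field_simps)
        qed auto
        finally have 1: "(cmod (p x))\<^sup>2 \<le> 4 * exp 2" by simp
        have 2: "W.wtr x \<le> exp (- \<Psi> x)" unfolding wtr \<Phi>_def by simp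
        have "(cmod (p x))\<^sup>2 * W.wtr x \<le> 4 * exp 2 * exp (- \<Psi> x)" using 1 2 W.wtr_pos[of x] by (intro mult_mono) auto
        moreover have "V x = ennreal (exp (- \<Psi> x))" unfolding V_def using True by (simp add: min_def)
        ultimately show ?thesis by (simp add: ennreal_mult[symmetric] ennreal_leI)
      qed (simp add: p0)
    qed
    also have "\<dots> = ennreal (4 * exp 2) * (\<integral>\<^sup>+x. V x \<partial>lborel)" by (rule nn_integral_cmult) measurable
    also have "\<dots> \<le> ennreal (4 * exp 2) * ennreal X" using X(2) unfolding V_def by (intro mult_left_mono) auto
    also have "\<dots> = ennreal (4 * exp 2 * X)" using X(1) by (simp add: ennreal_mult[symmetric])
    finally show ?thesis using X(1) by (simp add: ennreal_le_iff)
  qed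
  define K where "K = norm a + s"
  have BK: "ball a s \<subseteq> cball 0 K"
  proof
    fix x assume "x \<in> ball a s"
    then show "x \<in> cball 0 K" using norm_triangle_ineq2[of x a] by (auto simp: K_def dist_norm norm_minus_commute)
  qed
  \<comment> \<open>On the ball \<Psi> \<le> 3 and t \<ge> 1, so \<Phi> \<le> 3 + exp 3: passing
    from weighted to plain L^2 norms there costs e3.\<close>
  define e3 where "e3 = exp (3 + exp (3::real))"
  have e3: "e3 > 0" by (simp add: e3_def)
  have wlow: "1 \<le> e3 * W.wtr x" if "x \<in> ball a s" for x
  proof -
    have "\<Psi> x \<le> 3" by (rule up[OF that])
    moreover have "\<Psi> x / t \<le> 3"
    proof -
      have "3 * 1 \<le> 3 * t" using t by simp
      then show ?thesis using \<open>\<Psi> x \<le> 3\<close> t0 by (simp add: divide_le_eq)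
    qed
    ultimately have "\<Phi> x \<le> 3 + exp 3" unfolding \<Phi>_def by (intro add_mono) auto
    then have "1 \<le> exp (3 + exp 3 + - \<Phi> x)" by simp
    then show ?thesis unfolding e3_def wtr exp_add[symmetric] by simp
  qed
  define n where "n = real CARD('n)"
  have n: "n \<ge> 1" unfolding n_def by (simp add: Suc_leI)
  show ?thesis
  proof (rule ennreal_le_epsilon)
    fix e :: real assume e: "0 < e"
    \<comment> \<open>Three demands on the error of the approximation: it costs at most e in the
      final bound, it is negligible in the L^2 norm of F, and it keeps the defect in the mean value
      property below 1/4.\<close>
    define \<tau> where "\<tau> = min (e / (4 * exp 1)) (min (1 / (64 * M1 * e3)) (1 / (4 * n * s)))"
    have \<tau>: "\<tau> > 0" unfolding \<tau>_def using e M1 e3 n s by simp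
    have \<tau>1: "4 * exp 1 * \<tau> \<le> e"
    proof -
      have "4 * exp 1 * \<tau> \<le> 4 * exp 1 * (e / (4 * exp 1))" unfolding \<tau>_def by (intro mult_left_mono) auto
      then show ?thesis by simp
    qed
    have \<tau>2: "64 * M1 * e3 * \<tau> \<le> 1"
    proof -
      have "64 * M1 * e3 * \<tau> \<le> 64 * M1 * e3 * (1 / (64 * M1 * e3))" unfolding \<tau>_def using M1 e3 by (intro mult_left_mono) auto
      then show ?thesis using M1 e3 by simp
    qed
    have \<tau>3: "n * s * \<tau> \<le> 1 / 4"
    proof -
      have "n * s * \<tau> \<le> n * s * (1 / (4 * n * s))" unfolding \<tau>_def using n s by (intro mult_left_mono) auto
      then show ?thesis using n s by simp
    qed
    obtain F where F: "C1c F" "(\<integral>x. indicator (cball 0 K) x * ((cmod (h x - F x))\<^sup>2 * W.wtr x) \<partial>lborel) \<le> 192 * W.wnorm2 p + \<tau>"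
      "\<And>x j. norm x \<le> K \<Longrightarrow> cmod (dbar j F x) \<le> \<tau>"
      using W.dbar_estimate[OF hcc pcc elc hp levi \<tau>, of K] by blast
    define Y where "Y = 768 * exp 2 * X + \<tau>"
    define f where "f x = indicator (cball 0 K) x * ((cmod (h x - F x))\<^sup>2 * W.wtr x)" for x
    have f0: "f x \<ge> 0" for x unfolding f_def using W.wtr_pos[of x] by (simp add: less_imp_le)
    have fi: "integrable lborel f"
    proof -
      have "integrable lborel (\<lambda>x. indicator (cball 0 K) x *\<^sub>R ((cmod (h x - F x))\<^sup>2 * W.wtr x))"
        by (rule borel_integrable_compact[OF compact_cball])
           (intro continuous_on_subset[OF C0c_continuous[OF W.wnorm2_C0c[OF C0c_diff[OF C1c_C0c[OF hcc] C1c_C0c[OF F(1)]]]]] subset_UNIV)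
      then show ?thesis by (simp add: f_def[abs_def])
    qed
    have fY: "(\<integral>x. f x \<partial>lborel) \<le> Y" using F(2) qp unfolding f_def Y_def by linarith
    \<comment> \<open>F is small in L^2 of the ball because h and h - F are. Averaging at scale s /
      2 bounds the mollification of F at z by 1/4, and the mean value property passes this on to F
      z.\<close>
    have nF: "norm (F z) \<le> 1 / 2" if z: "z \<in> ball a (s / 2)" for z
    proof -
      define B where "B x = indicator (ball a s) x * (cmod (F x))\<^sup>2" for x
      have intB: "integrable lborel (\<lambda>x. indicator (ball a s) x * (cmod (g x))\<^sup>2)" if "C0c g" for g
      proof -
        have "integrable lborel (\<lambda>x. (cmod (g x))\<^sup>2 * indicator (ball a s) x)"
          by (rule integrable_real_mult_indicator[OF _ C0c_integrable[OF C0c_comp[OF that]]]) (auto intro!: continuous_intros)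
        then show ?thesis by (simp add: mult.commute)
      qed
      \<comment> \<open>On the support of h the truncated integrand is at least 1, so X controls the
        plain L^2 norm of h too.\<close>
      have hX: "(\<integral>x. indicator (ball a s) x * (cmod (h x))\<^sup>2 \<partial>lborel) \<le> X"
      proof -
        have "ennreal (\<integral>x. indicator (ball a s) x * (cmod (h x))\<^sup>2 \<partial>lborel) = (\<integral>\<^sup>+x. ennreal (indicator (ball a s) x * (cmod (h x))\<^sup>2) \<partial>lborel)"
          by (rule nn_integral_eq_integral[symmetric, OF intB[OF C1c_C0c[OF hcc]]]) simp
        also have "\<dots> \<le> (\<integral>\<^sup>+x. V x \<partial>lborel)"
        proof (rule nn_integral_mono)
          fix x
          show "ennreal (indicator (ball a s) x * (cmod (h x))\<^sup>2) \<le> V x"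
          proof (cases "\<Psi> x \<le> - t")
            case True
            have "(cmod (h x))\<^sup>2 \<le> 1" unfolding h_def norm_of_real power2_abs using step_down_range[of "\<Psi> x / t"] by (intro power_le_one)
            then have "indicator (ball a s) x * (cmod (h x))\<^sup>2 \<le> 1" by (auto simp: indicator_def)
            also have "1 \<le> min (exp (- \<Psi> x)) (exp (2 * t))" using True t by auto
            finally show ?thesis unfolding V_def using True by (simp add: ennreal_leI)
          qed (simp add: h0)
        qed
        also have "\<dots> \<le> ennreal X" using X(2) unfolding V_def .
        finally show ?thesis using X(1) by (simp add: ennreal_le_iff)
      qed
      have hF: "(\<integral>x. indicator (ball a s) x * (cmod (h x - F x))\<^sup>2 \<partial>lborel) \<le> e3 * Y"
      proof -
        have "(\<integral>x. indicator (ball a s) x * (cmod (h x - F x))\<^sup>2 \<partial>lborel) \<le> (\<integral>x. e3 * f x \<partial>lborel)"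
        proof (rule integral_mono[OF intB[OF C0c_diff[OF C1c_C0c[OF hcc] C1c_C0c[OF F(1)]]]])
          show "integrable lborel (\<lambda>x. e3 * f x)" using fi by simp
          fix x
          show "indicator (ball a s) x * (cmod (h x - F x))\<^sup>2 \<le> e3 * f x"
          proof (cases "x \<in> ball a s")
            case True
            then have "f x = (cmod (h x - F x))\<^sup>2 * W.wtr x" using BK by (auto simp: f_def)
            then show ?thesis using True mult_left_mono[OF wlow[OF True], of "(cmod (h x - F x))\<^sup>2"] by (simp add: mult_ac)
          qed (use f0 e3 in simp)
        qed
        also have "\<dots> \<le> e3 * Y" using fY e3 by simp
        finally show ?thesis .
      qed
      have BX: "(\<integral>x. B x \<partial>lborel) \<le> 2 * X + 2 * (e3 * Y)"
      proof -
        have "(\<integral>x. B x \<partial>lborel) \<le> (\<integral>x. 2 * (indicator (ball a s) x * (cmod (h x))\<^sup>2) + 2 * (indicator (ball a s) x * (cmod (h x - F x))\<^sup>2) \<partial>lborel)"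
        proof (rule integral_mono)
          show "integrable lborel B" unfolding B_def[abs_def] by (rule intB[OF C1c_C0c[OF F(1)]])
          show "integrable lborel (\<lambda>x. 2 * (indicator (ball a s) x * (cmod (h x))\<^sup>2) + 2 * (indicator (ball a s) x * (cmod (h x - F x))\<^sup>2))"
            by (intro Bochner_Integration.integrable_add integrable_mult_right intB C1c_C0c hcc C0c_diff F)
          fix x
          have "F x = h x + - (h x - F x)" by simp
          then have "(cmod (F x))\<^sup>2 \<le> 2 * (cmod (h x))\<^sup>2 + 2 * (cmod (h x - F x))\<^sup>2"
            using cmod_sq_add_le[of "h x" "- (h x - F x)"] by (simp only: norm_minus_cancel)
          then show "B x \<le> 2 * (indicator (ball a s) x * (cmod (h x))\<^sup>2) + 2 * (indicator (ball a s) x * (cmod (h x - F x))\<^sup>2)"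
            unfolding B_def by (simp add: indicator_def)
        qed
        also have "\<dots> = 2 * (\<integral>x. indicator (ball a s) x * (cmod (h x))\<^sup>2 \<partial>lborel) + 2 * (\<integral>x. indicator (ball a s) x * (cmod (h x - F x))\<^sup>2 \<partial>lborel)"
          using intB[OF C1c_C0c[OF hcc]] intB[OF C0c_diff[OF C1c_C0c[OF hcc] C1c_C0c[OF F(1)]]] by simp
        finally show ?thesis using hX hF by linarith
      qed
      have s2: "s / 2 > 0" using s by simp
      have Bm: "B \<in> borel_measurable borel"
        using borel_measurable_integrable[OF intB[OF C1c_C0c[OF F(1)]]] by (simp add: B_def[abs_def])
      have Bi: "integrable lborel B" unfolding B_def[abs_def] by (rule intB[OF C1c_C0c[OF F(1)]])
      have "(cmod (conv F (moll (s / 2)) z))\<^sup>2 \<le> (\<integral>u. (cmod (F (z - u)))\<^sup>2 * mollr (s / 2) u \<partial>lborel)"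
        by (rule conv_moll_sq_le[OF C1c_C0c[OF F(1)] s2])
      also have "\<dots> \<le> (\<integral>u. M1 * B (z - u) \<partial>lborel)"
      proof (rule integral_mono)
        show "integrable lborel (\<lambda>u. (cmod (F (z - u)))\<^sup>2 * mollr (s / 2) u)"
          by (intro C0c_integrable C0c_mult2 mollr_C0c s2 continuous_intros continuous_on_translate C0c_continuous[OF C1c_C0c[OF F(1)]])
        have "integrable lborel (\<lambda>u. B (z - u))"
        proof -
          have "integrable (distr lborel borel (\<lambda>u. z + (-1) *\<^sub>R u)) B"
          proof -
            have "density M (\<lambda>x. ennreal (\<bar>-1\<bar> ^ DIM(complex^'n))) = M" for M :: "(complex^'n) measure" by (simp add: density_1)
            then have "lborel = distr lborel borel (\<lambda>u. z + (-1) *\<^sub>R u)" using lborel_affine[of "-1" z] by simp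
            then show ?thesis using Bi by simp
          qed
          then show ?thesis by (subst (asm) integrable_distr_eq) (use Bm in auto)
        qed
        then show "integrable lborel (\<lambda>u. M1 * B (z - u))" by simp
        fix u
        show "(cmod (F (z - u)))\<^sup>2 * mollr (s / 2) u \<le> M1 * B (z - u)"
        proof (cases "norm u < s / 2")
          case True
          have "dist a (z - u) \<le> dist a z + dist z (z - u)" by (rule dist_triangle)
          then have "z - u \<in> ball a s" using z True by (simp add: dist_norm)
          then have "B (z - u) = (cmod (F (z - u)))\<^sup>2" by (simp add: B_def)
          then show ?thesis using mult_left_mono[OF M1(2)[of u], of "(cmod (F (z - u)))\<^sup>2"] by (simp add: mult.commute)
        next
          case False
          have "0 \<le> B (z - u)" by (simp add: B_def)
          then show ?thesis using False mollr_eq_0[OF s2, of u] M1 by simp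
        qed
      qed
      also have "\<dots> = M1 * (\<integral>x. B x \<partial>lborel)" using lborel_integral_reflect[OF Bm, of z] by simp
      also have "\<dots> \<le> M1 * (2 * X + 2 * (e3 * Y))" using BX M1 by simp
      \<comment> \<open>The hypothesis \<open>small\<close> is scaled so that each summand is at
        most 1/32, together (1/4)^2.\<close>
      also have "\<dots> = (32 * M1 * (2 + 1536 * exp 2 * e3) * X) / 32 + (64 * M1 * e3 * \<tau>) / 32"
        unfolding Y_def by (simp add: field_simps)
      also have "\<dots> \<le> 1 / 32 + 1 / 32" using small \<tau>2 unfolding e3_def by (intro add_mono divide_right_mono) auto
      also have "\<dots> = (1 / 4)\<^sup>2" by (simp add: power2_eq_square)
      finally have c: "cmod (conv F (moll (s / 2)) z) \<le> 1 / 4" by (rule power2_le_imp_le) simp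
      have "cmod (conv F (moll (s / 2)) z - F z) \<le> 2 * real CARD('n) * (s / 2) * \<tau>"
      proof (rule mean_value_moll[OF F(1) s2])
        fix x j assume "norm (x - z) \<le> s / 2"
        moreover have "norm (z - a) < s / 2" using z by (simp add: dist_norm norm_minus_commute)
        ultimately have "norm x \<le> K" using norm_triangle_ineq[of "x - z" z] norm_triangle_ineq[of "z - a" a] by (simp add: K_def)
        then show "cmod (dbar j F x) \<le> \<tau>" by (rule F(3))
      qed
      also have "\<dots> \<le> 1 / 4" using \<tau>3 by (simp add: n_def)
      finally show ?thesis using c norm_triangle_ineq4[of "conv F (moll (s / 2)) z" "conv F (moll (s / 2)) z - F z"] by simp
    qed
    have pwf: "indicator {x \<in> ball a (s / 2). \<Psi> x \<le> - 2 * t} x * ennreal (exp (- \<Psi> x)) \<le> ennreal (4 * exp 1 * f x)" for x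
    proof (cases "x \<in> ball a (s / 2) \<and> \<Psi> x \<le> - 2 * t")
      case True
      have "x \<in> ball a s" using True s by simp
      then have xK: "x \<in> cball 0 K" using BK by blast
      have "\<Psi> x / t \<le> -2" using True t0 by (simp add: field_simps)
      then have h1: "h x = 1" by (simp add: h_def step_down_low)
      have "1 / 2 \<le> cmod (h x - F x)" using nF[of x] True norm_triangle_ineq2[of "h x" "F x"] by (simp add: h1)
      then have "(1 / 2)\<^sup>2 \<le> (cmod (h x - F x))\<^sup>2" by (intro power_mono) auto
      then have 4: "1 \<le> 4 * (cmod (h x - F x))\<^sup>2" by (simp add: power2_eq_square)
      \<comment> \<open>Where \<Psi> is negative the added term exp (\<Psi> / t) of the weight is at
        most 1, so returning to exp (- \<Psi>) costs exp 1.\<close>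
      have "exp (\<Psi> x / t) \<le> exp 0" using \<open>\<Psi> x / t \<le> -2\<close> by (intro exp_le_cancel_iff[THEN iffD2]) simp
      then have "exp (- \<Psi> x) \<le> exp (1 + - \<Phi> x)" unfolding \<Phi>_def by simp
      then have w: "exp (- \<Psi> x) \<le> exp 1 * W.wtr x" unfolding wtr exp_add .
      have "exp (- \<Psi> x) * 1 \<le> (exp 1 * W.wtr x) * (4 * (cmod (h x - F x))\<^sup>2)" using w 4 W.wtr_pos[of x] by (intro mult_mono) auto
      also have "\<dots> = 4 * exp 1 * f x" using xK by (simp add: f_def mult_ac)
      finally show ?thesis using True by (simp add: ennreal_leI)
    qed (auto simp: indicator_def)
    have "(\<integral>\<^sup>+x. indicator {x \<in> ball a (s / 2). \<Psi> x \<le> - 2 * t} x * ennreal (exp (- \<Psi> x)) \<partial>lborel) \<le> (\<integral>\<^sup>+x. ennreal (4 * exp 1 * f x) \<partial>lborel)"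
      by (rule nn_integral_mono) (rule pwf)
    also have "\<dots> = ennreal (\<integral>x. 4 * exp 1 * f x \<partial>lborel)" by (rule nn_integral_eq_integral) (use fi f0 in auto)
    also have "\<dots> \<le> ennreal (3072 * exp 3 * X + e)"
    proof (rule ennreal_leI)
      \<comment> \<open>The constants meet: 4 from |h - F| \<ge> 1/2, 768 = 192 * 4 from the dbar
        estimate and \<open>qp\<close>, and exp 3 from the two exponential losses.\<close>
      have "exp (1::real) * exp 2 = exp 3" by (simp flip: exp_add)
      then have E: "4 * exp 1 * Y = 3072 * exp 3 * X + 4 * exp 1 * \<tau>" unfolding Y_def by (simp add: algebra_simps)
      have "(\<integral>x. 4 * exp 1 * f x \<partial>lborel) \<le> 4 * exp 1 * Y" using fY by simp
      then show "(\<integral>x. 4 * exp 1 * f x \<partial>lborel) \<le> 3072 * exp 3 * X + e" using E \<tau>1 by linarith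
    qed
    also have "\<dots> = ennreal (3072 * exp 3 * X) + ennreal e" using X(1) e by (intro ennreal_plus) auto
    finally show "(\<integral>\<^sup>+x. indicator {x \<in> ball a (s / 2). \<Psi> x \<le> - 2 * t} x * ennreal (exp (- \<Psi> x)) \<partial>lborel) \<le> ennreal (3072 * exp 3 * X) + ennreal e" .
  qed
qed

section \<open>Gluing of singular weights to quadratic polynomials, and removal of the
  gluing\<close>

lemma
  fixes a :: "'a::real_inner"
  shows C2_on_norm_sq_shift: "C2_on UNIV (\<lambda>x. (norm (x - a))\<^sup>2)"
    and pd_pd_norm_sq_shift: "pd u (pd v (\<lambda>x. (norm (x - a))\<^sup>2)) x = 2 * (u \<bullet> v)"
proof -
  have d: "((\<lambda>x. (norm (x - a))\<^sup>2) has_derivative (\<lambda>v. 2 * ((x - a) \<bullet> v))) (at x)" for x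
    unfolding power2_norm_eq_inner by (auto intro!: derivative_eq_intros simp: inner_commute)
  have p: "pd v (\<lambda>x. (norm (x - a))\<^sup>2) = (\<lambda>x. 2 * (x \<bullet> v) - 2 * (a \<bullet> v))" for v
    using pd_eqI[OF d] by (auto simp: inner_diff_left algebra_simps)
  have c: "C1_on UNIV (\<lambda>x. 2 * (x \<bullet> v) - 2 * (a \<bullet> v))" for v by (intro C1_on_diff C1_on_inner C1_on_const)
  show "C2_on UNIV (\<lambda>x. (norm (x - a))\<^sup>2)" unfolding C2_on_def p
  proof (intro conjI allI c)
    show "C1_on UNIV (\<lambda>x. (norm (x - a))\<^sup>2)" unfolding C1_on_def p
      using d C1_on_continuous[OF c] by (auto simp: differentiable_def)
  qed
  show "pd u (pd v (\<lambda>x. (norm (x - a))\<^sup>2)) x = 2 * (u \<bullet> v)" unfolding p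
    using pd_diff[of "\<lambda>x. 2 * (x \<bullet> v)" x "\<lambda>x. 2 * (a \<bullet> v)" u] C1_on_differentiable[OF C1_on_inner[of UNIV v], of x] by (simp add: pd_inner)
qed

text \<open>\<Psi> is a regularised maximum of ln w and a quadratic q. On the sphere q = 2 while ln
  w \<le> 0, so near it and outside \<Psi> = q, as also near the zeros of w; thus \<Psi> is C^2
  everywhere. The level 2 leaves room for the width 1 of the smoothing. Since \<Psi> \<ge> ln w, the
  truncated integral of w controls that of \<Psi>.\<close>

lemma singular_part_estimate_fixed:
  fixes a :: "complex^'n::finite" and w :: "complex^'n \<Rightarrow> real"
  assumes s: "s > 0" and t: "t \<ge> 1" and A: "A > 0"
    and wc: "continuous_on (ball a s) w" and w01: "\<And>x. x \<in> ball a s \<Longrightarrow> 0 \<le> w x \<and> w x \<le> 1"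
    and w2: "C2_on {x \<in> ball a s. 0 < w x} (\<lambda>x. ln (w x))"
    and wl: "\<And>x \<xi>. x \<in> ball a s \<Longrightarrow> 0 < w x \<Longrightarrow> lap (\<lambda>x. ln (w x)) x \<xi> \<ge> 0"
    and M1: "M1 > 0" "\<And>x::complex^'n. mollr (s / 2) x \<le> M1"
    and X: "X \<ge> 0" "(\<integral>\<^sup>+x. indicator {x \<in> ball a s. w x \<le> exp (- t)} x * ennreal (1 / max (w x) (exp (- 2 * t))) \<partial>lborel) \<le> ennreal X"
    and small: "32 * M1 * (2 + 1536 * exp 2 * exp (3 + exp 3)) * X \<le> 1"
  defines "q \<equiv> \<lambda>x. A * ((norm (x - a))\<^sup>2 - s\<^sup>2) + 2"
  defines "\<Psi> \<equiv> \<lambda>x. if x \<in> ball a s \<and> 0 < w x then q x + soft_pos (ln (w x) - q x) else q x"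
  shows "(\<integral>\<^sup>+x. indicator {x \<in> ball a (s / 2). \<Psi> x \<le> - 2 * t} x * ennreal (exp (- \<Psi> x)) \<partial>lborel) \<le> ennreal (3072 * exp 3 * X)"
    and "\<Psi> \<in> borel_measurable borel"
proof -
  have q2: "C2_on UNIV q" unfolding q_def
    by (intro C2_on_add C2_on_mult C2_on_diff C2_on_norm_sq_shift C2_on_const open_UNIV)
  have qc: "continuous_on S q" for S using C1_on_continuous[OF C2_on_C1[OF q2]] continuous_on_subset by blast
  have lapq: "lap q x \<xi> \<ge> 0" for x \<xi>
  proof -
    have e: "q = (\<lambda>x. A * (norm (x - a))\<^sup>2 + (2 - A * s\<^sup>2))" by (auto simp: q_def algebra_simps)
    have "C2_on UNIV (\<lambda>x. A * (norm (x - a))\<^sup>2)" by (intro C2_on_mult C2_on_norm_sq_shift C2_on_const open_UNIV)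
    then have "lap q x \<xi> = A * lap (\<lambda>x. (norm (x - a))\<^sup>2) x \<xi>"
      unfolding e by (simp add: lap_add[OF open_UNIV UNIV_I] lap_cmult[OF open_UNIV UNIV_I C2_on_norm_sq_shift] lap_const)
    moreover have "lap (\<lambda>x. (norm (x - a))\<^sup>2) x \<xi> \<ge> 0" unfolding lap_def pd_pd_norm_sq_shift by simp
    ultimately show ?thesis using A by simp
  qed
  define P where "P = {x \<in> ball a s. 0 < w x}"
  have oP: "open P"
  proof -
    have "P = ball a s \<inter> w -` {0<..}" by (auto simp: P_def)
    then show ?thesis using continuous_open_preimage[OF wc open_ball open_greaterThan, of 0] by simp
  qed
  \<comment> \<open>An open region on which \<Psi> = q: inside the ball ln w < q - 1 there, so the
    smoothed maximum contributes nothing. P and T cover the space, and regularity and Levi form are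
    checked on each.\<close>
  define T where "T = {x. 1 < q x} \<union> {x \<in> ball a s. w x < exp (q x - 1)}"
  have oT: "open T"
  proof -
    have "open {x. 1 < q x}" by (intro open_Collect_less continuous_intros qc)
    moreover have "continuous_on (ball a s) (\<lambda>x. exp (q x - 1) - w x)" by (intro continuous_intros qc wc)
    note o = continuous_open_preimage[OF this open_ball open_greaterThan, of 0]
    have "{x \<in> ball a s. w x < exp (q x - 1)} = ball a s \<inter> (\<lambda>x. exp (q x - 1) - w x) -` {0<..}" by auto
    then have "open {x \<in> ball a s. w x < exp (q x - 1)}" using o by simp
    ultimately show ?thesis unfolding T_def by blast
  qed
  have PT: "P \<union> T = UNIV"
  proof -
    have "x \<in> P \<union> T" for x
    proof (cases "x \<in> ball a s")
      case True
      show ?thesis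
      proof (cases "0 < w x")
        case False
        then have "w x < exp (q x - 1)" using w01[OF True] by (simp add: less_le_trans[of _ 0])
        then show ?thesis using True by (simp add: T_def)
      qed (use True in \<open>simp add: P_def\<close>)
    next
      case False
      then have "s \<le> norm (x - a)" by (simp add: dist_norm norm_minus_commute)
      then have "s\<^sup>2 \<le> (norm (x - a))\<^sup>2" using s by (intro power_mono) auto
      then have "q x \<ge> 2" using A by (simp add: q_def)
      then show ?thesis by (simp add: T_def)
    qed
    then show ?thesis by blast
  qed
  have \<Psi>P: "q x + soft_pos (ln (w x) - q x) = \<Psi> x" if "x \<in> P" for x using that by (simp add: \<Psi>_def P_def)
  have \<Psi>T: "q x = \<Psi> x" if "x \<in> T" for x
  proof (cases "x \<in> P")
    case True
    then have x: "x \<in> ball a s" "0 < w x" by (auto simp: P_def)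
    have "ln (w x) - q x \<le> -1"
    proof (cases "1 < q x")
      case True
      have "ln (w x) \<le> 0" using x w01[OF x(1)] by simp
      then show ?thesis using True by linarith
    next
      case False
      then have "w x < exp (q x - 1)" using \<open>x \<in> T\<close> by (simp add: T_def)
      then have "ln (w x) < q x - 1" using x(2) ln_less_cancel_iff[of "w x" "exp (q x - 1)"] by simp
      then show ?thesis by simp
    qed
    then show ?thesis using \<Psi>P[OF True] by (simp add: soft_pos_low)
  next
    case False then show ?thesis by (auto simp: \<Psi>_def P_def)
  qed
  have w2': "C2_on P (\<lambda>x. ln (w x))" using w2 by (simp add: P_def)
  have q2P: "C2_on P q" by (rule C2_on_subset[OF q2]) simp
  have g2: "C2_on P (\<lambda>x. ln (w x) + (-1) * q x)" by (intro C2_on_add C2_on_mult oP w2' q2P C2_on_const)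
  have m2: "C2_on P (\<lambda>x. soft_pos (ln (w x) + (-1) * q x))"
    by (rule C2_on_compose[where T=UNIV, OF oP g2 UNIV_I soft_pos_deriv soft_pos''_cont])
  have \<Psi>2: "C2_on UNIV \<Psi>"
    unfolding PT[symmetric]
  proof (rule C2_on_Un[OF oP oT])
    have "C2_on P (\<lambda>x. q x + soft_pos (ln (w x) + (-1) * q x))" by (intro C2_on_add oP q2P m2)
    then show "C2_on P \<Psi>" by (rule C2_on_cong[OF oP, rotated]) (use \<Psi>P in auto)
    have "C2_on T q" by (rule C2_on_subset[OF q2]) simp
    then show "C2_on T \<Psi>" by (rule C2_on_cong[OF oT, rotated]) (use \<Psi>T in auto)
  qed
  show \<Psi>m: "\<Psi> \<in> borel_measurable borel"
    by (rule borel_measurable_continuous_onI[OF C1_on_continuous[OF C2_on_C1[OF \<Psi>2]]])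
  have lap\<Psi>: "lap \<Psi> x \<xi> \<ge> 0" for x \<xi>
  proof (cases "x \<in> P")
    case True
    let ?g = "\<lambda>x. ln (w x) + (-1) * q x"
    have "lap \<Psi> x \<xi> = lap (\<lambda>x. q x + soft_pos (?g x)) x \<xi>"
      by (rule lap_cong[OF oP True]) (use \<Psi>P in auto)
    also have "\<dots> = lap q x \<xi> + lap (\<lambda>x. soft_pos (?g x)) x \<xi>" by (rule lap_add[OF oP True q2P m2])
    also have "lap (\<lambda>x. soft_pos (?g x)) x \<xi> = soft_pos' (?g x) * lap ?g x \<xi> + soft_pos'' (?g x) * ((pd \<xi> ?g x)\<^sup>2 + (pd (\<i> *s \<xi>) ?g x)\<^sup>2)"
      by (rule lap_compose[OF oP True g2 soft_pos_deriv])
    also have "lap ?g x \<xi> = lap (\<lambda>x. ln (w x)) x \<xi> + (-1) * lap q x \<xi>"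
      using lap_add[OF oP True w2' C2_on_mult[OF oP C2_on_const q2P], of "-1" \<xi>] lap_cmult[OF oP True q2P, of "-1" \<xi>] by simp
    \<comment> \<open>As \<open>soft_pos'\<close> lies in [0, 1], this is a convex combination of
      the Levi forms of q and ln w plus a nonnegative convexity term.\<close>
    finally have e: "lap \<Psi> x \<xi> = (1 - soft_pos' (?g x)) * lap q x \<xi> + soft_pos' (?g x) * lap (\<lambda>x. ln (w x)) x \<xi> + soft_pos'' (?g x) * ((pd \<xi> ?g x)\<^sup>2 + (pd (\<i> *s \<xi>) ?g x)\<^sup>2)"
      by (simp add: algebra_simps)
    have "x \<in> ball a s" "0 < w x" using True by (auto simp: P_def)
    then show ?thesis unfolding e using soft_pos'_bounds[of "?g x"] soft_pos''_nonneg[of "?g x"] lapq wl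
      by (intro add_nonneg_nonneg mult_nonneg_nonneg) auto
  next
    case False
    then have xT: "x \<in> T" using PT by blast
    have "lap \<Psi> x \<xi> = lap q x \<xi>" by (rule lap_cong[OF oT xT]) (use \<Psi>T in auto)
    then show ?thesis using lapq by simp
  qed
  have \<Psi>q: "q x \<le> \<Psi> x" for x unfolding \<Psi>_def using soft_pos_nonneg by simp
  have \<Psi>w: "ln (w x) \<le> \<Psi> x" if "x \<in> ball a s" "0 < w x" for x unfolding \<Psi>_def using soft_pos_ge[of "ln (w x) - q x"] that by simp
  have sub: "x \<in> ball a s" if "\<Psi> x \<le> - t" for x
  proof -
    have "q x < 0" using that \<Psi>q[of x] t by linarith
    then have "A * ((norm (x - a))\<^sup>2 - s\<^sup>2) < 0" by (simp add: q_def)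
    then have "(norm (x - a))\<^sup>2 < s\<^sup>2" using A by (simp add: mult_less_0_iff)
    then have "norm (x - a) < s" by (rule power2_less_imp_less) (use s in simp)
    then show ?thesis by (simp add: dist_norm norm_minus_commute)
  qed
  have up: "\<Psi> x \<le> 3" if x: "x \<in> ball a s" for x
  proof -
    have "norm (x - a) \<le> s" using x by (simp add: dist_norm norm_minus_commute)
    then have "(norm (x - a))\<^sup>2 \<le> s\<^sup>2" by (intro power_mono) auto
    then have "A * ((norm (x - a))\<^sup>2 - s\<^sup>2) \<le> 0" using A by (simp add: mult_le_0_iff)
    then have q: "q x \<le> 2" by (simp add: q_def)
    show ?thesis
    proof (cases "0 < w x")
      case True
      have "ln (w x) \<le> 0" using True w01[OF x] by simp
      moreover have "\<Psi> x = q x + soft_pos (ln (w x) - q x)" using x True by (simp add: \<Psi>_def)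
      moreover have "max 0 (ln (w x) - q x) \<le> max 0 (ln (w x) - q x)" by simp
      ultimately show ?thesis using q soft_pos_le[of "ln (w x) - q x"] by linarith
    qed (use q in \<open>simp add: \<Psi>_def\<close>)
  qed
  have "(\<integral>\<^sup>+x. indicator {x. \<Psi> x \<le> - t} x * ennreal (min (exp (- \<Psi> x)) (exp (2 * t))) \<partial>lborel)
     \<le> (\<integral>\<^sup>+x. indicator {x \<in> ball a s. w x \<le> exp (- t)} x * ennreal (1 / max (w x) (exp (- 2 * t))) \<partial>lborel)"
  proof (rule nn_integral_mono)
    fix x
    show "indicator {x. \<Psi> x \<le> - t} x * ennreal (min (exp (- \<Psi> x)) (exp (2 * t))) \<le> indicator {x \<in> ball a s. w x \<le> exp (- t)} x * ennreal (1 / max (w x) (exp (- 2 * t)))"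
    proof (cases "\<Psi> x \<le> - t")
      case True
      have x: "x \<in> ball a s" by (rule sub[OF True])
      have "w x \<le> exp (- t) \<and> min (exp (- \<Psi> x)) (exp (2 * t)) \<le> 1 / max (w x) (exp (- 2 * t))"
      proof (cases "0 < w x")
        case w: True
        have l: "ln (w x) \<le> \<Psi> x" by (rule \<Psi>w[OF x w])
        have "w x = exp (ln (w x))" using w by simp
        also have "\<dots> \<le> exp (- t)" using l True by simp
        finally have 1: "w x \<le> exp (- t)" .
        have "exp (- \<Psi> x) \<le> exp (- ln (w x))" using l by simp
        also have "\<dots> = 1 / w x" using w by (simp add: exp_minus field_simps)
        finally have 2: "exp (- \<Psi> x) \<le> 1 / w x" .
        have 3: "exp (2 * t) = 1 / exp (- 2 * t)" by (simp add: exp_minus field_simps)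
        have "min (exp (- \<Psi> x)) (exp (2 * t)) \<le> 1 / max (w x) (exp (- 2 * t))"
        proof (cases "w x \<le> exp (- 2 * t)")
          case True
          then have "max (w x) (exp (- 2 * t)) = exp (- 2 * t)" by simp
          then show ?thesis using 3 by (simp only: min.cobounded2)
        next
          case False
          then have "max (w x) (exp (- 2 * t)) = w x" by simp
          then show ?thesis using 2 by (simp only: min.coboundedI1)
        qed
        then show ?thesis using 1 by blast
      next
        case False
        then have "w x = 0" using w01[OF x] by simp
        then show ?thesis by (simp add: max_def exp_minus field_simps)
      qed
      then show ?thesis using True x by (simp add: ennreal_leI)
    qed simp
  qed
  then have X': "(\<integral>\<^sup>+x. indicator {x. \<Psi> x \<le> - t} x * ennreal (min (exp (- \<Psi> x)) (exp (2 * t))) \<partial>lborel) \<le> ennreal X"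
    using X(2) by (rule order_trans)
  show "(\<integral>\<^sup>+x. indicator {x \<in> ball a (s / 2). \<Psi> x \<le> - 2 * t} x * ennreal (exp (- \<Psi> x)) \<partial>lborel) \<le> ennreal (3072 * exp 3 * X)"
    by (rule sublevel_estimate[OF \<Psi>2 lap\<Psi> t s sub up M1 X(1) X' small])
qed

text \<open>As the slope of the quadratic grows, q tends to - \<infinity> throughout the open ball;
  \<Psi> is eventually ln w where w > 0 and tends to - \<infinity> where w = 0, and Fatou's lemma
  yields the estimate for w. The constants stem from the mollifier at scale s / 2, so they are
  uniform in a, w and t, as the passage to nearby c demands.\<close>

lemma singular_part_estimate:
  assumes s: "s > 0"
  obtains C \<eta> :: real where "C > 0" "\<eta> > 0"
    "\<And>(a::complex^'n::finite) w t X. \<lbrakk>t \<ge> 1; continuous_on (ball a s) w; \<And>x. x \<in> ball a s \<Longrightarrow> 0 \<le> w x \<and> w x \<le> 1;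
      C2_on {x \<in> ball a s. 0 < w x} (\<lambda>x. ln (w x));
      \<And>x \<xi>. x \<in> ball a s \<Longrightarrow> 0 < w x \<Longrightarrow> lap (\<lambda>x. ln (w x)) x \<xi> \<ge> 0;
      0 \<le> X; X \<le> \<eta>;
      (\<integral>\<^sup>+x. indicator {x \<in> ball a s. w x \<le> exp (- t)} x * ennreal (1 / max (w x) (exp (- 2 * t))) \<partial>lborel) \<le> ennreal X\<rbrakk>
     \<Longrightarrow> (\<integral>\<^sup>+x. indicator {x \<in> ball a (s / 2). w x < exp (- 2 * t)} x * inverse (ennreal (w x)) \<partial>lborel) \<le> ennreal (C * X)"
proof -
  have s2: "s / 2 > 0" using s by simp
  obtain M1 where M1: "M1 > 0" "\<And>x. norm (mollr (s / 2) (x::complex^'n)) \<le> M1" using C0c_bounded[OF mollr_C0c[OF s2]] by blast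
  have M1': "mollr (s / 2) (x::complex^'n) \<le> M1" for x using M1(2)[of x] by simp
  define G where "G = 32 * M1 * (2 + 1536 * exp 2 * exp (3 + exp 3))"
  have G: "G > 0" unfolding G_def using M1 by (intro mult_pos_pos add_pos_pos) auto
  show ?thesis
  proof (rule that[of "3072 * exp 3" "1 / G"])
    fix a :: "complex^'n" and w t X
    assume t: "t \<ge> 1" and wc: "continuous_on (ball a s) w" and w01: "\<And>x. x \<in> ball a s \<Longrightarrow> 0 \<le> w x \<and> w x \<le> 1"
      and w2: "C2_on {x \<in> ball a s. 0 < w x} (\<lambda>x. ln (w x))"
      and wl: "\<And>x \<xi>. x \<in> ball a s \<Longrightarrow> 0 < w x \<Longrightarrow> lap (\<lambda>x. ln (w x)) x \<xi> \<ge> 0"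
      and X0: "0 \<le> X" and X\<eta>: "X \<le> 1 / G"
      and X: "(\<integral>\<^sup>+x. indicator {x \<in> ball a s. w x \<le> exp (- t)} x * ennreal (1 / max (w x) (exp (- 2 * t))) \<partial>lborel) \<le> ennreal X"
    have small: "32 * M1 * (2 + 1536 * exp 2 * exp (3 + exp 3)) * X \<le> 1"
      using X\<eta> G unfolding G_def[symmetric] by (simp add: field_simps)
    define q where "q k x = real (Suc k) * ((norm (x - a))\<^sup>2 - s\<^sup>2) + 2" for k x
    define \<Psi> where "\<Psi> k x = (if x \<in> ball a s \<and> 0 < w x then q k x + soft_pos (ln (w x) - q k x) else q k x)" for k x
    have A: "real (Suc k) > 0" for k by simp
    note base = singular_part_estimate_fixed[OF s t A wc w01 w2 wl M1(1) M1' X0 X small]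
    have \<Psi>m[measurable]: "\<Psi> k \<in> borel_measurable borel" for k
      using base(2)[of k] unfolding \<Psi>_def[abs_def] q_def .
    define f where "f k x = indicator {x \<in> ball a (s / 2). \<Psi> k x \<le> - 2 * t} x * ennreal (exp (- \<Psi> k x))" for k x
    have fb: "(\<integral>\<^sup>+x. f k x \<partial>lborel) \<le> ennreal (3072 * exp 3 * X)" for k
      using base(1)[of k] unfolding f_def \<Psi>_def q_def .
    have fm: "f k \<in> borel_measurable lborel" for k
    proof -
      have "{x \<in> ball a (s / 2). \<Psi> k x \<le> - 2 * t} = ball a (s / 2) \<inter> (\<Psi> k -` {.. - 2 * t} \<inter> space borel)" by auto
      moreover have "\<Psi> k -` {.. - 2 * t} \<inter> space borel \<in> sets borel" by (rule measurable_sets[OF \<Psi>m]) simp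
      ultimately have S: "{x \<in> ball a (s / 2). \<Psi> k x \<le> - 2 * t} \<in> sets lborel" by simp
      have "(\<lambda>x. ennreal (exp (- \<Psi> k x))) \<in> borel_measurable borel" by measurable
      then show ?thesis unfolding f_def[abs_def]
        by (intro borel_measurable_times_ennreal borel_measurable_indicator S) simp
    qed
    have pw: "indicator {x \<in> ball a (s / 2). w x < exp (- 2 * t)} x * inverse (ennreal (w x)) \<le> liminf (\<lambda>k. f k x)" for x
    proof (cases "x \<in> ball a (s / 2) \<and> w x < exp (- 2 * t)")
      case True
      then have xb: "x \<in> ball a s" using s by simp
      have "norm (x - a) < s" using xb by (simp add: dist_norm norm_minus_commute)
      then have neg: "(norm (x - a))\<^sup>2 - s\<^sup>2 < 0" using power_strict_mono[of "norm (x - a)" s 2] by simp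
      have "filterlim (\<lambda>k. ((norm (x - a))\<^sup>2 - s\<^sup>2) * real (Suc k)) at_bot sequentially"
        by (rule filterlim_tendsto_neg_mult_at_bot[OF tendsto_const neg])
           (rule filterlim_compose[OF filterlim_real_sequentially filterlim_Suc])
      then have q1: "filterlim (\<lambda>k. q k x) at_bot sequentially"
        unfolding filterlim_at_bot
      proof (intro allI)
        fix Z :: real
        assume "\<forall>Z. \<forall>\<^sub>F k in sequentially. ((norm (x - a))\<^sup>2 - s\<^sup>2) * real (Suc k) \<le> Z"
        then have "\<forall>\<^sub>F k in sequentially. ((norm (x - a))\<^sup>2 - s\<^sup>2) * real (Suc k) \<le> Z - 2" by blast
        then show "\<forall>\<^sub>F k in sequentially. q k x \<le> Z" by eventually_elim (simp only: q_def mult.commute)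
      qed
      show ?thesis
      proof (cases "0 < w x")
        case w: True
        have "\<forall>\<^sub>F k in sequentially. q k x \<le> ln (w x) - 1" using q1 by (simp add: filterlim_at_bot)
        then have "\<forall>\<^sub>F k in sequentially. f k x = inverse (ennreal (w x))"
        proof eventually_elim
          case (elim k)
          then have e: "\<Psi> k x = ln (w x)" using xb w by (simp add: \<Psi>_def soft_pos_high)
          have "ln (w x) < ln (exp (- 2 * t))" using w True by (subst ln_less_cancel_iff) auto
          then have "\<Psi> k x \<le> - 2 * t" using e by simp
          moreover have "exp (- \<Psi> k x) = inverse (w x)" using w by (simp add: e exp_minus)
          ultimately show ?case using True w by (simp add: f_def inverse_ennreal)
        qed
        then have "(\<lambda>k. f k x) \<longlonglongrightarrow> inverse (ennreal (w x))" by (rule tendsto_eventually)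
        then have "liminf (\<lambda>k. f k x) = inverse (ennreal (w x))" by (intro lim_imp_Liminf) auto
        then show ?thesis using True by simp
      next
        case False
        then have w0: "w x = 0" using w01[OF xb] by simp
        have \<Psi>q: "\<Psi> k x = q k x" for k using w0 by (simp add: \<Psi>_def)
        have "\<forall>\<^sub>F k in sequentially. q k x \<le> - 2 * t" using q1 by (simp add: filterlim_at_bot)
        then have ev: "\<forall>\<^sub>F k in sequentially. ennreal (exp (- q k x)) = f k x"
          by eventually_elim (use True in \<open>simp add: f_def \<Psi>q\<close>)
        have "filterlim (\<lambda>k. exp (- q k x)) at_top sequentially"
          by (rule filterlim_compose[OF exp_at_top]) (use q1 in \<open>simp add: filterlim_uminus_at_top\<close>)
        then have "(\<lambda>k. ennreal (exp (- q k x))) \<longlonglongrightarrow> \<infinity>"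
          by (simp add: ennreal_tendsto_top_eq_at_top)
        then have "(\<lambda>k. f k x) \<longlonglongrightarrow> \<infinity>" by (rule Lim_transform_eventually[OF _ ev])
        then have "liminf (\<lambda>k. f k x) = \<infinity>" by (intro lim_imp_Liminf) auto
        then show ?thesis by simp
      qed
    qed (auto simp: indicator_def)
    have "(\<integral>\<^sup>+x. indicator {x \<in> ball a (s / 2). w x < exp (- 2 * t)} x * inverse (ennreal (w x)) \<partial>lborel) \<le> (\<integral>\<^sup>+x. liminf (\<lambda>k. f k x) \<partial>lborel)"
      by (rule nn_integral_mono) (rule pw)
    also have "\<dots> \<le> liminf (\<lambda>k. \<integral>\<^sup>+x. f k x \<partial>lborel)" by (rule nn_integral_liminf) (rule fm)
    also have "\<dots> \<le> liminf (\<lambda>k::nat. ennreal (3072 * exp 3 * X))" by (rule Liminf_mono) (simp add: fb)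
    also have "\<dots> = ennreal (3072 * exp 3 * X)" by (rule Liminf_const) simp
    finally show "(\<integral>\<^sup>+x. indicator {x \<in> ball a (s / 2). w x < exp (- 2 * t)} x * inverse (ennreal (w x)) \<partial>lborel) \<le> ennreal (3072 * exp 3 * X)" .
  qed (use G in auto)
qed

section \<open>Holomorphic functions and the sub-mean value property\<close>

lemma C1_on_local:
  assumes "\<And>z. z \<in> D \<Longrightarrow> \<exists>U. open U \<and> z \<in> U \<and> C1_on U g"
  shows "C1_on D g"
  unfolding C1_on_def
proof (intro conjI ballI allI)
  show "g differentiable at z" if "z \<in> D" for z using assms[OF that] by (auto simp: C1_on_def)
  show "continuous_on D (pd v g)" for v
  proof (intro continuous_at_imp_continuous_on ballI)
    fix z assume "z \<in> D"
    then obtain U where U: "open U" "z \<in> U" "C1_on U g" using assms by blast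
    then have "continuous_on U (pd v g)" by (simp add: C1_on_def)
    then show "isCont (pd v g) z" using U continuous_on_eq_continuous_at by blast
  qed
qed

text \<open>Holomorphy in several variables as complex linearity of the real differential, which is
  how the slices of \<open>holo_on\<close> deliver it; higher regularity follows from the Cauchy
  formula.\<close>

definition cn_holo :: "(complex^'n::finite) set \<Rightarrow> (complex^'n \<Rightarrow> complex) \<Rightarrow> bool" where
  "cn_holo D f \<longleftrightarrow> (\<forall>z\<in>D. f differentiable at z \<and> (\<forall>a v. pd (a *s v) f z = a * pd v f z))"

lemma bounded_linear_vector_scalar_mult: "bounded_linear (\<lambda>\<zeta>. \<zeta> *s (v::complex^'n::finite))"
proof -
  have "linear (\<lambda>\<zeta>. \<zeta> *s v)"
    by (rule linearI) (auto simp: vec_eq_iff algebra_simps)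
  then show ?thesis by (rule linear_conv_bounded_linear[THEN iffD1])
qed

lemma norm_vector_scalar_mult: "norm (\<zeta> *s (v::complex^'n::finite)) = cmod \<zeta> * norm v"
  by (simp add: norm_vec_def L2_set_def norm_mult power_mult_distrib sum_distrib_left[symmetric] real_sqrt_mult)

text \<open>Cauchy's formula for the first derivative in the variable \<zeta> of z + \<zeta> v. With
  the circle parametrised by e = \<rho> exp (2 \<pi> \<i> x), the derivative 2 \<pi> \<i> e of the
  path cancels one of the two powers of e and leaves the kernel 1 / e.\<close>

lemma Cauchy_pd:
  fixes f :: "complex^'n::finite \<Rightarrow> complex"
  assumes f: "cn_holo D f" and \<rho>: "\<rho> > 0" and sub: "\<And>\<zeta>. cmod \<zeta> \<le> \<rho> \<Longrightarrow> z + \<zeta> *s v \<in> D"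
  shows "((\<lambda>x. (inverse (of_real \<rho> * exp (2 * of_real pi * \<i> * of_real x))) * f (z + (of_real \<rho> * exp (2 * of_real pi * \<i> * of_real x)) *s v)) has_integral pd v f z) {0..1}"
proof -
  define \<phi> where "\<phi> \<zeta> = f (z + \<zeta> *s v)" for \<zeta>
  have der: "(\<phi> has_field_derivative pd v f (z + \<zeta> *s v)) (at \<zeta>)" if "cmod \<zeta> \<le> \<rho>" for \<zeta>
  proof -
    have fz: "f differentiable at (z + \<zeta> *s v)" "\<And>a. pd (a *s v) f (z + \<zeta> *s v) = a * pd v f (z + \<zeta> *s v)"
      using f sub[OF that] by (auto simp: cn_holo_def)
    have "((\<lambda>\<zeta>. z + \<zeta> *s v) has_derivative (\<lambda>h. h *s v)) (at \<zeta>)"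
      using has_derivative_add[OF has_derivative_const[of z] bounded_linear_imp_has_derivative[OF bounded_linear_vector_scalar_mult[of v]], of "at \<zeta>"] by simp
    from has_derivative_compose[OF this, of f "\<lambda>w. pd w f (z + \<zeta> *s v)"] has_derivative_pd[OF fz(1)]
    have "(\<phi> has_derivative (\<lambda>h. pd (h *s v) f (z + \<zeta> *s v))) (at \<zeta>)" by (simp add: \<phi>_def[abs_def])
    then show ?thesis unfolding has_field_derivative_def fz(2) by (simp add: mult_commute_abs)
  qed
  have c: "continuous_on (cball 0 \<rho>) \<phi>"
    by (intro continuous_at_imp_continuous_on ballI DERIV_isCont[OF der]) simp
  have hol: "\<phi> holomorphic_on ball 0 \<rho>"
    unfolding holomorphic_on_open[OF open_ball]
  proof
    fix \<zeta> :: complex assume "\<zeta> \<in> ball 0 \<rho>"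
    then have "cmod \<zeta> \<le> \<rho>" by simp
    from der[OF this] show "\<exists>f'. (\<phi> has_field_derivative f') (at \<zeta>)" by blast
  qed
  have "((\<lambda>u. \<phi> u / (u - 0) ^ Suc 1) has_contour_integral (2 * pi * \<i> / fact 1 * (deriv ^^ 1) \<phi> 0)) (circlepath 0 \<rho>)"
    by (rule Cauchy_has_contour_integral_higher_derivative_circlepath[OF c hol]) (use \<rho> in simp)
  moreover have "deriv \<phi> 0 = pd v f z" using DERIV_imp_deriv[OF der[of 0]] \<rho> by simp
  ultimately have "((\<lambda>u. \<phi> u / u ^ 2) has_contour_integral (2 * pi * \<i> * pd v f z)) (circlepath 0 \<rho>)"
    by (simp add: numeral_2_eq_2)
  then have "((\<lambda>x. \<phi> (circlepath 0 \<rho> x) / (circlepath 0 \<rho> x) ^ 2 * vector_derivative (circlepath 0 \<rho>) (at x within {0..1})) has_integral (2 * pi * \<i> * pd v f z)) {0..1}"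
    by (simp add: has_contour_integral_def)
  then have "((\<lambda>x. inverse (2 * pi * \<i>) * (\<phi> (circlepath 0 \<rho> x) / (circlepath 0 \<rho> x) ^ 2 * vector_derivative (circlepath 0 \<rho>) (at x within {0..1}))) has_integral inverse (2 * pi * \<i>) * (2 * pi * \<i> * pd v f z)) {0..1}"
    by (rule has_integral_mult_right)
  moreover have "inverse (2 * pi * \<i>) * (2 * pi * \<i> * pd v f z) = pd v f z" by (simp add: field_simps)
  ultimately have *: "((\<lambda>x. inverse (2 * pi * \<i>) * (\<phi> (circlepath 0 \<rho> x) / (circlepath 0 \<rho> x) ^ 2 * vector_derivative (circlepath 0 \<rho>) (at x within {0..1}))) has_integral pd v f z) {0..1}"
    by simp
  show ?thesis
  proof (rule has_integral_eq[OF _ *])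
    fix x :: real assume x: "x \<in> {0..1}"
    define e where "e = of_real \<rho> * exp (2 * of_real pi * \<i> * of_real x)"
    have e0: "e \<noteq> 0" using \<rho> by (simp add: e_def)
    have 1: "circlepath 0 \<rho> x = e" by (simp add: circlepath e_def)
    have 2: "vector_derivative (circlepath 0 \<rho>) (at x within {0..1}) = 2 * pi * \<i> * e"
      using x by (simp add: vector_derivative_circlepath01 e_def)
    show "inverse (2 * pi * \<i>) * (\<phi> (circlepath 0 \<rho> x) / (circlepath 0 \<rho> x) ^ 2 * vector_derivative (circlepath 0 \<rho>) (at x within {0..1}))
      = inverse (of_real \<rho> * exp (2 * of_real pi * \<i> * of_real x)) * f (z + (of_real \<rho> * exp (2 * of_real pi * \<i> * of_real x)) *s v)"
      unfolding 1 2 e_def[symmetric] \<phi>_def using e0 by (simp add: field_simps power2_eq_square)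
  qed
qed

text \<open>By the Cauchy formula a directional derivative is locally an average of translates of f
  with continuous kernel. Continuity of f therefore gives C^1, differentiation under the integral
  then gives C^2, and the complex linearity of the differential passes under the integral as
  well.\<close>

lemma
  fixes f :: "complex^'n::finite \<Rightarrow> complex"
  assumes D: "open D" and f: "cn_holo D f"
  shows cn_holo_C2: "C2_on D f" and cn_holo_pd: "cn_holo D (pd v f)"
proof -
  have local: "\<exists>U \<rho>. open U \<and> z0 \<in> U \<and> U \<subseteq> D \<and> \<rho> > 0 \<and> (\<forall>z\<in>U. \<forall>\<zeta>. cmod \<zeta> \<le> \<rho> \<longrightarrow> z + \<zeta> *s v \<in> D)" if z0: "z0 \<in> D" for z0 v
  proof -
    obtain e where e: "e > 0" "ball z0 e \<subseteq> D" using D z0 open_contains_ball by blast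
    \<comment> \<open>One radius for all z in the ball of radius e / 2, so that the representation
      can be differentiated in z; the summand 1 covers v = 0.\<close>
    define \<rho> where "\<rho> = e / (2 * (norm v + 1))"
    have nv: "norm v + 1 > 0" using norm_ge_zero[of v] by linarith
    have \<rho>: "\<rho> > 0" unfolding \<rho>_def using e nv by simp
    have \<rho>v: "\<rho> * norm v < e / 2"
    proof -
      have "\<rho> * norm v < \<rho> * (norm v + 1)" using \<rho> by simp
      also have "\<dots> = e / 2" unfolding \<rho>_def using nv by (simp add: field_simps)
      finally show ?thesis .
    qed
    have "z + \<zeta> *s v \<in> D" if "z \<in> ball z0 (e / 2)" "cmod \<zeta> \<le> \<rho>" for z \<zeta>
    proof -
      have "norm (\<zeta> *s v) \<le> \<rho> * norm v" unfolding norm_vector_scalar_mult using that(2) by (rule mult_right_mono) simp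
      then have "dist z0 (z + \<zeta> *s v) < e" using that(1) \<rho>v dist_triangle[of z0 "z + \<zeta> *s v" z] by (simp add: dist_norm)
      then show ?thesis using e by auto
    qed
    note in_D = this
    show ?thesis
    proof (intro exI[of _ "ball z0 (e / 2)"] exI[of _ \<rho>] conjI ballI allI impI)
      have "ball z0 (e / 2) \<subseteq> ball z0 e" using e(1) by (intro subset_ball) simp
      then show "ball z0 (e / 2) \<subseteq> D" using e(2) by (rule subset_trans)
      show "z0 \<in> ball z0 (e / 2)" using e(1) by simp
    qed (use \<rho> in_D in \<open>blast+\<close>)
  qed
  define \<kappa> where "\<kappa> \<rho> x = inverse (of_real \<rho> * exp (2 * of_real pi * \<i> * of_real x))" for \<rho> x :: real
  define \<psi> where "\<psi> \<rho> v x = (of_real \<rho> * exp (2 * of_real pi * \<i> * of_real x)) *s v" for \<rho> x :: real and v :: "complex^'n"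
  have \<kappa>c: "continuous_on (cbox 0 1) (\<kappa> \<rho>)" if "\<rho> > 0" for \<rho> unfolding \<kappa>_def[abs_def]
    using that by (intro continuous_intros) auto
  have \<psi>c: "continuous_on (cbox 0 1) (\<psi> \<rho> v)" for \<rho> v unfolding \<psi>_def[abs_def]
    by (rule bounded_linear.continuous_on[OF bounded_linear_vector_scalar_mult]) (intro continuous_intros)
  have n\<psi>: "cmod (of_real \<rho> * exp (2 * of_real pi * \<i> * of_real x)) \<le> \<rho>" if "\<rho> > 0" for \<rho> x :: real
    using that by (simp add: norm_mult)
  have rep: "\<exists>U \<rho>. open U \<and> z0 \<in> U \<and> U \<subseteq> D \<and> \<rho> > 0 \<and> (\<forall>z\<in>U. \<forall>x. z + \<psi> \<rho> v x \<in> D) \<and> (\<forall>z\<in>U. pd v f z = integral (cbox 0 1) (\<lambda>x. \<kappa> \<rho> x * f (z + \<psi> \<rho> v x)))" if z0: "z0 \<in> D" for z0 v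
  proof -
    obtain U \<rho> where U: "open U" "z0 \<in> U" "U \<subseteq> D" "\<rho> > 0" "\<And>z \<zeta>. z \<in> U \<Longrightarrow> cmod \<zeta> \<le> \<rho> \<Longrightarrow> z + \<zeta> *s v \<in> D"
      using local[OF z0, of v] by blast
    have "pd v f z = integral (cbox 0 1) (\<lambda>x. \<kappa> \<rho> x * f (z + \<psi> \<rho> v x))" if "z \<in> U" for z
      unfolding \<kappa>_def \<psi>_def using integral_unique[OF Cauchy_pd[OF f U(4) U(5)[OF that]]] by simp
    moreover have "z + \<psi> \<rho> v x \<in> D" if "z \<in> U" for z x unfolding \<psi>_def by (rule U(5)[OF that n\<psi>[OF U(4)]])
    ultimately show ?thesis using U by blast
  qed
  have fd: "f differentiable at z" "pd (a *s v) f z = a * pd v f z" if "z \<in> D" for z a v using f that by (auto simp: cn_holo_def)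
  have fc: "continuous_on D f" using fd(1) by (meson continuous_at_imp_continuous_on differentiable_imp_continuous_within)
  have c1: "C1_on D f"
    unfolding C1_on_def
  proof (intro conjI ballI allI continuous_at_imp_continuous_on)
    fix v z0 assume "z0 \<in> D"
    then obtain U \<rho> where U: "open U" "z0 \<in> U" "U \<subseteq> D" "\<rho> > 0" "\<And>z x. z \<in> U \<Longrightarrow> z + \<psi> \<rho> v x \<in> D" "\<And>z. z \<in> U \<Longrightarrow> pd v f z = integral (cbox 0 1) (\<lambda>x. \<kappa> \<rho> x * f (z + \<psi> \<rho> v x))"
      using rep by meson
    have "continuous_on U (\<lambda>z. integral (cbox 0 1) (\<lambda>x. \<kappa> \<rho> x * f (z + \<psi> \<rho> v x)))"
    proof (rule integral_continuous_on_param)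
      have "continuous_on (U \<times> cbox 0 1) (\<lambda>p. \<kappa> \<rho> (snd p))"
        by (rule continuous_on_compose2[OF \<kappa>c[OF U(4)]]) (auto intro!: continuous_intros)
      moreover have "continuous_on (U \<times> cbox 0 1) (\<lambda>p. \<psi> \<rho> v (snd p))"
        by (rule continuous_on_compose2[OF \<psi>c]) (auto intro!: continuous_intros)
      then have "continuous_on (U \<times> cbox 0 1) (\<lambda>p. f (fst p + \<psi> \<rho> v (snd p)))"
        by (intro continuous_on_compose2[OF fc]) (use U in \<open>auto intro!: continuous_intros\<close>)
      ultimately show "continuous_on (U \<times> cbox 0 1) (\<lambda>(z, x). \<kappa> \<rho> x * f (z + \<psi> \<rho> v x))" unfolding split_def by (intro continuous_intros)
    qed
    then have "continuous_on U (pd v f)" by (rule continuous_on_eq) (use U in auto)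
    then show "isCont (pd v f) z0" using U continuous_on_eq_continuous_at by blast
  qed (use fd in auto)
  have loc2: "\<exists>U. open U \<and> z0 \<in> U \<and> C1_on U (pd v f) \<and> (\<forall>z\<in>U. \<forall>a w. pd (a *s w) (pd v f) z = a * pd w (pd v f) z)" if z0: "z0 \<in> D" for z0 v
  proof -
    obtain U \<rho> where U: "open U" "z0 \<in> U" "U \<subseteq> D" "\<rho> > 0" "\<And>z x. z \<in> U \<Longrightarrow> z + \<psi> \<rho> v x \<in> D" "\<And>z. z \<in> U \<Longrightarrow> pd v f z = integral (cbox 0 1) (\<lambda>x. \<kappa> \<rho> x * f (z + \<psi> \<rho> v x))"
      using rep[OF z0] by meson
    let ?G = "\<lambda>z. integral (cbox 0 1) (\<lambda>x. \<kappa> \<rho> x * f (z + \<psi> \<rho> v x))"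
    have C: "C1_on U ?G" by (rule C1_on_param_integral[OF c1 \<psi>c \<kappa>c[OF U(4)] U(1) U(5)])
    have p: "pd w ?G z = integral (cbox 0 1) (\<lambda>x. \<kappa> \<rho> x * pd w f (z + \<psi> \<rho> v x))" if "z \<in> U" for w z
      by (rule pd_param_integral[OF c1 \<psi>c \<kappa>c[OF U(4)] U(1) U(5) that])
    have pw: "pd w (pd v f) z = pd w ?G z" if "z \<in> U" for w z by (rule pd_cong_open[OF U(1) that U(6)])
    have "pd (a *s w) (pd v f) z = a * pd w (pd v f) z" if z: "z \<in> U" for z a w
    proof -
      have "pd (a *s w) (pd v f) z = integral (cbox 0 1) (\<lambda>x. a * (\<kappa> \<rho> x * pd w f (z + \<psi> \<rho> v x)))"
        unfolding pw[OF z] p[OF z] by (rule integral_cong) (simp add: fd(2)[OF U(5)[OF z]])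
      then show ?thesis unfolding pw[OF z] p[OF z] by simp
    qed
    moreover have "C1_on U (pd v f)" by (rule C1_on_cong[OF U(1) _ C]) (use U(6) in auto)
    ultimately show ?thesis using U by blast
  qed
  have "C1_on D (pd v f)" for v by (rule C1_on_local) (use loc2 in meson)
  then show "C2_on D f" using c1 by (simp add: C2_on_def)
  then show "cn_holo D (pd v f)" for v
    unfolding cn_holo_def C2_on_def C1_on_def using loc2 by blast
qed

text \<open>The second derivatives of a holomorphic g along \<xi> and \<i> \<xi> are opposite, so in
  the Laplacian of |g|^2 only the squares of the first derivatives survive.\<close>

lemma
  fixes g :: "complex^'n::finite \<Rightarrow> complex"
  assumes D: "open D" and g: "cn_holo D g"
  shows C2_on_cmod_sq: "C2_on D (\<lambda>x. (cmod (g x))\<^sup>2)"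
    and pd_cmod_sq: "x \<in> D \<Longrightarrow> pd u (\<lambda>x. (cmod (g x))\<^sup>2) x = 2 * Re (cnj (g x) * pd u g x)"
    and lap_cmod_sq: "x \<in> D \<Longrightarrow> lap (\<lambda>x. (cmod (g x))\<^sup>2) x \<xi> = 4 * (cmod (pd \<xi> g x))\<^sup>2"
proof -
  let ?G = "\<lambda>x. cnj (g x) * g x"
  have e: "(\<lambda>x. (cmod (g x))\<^sup>2) = (\<lambda>x. Re (?G x))" by (simp only: cmod_power2) (simp add: power2_eq_square)
  have g2: "C2_on D g" by (rule cn_holo_C2[OF D g])
  have gc: "C2_on D (\<lambda>x. cnj (g x))" by (rule C2_on_bounded_linear[OF D bounded_linear_cnj g2])
  have G2: "C2_on D ?G" by (rule C2_on_mult[OF D gc g2])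
  show "C2_on D (\<lambda>x. (cmod (g x))\<^sup>2)" unfolding e by (rule C2_on_bounded_linear[OF D bounded_linear_Re G2])
  have d: "g differentiable at x" "pd u g differentiable at x" "?G differentiable at x" "pd u ?G differentiable at x" if "x \<in> D" for x u
    using g2 G2 that by (auto simp: C2_on_def C1_on_def)
  have pc: "pd u (\<lambda>x. cnj (g x)) x = cnj (pd u g x)" if "x \<in> D" for x u by (rule pd_bounded_linear[OF bounded_linear_cnj d(1)[OF that]])
  have pG: "pd u ?G x = cnj (g x) * pd u g x + cnj (pd u g x) * g x" if "x \<in> D" for x u
    using pd_mult[OF differentiable_cnj[OF d(1)[OF that]] d(1)[OF that]] pc[OF that] by simp
  have p1: "pd u (\<lambda>x. Re (?G x)) x = Re (pd u ?G x)" if "x \<in> D" for x u by (rule pd_bounded_linear[OF bounded_linear_Re d(3)[OF that]])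
  show "pd u (\<lambda>x. (cmod (g x))\<^sup>2) x = 2 * Re (cnj (g x) * pd u g x)" if "x \<in> D" for x u
    unfolding e p1[OF that] pG[OF that] by simp
  have p2: "pd u (pd u (\<lambda>x. Re (?G x))) x = 2 * Re (cnj (g x) * pd u (pd u g) x) + 2 * (cmod (pd u g x))\<^sup>2" if x: "x \<in> D" for x u
  proof -
    have "pd u (pd u (\<lambda>x. Re (?G x))) x = pd u (\<lambda>x. Re (pd u ?G x)) x" by (rule pd_cong_open[OF D x p1])
    also have "\<dots> = Re (pd u (pd u ?G) x)" by (rule pd_bounded_linear[OF bounded_linear_Re d(4)[OF x]])
    also have "pd u (pd u ?G) x = pd u (\<lambda>x. cnj (g x) * pd u g x + cnj (pd u g x) * g x) x" by (rule pd_cong_open[OF D x pG])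
    also have "\<dots> = cnj (g x) * pd u (pd u g) x + cnj (pd u g x) * pd u g x + (cnj (pd u g x) * pd u g x + cnj (pd u (pd u g) x) * g x)"
      using x d by (simp add: pd_add pd_mult differentiable_mult differentiable_cnj pc pd_bounded_linear[OF bounded_linear_cnj])
    finally have E: "pd u (pd u (\<lambda>x. Re (?G x))) x = Re (cnj (g x) * pd u (pd u g) x + cnj (pd u g x) * pd u g x + (cnj (pd u g x) * pd u g x + cnj (pd u (pd u g) x) * g x))" .
    show ?thesis unfolding E cmod_power2 by (simp add: power2_eq_square)
  qed
  show "lap (\<lambda>x. (cmod (g x))\<^sup>2) x \<xi> = 4 * (cmod (pd \<xi> g x))\<^sup>2" if x: "x \<in> D" for x
  proof -
    have l: "pd (\<i> *s \<xi>) g y = \<i> * pd \<xi> g y" if "y \<in> D" for y using g that by (simp add: cn_holo_def)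
    have "pd (\<i> *s \<xi>) (pd (\<i> *s \<xi>) g) x = pd (\<i> *s \<xi>) (\<lambda>y. \<i> * pd \<xi> g y) x" by (rule pd_cong_open[OF D x l])
    also have "\<dots> = \<i> * pd (\<i> *s \<xi>) (pd \<xi> g) x" by (rule pd_bounded_linear[OF bounded_linear_mult_right d(2)[OF x]])
    also have "pd (\<i> *s \<xi>) (pd \<xi> g) x = \<i> * pd \<xi> (pd \<xi> g) x" using cn_holo_pd[OF D g, of \<xi>] x by (simp add: cn_holo_def)
    finally have "pd (\<i> *s \<xi>) (pd (\<i> *s \<xi>) g) x = - pd \<xi> (pd \<xi> g) x" by simp
    then show ?thesis unfolding lap_def e p2[OF x] l[OF x] by (simp add: norm_mult)
  qed
qed

text \<open>Up to the factor 4 / S^2 the Laplacian of ln S is S times the sum of the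
  |\<partial>g_i|^2 minus the square of the modulus of the sum of the cnj g_i \<partial>g_i, and
  Cauchy-Schwarz applies.\<close>

lemma lap_ln_sum_nonneg:
  fixes g :: "nat \<Rightarrow> complex^'n::finite \<Rightarrow> complex"
  assumes D: "open D" and g: "\<And>i. i \<in> I \<Longrightarrow> cn_holo D (g i)"
  defines "S \<equiv> \<lambda>x. \<Sum>i\<in>I. (cmod (g i x))\<^sup>2"
  shows "C2_on D S" and "C2_on {x\<in>D. 0 < S x} (\<lambda>x. ln (S x))" and "x \<in> D \<Longrightarrow> 0 < S x \<Longrightarrow> lap (\<lambda>x. ln (S x)) x \<xi> \<ge> 0"
    and "open {x\<in>D. 0 < S x}"
proof -
  show S2: "C2_on D S" unfolding S_def by (intro C2_on_sum D C2_on_cmod_sq g)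
  define P where "P = {x\<in>D. 0 < S x}"
  have Pe: "P = D \<inter> S -` {0<..}" by (auto simp: P_def)
  show oP: "open {x\<in>D. 0 < S x}" unfolding P_def[symmetric] Pe
    by (rule continuous_open_preimage[OF C1_on_continuous[OF C2_on_C1[OF S2]] D open_greaterThan])
  have S2P: "C2_on P S" by (rule C2_on_subset[OF S2]) (auto simp: P_def)
  have der: "(ln has_real_derivative inverse y) (at y)" "(inverse has_real_derivative - (inverse y ^ 2)) (at y)" if "y > 0" for y :: real
    using that by (auto intro!: derivative_eq_intros simp: power2_eq_square field_simps)
  show "C2_on {x\<in>D. 0 < S x} (\<lambda>x. ln (S x))" unfolding P_def[symmetric]
    by (rule C2_on_compose[where T="{0<..}" and m'=inverse and m''="\<lambda>y. - (inverse y ^ 2)", OF oP[folded P_def] S2P])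
       (use der in \<open>auto simp: P_def intro!: continuous_intros\<close>)
  assume x: "x \<in> D" "0 < S x"
  then have xP: "x \<in> P" by (simp add: P_def)
  have "lap (\<lambda>x. ln (S x)) x \<xi> = inverse (S x) * lap S x \<xi> + (- (inverse (S x) ^ 2)) * ((pd \<xi> S x)\<^sup>2 + (pd (\<i> *s \<xi>) S x)\<^sup>2)"
    by (rule lap_compose[OF oP[folded P_def] xP S2P]) (use der in \<open>auto simp: P_def\<close>)
  moreover have "lap S x \<xi> = 4 * (\<Sum>i\<in>I. (cmod (pd \<xi> (g i) x))\<^sup>2)"
  proof -
    have "lap (\<lambda>x. \<Sum>i\<in>I'. (cmod (g i x))\<^sup>2) x \<xi> = (\<Sum>i\<in>I'. lap (\<lambda>x. (cmod (g i x))\<^sup>2) x \<xi>)" if "I' \<subseteq> I" for I'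
      using that
    proof (induction I' rule: infinite_finite_induct)
      case (insert i F)
      have "lap (\<lambda>x. (cmod (g i x))\<^sup>2 + (\<Sum>i\<in>F. (cmod (g i x))\<^sup>2)) x \<xi> = lap (\<lambda>x. (cmod (g i x))\<^sup>2) x \<xi> + lap (\<lambda>x. \<Sum>i\<in>F. (cmod (g i x))\<^sup>2) x \<xi>"
        by (rule lap_add[OF D x(1)]) (use insert in \<open>auto intro!: C2_on_sum D C2_on_cmod_sq g\<close>)
      then show ?case using insert by simp
    qed (auto simp: lap_const)
    then have "lap S x \<xi> = (\<Sum>i\<in>I. lap (\<lambda>x. (cmod (g i x))\<^sup>2) x \<xi>)" unfolding S_def by simp
    also have "\<dots> = (\<Sum>i\<in>I. 4 * (cmod (pd \<xi> (g i) x))\<^sup>2)" by (rule sum.cong) (auto intro!: lap_cmod_sq[OF D g x(1)])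
    finally show ?thesis by (simp add: sum_distrib_left)
  qed
  moreover have "(pd \<xi> S x)\<^sup>2 + (pd (\<i> *s \<xi>) S x)\<^sup>2 = 4 * (cmod (\<Sum>i\<in>I. cnj (g i x) * pd \<xi> (g i) x))\<^sup>2"
  proof -
    have pS: "pd u S x = 2 * Re (\<Sum>i\<in>I. cnj (g i x) * pd u (g i) x)" for u
    proof -
      have "pd u S x = (\<Sum>i\<in>I. pd u (\<lambda>x. (cmod (g i x))\<^sup>2) x)" unfolding S_def
        by (rule pd_sum) (use C2_on_cmod_sq[OF D g] x in \<open>auto simp: C2_on_def C1_on_def\<close>)
      also have "\<dots> = (\<Sum>i\<in>I. 2 * Re (cnj (g i x) * pd u (g i) x))" by (rule sum.cong) (auto simp: pd_cmod_sq[OF D g x(1)])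
      finally show ?thesis by (simp add: sum_distrib_left)
    qed
    have "(\<Sum>i\<in>I. cnj (g i x) * pd (\<i> *s \<xi>) (g i) x) = \<i> * (\<Sum>i\<in>I. cnj (g i x) * pd \<xi> (g i) x)"
      unfolding sum_distrib_left by (rule sum.cong) (use g x in \<open>auto simp: cn_holo_def\<close>)
    then show ?thesis unfolding pS by (simp add: cmod_power2 power_mult_distrib del: Re_sum Im_sum)
  qed
  moreover have "(cmod (\<Sum>i\<in>I. cnj (g i x) * pd \<xi> (g i) x))\<^sup>2 \<le> S x * (\<Sum>i\<in>I. (cmod (pd \<xi> (g i) x))\<^sup>2)"
  proof -
    have "cmod (\<Sum>i\<in>I. cnj (g i x) * pd \<xi> (g i) x) \<le> (\<Sum>i\<in>I. cmod (g i x) * cmod (pd \<xi> (g i) x))"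
      using norm_sum[of "\<lambda>i. cnj (g i x) * pd \<xi> (g i) x" I] by (simp add: norm_mult)
    then have "(cmod (\<Sum>i\<in>I. cnj (g i x) * pd \<xi> (g i) x))\<^sup>2 \<le> (\<Sum>i\<in>I. cmod (g i x) * cmod (pd \<xi> (g i) x))\<^sup>2" by (intro power_mono) auto
    also have "\<dots> \<le> S x * (\<Sum>i\<in>I. (cmod (pd \<xi> (g i) x))\<^sup>2)" unfolding S_def by (rule Cauchy_Schwarz_ineq_sum)
    finally show ?thesis .
  qed
  moreover have "inverse (S x) * (4 * A) + (- (inverse (S x) ^ 2)) * (4 * B) \<ge> 0" if "B \<le> S x * A" for A B :: real
  proof -
    have "inverse (S x) ^ 2 * B \<le> inverse (S x) ^ 2 * (S x * A)" using that by (intro mult_left_mono) auto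
    also have "\<dots> = inverse (S x) * A" using x by (simp add: power2_eq_square)
    finally show ?thesis by (simp add: algebra_simps)
  qed
  ultimately show "lap (\<lambda>x. ln (S x)) x \<xi> \<ge> 0" by simp
qed

text \<open>Average the second order Taylor expansion over a small circle: the first order terms
  cancel and s^2 / 4 times the Laplacian remains, which must not be negative. An upper Taylor bound
  is enough; it comes from bounding the second derivative near z and integrating twice.\<close>

lemma submean_lap_nonneg:
  fixes U :: "complex^'n::finite \<Rightarrow> real"
  assumes P: "open P" "z \<in> P" and U: "C2_on P U"
    and sm: "\<forall>\<^sub>F s in at_right (0::real). 2 * pi * U z \<le> integral {0..2*pi} (\<lambda>\<theta>. U (z + (of_real s * cis \<theta>) *s b))"
  shows "lap U z b \<ge> 0"
proof (rule ccontr)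
  assume "\<not> lap U z b \<ge> 0"
  then have neg: "lap U z b < 0" by simp
  \<comment> \<open>Four second derivatives may each deviate by \<kappa>, which adds 8 \<pi>
    \<kappa> to the integral of H; against \<pi> times the Laplacian, that is - 16 \<pi> \<kappa>,
    the total stays negative.\<close>
  define \<kappa> where "\<kappa> = - lap U z b / 16"
  have \<kappa>: "\<kappa> > 0" using neg by (simp add: \<kappa>_def)
  define b2 where "b2 = \<i> *s b"
  define v where "v \<theta> = cos \<theta> *\<^sub>R b + sin \<theta> *\<^sub>R b2" for \<theta>
  have ve: "(of_real s * cis \<theta>) *s b = s *\<^sub>R v \<theta>" for s \<theta>
    by (simp add: vec_eq_iff v_def b2_def complex_eq_iff algebra_simps)
  define D11 where "D11 = pd b (pd b U)"
  define D12 where "D12 = pd b (pd b2 U)"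
  define D21 where "D21 = pd b2 (pd b U)"
  define D22 where "D22 = pd b2 (pd b2 U)"
  have d: "U differentiable at x" "pd u U differentiable at x" if "x \<in> P" for x u
    using U that by (auto simp: C2_on_def C1_on_def)
  have pv: "pd (v \<theta>) U x = cos \<theta> * pd b U x + sin \<theta> * pd b2 U x" if "x \<in> P" for \<theta> x
    unfolding v_def using linear_add[OF linear_pd[OF d(1)[OF that]]] linear_scale[OF linear_pd[OF d(1)[OF that]]] by simp
  have pvv: "pd (v \<theta>) (pd (v \<theta>) U) x = (cos \<theta>)\<^sup>2 * D11 x + cos \<theta> * sin \<theta> * (D12 x + D21 x) + (sin \<theta>)\<^sup>2 * D22 x" if x: "x \<in> P" for \<theta> x
  proof -
    have "pd (v \<theta>) (pd (v \<theta>) U) x = pd (v \<theta>) (\<lambda>y. cos \<theta> * pd b U y + sin \<theta> * pd b2 U y) x"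
      by (rule pd_cong_open[OF P(1) x pv])
    also have "\<dots> = cos \<theta> * pd (v \<theta>) (pd b U) x + sin \<theta> * pd (v \<theta>) (pd b2 U) x"
      using d(2)[OF x] by (simp add: pd_add pd_bounded_linear[OF bounded_linear_mult_right])
    finally have 1: "pd (v \<theta>) (pd (v \<theta>) U) x = cos \<theta> * pd (v \<theta>) (pd b U) x + sin \<theta> * pd (v \<theta>) (pd b2 U) x" .
    have 2: "pd (v \<theta>) (pd u U) x = cos \<theta> * pd b (pd u U) x + sin \<theta> * pd b2 (pd u U) x" for u
      unfolding v_def using linear_add[OF linear_pd[OF d(2)[OF x]]] linear_scale[OF linear_pd[OF d(2)[OF x]]] by simp
    show ?thesis unfolding 1 2[of b] 2[of b2] by (simp add: D11_def D12_def D21_def D22_def power2_eq_square algebra_simps)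
  qed
  have cont: "isCont D11 z" "isCont D12 z" "isCont D21 z" "isCont D22 z"
  proof -
    have "isCont (pd u (pd w U)) z" for u w
      using C1_on_pd_continuous[OF C2_on_pd[OF U], of u w] continuous_on_eq_continuous_at[OF P(1)] P(2) by blast
    then show "isCont D11 z" "isCont D12 z" "isCont D21 z" "isCont D22 z"
      unfolding D11_def D12_def D21_def D22_def by blast+
  qed
  have near: "\<exists>r>0. \<forall>x. dist x z < r \<longrightarrow> \<bar>D x - D z\<bar> < \<kappa>" if "isCont D z" for D :: "complex^'n \<Rightarrow> real"
    using that \<kappa> unfolding continuous_at_eps_delta dist_real_def by blast
  obtain r1 where r1: "r1 > 0" "\<And>x. dist x z < r1 \<Longrightarrow> \<bar>D11 x - D11 z\<bar> < \<kappa>" using near[OF cont(1)] by blast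
  obtain r2 where r2: "r2 > 0" "\<And>x. dist x z < r2 \<Longrightarrow> \<bar>D12 x - D12 z\<bar> < \<kappa>" using near[OF cont(2)] by blast
  obtain r3 where r3: "r3 > 0" "\<And>x. dist x z < r3 \<Longrightarrow> \<bar>D21 x - D21 z\<bar> < \<kappa>" using near[OF cont(3)] by blast
  obtain r4 where r4: "r4 > 0" "\<And>x. dist x z < r4 \<Longrightarrow> \<bar>D22 x - D22 z\<bar> < \<kappa>" using near[OF cont(4)] by blast
  obtain r5 where r5: "r5 > 0" "ball z r5 \<subseteq> P" using P open_contains_ball by blast
  define r0 where "r0 = min (min r1 r2) (min (min r3 r4) r5)"
  have r0: "r0 > 0" using r1 r2 r3 r4 r5 by (simp add: r0_def)
  \<comment> \<open>The second derivative at z in the direction v \<theta>, raised by the total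
    deviation 4 \<kappa>.\<close>
  define H where "H \<theta> = (cos \<theta>)\<^sup>2 * D11 z + cos \<theta> * sin \<theta> * (D12 z + D21 z) + (sin \<theta>)\<^sup>2 * D22 z + 4 * \<kappa>" for \<theta>
  have Hb: "pd (v \<theta>) (pd (v \<theta>) U) x \<le> H \<theta>" if "dist x z < r0" for x \<theta>
  proof -
    have x: "x \<in> P" using that r5 by (auto simp: r0_def dist_commute)
    have m: "\<bar>c * (D x - D z)\<bar> \<le> \<kappa>" if "\<bar>c\<bar> \<le> 1" "\<bar>D x - D z\<bar> < \<kappa>" for c :: real and D
      using mult_mono[OF that(1) less_imp_le[OF that(2)]] by (simp add: abs_mult)
    have c: "\<bar>(cos \<theta>)\<^sup>2\<bar> \<le> 1" "\<bar>(sin \<theta>)\<^sup>2\<bar> \<le> 1" "\<bar>cos \<theta> * sin \<theta>\<bar> \<le> 1"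
      using abs_square_le_1[of "cos \<theta>"] abs_square_le_1[of "sin \<theta>"] mult_le_one[of "\<bar>cos \<theta>\<bar>" "\<bar>sin \<theta>\<bar>"] by (auto simp: abs_mult)
    have "(cos \<theta>)\<^sup>2 * (D11 x - D11 z) \<le> \<kappa>" "(sin \<theta>)\<^sup>2 * (D22 x - D22 z) \<le> \<kappa>" "cos \<theta> * sin \<theta> * (D12 x - D12 z) \<le> \<kappa>" "cos \<theta> * sin \<theta> * (D21 x - D21 z) \<le> \<kappa>"
      using m[OF c(1), of D11] m[OF c(2), of D22] m[OF c(3), of D12] m[OF c(3), of D21] r1(2)[of x] r2(2)[of x] r3(2)[of x] r4(2)[of x] that unfolding r0_def by auto
    then show ?thesis unfolding pvv[OF x] H_def by (simp add: algebra_simps)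
  qed
  have nv: "norm (v \<theta>) \<le> 2 * norm b" for \<theta>
  proof -
    have "norm (v \<theta>) \<le> \<bar>cos \<theta>\<bar> * norm b + \<bar>sin \<theta>\<bar> * norm b2" unfolding v_def by (rule order_trans[OF norm_triangle_ineq]) simp
    also have "\<dots> \<le> 1 * norm b + 1 * norm b2" by (intro add_mono mult_right_mono) auto
    also have "norm b2 = norm b" by (simp add: b2_def norm_vector_scalar_mult)
    finally show ?thesis by simp
  qed
  define s1 where "s1 = r0 / (2 * norm b + 1)"
  have nb: "2 * norm b + 1 > 0" using norm_ge_zero[of b] by linarith
  have s1: "s1 > 0" unfolding s1_def using r0 nb by simp
  have inr: "dist (z + s *\<^sub>R v \<theta>) z < r0" if "0 \<le> s" "s < s1" for s \<theta>
  proof -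
    have "s * norm (v \<theta>) \<le> s * (2 * norm b)" using nv that by (intro mult_left_mono) auto
    also have "\<dots> \<le> s * (2 * norm b + 1)" using that by (intro mult_left_mono) auto
    also have "\<dots> < s1 * (2 * norm b + 1)" using that nb by simp
    also have "\<dots> = r0" using nb by (simp add: s1_def)
    finally show ?thesis using that by (simp add: dist_norm)
  qed
  have inP: "z + s *\<^sub>R v \<theta> \<in> P" if "0 \<le> s" "s < s1" for s \<theta>
    using inr[OF that, of \<theta>] r5 by (auto simp: r0_def dist_commute)
  have taylor: "U (z + s *\<^sub>R v \<theta>) \<le> U z + s * pd (v \<theta>) U z + s\<^sup>2 / 2 * H \<theta>" if s: "0 \<le> s" "s < s1" for s \<theta>
  proof -
    have g1: "((\<lambda>s. U (z + s *\<^sub>R v \<theta>)) has_real_derivative pd (v \<theta>) U (z + y *\<^sub>R v \<theta>)) (at y)" if "0 \<le> y" "y \<le> s" for y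
      using line_has_vector_derivative[OF d(1)[OF inP[of y \<theta>]]] that s by (simp add: has_real_derivative_iff_has_vector_derivative)
    have g2: "((\<lambda>s. pd (v \<theta>) U (z + s *\<^sub>R v \<theta>)) has_real_derivative pd (v \<theta>) (pd (v \<theta>) U) (z + y *\<^sub>R v \<theta>)) (at y)" if "0 \<le> y" "y \<le> s" for y
      using line_has_vector_derivative[OF d(2)[OF inP[of y \<theta>]]] that s by (simp add: has_real_derivative_iff_has_vector_derivative)
    have h1: "pd (v \<theta>) U (z + y *\<^sub>R v \<theta>) \<le> pd (v \<theta>) U z + y * H \<theta>" if y: "0 \<le> y" "y \<le> s" for y
    proof -
      have "(\<lambda>y. pd (v \<theta>) U z + y * H \<theta> - pd (v \<theta>) U (z + y *\<^sub>R v \<theta>)) 0 \<le> (\<lambda>y. pd (v \<theta>) U z + y * H \<theta> - pd (v \<theta>) U (z + y *\<^sub>R v \<theta>)) y"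
      proof (rule DERIV_nonneg_imp_nondecreasing[OF y(1)])
        fix x assume x: "0 \<le> x" "x \<le> y"
        have "((\<lambda>y. pd (v \<theta>) U z + y * H \<theta> - pd (v \<theta>) U (z + y *\<^sub>R v \<theta>)) has_real_derivative H \<theta> - pd (v \<theta>) (pd (v \<theta>) U) (z + x *\<^sub>R v \<theta>)) (at x)"
          using g2[of x] x y by (auto intro!: derivative_eq_intros)
        moreover have "H \<theta> - pd (v \<theta>) (pd (v \<theta>) U) (z + x *\<^sub>R v \<theta>) \<ge> 0" using Hb[OF inr[of x \<theta>]] x y s by simp
        ultimately show "\<exists>y. ((\<lambda>y. pd (v \<theta>) U z + y * H \<theta> - pd (v \<theta>) U (z + y *\<^sub>R v \<theta>)) has_real_derivative y) (at x) \<and> 0 \<le> y" by blast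
      qed
      then show ?thesis by simp
    qed
    have "(\<lambda>y. U z + y * pd (v \<theta>) U z + y\<^sup>2 / 2 * H \<theta> - U (z + y *\<^sub>R v \<theta>)) 0 \<le> (\<lambda>y. U z + y * pd (v \<theta>) U z + y\<^sup>2 / 2 * H \<theta> - U (z + y *\<^sub>R v \<theta>)) s"
    proof (rule DERIV_nonneg_imp_nondecreasing[OF s(1)])
      fix x assume x: "0 \<le> x" "x \<le> s"
      have "((\<lambda>y. U z + y * pd (v \<theta>) U z + y\<^sup>2 / 2 * H \<theta> - U (z + y *\<^sub>R v \<theta>)) has_real_derivative pd (v \<theta>) U z + x * H \<theta> - pd (v \<theta>) U (z + x *\<^sub>R v \<theta>)) (at x)"
        using g1[of x] x by (auto intro!: derivative_eq_intros)
      moreover have "pd (v \<theta>) U z + x * H \<theta> - pd (v \<theta>) U (z + x *\<^sub>R v \<theta>) \<ge> 0" using h1[OF x] by simp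
      ultimately show "\<exists>y. ((\<lambda>y. U z + y * pd (v \<theta>) U z + y\<^sup>2 / 2 * H \<theta> - U (z + y *\<^sub>R v \<theta>)) has_real_derivative y) (at x) \<and> 0 \<le> y" by blast
    qed
    then show ?thesis by simp
  qed
  have "\<forall>\<^sub>F s in at_right (0::real). s < s1" using s1 unfolding eventually_at_right_field by auto
  then have "\<forall>\<^sub>F s in at_right (0::real). (2 * pi * U z \<le> integral {0..2*pi} (\<lambda>\<theta>. U (z + (of_real s * cis \<theta>) *s b))) \<and> s < s1 \<and> 0 < s"
    using sm by (intro eventually_conj eventually_at_right_less)
  then obtain s where s: "2 * pi * U z \<le> integral {0..2*pi} (\<lambda>\<theta>. U (z + s *\<^sub>R v \<theta>))" "s < s1" "0 < s"
    unfolding ve by (auto dest!: eventually_happens'[OF trivial_limit_at_right_real])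
  define R where "R \<theta> = U z + s * (cos \<theta> * pd b U z + sin \<theta> * pd b2 U z) + s\<^sup>2 / 2 * H \<theta>" for \<theta>
  \<comment> \<open>An explicit primitive of R, so that the mean of the Taylor bound is a difference
    of two values.\<close>
  define RI where "RI \<theta> = U z * \<theta> + s * (sin \<theta> * pd b U z - cos \<theta> * pd b2 U z) + s\<^sup>2 / 2 * ((\<theta> + sin \<theta> * cos \<theta>) / 2 * D11 z + (sin \<theta>)\<^sup>2 / 2 * (D12 z + D21 z) + (\<theta> - sin \<theta> * cos \<theta>) / 2 * D22 z + 4 * \<kappa> * \<theta>)" for \<theta>
  have RI: "(RI has_vector_derivative R \<theta>) (at \<theta> within {0..2*pi})" for \<theta>
  proof -
    have sc: "(sin \<theta>)\<^sup>2 = 1 - (cos \<theta>)\<^sup>2" by (simp add: sin_squared_eq)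
    have "(RI has_real_derivative R \<theta>) (at \<theta>)"
      unfolding RI_def[abs_def] R_def H_def
      by (rule derivative_eq_intros refl | simp)+ (simp add: sc power2_eq_square[symmetric] algebra_simps, simp add: field_simps)
    then show ?thesis using has_field_derivative_at_within has_real_derivative_iff_has_vector_derivative by blast
  qed
  have "(R has_integral (RI (2 * pi) - RI 0)) {0..2*pi}"
    by (rule fundamental_theorem_of_calculus) (use RI in auto)
  then have Ri: "R integrable_on {0..2*pi}" "integral {0..2*pi} R = RI (2 * pi) - RI 0" by (auto simp: integral_unique)
  have cU: "continuous_on P U" by (rule C1_on_continuous[OF C2_on_C1[OF U]])
  have "continuous_on {0..2*pi} (\<lambda>\<theta>. U (z + s *\<^sub>R v \<theta>))"
    by (rule continuous_on_compose2[OF cU]) (use inP s in \<open>auto simp: v_def intro!: continuous_intros\<close>)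
  then have "integral {0..2*pi} (\<lambda>\<theta>. U (z + s *\<^sub>R v \<theta>)) \<le> integral {0..2*pi} R"
    using taylor[of s] s pv[OF P(2)] by (intro integral_le integrable_continuous_real Ri) (auto simp: R_def)
  also have "\<dots> = 2 * pi * U z + s\<^sup>2 / 2 * (pi * (D11 z + D22 z) + 8 * pi * \<kappa>)"
    unfolding Ri RI_def by (simp add: algebra_simps)
  also have "D11 z + D22 z = - 16 * \<kappa>" by (simp add: \<kappa>_def lap_def D11_def D22_def b2_def)
  finally have "0 \<le> s\<^sup>2 / 2 * (pi * (- 16 * \<kappa>) + 8 * pi * \<kappa>)" using s(1) by linarith
  moreover have "s\<^sup>2 / 2 * (pi * (- 16 * \<kappa>) + 8 * pi * \<kappa>) < 0" using s \<kappa> by (simp add: mult_less_0_iff)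
  ultimately show False by linarith
qed

section \<open>Uniform integrability of the family of quotients\<close>

text \<open>For nonpositive real values the positive part in \<open>ereal_int\<close> vanishes and
  the negative part is minus the ordinary integral, so the extended inequality becomes one between
  reals.\<close>

lemma submean_real:
  fixes u :: "(complex^'n) \<times> complex \<Rightarrow> ereal"
  assumes le: "u a \<le> ereal (1 / (2 * pi)) * ereal_int (\<lambda>\<theta>. u (cline a b (cis \<theta>))) {0..2*pi}"
    and G: "\<And>\<theta>. \<theta> \<in> {0..2*pi} \<Longrightarrow> u (cline a b (cis \<theta>)) = ereal (G \<theta>)" "\<And>\<theta>. \<theta> \<in> {0..2*pi} \<Longrightarrow> G \<theta> \<le> 0"
    and c: "continuous_on {0..2*pi} G" and U: "u a = ereal U0"
  shows "2 * pi * U0 \<le> integral {0..2*pi} G"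
proof -
  have i: "integrable lborel (\<lambda>\<theta>. indicator {0..2*pi} \<theta> *\<^sub>R (- G \<theta>))"
    by (rule borel_integrable_compact[OF compact_Icc]) (intro continuous_intros c)
  have "set_integrable lborel {0..2*pi} (\<lambda>\<theta>. - G \<theta>)" using i by (simp add: set_integrable_def)
  from set_borel_integral_eq_integral(2)[OF this] have e: "(\<integral>\<theta>. indicator {0..2*pi} \<theta> *\<^sub>R (- G \<theta>) \<partial>lborel) = - integral {0..2*pi} G"
    by (simp add: set_lebesgue_integral_def)
  have z: "(\<integral>\<^sup>+ t. e2ennreal (max 0 (u (cline a b (cis t)))) * indicator {0..2*pi} t \<partial>lborel) = 0"
  proof -
    have h: "e2ennreal (max 0 (u (cline a b (cis t)))) * indicator {0..2*pi} t = 0" for t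
      by (cases "t \<in> {0..2*pi}") (use G in \<open>auto simp: max_def zero_ereal_def e2ennreal_neg\<close>)
    show ?thesis unfolding h by simp
  qed
  have p: "(\<integral>\<^sup>+ t. e2ennreal (max 0 (- u (cline a b (cis t)))) * indicator {0..2*pi} t \<partial>lborel) = ennreal (- integral {0..2*pi} G)"
  proof -
    have "e2ennreal (max 0 (- u (cline a b (cis t)))) * indicator {0..2*pi} t = ennreal (indicator {0..2*pi} t *\<^sub>R (- G t))" for t
    proof (cases "t \<in> {0..2*pi}")
      case True
      have "max 0 (- u (cline a b (cis t))) = ereal (- G t)" using G[OF True] by (simp add: max_def zero_ereal_def)
      then show ?thesis using True by simp
    qed auto
    then have "(\<integral>\<^sup>+ t. e2ennreal (max 0 (- u (cline a b (cis t)))) * indicator {0..2*pi} t \<partial>lborel) = (\<integral>\<^sup>+ t. ennreal (indicator {0..2*pi} t *\<^sub>R (- G t)) \<partial>lborel)"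
      by simp
    also have "\<dots> = ennreal (\<integral>t. indicator {0..2*pi} t *\<^sub>R (- G t) \<partial>lborel)"
      by (rule nn_integral_eq_integral[OF i]) (use G(2) in \<open>auto simp: indicator_def\<close>)
    finally show ?thesis unfolding e .
  qed
  have n: "- integral {0..2*pi} G \<ge> 0"
    using e Bochner_Integration.integral_nonneg[of lborel "\<lambda>\<theta>. indicator {0..2*pi} \<theta> *\<^sub>R (- G \<theta>)"] G(2) by (auto simp: indicator_def)
  have "ereal_int (\<lambda>\<theta>. u (cline a b (cis \<theta>))) {0..2*pi} = ereal (integral {0..2*pi} G)"
    unfolding ereal_int_def z p using n by (simp add: enn2ereal_ennreal zero_ennreal.rep_eq zero_ereal_def)
  then have "ereal U0 \<le> ereal (1 / (2 * pi) * integral {0..2*pi} G)" using le U by simp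
  then have "U0 \<le> 1 / (2 * pi) * integral {0..2*pi} G" by simp
  then show ?thesis by (simp add: field_simps)
qed

lemma holo_on_slice:
  fixes F :: "complex^'n::finite \<Rightarrow> complex \<Rightarrow> complex"
  assumes F: "holo_on TYPE('n) (D \<times> B) F" and c: "c \<in> B"
  shows "cn_holo D (\<lambda>z. F z c)"
  unfolding cn_holo_def
proof
  fix z assume z: "z \<in> D"
  obtain L where L: "((\<lambda>q. F (fst q) (snd q)) has_derivative L) (at (z, c))" "\<And>a v w. L (a *s v, a * w) = a * L (v, w)"
    using F z c unfolding holo_on_def by blast
  have "((\<lambda>z. (z, c)) has_derivative (\<lambda>v. (v, 0))) (at z)" by (auto intro!: derivative_eq_intros)
  from has_derivative_compose[OF this L(1)] have D: "((\<lambda>z. F z c) has_derivative (\<lambda>v. L (v, 0))) (at z)" by simp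
  have "L (a *s v, 0) = a * L (v, 0)" for a v using L(2)[of a v 0] by simp
  then show "(\<lambda>z. F z c) differentiable at z \<and> (\<forall>a v. pd (a *s v) (\<lambda>z. F z c) z = a * pd v (\<lambda>z. F z c) z)"
    using D pd_eqI[OF D] by (auto simp: differentiable_def)
qed

lemma holo_on_continuous:
  assumes "holo_on TYPE('n::finite) S F"
  shows "continuous_on S (\<lambda>q. F (fst q) (snd q))"
  using assms unfolding holo_on_def
  by (meson continuous_at_imp_continuous_on has_derivative_continuous)

section \<open>Numerator, denominator and quotient on the slices of constant c\<close>

lemma rpow_nonneg: "rpow x a \<ge> 0" by (simp add: rpow_def)

text \<open>The exponent 0 is split off because \<open>rpow\<close> is then constantly 1, also at
  zeros of h, where \<open>powr\<close> would give 0.\<close>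

lemma continuous_on_rpow:
  assumes "continuous_on S h" "\<And>x. x \<in> S \<Longrightarrow> h x \<ge> 0" "a \<ge> 0"
  shows "continuous_on S (\<lambda>x. rpow (h x) a)"
proof (cases "a = 0")
  case False
  then show ?thesis using continuous_on_powr'[OF assms(1), of "\<lambda>_. a"] assms by (simp add: rpow_def)
qed (simp add: rpow_def)

text \<open>For a > 0 the logarithm is a times that of a sum of squared moduli; for a = 0 the
  convention makes h constantly 1.\<close>

lemma
  fixes g :: "nat \<Rightarrow> complex^'n::finite \<Rightarrow> complex"
  assumes D: "open D" and g: "\<And>i. i \<in> A \<Longrightarrow> cn_holo D (g i)" and a: "a \<ge> 0"
  defines "h \<equiv> \<lambda>z. rpow (\<Sum>i\<in>A. (cmod (g i z))\<^sup>2) a"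
  shows C2_on_ln_rpow: "C2_on {z\<in>D. 0 < h z} (\<lambda>z. ln (h z))" and open_rpow_pos: "open {z\<in>D. 0 < h z}"
    and lap_ln_rpow: "z \<in> D \<Longrightarrow> 0 < h z \<Longrightarrow> lap (\<lambda>z. ln (h z)) z \<xi> \<ge> 0"
proof -
  define S where "S z = (\<Sum>i\<in>A. (cmod (g i z))\<^sup>2)" for z
  have S0: "S z \<ge> 0" for z by (simp add: S_def sum_nonneg)
  have oP: "open {x\<in>D. 0 < S x}" and lnS: "C2_on {x\<in>D. 0 < S x} (\<lambda>x. ln (S x))"
    by (rule lap_ln_sum_nonneg[where I=A and g=g, OF D, folded S_def]; use g in auto)+
  have lapS: "lap (\<lambda>x. ln (S x)) x \<xi> \<ge> 0" if "x \<in> D" "0 < S x" for x \<xi>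
    by (rule lap_ln_sum_nonneg(3)[where I=A and g=g, OF D, folded S_def]) (use g that in auto)
  have "C2_on {z\<in>D. 0 < h z} (\<lambda>z. ln (h z)) \<and> open {z\<in>D. 0 < h z} \<and> (z \<in> D \<longrightarrow> 0 < h z \<longrightarrow> lap (\<lambda>z. ln (h z)) z \<xi> \<ge> 0)" for z \<xi>
  proof (cases "a = 0")
    case True
    then have "h = (\<lambda>z. 1)" by (auto simp: h_def rpow_def)
    then show ?thesis using D by (simp add: lap_const)
  next
    case False
    then have a0: "a > 0" using a by simp
    have hS: "h z = S z powr a" for z using False by (simp add: h_def rpow_def S_def)
    have pos: "0 < h z \<longleftrightarrow> 0 < S z" for z unfolding hS using S0[of z] by auto
    let ?P = "{z\<in>D. 0 < S z}"
    have e: "a * ln (S z) = ln (h z)" if "z \<in> ?P" for z using that by (simp add: hS ln_powr)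
    have "C2_on ?P (\<lambda>z. a * ln (S z))" by (intro C2_on_mult oP lnS C2_on_const)
    then have "C2_on ?P (\<lambda>z. ln (h z))" by (rule C2_on_cong[OF oP, rotated 1]) (use e in auto)
    moreover have "lap (\<lambda>z. ln (h z)) z \<xi> \<ge> 0" if "z \<in> D" "0 < S z"
    proof -
      have "lap (\<lambda>z. ln (h z)) z \<xi> = lap (\<lambda>z. a * ln (S z)) z \<xi>"
        by (rule lap_cong[OF oP]) (use that e in auto)
      also have "\<dots> = a * lap (\<lambda>z. ln (S z)) z \<xi>" by (rule lap_cmult[OF oP _ lnS]) (use that in auto)
      finally show ?thesis using lapS[OF that] a by simp
    qed
    ultimately show ?thesis unfolding pos using oP by auto
  qed
  then show "C2_on {z\<in>D. 0 < h z} (\<lambda>z. ln (h z))" "open {z\<in>D. 0 < h z}"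
    "z \<in> D \<Longrightarrow> 0 < h z \<Longrightarrow> lap (\<lambda>z. ln (h z)) z \<xi> \<ge> 0" by blast+
qed

text \<open>The setting of the theorem with the plurisubharmonic function named u. At common zeros
  of numerator and denominator, where the quotient is 0/0, u is not tied to a value of - log
  R.\<close>

locale quotient_family =
  fixes D :: "(complex^'n::finite) set" and r :: real
    and I J :: nat and f g :: "nat \<Rightarrow> complex^'n \<Rightarrow> complex \<Rightarrow> complex"
    and \<epsilon> \<delta> :: real and u :: "(complex^'n) \<times> complex \<Rightarrow> ereal"
  assumes D: "open D" and r: "r > 0" and eps: "\<epsilon> \<ge> 0" and del: "\<delta> \<ge> 0"
    and hf: "\<forall>i\<in>{1..I}. holo_on TYPE('n) (D \<times> ball 0 r) (f i)"
    and hg: "\<forall>j\<in>{1..J}. holo_on TYPE('n) (D \<times> ball 0 r) (g j)"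
    and psh: "psh_on (D \<times> ball 0 r) u" and un: "\<forall>p\<in>D \<times> ball 0 r. u p \<le> 0"
    and uR: "\<forall>z\<in>D. \<forall>c\<in>ball 0 r. \<not> (numR I f \<epsilon> z c = 0 \<and> numR J g \<delta> z c = 0) \<longrightarrow> u (z, c) = neglog (Rfun I J f g \<epsilon> \<delta> z c)"
begin

abbreviation "B \<equiv> ball (0::complex) r"
definition "N z c = numR I f \<epsilon> z c"
definition "G z c = numR J g \<delta> z c"
definition "R z c = Rfun I J f g \<epsilon> \<delta> z c"

lemma N_nonneg: "N z c \<ge> 0" and G_nonneg: "G z c \<ge> 0"
  by (simp_all add: N_def G_def numR_def rpow_nonneg)

lemma R_eq: "R z c = (if G z c = 0 then \<infinity> else ennreal (N z c / G z c))"
  by (simp add: R_def Rfun_def N_def G_def)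

text \<open>The sign of u says R \<ge> 1. A zero of the numerator where the denominator is positive
  would give - log R = \<infinity>, against the same sign.\<close>

lemma G_le_N:
  assumes "z \<in> D" "c \<in> B" shows "G z c \<le> N z c"
proof (cases "G z c = 0")
  case False
  then have G: "G z c > 0" using G_nonneg[of z c] by linarith
  have "u (z, c) = neglog (R z c)" using uR assms False by (auto simp: R_def N_def G_def)
  moreover have "u (z, c) \<le> 0" using un assms by auto
  ultimately have n: "neglog (ennreal (N z c / G z c)) \<le> 0" using False by (simp add: R_eq)
  have NG: "N z c / G z c > 0"
  proof (rule ccontr)
    assume "\<not> N z c / G z c > 0"
    then have "N z c / G z c = 0" using N_nonneg[of z c] G divide_nonneg_pos[of "N z c" "G z c"] by linarith
    then have "neglog (ennreal (N z c / G z c)) = \<infinity>" by (simp only: neglog_def) simp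
    then show False using n by simp
  qed
  then have "- ln (N z c / G z c) \<le> 0" using n by (simp add: neglog_def split: if_splits)
  then have "N z c / G z c \<ge> 1" using NG by simp
  then show ?thesis using G by (simp add: field_simps)
qed (use N_nonneg in simp)

lemma N_pos: "z \<in> D \<Longrightarrow> c \<in> B \<Longrightarrow> G z c > 0 \<Longrightarrow> N z c > 0"
  using G_le_N[of z c] by linarith

lemma u_eq:
  assumes "z \<in> D" "c \<in> B" "G z c > 0"
  shows "u (z, c) = ereal (ln (G z c) - ln (N z c))"
proof -
  have N: "N z c > 0" by (rule N_pos[OF assms])
  have "u (z, c) = neglog (R z c)" using uR assms by (auto simp: R_def N_def G_def)
  also have "R z c = ennreal (N z c / G z c)" using assms by (simp add: R_eq)
  also have "neglog \<dots> = ereal (- ln (N z c / G z c))" using N assms by (simp add: neglog_def)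
  also have "- ln (N z c / G z c) = ln (G z c) - ln (N z c)" using N assms by (simp add: ln_div)
  finally show ?thesis .
qed

lemma N_cont: "continuous_on (D \<times> B) (\<lambda>p. N (fst p) (snd p))"
  and G_cont: "continuous_on (D \<times> B) (\<lambda>p. G (fst p) (snd p))"
proof -
  have 1: "continuous_on (D \<times> B) (\<lambda>p. \<Sum>i=1..I. (cmod (f i (fst p) (snd p)))\<^sup>2)"
    using hf by (intro continuous_intros holo_on_continuous[where 'n='n]) auto
  show "continuous_on (D \<times> B) (\<lambda>p. N (fst p) (snd p))"
    unfolding N_def numR_def by (rule continuous_on_rpow[OF 1]) (use eps in \<open>auto intro!: sum_nonneg\<close>)
  have 2: "continuous_on (D \<times> B) (\<lambda>p. \<Sum>i=1..J. (cmod (g i (fst p) (snd p)))\<^sup>2)"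
    using hg by (intro continuous_intros holo_on_continuous[where 'n='n]) auto
  show "continuous_on (D \<times> B) (\<lambda>p. G (fst p) (snd p))"
    unfolding G_def numR_def by (rule continuous_on_rpow[OF 2]) (use del in \<open>auto intro!: sum_nonneg\<close>)
qed

lemma N_cont_z: "c \<in> B \<Longrightarrow> continuous_on D (\<lambda>z. N z c)" and G_cont_z: "c \<in> B \<Longrightarrow> continuous_on D (\<lambda>z. G z c)"
proof -
  assume "c \<in> B"
  then have *: "continuous_on D (\<lambda>z. (z, c))" "(\<lambda>z. (z, c)) ` D \<subseteq> D \<times> B" by (auto intro!: continuous_intros)
  show "continuous_on D (\<lambda>z. N z c)" using continuous_on_compose2[OF N_cont *] by simp
  show "continuous_on D (\<lambda>z. G z c)" using continuous_on_compose2[OF G_cont *] by simp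
qed

lemma N_tendsto: "z \<in> D \<Longrightarrow> c \<in> B \<Longrightarrow> (\<forall>k. cs k \<in> B) \<Longrightarrow> cs \<longlonglongrightarrow> c \<Longrightarrow> (\<lambda>k. N z (cs k)) \<longlonglongrightarrow> N z c"
  and G_tendsto: "z \<in> D \<Longrightarrow> c \<in> B \<Longrightarrow> (\<forall>k. cs k \<in> B) \<Longrightarrow> cs \<longlonglongrightarrow> c \<Longrightarrow> (\<lambda>k. G z (cs k)) \<longlonglongrightarrow> G z c"
proof -
  assume a: "z \<in> D" "c \<in> B" "\<forall>k. cs k \<in> B" "cs \<longlonglongrightarrow> c"
  have *: "(\<lambda>k. (z, cs k)) \<longlonglongrightarrow> (z, c)" "\<forall>k. (z, cs k) \<in> D \<times> B" "(z, c) \<in> D \<times> B" using a by (auto intro!: tendsto_intros)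
  show "(\<lambda>k. N z (cs k)) \<longlonglongrightarrow> N z c" using continuous_on_tendsto_compose[OF N_cont *(1,3)] * by simp
  show "(\<lambda>k. G z (cs k)) \<longlonglongrightarrow> G z c" using continuous_on_tendsto_compose[OF G_cont *(1,3)] * by simp
qed

lemma G_slice:
  assumes c: "c \<in> B"
  shows "C2_on {z\<in>D. 0 < G z c} (\<lambda>z. ln (G z c))" "open {z\<in>D. 0 < G z c}"
    "z \<in> D \<Longrightarrow> 0 < G z c \<Longrightarrow> lap (\<lambda>z. ln (G z c)) z \<xi> \<ge> 0"
proof -
  have g: "cn_holo D (\<lambda>z. g i z c)" if "i \<in> {1..J}" for i by (rule holo_on_slice[where B=B]) (use hg that c in auto)
  have d: "\<delta> / 2 \<ge> 0" using del by simp
  show "C2_on {z\<in>D. 0 < G z c} (\<lambda>z. ln (G z c))" "open {z\<in>D. 0 < G z c}"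
    "z \<in> D \<Longrightarrow> 0 < G z c \<Longrightarrow> lap (\<lambda>z. ln (G z c)) z \<xi> \<ge> 0"
    unfolding G_def numR_def
    by (rule C2_on_ln_rpow[OF D g d] open_rpow_pos[OF D g d] lap_ln_rpow[OF D g d]; assumption)+
qed

lemma N_slice:
  assumes c: "c \<in> B"
  shows "C2_on {z\<in>D. 0 < N z c} (\<lambda>z. ln (N z c))"
proof -
  have f: "cn_holo D (\<lambda>z. f i z c)" if "i \<in> {1..I}" for i by (rule holo_on_slice[where B=B]) (use hf that c in auto)
  have d: "\<epsilon> / 2 \<ge> 0" using eps by simp
  show ?thesis unfolding N_def numR_def by (rule C2_on_ln_rpow[OF D f d])
qed

text \<open>On complex lines inside a slice, with circles small enough to stay in G > 0, the
  sub-mean value inequality for u is one for the C^2 function ln G - ln N, and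
  \<open>submean_lap_nonneg\<close> applies.\<close>

lemma lap_quotient:
  assumes c: "c \<in> B" and z: "z \<in> D" "0 < G z c"
  shows "C2_on {z\<in>D. 0 < G z c} (\<lambda>z. ln (G z c) - ln (N z c))" "lap (\<lambda>z. ln (G z c) - ln (N z c)) z b \<ge> 0"
proof -
  define P where "P = {z\<in>D. 0 < G z c}"
  have P: "open P" "z \<in> P" unfolding P_def using G_slice(2)[OF c] z by auto
  have sub: "P \<subseteq> {z\<in>D. 0 < N z c}" unfolding P_def using N_pos c by auto
  let ?U = "\<lambda>z. ln (G z c) - ln (N z c)"
  have U2: "C2_on P ?U"
    by (intro C2_on_diff P(1) C2_on_subset[OF N_slice[OF c] sub]) (use G_slice(1)[OF c] in \<open>simp add: P_def\<close>)
  then show "C2_on {z\<in>D. 0 < G z c} (\<lambda>z. ln (G z c) - ln (N z c))" by (simp add: P_def)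
  obtain e where e: "e > 0" "ball z e \<subseteq> P" using P open_contains_ball by blast
  define s1 where "s1 = e / (norm b + 1)"
  have nb: "norm b + 1 > 0" using norm_ge_zero[of b] by linarith
  have s1: "s1 > 0" unfolding s1_def using e nb by simp
  have inP: "z + \<zeta> *s (s *\<^sub>R b) \<in> P" if "0 < s" "s < s1" "cmod \<zeta> \<le> 1" for s \<zeta>
  proof -
    have "norm (\<zeta> *s (s *\<^sub>R b)) \<le> 1 * (s * norm b)" unfolding norm_vector_scalar_mult using that by (intro mult_mono) auto
    also have "\<dots> \<le> s * (norm b + 1)" using that by simp
    also have "\<dots> < s1 * (norm b + 1)" using that nb by simp
    also have "\<dots> = e" unfolding s1_def using nb by simp
    finally have "z + \<zeta> *s (s *\<^sub>R b) \<in> ball z e" by (simp add: dist_norm)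
    then show ?thesis using e by blast
  qed
  have "2 * pi * ?U z \<le> integral {0..2*pi} (\<lambda>\<theta>. ?U (z + (of_real s * cis \<theta>) *s b))" if s: "0 < s" "s < s1" for s
  proof -
    have eq: "z + (of_real s * cis \<theta>) *s b = z + cis \<theta> *s (s *\<^sub>R b)" for \<theta>
      by (simp add: vec_eq_iff complex_eq_iff algebra_simps)
    have cl: "cline (z, c) (s *\<^sub>R b, 0) \<zeta> = (z + \<zeta> *s (s *\<^sub>R b), c)" for \<zeta> by (simp add: cline_def)
    have "\<forall>\<zeta>. cmod \<zeta> \<le> 1 \<longrightarrow> cline (z, c) (s *\<^sub>R b, 0) \<zeta> \<in> D \<times> B"
      unfolding cl using inP[OF s] c by (auto simp: P_def)
    then have le: "u (z, c) \<le> ereal (1 / (2 * pi)) * ereal_int (\<lambda>\<theta>. u (cline (z, c) (s *\<^sub>R b, 0) (cis \<theta>))) {0..2*pi}"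
      using psh unfolding psh_on_def by blast
    have in': "z + cis \<theta> *s (s *\<^sub>R b) \<in> P" for \<theta> by (rule inP[OF s]) simp
    show ?thesis unfolding eq
    proof (rule submean_real[OF le])
      fix \<theta>
      have "z + cis \<theta> *s (s *\<^sub>R b) \<in> D" "0 < G (z + cis \<theta> *s (s *\<^sub>R b)) c" using in'[of \<theta>] by (auto simp: P_def)
      then show "u (cline (z, c) (s *\<^sub>R b, 0) (cis \<theta>)) = ereal (?U (z + cis \<theta> *s (s *\<^sub>R b)))"
        unfolding cl using u_eq[OF _ c] by simp
      show "?U (z + cis \<theta> *s (s *\<^sub>R b)) \<le> 0"
        using in'[of \<theta>] G_le_N[OF _ c, of "z + cis \<theta> *s (s *\<^sub>R b)"] N_pos[OF _ c, of "z + cis \<theta> *s (s *\<^sub>R b)"] by (simp add: P_def)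
    next
      show "continuous_on {0..2*pi} (\<lambda>\<theta>. ?U (z + cis \<theta> *s (s *\<^sub>R b)))"
      proof (rule continuous_on_compose2[OF C1_on_continuous[OF C2_on_C1[OF U2]]])
        show "continuous_on {0..2*pi} (\<lambda>\<theta>. z + cis \<theta> *s (s *\<^sub>R b))"
          by (intro continuous_intros bounded_linear.continuous_on[OF bounded_linear_vector_scalar_mult])
      qed (use in' in auto)
      show "u (z, c) = ereal (?U z)" by (rule u_eq[OF z(1) c z(2)])
    qed
  qed
  then have "\<forall>\<^sub>F s in at_right (0::real). 2 * pi * ?U z \<le> integral {0..2*pi} (\<lambda>\<theta>. ?U (z + (of_real s * cis \<theta>) *s b))"
    unfolding eventually_at_right_field using s1 by blast
  then show "lap (\<lambda>z. ln (G z c) - ln (N z c)) z b \<ge> 0" by (rule submean_lap_nonneg[OF P U2])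
qed

text \<open>The factor \<open>(N / b) powr \<kappa>\<close> makes the quotient continuous across the common zeros of the \<open>f i\<close> and \<open>g j\<close>;
  its logarithm \<open>(1 - \<kappa>) (ln G - ln N) + \<kappa> ln G - \<kappa> ln b\<close> is still plurisubharmonic.\<close>

definition "reg_quotient \<kappa> b z c = G z c / N z c * ((N z c / b) powr \<kappa>)" for \<kappa> b :: real

text \<open>These are the demands of \<open>singular_part_estimate\<close> on w. Both factors lie in
  [0, 1] because G \<le> N \<le> b; at a zero of N the power of N / b squeezes the product to 0; and
  as that power is at most 1, the inverse of w dominates R.\<close>

lemma reg_quotient_props:
  assumes c: "c \<in> B" and \<kappa>: "0 < \<kappa>" "\<kappa> \<le> 1" and b: "b > 0" and S: "open S" "S \<subseteq> D" "\<And>z. z \<in> S \<Longrightarrow> N z c \<le> b"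
  shows "continuous_on S (\<lambda>z. reg_quotient \<kappa> b z c)" "\<And>z. z \<in> S \<Longrightarrow> 0 \<le> reg_quotient \<kappa> b z c \<and> reg_quotient \<kappa> b z c \<le> 1"
    "C2_on {z\<in>S. 0 < reg_quotient \<kappa> b z c} (\<lambda>z. ln (reg_quotient \<kappa> b z c))" "\<And>z \<xi>. z \<in> S \<Longrightarrow> 0 < reg_quotient \<kappa> b z c \<Longrightarrow> lap (\<lambda>z. ln (reg_quotient \<kappa> b z c)) z \<xi> \<ge> 0"
    "\<And>z. z \<in> S \<Longrightarrow> R z c \<le> inverse (ennreal (reg_quotient \<kappa> b z c))"
proof -
  have Nb: "0 \<le> N z c / b" "N z c / b \<le> 1" if "z \<in> S" for z using S(3)[OF that] N_nonneg[of z c] b by auto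
  have pw: "0 \<le> (N z c / b) powr \<kappa>" "(N z c / b) powr \<kappa> \<le> 1" if "z \<in> S" for z
    using Nb[OF that] \<kappa> by (auto intro!: powr_le1)
  have q: "0 \<le> G z c / N z c" "G z c / N z c \<le> 1" if "z \<in> S" for z
    using G_le_N[of z c] G_nonneg[of z c] N_nonneg[of z c] S(2) that c by (auto simp: divide_le_eq_1)
  have wle: "reg_quotient \<kappa> b z c \<le> (N z c / b) powr \<kappa>" "reg_quotient \<kappa> b z c \<le> G z c / N z c" "0 \<le> reg_quotient \<kappa> b z c" if "z \<in> S" for z
    unfolding reg_quotient_def using q[OF that] pw[OF that] mult_left_le_one_le[of "(N z c / b) powr \<kappa>" "G z c / N z c"] mult_right_le_one_le[of "G z c / N z c" "(N z c / b) powr \<kappa>"] mult_nonneg_nonneg[of "G z c / N z c" "(N z c / b) powr \<kappa>"] by auto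
  show "0 \<le> reg_quotient \<kappa> b z c \<and> reg_quotient \<kappa> b z c \<le> 1" if "z \<in> S" for z using wle[OF that] q[OF that] by linarith
  have Nc: "continuous_on S (\<lambda>z. N z c)" and Gc: "continuous_on S (\<lambda>z. G z c)"
    using N_cont_z[OF c] G_cont_z[OF c] S(2) continuous_on_subset by blast+
  show "continuous_on S (\<lambda>z. reg_quotient \<kappa> b z c)"
    unfolding continuous_on_eq_continuous_at[OF S(1)]
  proof
    fix z assume z: "z \<in> S"
    have iN: "isCont (\<lambda>z. N z c) z" and iG: "isCont (\<lambda>z. G z c) z"
      using Nc Gc z continuous_on_eq_continuous_at[OF S(1)] by auto
    show "isCont (\<lambda>z. reg_quotient \<kappa> b z c) z"
    proof (cases "N z c = 0")
      case False
      then have "N z c / b \<noteq> 0" using b by simp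
      then show ?thesis unfolding reg_quotient_def using False b by (intro continuous_intros iN iG) auto
    next
      case True
      have lim: "((\<lambda>z. (N z c / b) powr \<kappa>) \<longlongrightarrow> 0) (at z)"
      proof -
        have "((\<lambda>z. N z c / b) \<longlongrightarrow> 0) (at z)" using iN True b unfolding isCont_def by (auto intro!: tendsto_eq_intros)
        moreover have "\<forall>\<^sub>F z in at z. 0 \<le> N z c / b" using N_nonneg b by (auto intro!: always_eventually)
        ultimately show ?thesis using \<kappa>(1) tendsto_powr'[of "\<lambda>z. N z c / b" 0 "at z" "\<lambda>_. \<kappa>" \<kappa>] by simp
      qed
      have ev: "\<forall>\<^sub>F y in at z. y \<in> S" using S(1) z by (auto simp: eventually_at_topological)
      have "((\<lambda>z. reg_quotient \<kappa> b z c) \<longlongrightarrow> 0) (at z)"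
        by (rule tendsto_sandwich[OF _ _ tendsto_const lim]) (use ev wle in \<open>auto elim!: eventually_mono\<close>)
      then show ?thesis unfolding isCont_def using True by (simp add: reg_quotient_def)
    qed
  qed
  have pos: "0 < reg_quotient \<kappa> b z c \<longleftrightarrow> 0 < G z c" if "z \<in> S" for z
  proof
    assume "0 < reg_quotient \<kappa> b z c"
    then have "G z c \<noteq> 0" by (auto simp: reg_quotient_def)
    then show "0 < G z c" using G_nonneg[of z c] by linarith
  next
    assume G: "0 < G z c"
    then have "N z c > 0" using N_pos c S(2) that by blast
    then show "0 < reg_quotient \<kappa> b z c" unfolding reg_quotient_def using G b by simp
  qed
  define P where "P = {z\<in>D. 0 < G z c}"
  define Q where "Q = {z\<in>S. 0 < reg_quotient \<kappa> b z c}"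
  have QP: "Q = S \<inter> P" unfolding Q_def P_def using pos S(2) by auto
  have oP: "open P" unfolding P_def by (rule G_slice(2)[OF c])
  have oQ: "open Q" unfolding QP using oP S(1) by blast
  let ?U = "\<lambda>z. ln (G z c) - ln (N z c)" and ?L = "\<lambda>z. ln (G z c)"
  have lnw: "((1 - \<kappa>) * ?U z + \<kappa> * ?L z) + (- \<kappa> * ln b) = ln (reg_quotient \<kappa> b z c)" if "z \<in> Q" for z
  proof -
    have z: "z \<in> D" "G z c > 0" using that by (auto simp: QP P_def)
    then have N: "N z c > 0" using N_pos c by blast
    have "ln (reg_quotient \<kappa> b z c) = ln (G z c) - ln (N z c) + \<kappa> * (ln (N z c) - ln b)"
      unfolding reg_quotient_def using N z b by (simp add: ln_mult ln_div ln_powr)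
    then show ?thesis by (simp add: algebra_simps)
  qed
  have QU: "C2_on Q ?U" if "Q \<noteq> {}"
  proof -
    obtain z where "z \<in> Q" using \<open>Q \<noteq> {}\<close> by blast
    then have "z \<in> D" "0 < G z c" by (auto simp: QP P_def)
    from lap_quotient(1)[OF c this] show ?thesis by (rule C2_on_subset) (auto simp: QP P_def)
  qed
  have QL: "C2_on Q ?L" by (rule C2_on_subset[OF G_slice(1)[OF c]]) (auto simp: QP P_def)
  have QA: "C2_on Q (\<lambda>z. (1 - \<kappa>) * ?U z + \<kappa> * ?L z)" if "Q \<noteq> {}"
    by (intro C2_on_add C2_on_mult oQ QU that QL C2_on_const)
  have "C2_on Q (\<lambda>z. ln (reg_quotient \<kappa> b z c))"
  proof (cases "Q = {}")
    case False
    have "C2_on Q (\<lambda>z. ((1 - \<kappa>) * ?U z + \<kappa> * ?L z) + (- \<kappa> * ln b))" by (intro C2_on_add oQ QA False C2_on_const)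
    then show ?thesis by (rule C2_on_cong[OF oQ, rotated]) (use lnw in auto)
  qed (simp add: C2_on_def C1_on_def)
  then show "C2_on {z\<in>S. 0 < reg_quotient \<kappa> b z c} (\<lambda>z. ln (reg_quotient \<kappa> b z c))" by (simp add: Q_def)
  show "lap (\<lambda>z. ln (reg_quotient \<kappa> b z c)) z \<xi> \<ge> 0" if z: "z \<in> S" "0 < reg_quotient \<kappa> b z c" for z \<xi>
  proof -
    have zQ: "z \<in> Q" using z by (simp add: Q_def)
    then have ne: "Q \<noteq> {}" by blast
    have zD: "z \<in> D" "0 < G z c" using zQ by (auto simp: QP P_def)
    have "lap (\<lambda>z. ln (reg_quotient \<kappa> b z c)) z \<xi> = lap (\<lambda>z. ((1 - \<kappa>) * ?U z + \<kappa> * ?L z) + (- \<kappa> * ln b)) z \<xi>"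
      by (rule lap_cong[OF oQ zQ]) (use lnw in auto)
    also have "\<dots> = lap (\<lambda>z. (1 - \<kappa>) * ?U z + \<kappa> * ?L z) z \<xi>"
      using lap_add[OF oQ zQ QA[OF ne] C2_on_const, of "- \<kappa> * ln b"] by (simp add: lap_const)
    also have "\<dots> = lap (\<lambda>z. (1 - \<kappa>) * ?U z) z \<xi> + lap (\<lambda>z. \<kappa> * ?L z) z \<xi>"
      by (rule lap_add[OF oQ zQ]) (intro C2_on_mult oQ QU ne QL C2_on_const)+
    also have "\<dots> = (1 - \<kappa>) * lap ?U z \<xi> + \<kappa> * lap ?L z \<xi>"
      using lap_cmult[OF oQ zQ QU[OF ne]] lap_cmult[OF oQ zQ QL] by simp
    finally show ?thesis using lap_quotient(2)[OF c zD, of \<xi>] G_slice(3)[OF c zD, of \<xi>] \<kappa> by simp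
  qed
  show "R z c \<le> inverse (ennreal (reg_quotient \<kappa> b z c))" if z: "z \<in> S" for z
  proof (cases "G z c = 0")
    case True
    then show ?thesis by (simp add: reg_quotient_def)
  next
    case False
    then have G: "G z c > 0" using G_nonneg[of z c] by linarith
    have N: "N z c > 0" using N_pos G c S(2) z by blast
    have w: "reg_quotient \<kappa> b z c > 0" using pos[OF z] G by simp
    have "N z c / G z c = inverse (G z c / N z c)" by simp
    also have "\<dots> \<le> inverse (reg_quotient \<kappa> b z c)" using wle(2)[OF z] w by (rule le_imp_inverse_le)
    finally show ?thesis using False w by (simp add: R_eq inverse_ennreal ennreal_leI)
  qed
qed

end

text \<open>A function with finite integral is finite almost everywhere, so its tails vanish
  pointwise in the limit, and h itself dominates them.\<close>

lemma nn_integral_tail_small: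
  fixes h :: "'a \<Rightarrow> ennreal"
  assumes h[measurable]: "h \<in> borel_measurable M" and fin: "(\<integral>\<^sup>+z. h z \<partial>M) < \<infinity>" and e: "e > 0"
  shows "\<forall>\<^sub>F k::nat in sequentially. (\<integral>\<^sup>+z. h z * indicator {z. of_nat k \<le> h z} z \<partial>M) < e"
proof -
  have ae: "AE z in M. h z \<noteq> \<infinity>" by (rule nn_integral_PInf_AE[OF h]) (use fin in auto)
  have [measurable]: "(\<lambda>z. h z * indicator {z. of_nat k \<le> h z} z) \<in> borel_measurable M" for k :: nat
  proof -
    have "(\<lambda>z. h z * indicator {z. of_nat k \<le> h z} z) = (\<lambda>z. if of_nat k \<le> h z then h z else 0)"
      by (auto simp: indicator_def fun_eq_iff)
    then show ?thesis by simp
  qed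
  have "(\<lambda>k::nat. \<integral>\<^sup>+z. h z * indicator {z. of_nat k \<le> h z} z \<partial>M) \<longlonglongrightarrow> (\<integral>\<^sup>+z. 0 \<partial>M)"
  proof (rule nn_integral_dominated_convergence[where w=h])
    show "AE z in M. (\<lambda>k. h z * indicator {z. of_nat k \<le> h z} z) \<longlonglongrightarrow> 0"
      using ae
    proof eventually_elim
      case (elim z)
      then obtain n :: nat where n: "h z < of_nat n" using ennreal_Ex_less_of_nat[of "h z"] by (auto simp: less_top)
      have "h z * indicator {z. of_nat k \<le> h z} z = 0" if "k \<ge> n" for k
      proof -
        have "(of_nat n :: ennreal) \<le> of_nat k" using that by simp
        then have "h z < of_nat k" using n by (rule less_le_trans[rotated])
        then show ?thesis by simp
      qed
      then show ?case by (intro tendsto_eventually eventually_sequentiallyI[of n]) auto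
    qed
  qed (use fin in \<open>auto simp: indicator_def\<close>)
  then show ?thesis using e by (simp add: order_tendsto_iff)
qed

context quotient_family begin

text \<open>Continuity is known on D alone; the indicator of an open subset turns it into Borel
  measurability on the whole space.\<close>

lemma G_measurable:
  assumes "c \<in> B" "open S" "S \<subseteq> D"
  shows "(\<lambda>z. indicator S z * G z c) \<in> borel_measurable borel" "(\<lambda>z. indicator S z * N z c) \<in> borel_measurable borel"
  using borel_measurable_continuous_on_indicator[of S "\<lambda>z. G z c"] borel_measurable_continuous_on_indicator[of S "\<lambda>z. N z c"]
    continuous_on_subset[OF G_cont_z[OF assms(1)] assms(3)] continuous_on_subset[OF N_cont_z[OF assms(1)] assms(3)] assms(2) by auto

lemma R_measurable:
  assumes "c \<in> B" "open S" "S \<subseteq> D"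
  shows "(\<lambda>z. R z c * indicator S z) \<in> borel_measurable borel"
proof -
  note [measurable] = G_measurable[OF assms] borel_open[OF assms(2)]
  have "(\<lambda>z. R z c * indicator S z) = (\<lambda>z. if z \<in> S then if indicator S z * G z c = 0 then \<infinity> else ennreal ((indicator S z * N z c) / (indicator S z * G z c)) else 0)"
    by (auto simp: R_eq fun_eq_iff)
  also have "\<dots> \<in> borel_measurable borel" by measurable
  finally show ?thesis .
qed

lemma R_tail_measurable:
  assumes "c \<in> B" "open S" "S \<subseteq> D"
  shows "(\<lambda>z. indicator {z\<in>S. ennreal K < R z c} z * R z c) \<in> borel_measurable borel"
proof -
  note [measurable] = R_measurable[OF assms] borel_open[OF assms(2)]
  have "(\<lambda>z. indicator {z\<in>S. ennreal K < R z c} z * R z c) = (\<lambda>z. if z \<in> S \<and> ennreal K < R z c * indicator S z then R z c * indicator S z else 0)"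
    by (auto simp: fun_eq_iff indicator_def)
  also have "\<dots> \<in> borel_measurable borel" by measurable
  finally show ?thesis .
qed

lemma reg_quotient_measurable:
  assumes "c \<in> B" "open S" "S \<subseteq> D"
  shows "(\<lambda>z. indicator S z * reg_quotient \<kappa> b z c) \<in> borel_measurable borel"
proof -
  note [measurable] = G_measurable[OF assms] borel_open[OF assms(2)]
  have "(\<lambda>z. indicator S z * reg_quotient \<kappa> b z c) = (\<lambda>z. (indicator S z * G z c) / (indicator S z * N z c) * (((indicator S z * N z c) / b) powr \<kappa>))"
    by (auto simp: reg_quotient_def fun_eq_iff indicator_def)
  also have "\<dots> \<in> borel_measurable borel" by measurable
  finally show ?thesis .
qed

text \<open>R is infinite where G = 0, so a finite integral makes this set null. Off it the
  quotients converge pointwise as c varies.\<close>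

lemma AE_G_pos:
  assumes S: "c \<in> B" "open S" "S \<subseteq> D" and fin: "(\<integral>\<^sup>+z. R z c * indicator S z \<partial>lborel) < \<infinity>"
  shows "AE z in lborel. z \<in> S \<longrightarrow> 0 < G z c"
proof -
  have "AE z in lborel. R z c * indicator S z \<noteq> \<infinity>"
    by (rule nn_integral_PInf_AE) (use R_measurable[OF S] fin in auto)
  then show ?thesis
  proof eventually_elim
    case (elim z)
    then show ?case using G_nonneg[of z c] by (auto simp: R_eq less_le)
  qed
qed

lemma R_tendsto:
  assumes z: "z \<in> D" "c \<in> B" "0 < G z c" and cs: "\<forall>k. cs k \<in> B" "cs \<longlonglongrightarrow> c"
  shows "(\<lambda>k. R z (cs k)) \<longlonglongrightarrow> R z c"
proof -
  have G: "(\<lambda>k. G z (cs k)) \<longlonglongrightarrow> G z c" and N: "(\<lambda>k. N z (cs k)) \<longlonglongrightarrow> N z c"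
    using G_tendsto N_tendsto z cs by auto
  have ev: "\<forall>\<^sub>F k in sequentially. 0 < G z (cs k)" using order_tendstoD(1)[OF G z(3)] .
  have "(\<lambda>k. ennreal (N z (cs k) / G z (cs k))) \<longlonglongrightarrow> ennreal (N z c / G z c)"
    by (intro tendsto_ennrealI tendsto_divide N G) (use z in auto)
  moreover have "\<forall>\<^sub>F k in sequentially. ennreal (N z (cs k) / G z (cs k)) = R z (cs k)"
    using ev by eventually_elim (auto simp: R_eq)
  ultimately have "(\<lambda>k. R z (cs k)) \<longlonglongrightarrow> ennreal (N z c / G z c)" by (rule Lim_transform_eventually)
  then show ?thesis using z by (simp add: R_eq)
qed

lemma reg_quotient_tendsto:
  assumes z: "z \<in> D" "c \<in> B" "0 < G z c" and cs: "\<forall>k. cs k \<in> B" "cs \<longlonglongrightarrow> c" and ks: "ks \<longlonglongrightarrow> 0" and b: "b > 0"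
  shows "(\<lambda>k. reg_quotient (ks k) b z (cs k)) \<longlonglongrightarrow> G z c / N z c"
proof -
  have N0: "N z c > 0" using N_pos z by blast
  have G: "(\<lambda>k. G z (cs k)) \<longlonglongrightarrow> G z c" and N: "(\<lambda>k. N z (cs k)) \<longlonglongrightarrow> N z c"
    using G_tendsto N_tendsto z cs by auto
  have "(\<lambda>k. G z (cs k) / N z (cs k) * ((N z (cs k) / b) powr ks k)) \<longlonglongrightarrow> G z c / N z c * ((N z c / b) powr 0)"
    by (intro tendsto_intros G N ks) (use N0 b in auto)
  then show ?thesis using N0 b by (simp add: reg_quotient_def)
qed

text \<open>Two limits are coupled through one index m: c tends to c0 and the regularising exponent
  tends to 0. If the premise of the estimate failed for every m, the offending parameters would
  contradict dominated convergence to the quotient at c0. The m so obtained fixes the exponent and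
  the radius in c together.\<close>

lemma uniform_integrability:
  assumes c0: "c0 \<in> B" and s: "s > 0" "cball a s \<subseteq> D"
    and fin: "(\<integral>\<^sup>+z. R z c0 * indicator (ball a s) z \<partial>lborel) < \<infinity>" and \<eta>: "\<eta> > 0"
  obtains K \<rho> where "K > 0" "\<rho> > 0" "ball c0 \<rho> \<subseteq> B"
    "\<And>c. c \<in> ball c0 \<rho> \<Longrightarrow> (\<integral>\<^sup>+z. indicator {z\<in>ball a (s / 2). ennreal K < R z c} z * R z c \<partial>lborel) \<le> ennreal \<eta>"
proof -
  obtain C \<eta>1 :: real where C: "C > 0" "\<eta>1 > 0"
    and est: "\<And>(a::complex^'n) w t X. \<lbrakk>t \<ge> 1; continuous_on (ball a s) w; \<And>x. x \<in> ball a s \<Longrightarrow> 0 \<le> w x \<and> w x \<le> 1;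
      C2_on {x \<in> ball a s. 0 < w x} (\<lambda>x. ln (w x));
      \<And>x \<xi>. x \<in> ball a s \<Longrightarrow> 0 < w x \<Longrightarrow> lap (\<lambda>x. ln (w x)) x \<xi> \<ge> 0;
      0 \<le> X; X \<le> \<eta>1;
      (\<integral>\<^sup>+x. indicator {x \<in> ball a s. w x \<le> exp (- t)} x * ennreal (1 / max (w x) (exp (- 2 * t))) \<partial>lborel) \<le> ennreal X\<rbrakk>
     \<Longrightarrow> (\<integral>\<^sup>+x. indicator {x \<in> ball a (s / 2). w x < exp (- 2 * t)} x * inverse (ennreal (w x)) \<partial>lborel) \<le> ennreal (C * X)"
    using singular_part_estimate[OF s(1), where 'n='n] by blast
  \<comment> \<open>Below the threshold of the estimate, and small enough that its conclusion C X is
    at most \<eta>.\<close>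
  define X where "X = min \<eta>1 (\<eta> / C)"
  have X: "X > 0" "X \<le> \<eta>1" using C \<eta> by (auto simp: X_def)
  have "X \<le> \<eta> / C" by (simp add: X_def)
  then have CX: "C * X \<le> \<eta>" using C by (simp add: field_simps)
  have bD: "ball a s \<subseteq> D" using s(2) ball_subset_cball by blast
  obtain \<rho>0 where \<rho>0: "\<rho>0 > 0" "cball c0 \<rho>0 \<subseteq> B" using c0 open_ball open_contains_cball by metis
  have "compact (cball a s \<times> cball c0 \<rho>0)" by (intro compact_Times compact_cball)
  moreover have "continuous_on (cball a s \<times> cball c0 \<rho>0) (\<lambda>p. N (fst p) (snd p))"
    by (rule continuous_on_subset[OF N_cont]) (use s \<rho>0 in blast)
  ultimately have "bounded ((\<lambda>p. N (fst p) (snd p)) ` (cball a s \<times> cball c0 \<rho>0))"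
    by (intro compact_imp_bounded compact_continuous_image)
  then obtain b0 where b0: "\<forall>p\<in>cball a s \<times> cball c0 \<rho>0. \<bar>N (fst p) (snd p)\<bar> \<le> b0"
    unfolding bounded_iff by (auto simp: image_iff)
  define b where "b = max 1 b0"
  have b: "b > 0" by (simp add: b_def)
  have Nb: "N z c \<le> b" if "z \<in> ball a s" "c \<in> cball c0 \<rho>0" for z c
  proof -
    have "(z, c) \<in> cball a s \<times> cball c0 \<rho>0" using that by auto
    with b0 have "\<bar>N z c\<bar> \<le> b0" by force
    then show ?thesis by (simp add: b_def)
  qed
  define h where "h z = R z c0 * indicator (ball a s) z" for z
  have hm[measurable]: "h \<in> borel_measurable borel" unfolding h_def by (rule R_measurable[OF c0 open_ball bD])
  have "\<forall>\<^sub>F k::nat in sequentially. (\<integral>\<^sup>+z. h z * indicator {z. of_nat k \<le> h z} z \<partial>lborel) < ennreal (X / 4)"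
    by (rule nn_integral_tail_small) (use hm fin X in \<open>auto simp: h_def[abs_def]\<close>)
  then obtain k0 where k0: "\<And>k. k \<ge> k0 \<Longrightarrow> (\<integral>\<^sup>+z. h z * indicator {z. of_nat k \<le> h z} z \<partial>lborel) < ennreal (X / 4)"
    by (auto simp: eventually_sequentially)
  \<comment> \<open>The offset 2 makes T \<ge> 4, hence t = ln T \<ge> 1.\<close>
  define k where "k = k0 + 2"
  have tail: "(\<integral>\<^sup>+z. h z * indicator {z. of_nat k \<le> h z} z \<partial>lborel) < ennreal (X / 4)" by (rule k0) (simp add: k_def)
  define T where "T = 2 * real k"
  have T: "T \<ge> 4" by (simp add: T_def k_def)
  define t where "t = ln T"
  have expt: "exp t = T" "exp (- t) = 1 / T" "exp (- 2 * t) = 1 / T\<^sup>2"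
  proof -
    show 1: "exp t = T" using T by (simp add: t_def)
    then show "exp (- t) = 1 / T" by (simp add: exp_minus field_simps)
    have "exp (- 2 * t) = inverse (exp t * exp t)" by (simp add: exp_minus exp_add[symmetric])
    then show "exp (- 2 * t) = 1 / T\<^sup>2" using 1 by (simp add: power2_eq_square field_simps)
  qed
  have t1: "t \<ge> 1"
  proof -
    have "exp 1 \<le> exp t" unfolding expt(1) using exp_le T by linarith
    then show ?thesis by simp
  qed
  \<comment> \<open>A continuous substitute for the sharp cut at x \<le> 1 / T: there it dominates 1
    / max x (1 / T^2), it vanishes for x \<ge> 2 / T, and it is bounded by 2 T^2. At x = G / N the
    point 2 / T corresponds to R = k, and continuity lets Y follow the limit in c.\<close>
  define Y where "Y x = max 0 (2 / max x (1 / T\<^sup>2) - T)" for x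
  have T2: "1 / T\<^sup>2 > 0" "1 / T\<^sup>2 \<le> 1 / T" using T by (auto simp: power2_eq_square field_simps)
  have Ya: "1 / max x (1 / T\<^sup>2) \<le> Y x" if "x \<le> 1 / T" for x
  proof -
    have m: "max x (1 / T\<^sup>2) \<le> 1 / T" "max x (1 / T\<^sup>2) > 0" using that T2 unfolding less_max_iff_disj by auto
    have "1 / (1 / T) \<le> 1 / max x (1 / T\<^sup>2)" using m(1) T by (intro divide_left_mono mult_pos_pos m(2)) auto
    then have "T \<le> 1 / max x (1 / T\<^sup>2)" by simp
    then show ?thesis unfolding Y_def by linarith
  qed
  have Yb: "Y x \<le> 2 * T\<^sup>2" "0 \<le> Y x" for x
  proof -
    have "2 / max x (1 / T\<^sup>2) \<le> 2 / (1 / T\<^sup>2)" using T2 by (intro divide_left_mono mult_pos_pos) (auto simp: less_max_iff_disj)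
    then have "2 / max x (1 / T\<^sup>2) \<le> 2 * T\<^sup>2" by simp
    then show "Y x \<le> 2 * T\<^sup>2" unfolding Y_def using T by (smt (verit) zero_le_power2)
    show "0 \<le> Y x" by (simp add: Y_def)
  qed
  have Yc: "continuous_on UNIV Y" unfolding Y_def using T2 by (intro continuous_intros) (auto simp: max_def)
  then have Ym[measurable]: "Y \<in> borel_measurable borel" by (rule borel_measurable_continuous_onI)
  have Yd: "ennreal (Y (G z c0 / N z c0)) * indicator (ball a s) z \<le> 2 * (h z * indicator {z. of_nat k \<le> h z} z)"
    if "z \<in> ball a s \<longrightarrow> 0 < G z c0" for z
  proof (cases "z \<in> ball a s \<and> Y (G z c0 / N z c0) > 0")
    case True
    define q where "q = G z c0 / N z c0"
    have z: "z \<in> D" "G z c0 > 0" using True that bD by auto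
    have N: "N z c0 > 0" using N_pos z c0 by blast
    have q: "q > 0" unfolding q_def using z N by simp
    have "N z c0 / G z c0 = 1 / q" by (simp add: q_def)
    then have Rq: "h z = ennreal (1 / q)" using True z by (simp add: h_def R_eq)
    have "2 / max q (1 / T\<^sup>2) > T" using True unfolding Y_def q_def by linarith
    moreover have m: "2 / max q (1 / T\<^sup>2) \<le> 2 / q" using q T2 by (intro divide_left_mono mult_pos_pos) (auto simp: less_max_iff_disj)
    ultimately have "2 * real k < 2 / q" unfolding T_def by linarith
    then have "real k \<le> 1 / q" by simp
    then have "ennreal (real k) \<le> h z" unfolding Rq by (rule ennreal_leI)
    then have k: "of_nat k \<le> h z" by (simp add: ennreal_of_nat_eq_real_of_nat)
    have "0 \<le> 2 / q" using q by simp
    then have "Y q \<le> 2 / q" unfolding Y_def using m T by linarith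
    then have "ennreal (Y q) \<le> ennreal (2 * (1 / q))" by (intro ennreal_leI) simp
    also have "\<dots> = 2 * h z" unfolding Rq using q by (subst ennreal_mult) auto
    finally show ?thesis using True k by (simp add: q_def)
  next
    case False
    then have "ennreal (Y (G z c0 / N z c0)) * indicator (ball a s) z = 0" using Yb(2)[of "G z c0 / N z c0"] by (auto simp: indicator_def ennreal_eq_0_iff)
    then show ?thesis by (simp only: zero_le)
  qed
  have good: "AE z in lborel. z \<in> ball a s \<longrightarrow> 0 < G z c0" by (rule AE_G_pos[OF c0 open_ball bD fin])
  have h2[measurable]: "(\<lambda>z. h z * indicator {z. of_nat k \<le> h z} z) \<in> borel_measurable borel"
  proof -
    have "(\<lambda>z. h z * indicator {z. of_nat k \<le> h z} z) = (\<lambda>z. if of_nat k \<le> h z then h z else 0)"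
      by (auto simp: indicator_def fun_eq_iff)
    then show ?thesis by simp
  qed
  \<comment> \<open>Y is at most 2 h on the tail h \<ge> k and 0 elsewhere; as the tail integral is
    below X / 4, the strict inequality leaves room for the limit.\<close>
  have lim: "(\<integral>\<^sup>+z. ennreal (Y (G z c0 / N z c0)) * indicator (ball a s) z \<partial>lborel) < ennreal X"
  proof -
    have "(\<integral>\<^sup>+z. ennreal (Y (G z c0 / N z c0)) * indicator (ball a s) z \<partial>lborel) \<le> (\<integral>\<^sup>+z. 2 * (h z * indicator {z. of_nat k \<le> h z} z) \<partial>lborel)"
      by (rule nn_integral_mono_AE) (use good Yd in auto)
    also have "\<dots> = 2 * (\<integral>\<^sup>+z. h z * indicator {z. of_nat k \<le> h z} z \<partial>lborel)" by (rule nn_integral_cmult) simp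
    also have "\<dots> \<le> 2 * ennreal (X / 4)" using tail by (intro mult_left_mono) auto
    also have "\<dots> = ennreal (2 * (X / 4))" using X by (subst ennreal_mult) auto
    also have "\<dots> < ennreal X" using X by (intro ennreal_lessI) auto
    finally show ?thesis .
  qed
  let ?\<kappa> = "\<lambda>m::nat. 1 / (real m + 1)"
  have "\<exists>m. \<forall>c. dist c0 c < ?\<kappa> m \<and> c \<in> ball c0 \<rho>0 \<longrightarrow> (\<integral>\<^sup>+z. ennreal (Y (reg_quotient (?\<kappa> m) b z c)) * indicator (ball a s) z \<partial>lborel) \<le> ennreal X"
  proof (rule ccontr)
    assume "\<not> ?thesis"
    then have "\<forall>m. \<exists>c. dist c0 c < ?\<kappa> m \<and> c \<in> ball c0 \<rho>0 \<and> ennreal X < (\<integral>\<^sup>+z. ennreal (Y (reg_quotient (?\<kappa> m) b z c)) * indicator (ball a s) z \<partial>lborel)"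
      by (simp only: not_ex not_all not_imp not_le conj_assoc) simp
    from choice[OF this] obtain cs where "\<forall>m. dist c0 (cs m) < ?\<kappa> m \<and> cs m \<in> ball c0 \<rho>0 \<and> ennreal X < (\<integral>\<^sup>+z. ennreal (Y (reg_quotient (?\<kappa> m) b z (cs m))) * indicator (ball a s) z \<partial>lborel)" ..
    then have cs: "dist c0 (cs m) < ?\<kappa> m" "cs m \<in> ball c0 \<rho>0"
      "ennreal X < (\<integral>\<^sup>+z. ennreal (Y (reg_quotient (?\<kappa> m) b z (cs m))) * indicator (ball a s) z \<partial>lborel)" for m by blast+
    have csB: "\<forall>m. cs m \<in> B" using cs(2) \<rho>0(2) ball_subset_cball by blast
    have k0': "?\<kappa> \<longlonglongrightarrow> 0" using LIMSEQ_inverse_real_of_nat by (simp add: inverse_eq_divide add.commute)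
    have csl: "cs \<longlonglongrightarrow> c0"
      unfolding tendsto_dist_iff[of cs]
      by (rule tendsto_sandwich[OF _ _ tendsto_const k0']) (auto intro!: always_eventually less_imp_le cs(1) simp: dist_commute[of _ c0])
    have eqY: "ennreal (Y (reg_quotient \<kappa> b z c)) * indicator (ball a s) z = ennreal (Y (indicator (ball a s) z * reg_quotient \<kappa> b z c)) * indicator (ball a s) z" for \<kappa> z c
      by (auto simp: indicator_def)
    have "(\<lambda>m. \<integral>\<^sup>+z. ennreal (Y (reg_quotient (?\<kappa> m) b z (cs m))) * indicator (ball a s) z \<partial>lborel) \<longlonglongrightarrow> (\<integral>\<^sup>+z. ennreal (Y (G z c0 / N z c0)) * indicator (ball a s) z \<partial>lborel)"
    proof (rule nn_integral_dominated_convergence[where w="\<lambda>z. ennreal (2 * T\<^sup>2) * indicator (ball a s) z"])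
      show "(\<lambda>z. ennreal (Y (reg_quotient (?\<kappa> m) b z (cs m))) * indicator (ball a s) z) \<in> borel_measurable lborel" for m
      proof -
        note [measurable] = reg_quotient_measurable[OF csB[rule_format, of m] open_ball bD, of "?\<kappa> m" b] borel_open[OF open_ball, of a s]
        have "(\<lambda>z. ennreal (Y (indicator (ball a s) z * reg_quotient (?\<kappa> m) b z (cs m))) * indicator (ball a s) z) \<in> borel_measurable borel" by measurable
        then show ?thesis unfolding eqY by simp
      qed
      show "(\<lambda>z. ennreal (Y (G z c0 / N z c0)) * indicator (ball a s) z) \<in> borel_measurable lborel"
      proof -
        note [measurable] = G_measurable[OF c0 open_ball bD] borel_open[OF open_ball, of a s]
        have "(\<lambda>z. ennreal (Y (G z c0 / N z c0)) * indicator (ball a s) z) = (\<lambda>z. ennreal (Y ((indicator (ball a s) z * G z c0) / (indicator (ball a s) z * N z c0))) * indicator (ball a s) z)"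
          by (auto simp: indicator_def fun_eq_iff)
        also have "\<dots> \<in> borel_measurable borel" by measurable
        finally show ?thesis by simp
      qed
      show "(\<integral>\<^sup>+z. ennreal (2 * T\<^sup>2) * indicator (ball a s) z \<partial>lborel) < \<infinity>"
        using emeasure_bounded_finite[OF bounded_ball, of a s] by (simp add: nn_integral_cmult_indicator ennreal_mult_less_top)
      show "AE z in lborel. (\<lambda>m. ennreal (Y (reg_quotient (?\<kappa> m) b z (cs m))) * indicator (ball a s) z) \<longlonglongrightarrow> ennreal (Y (G z c0 / N z c0)) * indicator (ball a s) z"
        using good
      proof eventually_elim
        case (elim z)
        show ?case
        proof (cases "z \<in> ball a s")
          case True
          then have z: "z \<in> D" "0 < G z c0" using elim bD by auto
          have "(\<lambda>m. reg_quotient (?\<kappa> m) b z (cs m)) \<longlonglongrightarrow> G z c0 / N z c0" by (rule reg_quotient_tendsto[OF z(1) c0 z(2) csB csl k0' b])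
          then have "(\<lambda>m. Y (reg_quotient (?\<kappa> m) b z (cs m))) \<longlonglongrightarrow> Y (G z c0 / N z c0)"
            by (rule continuous_on_tendsto_compose[OF Yc]) auto
          then show ?thesis using True by (auto intro: tendsto_ennrealI)
        qed auto
      qed
    qed (auto simp: indicator_def ennreal_leI Yb)
    from order_tendstoD(2)[OF this lim] obtain m where "(\<integral>\<^sup>+z. ennreal (Y (reg_quotient (?\<kappa> m) b z (cs m))) * indicator (ball a s) z \<partial>lborel) < ennreal X"
      by (auto simp: eventually_sequentially)
    then show False using cs(3)[of m] by auto
  qed
  then obtain m where m: "\<And>c. dist c0 c < ?\<kappa> m \<Longrightarrow> c \<in> ball c0 \<rho>0 \<Longrightarrow> (\<integral>\<^sup>+z. ennreal (Y (reg_quotient (?\<kappa> m) b z c)) * indicator (ball a s) z \<partial>lborel) \<le> ennreal X"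
    by blast
  define \<rho> where "\<rho> = min \<rho>0 (?\<kappa> m)"
  show thesis
  \<comment> \<open>The threshold T^2 is exp (2 t): R > T^2 and R \<le> 1 / w force w < exp (- 2
    t).\<close>
  proof (rule that[of "T\<^sup>2" \<rho>])
    show "T\<^sup>2 > 0" using T by simp
    show "\<rho> > 0" unfolding \<rho>_def using \<rho>0 by simp
    show "ball c0 \<rho> \<subseteq> B" using \<rho>0(2) unfolding \<rho>_def by (auto simp: subset_iff)
    fix c assume c: "c \<in> ball c0 \<rho>"
    then have C0c: "dist c0 c < ?\<kappa> m" "c \<in> ball c0 \<rho>0" "c \<in> cball c0 \<rho>0" by (auto simp: \<rho>_def)
    have cB: "c \<in> B" using C0c \<rho>0 by blast
    have \<kappa>: "0 < ?\<kappa> m" "?\<kappa> m \<le> 1" by auto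
    have Nc: "\<And>z. z \<in> ball a s \<Longrightarrow> N z c \<le> b" using Nb C0c(3) by blast
    note w = reg_quotient_props[OF cB \<kappa> b open_ball bD Nc]
    let ?w = "\<lambda>z. reg_quotient (?\<kappa> m) b z c"
    have "(\<integral>\<^sup>+x. indicator {x \<in> ball a s. ?w x \<le> exp (- t)} x * ennreal (1 / max (?w x) (exp (- 2 * t))) \<partial>lborel) \<le> (\<integral>\<^sup>+z. ennreal (Y (?w z)) * indicator (ball a s) z \<partial>lborel)"
      unfolding expt by (rule nn_integral_mono) (use Ya in \<open>auto simp: indicator_def intro!: ennreal_leI\<close>)
    also have "\<dots> \<le> ennreal X" by (rule m[OF C0c(1,2)])
    finally have I: "(\<integral>\<^sup>+x. indicator {x \<in> ball a s. ?w x \<le> exp (- t)} x * ennreal (1 / max (?w x) (exp (- 2 * t))) \<partial>lborel) \<le> ennreal X" .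
    have "(\<integral>\<^sup>+x. indicator {x \<in> ball a (s / 2). ?w x < exp (- 2 * t)} x * inverse (ennreal (?w x)) \<partial>lborel) \<le> ennreal (C * X)"
      by (rule est[OF t1 w(1) w(2) w(3) w(4) less_imp_le[OF X(1)] X(2) I])
    also have "\<dots> \<le> ennreal \<eta>" by (rule ennreal_leI[OF CX])
    finally have E: "(\<integral>\<^sup>+x. indicator {x \<in> ball a (s / 2). ?w x < exp (- 2 * t)} x * inverse (ennreal (?w x)) \<partial>lborel) \<le> ennreal \<eta>" .
    have "(\<integral>\<^sup>+z. indicator {z\<in>ball a (s / 2). ennreal (T\<^sup>2) < R z c} z * R z c \<partial>lborel) \<le> (\<integral>\<^sup>+x. indicator {x \<in> ball a (s / 2). ?w x < exp (- 2 * t)} x * inverse (ennreal (?w x)) \<partial>lborel)"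
    proof (rule nn_integral_mono)
      fix z
      show "indicator {z\<in>ball a (s / 2). ennreal (T\<^sup>2) < R z c} z * R z c \<le> indicator {x \<in> ball a (s / 2). ?w x < exp (- 2 * t)} z * inverse (ennreal (?w z))"
      proof (cases "z \<in> ball a (s / 2) \<and> ennreal (T\<^sup>2) < R z c")
        case True
        then have z: "z \<in> ball a s" using s(1) by auto
        have Rw: "R z c \<le> inverse (ennreal (?w z))" by (rule w(5)[OF _ z])
        then have lt: "ennreal (T\<^sup>2) < inverse (ennreal (?w z))" using True by (blast intro: less_le_trans)
        have "?w z < 1 / T\<^sup>2"
        proof (rule ccontr)
          assume "\<not> ?w z < 1 / T\<^sup>2"
          then have "1 / T\<^sup>2 \<le> ?w z" by simp
          then have "inverse (?w z) \<le> inverse (1 / T\<^sup>2)" "?w z > 0" using T2(1) le_imp_inverse_le[of "1 / T\<^sup>2" "?w z"] by linarith+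
          then have "inverse (ennreal (?w z)) \<le> ennreal (T\<^sup>2)" by (simp add: inverse_ennreal ennreal_leI)
          then show False using lt by auto
        qed
        then show ?thesis using True Rw unfolding expt by (simp add: indicator_def)
      qed (auto simp: indicator_def)
    qed
    then show "(\<integral>\<^sup>+z. indicator {z\<in>ball a (s / 2). ennreal (T\<^sup>2) < R z c} z * R z c \<partial>lborel) \<le> ennreal \<eta>"
      using E by (rule order_trans)
  qed
qed

text \<open>The tails over the balls of the cover add up, so the induction halves \<eta>, keeps the
  larger threshold and shrinks the radius in c.\<close>

lemma uniform_integrability_union:
  assumes c0: "c0 \<in> B" and s: "s > 0" and P: "finite P" "\<And>p. p \<in> P \<Longrightarrow> cball p s \<subseteq> D"
    and fin: "\<And>p. p \<in> P \<Longrightarrow> (\<integral>\<^sup>+z. R z c0 * indicator (ball p s) z \<partial>lborel) < \<infinity>" and \<eta>: "\<eta> > 0"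
  shows "\<exists>K>0. \<exists>\<rho>>0. ball c0 \<rho> \<subseteq> B \<and> (\<forall>c\<in>ball c0 \<rho>.
    (\<integral>\<^sup>+z. indicator {z\<in>(\<Union>p\<in>P. ball p (s / 2)). ennreal K < R z c} z * R z c \<partial>lborel) \<le> ennreal \<eta>)"
  using P fin \<eta>
proof (induction P arbitrary: \<eta> rule: finite_induct)
  case empty
  obtain \<rho> where "\<rho> > 0" "ball c0 \<rho> \<subseteq> B" using c0 open_ball open_contains_ball by metis
  then show ?case by (intro exI[of _ 1] exI[of _ \<rho>] conjI) auto
next
  case (insert p P)
  have e2: "\<eta> / 2 > 0" using insert.prems by simp
  let ?I = "\<lambda>S K c. \<integral>\<^sup>+z. indicator {z\<in>S. ennreal K < R z c} z * R z c \<partial>lborel"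
  let ?U = "\<Union>p\<in>P. ball p (s / 2)"
  have "\<exists>K>0. \<exists>\<rho>>0. ball c0 \<rho> \<subseteq> B \<and> (\<forall>c\<in>ball c0 \<rho>. ?I ?U K c \<le> ennreal (\<eta> / 2))"
    by (rule insert.IH) (use insert.prems e2 in auto)
  then obtain K1 \<rho>1 where 1: "K1 > 0" "\<rho>1 > 0" "ball c0 \<rho>1 \<subseteq> B" "\<And>c. c \<in> ball c0 \<rho>1 \<Longrightarrow> ?I ?U K1 c \<le> ennreal (\<eta> / 2)"
    by blast
  have pD: "cball p s \<subseteq> D" and pf: "(\<integral>\<^sup>+z. R z c0 * indicator (ball p s) z \<partial>lborel) < \<infinity>" using insert.prems by auto
  obtain K2 \<rho>2 where 2: "K2 > 0" "\<rho>2 > 0" "ball c0 \<rho>2 \<subseteq> B" "\<And>c. c \<in> ball c0 \<rho>2 \<Longrightarrow> ?I (ball p (s / 2)) K2 c \<le> ennreal (\<eta> / 2)"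
    using uniform_integrability[OF c0 s pD pf e2] by blast
  have sub: "ball q (s / 2) \<subseteq> cball q s" for q :: "complex^'n" using s by (auto simp: subset_iff)
  have UD: "?U \<subseteq> D" using insert.prems sub by blast
  have bD: "ball p (s / 2) \<subseteq> D" using pD sub by blast
  have "?I (\<Union>p\<in>insert p P. ball p (s / 2)) (max K1 K2) c \<le> ennreal \<eta>" if c: "c \<in> ball c0 (min \<rho>1 \<rho>2)" for c
  proof -
    have c1: "c \<in> ball c0 \<rho>1" "c \<in> ball c0 \<rho>2" using c by auto
    have cB: "c \<in> B" using c1 1 by blast
    have oU: "open ?U" by blast
    note [measurable] = R_tail_measurable[OF cB oU UD] R_tail_measurable[OF cB open_ball bD]
    have "?I (\<Union>p\<in>insert p P. ball p (s / 2)) (max K1 K2) c \<le> (\<integral>\<^sup>+z. indicator {z\<in>?U. ennreal K1 < R z c} z * R z c + indicator {z\<in>ball p (s / 2). ennreal K2 < R z c} z * R z c \<partial>lborel)"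
    proof (rule nn_integral_mono)
      fix z
      have "ennreal K1 < R z c \<and> ennreal K2 < R z c" if "ennreal (max K1 K2) < R z c"
        using that ennreal_leI[of K1 "max K1 K2"] ennreal_leI[of K2 "max K1 K2"] by (auto intro: le_less_trans)
      then show "indicator {z\<in>(\<Union>p\<in>insert p P. ball p (s / 2)). ennreal (max K1 K2) < R z c} z * R z c \<le> indicator {z\<in>?U. ennreal K1 < R z c} z * R z c + indicator {z\<in>ball p (s / 2). ennreal K2 < R z c} z * R z c"
        by (auto simp: indicator_def)
    qed
    also have "\<dots> = ?I ?U K1 c + ?I (ball p (s / 2)) K2 c" by (rule nn_integral_add) measurable
    also have "\<dots> \<le> ennreal (\<eta> / 2) + ennreal (\<eta> / 2)" by (intro add_mono 1 2 c1)
    also have "\<dots> = ennreal \<eta>" using e2 by (subst ennreal_plus[symmetric]) auto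
    finally show ?thesis .
  qed
  moreover have "ball c0 (min \<rho>1 \<rho>2) \<subseteq> B" using 1 by (auto simp: subset_iff)
  ultimately show ?case using 1 2 by (intro exI[of _ "max K1 K2"] exI[of _ "min \<rho>1 \<rho>2"] conjI) auto
qed

text \<open>The estimate halves the radius of balls and is used at two scales: at 0, from s to s /
  2, it makes the integrals finite on a neighbourhood U of the closure of D' for all c near 0; at
  each such c0, from s / 2 to s / 4, it gives continuity. Hence the cover by balls of radius s /
  4.\<close>

lemma integral_finite_continuous:
  assumes D': "open D'" "compact (closure D')" "closure D' \<subseteq> D"
    and fin: "(\<integral>\<^sup>+z. R z 0 * indicator D z \<partial>lborel) < \<infinity>"
  shows "\<exists>\<rho>>0. ball 0 \<rho> \<subseteq> B \<and> (\<forall>c\<in>ball 0 \<rho>. (\<integral>\<^sup>+z. R z c * indicator D' z \<partial>lborel) < \<infinity>) \<and>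
    continuous_on (ball 0 \<rho>) (\<lambda>c. enn2real (\<integral>\<^sup>+z. R z c * indicator D' z \<partial>lborel))"
proof -
  obtain s where s: "s > 0" "(\<Union>x\<in>closure D'. cball x s) \<subseteq> D"
    using compact_subset_open_imp_cball_epsilon_subset[OF D'(2) D D'(3)] by blast
  have s4: "s / 4 > 0" "s / 2 > 0" using s by auto
  obtain P where P: "finite P" "P \<subseteq> closure D'" "closure D' \<subseteq> (\<Union>x\<in>P. ball x (s / 4))"
  proof -
    have "closure D' \<subseteq> (\<Union>x\<in>closure D'. ball x (s / 4))" using s4(1) by (auto intro: centre_in_ball[THEN iffD2])
    then obtain P where "P \<subseteq> closure D'" "finite P" "closure D' \<subseteq> (\<Union>x\<in>P. ball x (s / 4))"
      using compactE_image[OF D'(2), of "closure D'" "\<lambda>x. ball x (s / 4)"] open_ball by metis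
    then show thesis by (intro that)
  qed
  have PD: "cball p s \<subseteq> D" if "p \<in> P" for p using s(2) P(2) that by blast
  have PD2: "cball p (s / 2) \<subseteq> D" "ball p s \<subseteq> D" "ball p (s / 2) \<subseteq> D" if "p \<in> P" for p
    using PD[OF that] s(1) by (auto simp: subset_iff)
  have D'D: "D' \<subseteq> D" using D'(3) closure_subset by blast
  define U where "U = (\<Union>p\<in>P. ball p (s / 2))"
  have U: "open U" "U \<subseteq> D" unfolding U_def using PD2(3) by auto
  have bU: "emeasure lborel U < \<infinity>" unfolding U_def by (rule emeasure_bounded_finite) (use P(1) in auto)
  have D'U: "D' \<subseteq> U" "D' \<subseteq> (\<Union>p\<in>P. ball p (s / 2 / 2))"
  proof -
    show "D' \<subseteq> (\<Union>p\<in>P. ball p (s / 2 / 2))" using P(3) closure_subset[of D'] by auto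
    then show "D' \<subseteq> U" unfolding U_def using s(1) by (force simp: subset_iff)
  qed
  have bD': "emeasure lborel D' < \<infinity>"
    by (rule emeasure_bounded_finite) (meson D'(2) bounded_subset closure_subset compact_imp_bounded)
  have B0: "0 \<in> B" using r by simp
  have "\<exists>K>0. \<exists>\<rho>>0. ball 0 \<rho> \<subseteq> B \<and> (\<forall>c\<in>ball 0 \<rho>. (\<integral>\<^sup>+z. indicator {z\<in>(\<Union>p\<in>P. ball p (s / 2)). ennreal K < R z c} z * R z c \<partial>lborel) \<le> ennreal 1)"
  proof (rule uniform_integrability_union[OF B0 s(1) P(1) PD])
    fix p assume p: "p \<in> P"
    have "(\<integral>\<^sup>+z. R z 0 * indicator (ball p s) z \<partial>lborel) \<le> (\<integral>\<^sup>+z. R z 0 * indicator D z \<partial>lborel)"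
      by (rule nn_integral_mono) (use PD2(2)[OF p] in \<open>auto simp: indicator_def\<close>)
    then show "(\<integral>\<^sup>+z. R z 0 * indicator (ball p s) z \<partial>lborel) < \<infinity>" using fin by (rule le_less_trans)
  qed auto
  then obtain K1 \<rho>1 where 1: "K1 > 0" "\<rho>1 > 0" "ball 0 \<rho>1 \<subseteq> B"
    "\<And>c. c \<in> ball 0 \<rho>1 \<Longrightarrow> (\<integral>\<^sup>+z. indicator {z\<in>U. ennreal K1 < R z c} z * R z c \<partial>lborel) \<le> ennreal 1"
    unfolding U_def by blast
  \<comment> \<open>Up to the threshold K1 the integrand is bounded on a set of finite measure;
    beyond it the tail bound applies.\<close>
  have finU: "(\<integral>\<^sup>+z. R z c * indicator U z \<partial>lborel) < \<infinity>" if c: "c \<in> ball 0 \<rho>1" for c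
  proof -
    have cB: "c \<in> B" using c 1(3) by blast
    note [measurable] = R_tail_measurable[OF cB U] borel_open[OF U(1)]
    have "(\<integral>\<^sup>+z. R z c * indicator U z \<partial>lborel) \<le> (\<integral>\<^sup>+z. ennreal K1 * indicator U z + indicator {z\<in>U. ennreal K1 < R z c} z * R z c \<partial>lborel)"
      by (rule nn_integral_mono) (auto simp: indicator_def not_less)
    also have "\<dots> = ennreal K1 * emeasure lborel U + (\<integral>\<^sup>+z. indicator {z\<in>U. ennreal K1 < R z c} z * R z c \<partial>lborel)"
      by (subst nn_integral_add) (auto simp: nn_integral_cmult_indicator)
    also have "\<dots> \<le> ennreal K1 * emeasure lborel U + ennreal 1" by (intro add_left_mono 1(4) c)
    also have "\<dots> < \<infinity>" using bU by (simp add: ennreal_mult_less_top)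
    finally show ?thesis .
  qed
  have sub: "(\<integral>\<^sup>+z. R z c * indicator A z \<partial>lborel) \<le> (\<integral>\<^sup>+z. R z c * indicator U z \<partial>lborel)" if "A \<subseteq> U" for c A
    by (rule nn_integral_mono) (use that in \<open>auto simp: indicator_def\<close>)
  define j where "j c = (\<integral>\<^sup>+z. R z c * indicator D' z \<partial>lborel)" for c
  have jfin: "j c < \<infinity>" if "c \<in> ball 0 \<rho>1" for c unfolding j_def by (rule le_less_trans[OF sub[OF D'U(1)] finU[OF that]])
  have cont: "continuous_on (ball 0 \<rho>1) (\<lambda>c. enn2real (j c))"
  proof (rule continuous_on_sequentiallyI)
    fix cs :: "nat \<Rightarrow> complex" and c0 assume cs: "\<forall>n. cs n \<in> ball 0 \<rho>1" and c0: "c0 \<in> ball 0 \<rho>1" and lim: "cs \<longlonglongrightarrow> c0"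
    have c0B: "c0 \<in> B" and csB: "\<forall>n. cs n \<in> B" using cs c0 1(3) by blast+
    show "(\<lambda>n. enn2real (j (cs n))) \<longlonglongrightarrow> enn2real (j c0)"
    proof (rule LIMSEQ_I)
      fix e :: real assume e: "e > 0"
      have "\<exists>K>0. \<exists>\<rho>>0. ball c0 \<rho> \<subseteq> B \<and> (\<forall>c\<in>ball c0 \<rho>. (\<integral>\<^sup>+z. indicator {z\<in>(\<Union>p\<in>P. ball p (s / 2 / 2)). ennreal K < R z c} z * R z c \<partial>lborel) \<le> ennreal (e / 4))"
      proof (rule uniform_integrability_union[OF c0B s4(2) P(1) PD2(1)])
        fix p assume "p \<in> P"
        then have "ball p (s / 2) \<subseteq> U" by (auto simp: U_def)
        then show "(\<integral>\<^sup>+z. R z c0 * indicator (ball p (s / 2)) z \<partial>lborel) < \<infinity>" by (rule le_less_trans[OF sub finU[OF c0]])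
      qed (use e in auto)
      then obtain K \<rho> where K: "K > 0" "\<rho> > 0" "ball c0 \<rho> \<subseteq> B"
        "\<And>c. c \<in> ball c0 \<rho> \<Longrightarrow> (\<integral>\<^sup>+z. indicator {z\<in>(\<Union>p\<in>P. ball p (s / 2 / 2)). ennreal K < R z c} z * R z c \<partial>lborel) \<le> ennreal (e / 4)"
        by blast
      \<comment> \<open>Truncation at K: these integrals converge by dominated convergence, and near
        c0 they differ from j by at most e / 4, uniformly in c, so three small terms compare j along
        the sequence with j at c0.\<close>
      define M where "M c = (\<integral>\<^sup>+z. min (R z c) (ennreal K) * indicator D' z \<partial>lborel)" for c
      have Mm: "(\<lambda>z. min (R z c) (ennreal K) * indicator D' z) \<in> borel_measurable borel" if c: "c \<in> B" for c
      proof -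
        note [measurable] = R_measurable[OF c D'(1) D'D] borel_open[OF D'(1)]
        have "(\<lambda>z. min (R z c) (ennreal K) * indicator D' z) = (\<lambda>z. min (R z c * indicator D' z) (ennreal K))"
          by (auto simp: fun_eq_iff indicator_def)
        also have "\<dots> \<in> borel_measurable borel" by measurable
        finally show ?thesis .
      qed
      have wfin: "(\<integral>\<^sup>+z. ennreal K * indicator D' z \<partial>lborel) < \<infinity>"
        using bD' D'(1) by (simp add: nn_integral_cmult_indicator ennreal_mult_less_top)
      have Mj: "M c \<le> j c" for c unfolding M_def j_def by (rule nn_integral_mono) (auto simp: indicator_def)
      have Mfin: "M c < \<infinity>" for c
      proof -
        have "M c \<le> (\<integral>\<^sup>+z. ennreal K * indicator D' z \<partial>lborel)" unfolding M_def by (rule nn_integral_mono) (auto simp: indicator_def)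
        then show ?thesis using wfin by (rule le_less_trans)
      qed
      have jM: "j c \<le> M c + ennreal (e / 4)" if c: "c \<in> ball c0 \<rho>" for c
      proof -
        have cB: "c \<in> B" using K c by blast
        note [measurable] = Mm[OF cB] R_tail_measurable[OF cB D'(1) D'D]
        have "j c \<le> (\<integral>\<^sup>+z. min (R z c) (ennreal K) * indicator D' z + indicator {z\<in>D'. ennreal K < R z c} z * R z c \<partial>lborel)"
          unfolding j_def by (rule nn_integral_mono) (auto simp: indicator_def min_def)
        also have "\<dots> = M c + (\<integral>\<^sup>+z. indicator {z\<in>D'. ennreal K < R z c} z * R z c \<partial>lborel)"
          unfolding M_def by (rule nn_integral_add) measurable
        also have "(\<integral>\<^sup>+z. indicator {z\<in>D'. ennreal K < R z c} z * R z c \<partial>lborel) \<le> (\<integral>\<^sup>+z. indicator {z\<in>(\<Union>p\<in>P. ball p (s / 2 / 2)). ennreal K < R z c} z * R z c \<partial>lborel)"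
          by (rule nn_integral_mono) (use D'U(2) in \<open>auto simp: indicator_def\<close>)
        also have "\<dots> \<le> ennreal (e / 4)" by (rule K(4)[OF c])
        finally show ?thesis by (simp add: add_left_mono)
      qed
      have real: "\<bar>enn2real (j c) - enn2real (M c)\<bar> \<le> e / 4" if c: "c \<in> ball c0 \<rho>" for c
      proof -
        have "enn2real (j c) \<le> enn2real (M c + ennreal (e / 4))" by (rule enn2real_mono[OF jM[OF c]]) (use Mfin in auto)
        also have "\<dots> = enn2real (M c) + e / 4" using e Mfin[of c] by (subst enn2real_plus) auto
        finally have 1: "enn2real (j c) \<le> enn2real (M c) + e / 4" .
        have "j c < \<infinity>" using jM[OF c] Mfin[of c] by (auto intro: le_less_trans)
        then have "enn2real (M c) \<le> enn2real (j c)" by (intro enn2real_mono Mj) auto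
        with 1 show ?thesis by simp
      qed
      have good: "AE z in lborel. z \<in> U \<longrightarrow> 0 < G z c0" by (rule AE_G_pos[OF c0B U finU[OF c0]])
      have "(\<lambda>n. M (cs n)) \<longlonglongrightarrow> M c0" unfolding M_def
      proof (rule nn_integral_dominated_convergence[where w="\<lambda>z. ennreal K * indicator D' z"])
        show "AE z in lborel. (\<lambda>n. min (R z (cs n)) (ennreal K) * indicator D' z) \<longlonglongrightarrow> min (R z c0) (ennreal K) * indicator D' z"
          using good
        proof eventually_elim
          case (elim z)
          show ?case
          proof (cases "z \<in> D'")
            case True
            then have z: "z \<in> D" "0 < G z c0" using elim D'U D'D by auto
            have "(\<lambda>n. min (R z (cs n)) (ennreal K)) \<longlonglongrightarrow> min (R z c0) (ennreal K)"
              by (intro tendsto_min tendsto_const R_tendsto z c0B csB lim)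
            then show ?thesis using True by simp
          qed auto
        qed
        show "(\<lambda>z. ennreal K * indicator D' z) \<in> borel_measurable lborel" using borel_open[OF D'(1)] by simp
      qed (use Mm csB c0B wfin in \<open>auto simp: indicator_def\<close>)
      then have "(\<lambda>n. enn2real (M (cs n))) \<longlonglongrightarrow> enn2real (M c0)" using Mfin[of c0] by (intro tendsto_enn2real) auto
      then have tend: "(\<lambda>n. \<bar>enn2real (M (cs n)) - enn2real (M c0)\<bar>) \<longlonglongrightarrow> 0" by (simp add: LIM_zero tendsto_rabs_zero)
      have "\<forall>\<^sub>F n in sequentially. \<bar>enn2real (M (cs n)) - enn2real (M c0)\<bar> < e / 4" by (rule order_tendstoD(2)[OF tend]) (use e in simp)
      moreover have "\<forall>\<^sub>F n in sequentially. dist (cs n) c0 < \<rho>" using lim K(2) by (rule tendstoD)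
      ultimately have "\<forall>\<^sub>F n in sequentially. norm (enn2real (j (cs n)) - enn2real (j c0)) < e"
      proof eventually_elim
        case (elim n)
        have "\<bar>enn2real (j (cs n)) - enn2real (M (cs n))\<bar> \<le> e / 4" by (rule real) (use elim in \<open>simp add: dist_commute\<close>)
        moreover have "\<bar>enn2real (j c0) - enn2real (M c0)\<bar> \<le> e / 4" by (rule real) (use K(2) in simp)
        ultimately show ?case using elim(1) e unfolding real_norm_def by linarith
      qed
      then show "\<exists>no. \<forall>n\<ge>no. norm (enn2real (j (cs n)) - enn2real (j c0)) < e" by (simp add: eventually_sequentially)
    qed
  qed
  show ?thesis using 1 jfin cont unfolding j_def by blast
qed

end

theorem theorem7:
  fixes D D' :: "(complex^'n) set" and r :: real
    and I J :: nat and f g :: "nat \<Rightarrow> complex^'n \<Rightarrow> complex \<Rightarrow> complex"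
    and \<epsilon> \<delta> :: real
  assumes "open D" and "open D'" and "D' \<subseteq> D"
    and "compact (closure D')" and "closure D' \<subseteq> D"
    and "r > 0"
    and "\<epsilon> \<in> \<rat>" and "\<epsilon> \<ge> 0" and "\<delta> \<in> \<rat>" and "\<delta> \<ge> 0"
    and "\<forall>i\<in>{1..I}. holo_on TYPE('n) (D \<times> ball 0 r) (f i)"
    and "\<forall>j\<in>{1..J}. holo_on TYPE('n) (D \<times> ball 0 r) (g j)"
    and "\<exists>i\<in>{1..I}. \<exists>z\<in>D. \<exists>c\<in>ball 0 r. f i z c \<noteq> 0"
    and "(\<integral>\<^sup>+ z. Rfun I J f g \<epsilon> \<delta> z 0 * indicator D z \<partial>lebesgue) < \<infinity>"
    and "\<exists>u. psh_on (D \<times> ball 0 r) u \<and> (\<forall>p\<in>D \<times> ball 0 r. u p \<le> 0) \<and>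
           (\<forall>z\<in>D. \<forall>c\<in>ball 0 r. \<not> (numR I f \<epsilon> z c = 0 \<and> numR J g \<delta> z c = 0) \<longrightarrow>
              u (z, c) = neglog (Rfun I J f g \<epsilon> \<delta> z c))"
  shows "\<exists>\<rho>>0. ball 0 \<rho> \<subseteq> ball 0 r \<and>
    (\<forall>c\<in>ball 0 \<rho>. (\<integral>\<^sup>+ z. Rfun I J f g \<epsilon> \<delta> z c * indicator D' z \<partial>lebesgue) < \<infinity>) \<and>
    continuous_on (ball 0 \<rho>)
      (\<lambda>c. enn2real (\<integral>\<^sup>+ z. Rfun I J f g \<epsilon> \<delta> z c * indicator D' z \<partial>lebesgue))"
proof -
  obtain u where u: "psh_on (D \<times> ball 0 r) u" "\<forall>p\<in>D \<times> ball 0 r. u p \<le> 0"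
    "\<forall>z\<in>D. \<forall>c\<in>ball 0 r. \<not> (numR I f \<epsilon> z c = 0 \<and> numR J g \<delta> z c = 0) \<longrightarrow> u (z, c) = neglog (Rfun I J f g \<epsilon> \<delta> z c)"
    using assms(15) by blast
  interpret quotient_family D r I J f g \<epsilon> \<delta> u
    by (rule quotient_family.intro) (fact assms(1,6,8,10-12) u)+
  obtain \<rho> where \<rho>: "\<rho> > 0" "\<forall>c\<in>ball 0 \<rho>. (\<integral>\<^sup>+ z. R z c * indicator D' z \<partial>lborel) < \<infinity>"
    "continuous_on (ball 0 \<rho>) (\<lambda>c. enn2real (\<integral>\<^sup>+ z. R z c * indicator D' z \<partial>lborel))"
    using integral_finite_continuous[OF assms(2,4,5) assms(14)[unfolded nn_integral_completion, folded R_def]] by auto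
  have sub: "ball 0 (min \<rho> r) \<subseteq> ball 0 \<rho>" by (simp add: subset_ball)
  show ?thesis
    \<comment> \<open>Lebesgue measure is the completion of \<open>lborel\<close>, and nonnegative
      integrals agree on both, so the Borel statement transfers.\<close>
    unfolding nn_integral_completion R_def[symmetric]
  proof (intro exI[of _ "min \<rho> r"] conjI)
    \<comment> \<open>The centre of these two balls has a polymorphic type in the statement, so the inclusion is one of radii.\<close>
    show "ball 0 (min \<rho> r) \<subseteq> ball 0 r" by (simp add: subset_ball)
  qed (use \<rho> r sub continuous_on_subset in auto)
qed

end
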